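(* Let $\mu$ be a log-concave probability measure on $\mathbb{R}^n$, and let $\gamma$ be the standard Gaussian probability measure on $\mathbb{R}^n$. Then $$ C_P(\mu) \leq C_P(\mu * \gamma). $$ Moreover, assuming that $\mu$ admits a density that is smooth and positive in $\mathbb{R}^n$ and that $L_{\mu}$ has a discrete spectrum, we have $$ \lambda_k^{(\mu * \gamma)} \leq \lambda_k^{(\mu)} \qquad (k=1,2,\ldots). $$
   Context: A non-negative function $\rho$ on $\mathbb{R}^n$ is log-concave if $K=\{x\in\mathbb{R}^n : \rho(x)>0\}$ is convex and $\log\rho$ is concave in $K$. An absolutely continuous probability measure on $\mathbb{R}^n$ is log-concave if it has a log-concave density. An arbitrary probability measure on $\mathbb{R}^n$ is log-concave if it is the pushforward of some absolutely continuous log-concave probability measure on some $\mathbb{R}^k$ under an injective affine map. The Poincaré constant $C_P(\mu)$ of a Borel probability measure $\mu$ on $\mathbb{R}^n$ is the smallest constant $C\ge 0$ such that for any locally-Lipschitz function $f\in L^2(\mu)$, $\mathrm{Var}_\mu(f)\le C\int_{\mathbb{R}^n}|\nabla f|^2\,d\mu$, where $\mathrm{Var}_\mu(f)=\int f^2\,d\mu-\left(\int f\,d\mu\right)^2$ and $|\cdot|$ is the Euclidean norm. $\mu*\gamma$ denotes convolution; $\gamma$ has density $(2\pi)^{-n/2}e^{-|x|^2/2}$. For a probability measure $\nu$ on $\mathbb{R}^n$ with smooth, positive density $\rho$, the Laplace operator associated with $\nu$ is defined a priori on smooth, compactly supported functions $u:\mathbb{R}^n\to\mathbb{R}$ by $L_\nu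 u=\Delta u+\nabla(\log\rho)\cdot\nabla u$. It is essentially self-adjoint and negative semi-definite in $L^2(\nu)$, with a simple eigenvalue at $0$ corresponding to constants; its spectrum means the spectrum of its self-adjoint extension. When the spectrum of $L_\nu$ is discrete, $0=\lambda_0^{(\nu)}<\lambda_1^{(\nu)}\le\lambda_2^{(\nu)}\le\cdots$ denote the eigenvalues of $-L_\nu$, repeated according to multiplicity. In general $\lambda_k^{(\nu)}$ is understood as the min-max value $$\lambda_k^{(\nu)}=\inf_{E}\ \sup_{0\ne f\in E}\frac{\int|\nabla f|^2\,d\nu}{\int f^2\,d\nu},$$ where $E$ runs over the $(k+1)$-dimensional subspaces of $H^1(\nu)$ (functions in $L^2(\nu)$ whose weak derivatives belong to $L^2(\nu)$); this coincides with the $k$-th eigenvalue when the spectrum is discrete. *)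

theory Defs
  imports "HOL-Probability.Probability"
begin

section \<open>Log-concave measures\<close>

text \<open>
  A log-concave measure on \<open>\<real>\<^sup>n\<close> is the image of an absolutely continuous one on some \<open>\<real>\<^sup>k\<close>, where
  \<open>k\<close> is existentially quantified and may be \<open>0\<close> (point masses). Hence \<open>\<real>\<^sup>k\<close> is taken here to be the
  underlying space of the \<open>k\<close>-fold product of \<^const>\<open>lborel\<close>, i.e. the functions on \<open>{..<k}\<close>
  that are \<^const>\<open>undefined\<close> outside.
\<close>

definition lborel_pow :: "nat \<Rightarrow> (nat \<Rightarrow> real) measure" where
  "lborel_pow k = (\<Pi>\<^sub>M i\<in>{..<k}. lborel)"

definition segment_pt :: "nat \<Rightarrow> real \<Rightarrow> (nat \<Rightarrow> real) \<Rightarrow> (nat \<Rightarrow> real) \<Rightarrow> (nat \<Rightarrow> real)" where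
  "segment_pt k t x y = (\<lambda>i\<in>{..<k}. (1 - t) * x i + t * y i)"

definition log_concave_fun :: "nat \<Rightarrow> ((nat \<Rightarrow> real) \<Rightarrow> real) \<Rightarrow> bool" where
  "log_concave_fun k \<rho> \<longleftrightarrow>
     (\<forall>x\<in>space (lborel_pow k). 0 \<le> \<rho> x) \<and>
     (let K = {x \<in> space (lborel_pow k). \<rho> x > 0} in
        (\<forall>x\<in>K. \<forall>y\<in>K. \<forall>t\<in>{0..1}. segment_pt k t x y \<in> K) \<and>
        (\<forall>x\<in>K. \<forall>y\<in>K. \<forall>t\<in>{0..1}.
           (1 - t) * ln (\<rho> x) + t * ln (\<rho> y) \<le> ln (\<rho> (segment_pt k t x y))))"

definition ac_log_concave_measure :: "nat \<Rightarrow> (nat \<Rightarrow> real) measure \<Rightarrow> bool" where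
  "ac_log_concave_measure k \<kappa> \<longleftrightarrow>
     prob_space \<kappa> \<and>
     (\<exists>\<rho>\<in>borel_measurable (lborel_pow k).
        log_concave_fun k \<rho> \<and> \<kappa> = density (lborel_pow k) (\<lambda>x. ennreal (\<rho> x)))"

text \<open>The affine maps \<open>\<real>\<^sup>k \<rightarrow> \<real>\<^sup>n\<close> are exactly those of the form \<open>x \<mapsto> b + \<Sum>\<^sub>i x\<^sub>i v\<^sub>i\<close>.\<close>

definition affine_map :: "nat \<Rightarrow> 'a::real_vector \<Rightarrow> (nat \<Rightarrow> 'a) \<Rightarrow> (nat \<Rightarrow> real) \<Rightarrow> 'a" where
  "affine_map k b v x = b + (\<Sum>i<k. x i *\<^sub>R v i)"

definition log_concave_measure :: "(real ^ 'n) measure \<Rightarrow> bool" where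
  "log_concave_measure \<mu> \<longleftrightarrow>
     (\<exists>k \<kappa> b v. ac_log_concave_measure k \<kappa> \<and>
        inj_on (affine_map k b v) (space (lborel_pow k)) \<and>
        \<mu> = distr \<kappa> borel (affine_map k b v))"

definition std_gaussian :: "(real ^ 'n) measure" where
  "std_gaussian = density lborel
     (\<lambda>x. ennreal ((2 * pi) powr (- real CARD('n) / 2) * exp (- (norm x)\<^sup>2 / 2)))"


section \<open>Derivatives and smooth functions\<close>

definition partial :: "'n \<Rightarrow> (real ^ 'n \<Rightarrow> real) \<Rightarrow> real ^ 'n \<Rightarrow> real" where
  "partial i f x = frechet_derivative f (at x) (axis i 1)"

definition gradient :: "(real ^ 'n \<Rightarrow> real) \<Rightarrow> real ^ 'n \<Rightarrow> real ^ 'n" where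
  "gradient f x = (\<chi> i. partial i f x)"

definition laplacian :: "(real ^ 'n \<Rightarrow> real) \<Rightarrow> real ^ 'n \<Rightarrow> real" where
  "laplacian f x = (\<Sum>i\<in>UNIV. partial i (partial i f) x)"

primrec Ck :: "nat \<Rightarrow> (real ^ 'n \<Rightarrow> real) \<Rightarrow> bool" where
  "Ck 0 f \<longleftrightarrow> continuous_on UNIV f"
| "Ck (Suc k) f \<longleftrightarrow> (\<forall>x. f differentiable (at x)) \<and> (\<forall>i. Ck k (partial i f))"

definition smooth :: "(real ^ 'n \<Rightarrow> real) \<Rightarrow> bool" where
  "smooth f \<longleftrightarrow> (\<forall>k. Ck k f)"

definition test_fun :: "(real ^ 'n \<Rightarrow> real) \<Rightarrow> bool" where
  "test_fun f \<longleftrightarrow> smooth f \<and> compact (closure {x. f x \<noteq> 0})"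

definition L2 :: "'a measure \<Rightarrow> ('a \<Rightarrow> real) \<Rightarrow> bool" where
  "L2 M f \<longleftrightarrow> f \<in> borel_measurable M \<and> integrable M (\<lambda>x. (f x)\<^sup>2)"


section \<open>The Poincare constant\<close>

definition locally_lipschitz :: "(real ^ 'n \<Rightarrow> real) \<Rightarrow> bool" where
  "locally_lipschitz f \<longleftrightarrow> (\<forall>x. \<exists>r>0. \<exists>C. C-lipschitz_on (ball x r) f)"

text \<open>
  A log-concave measure may be carried by a proper affine subspace, and a locally Lipschitz function
  may fail to be differentiable on all of that subspace. At points of non-differentiability
  \<open>|\<nabla>f|\<close> is the local Lipschitz constant; where \<open>f\<close> is differentiable
  that quantity equals the norm of the gradient. For absolutely continuous measures the
  convention is immaterial by Rademacher's theorem.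
\<close>

definition grad_norm :: "(real ^ 'n \<Rightarrow> real) \<Rightarrow> real ^ 'n \<Rightarrow> ennreal" where
  "grad_norm f x =
     (if f differentiable (at x) then ennreal (norm (gradient f x))
      else Limsup (at x) (\<lambda>y. ennreal (\<bar>f y - f x\<bar> / dist y x)))"

definition Var :: "'a measure \<Rightarrow> ('a \<Rightarrow> real) \<Rightarrow> real" where
  "Var M f = (\<integral>x. (f x)\<^sup>2 \<partial>M) - (\<integral>x. f x \<partial>M)\<^sup>2"

text \<open>
  The value is \<open>\<infinity>\<close> if no finite constant is admissible. The convention \<open>0 * \<infinity> = 0\<close> of
  \<^typ>\<open>ennreal\<close> can only affect whether \<open>C = 0\<close> is admissible, never the infimum.
\<close>

definition poincare_constant :: "(real ^ 'n) measure \<Rightarrow> ennreal" where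
  "poincare_constant \<mu> = Inf {ennreal C | C. 0 \<le> C \<and>
     (\<forall>f. locally_lipschitz f \<and> L2 \<mu> f \<longrightarrow>
        ennreal (Var \<mu> f) \<le> ennreal C * (\<integral>\<^sup>+x. (grad_norm f x)\<^sup>2 \<partial>\<mu>))}"


section \<open>The Laplace operator of a measure and its spectrum\<close>

text \<open>Elements of \<open>L\<^sup>2(\<nu>)\<close> are represented by functions, with equality almost everywhere.\<close>

definition laplace_op :: "(real ^ 'n \<Rightarrow> real) \<Rightarrow> (real ^ 'n \<Rightarrow> real) \<Rightarrow> real ^ 'n \<Rightarrow> real" where
  "laplace_op \<rho> u x = laplacian u x + gradient (\<lambda>y. ln (\<rho> y)) x \<bullet> gradient u x"

definition density_measure :: "(real ^ 'n \<Rightarrow> real) \<Rightarrow> (real ^ 'n) measure" where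
  "density_measure \<rho> = density lborel (\<lambda>x. ennreal (\<rho> x))"

definition L2_lim :: "'a measure \<Rightarrow> (nat \<Rightarrow> 'a \<Rightarrow> real) \<Rightarrow> ('a \<Rightarrow> real) \<Rightarrow> bool" where
  "L2_lim M F f \<longleftrightarrow> (\<lambda>j. \<integral>x. (F j x - f x)\<^sup>2 \<partial>M) \<longlonglongrightarrow> 0"

text \<open>
  \<open>laplace_closure \<rho> u g\<close>: the function \<open>u\<close> is in the domain of the closure of the operator on test
  functions, and is mapped to \<open>g\<close>. Since the operator is essentially self-adjoint, the closure is
  its unique self-adjoint extension. Its spectrum is real, so real scalars and functions suffice.
\<close>

definition laplace_closure ::
    "(real ^ 'n \<Rightarrow> real) \<Rightarrow> (real ^ 'n \<Rightarrow> real) \<Rightarrow> (real ^ 'n \<Rightarrow> real) \<Rightarrow> bool" where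
  "laplace_closure \<rho> u g \<longleftrightarrow>
     L2 (density_measure \<rho>) u \<and> L2 (density_measure \<rho>) g \<and>
     (\<exists>U. (\<forall>j. test_fun (U j)) \<and> L2_lim (density_measure \<rho>) U u \<and>
          L2_lim (density_measure \<rho>) (\<lambda>j. laplace_op \<rho> (U j)) g)"

text \<open>\<open>z\<close> is in the resolvent set iff the closure minus \<open>z\<close> is a bijection from its domain onto
  \<open>L\<^sup>2\<close> with bounded inverse.\<close>

definition laplace_resolvent_set :: "(real ^ 'n \<Rightarrow> real) \<Rightarrow> real set" where
  "laplace_resolvent_set \<rho> = {z. \<exists>C. \<forall>g. L2 (density_measure \<rho>) g \<longrightarrow>
     (\<exists>u. laplace_closure \<rho> u (\<lambda>x. g x + z * u x) \<and>
          (\<integral>x. (u x)\<^sup>2 \<partial>density_measure \<rho>) \<le> C * (\<integral>x. (g x)\<^sup>2 \<partial>density_measure \<rho>) \<and>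
          (\<forall>w. laplace_closure \<rho> w (\<lambda>x. g x + z * w x) \<longrightarrow>
             (AE x in density_measure \<rho>. w x = u x)))}"

definition laplace_spectrum :: "(real ^ 'n \<Rightarrow> real) \<Rightarrow> real set" where
  "laplace_spectrum \<rho> = - laplace_resolvent_set \<rho>"

definition laplace_eigenspace :: "(real ^ 'n \<Rightarrow> real) \<Rightarrow> real \<Rightarrow> (real ^ 'n \<Rightarrow> real) set" where
  "laplace_eigenspace \<rho> z = {u. laplace_closure \<rho> u (\<lambda>x. z * u x)}"

text \<open>The spectrum consists of isolated eigenvalues of finite multiplicity.\<close>

definition discrete_laplace_spectrum :: "(real ^ 'n \<Rightarrow> real) \<Rightarrow> bool" where
  "discrete_laplace_spectrum \<rho> \<longleftrightarrow> (\<forall>z\<in>laplace_spectrum \<rho>.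
     (\<exists>\<epsilon>>0. \<forall>w\<in>laplace_spectrum \<rho>. \<bar>w - z\<bar> < \<epsilon> \<longrightarrow> w = z) \<and>
     (\<exists>u\<in>laplace_eigenspace \<rho> z. \<not> (AE x in density_measure \<rho>. u x = 0)) \<and>
     (\<exists>(N::nat) B. \<forall>u\<in>laplace_eigenspace \<rho> z.
        \<exists>c. AE x in density_measure \<rho>. u x = (\<Sum>i<N. c i * B i x)))"


section \<open>Sobolev space and min-max values\<close>

definition locally_integrable ::
    "(real ^ 'n \<Rightarrow> 'b::{banach, second_countable_topology}) \<Rightarrow> bool" where
  "locally_integrable f \<longleftrightarrow>
     f \<in> borel_measurable borel \<and> (\<forall>K. compact K \<longrightarrow> set_integrable lborel K f)"

definition is_weak_gradient :: "(real ^ 'n \<Rightarrow> real) \<Rightarrow> (real ^ 'n \<Rightarrow> real ^ 'n) \<Rightarrow> bool" where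
  "is_weak_gradient f G \<longleftrightarrow> locally_integrable f \<and> locally_integrable G \<and>
     (\<forall>\<phi> i. test_fun \<phi> \<longrightarrow>
        (\<integral>x. f x * partial i \<phi> x \<partial>lborel) = - (\<integral>x. G x $ i * \<phi> x \<partial>lborel))"

text \<open>Unique up to Lebesgue-null sets, which are null for the absolutely continuous measures
  considered here.\<close>

definition weak_gradient :: "(real ^ 'n \<Rightarrow> real) \<Rightarrow> real ^ 'n \<Rightarrow> real ^ 'n" where
  "weak_gradient f = (SOME G. is_weak_gradient f G)"

definition H1 :: "(real ^ 'n) measure \<Rightarrow> (real ^ 'n \<Rightarrow> real) set" where
  "H1 \<nu> = {f. L2 \<nu> f \<and> (\<exists>G. is_weak_gradient f G \<and> (\<forall>i. L2 \<nu> (\<lambda>x. G x $ i)))}"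

definition lin_comb :: "nat \<Rightarrow> (nat \<Rightarrow> real) \<Rightarrow> (nat \<Rightarrow> 'a \<Rightarrow> real) \<Rightarrow> 'a \<Rightarrow> real" where
  "lin_comb m c F x = (\<Sum>i<m. c i * F i x)"

text \<open>\<open>m\<close>-tuples in \<open>H\<^sup>1(\<nu>)\<close> that are linearly independent modulo almost everywhere equality.
  Their spans are exactly the \<open>m\<close>-dimensional subspaces of \<open>H\<^sup>1(\<nu>)\<close>.\<close>

definition H1_frames :: "(real ^ 'n) measure \<Rightarrow> nat \<Rightarrow> (nat \<Rightarrow> real ^ 'n \<Rightarrow> real) set" where
  "H1_frames \<nu> m = {F. (\<forall>i<m. F i \<in> H1 \<nu>) \<and>
     (\<forall>c. (AE x in \<nu>. lin_comb m c F x = 0) \<longrightarrow> (\<forall>i<m. c i = 0))}"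

definition span_frame :: "nat \<Rightarrow> (nat \<Rightarrow> 'a \<Rightarrow> real) \<Rightarrow> ('a \<Rightarrow> real) set" where
  "span_frame m F = range (\<lambda>c. lin_comb m c F)"

definition rayleigh :: "(real ^ 'n) measure \<Rightarrow> (real ^ 'n \<Rightarrow> real) \<Rightarrow> ennreal" where
  "rayleigh \<nu> f = (\<integral>\<^sup>+x. ennreal ((norm (weak_gradient f x))\<^sup>2) \<partial>\<nu>) / (\<integral>\<^sup>+x. ennreal ((f x)\<^sup>2) \<partial>\<nu>)"

definition eigval :: "(real ^ 'n) measure \<Rightarrow> nat \<Rightarrow> ennreal" where
  "eigval \<nu> k = (INF F\<in>H1_frames \<nu> (k + 1).
     SUP f\<in>{f \<in> span_frame (k + 1) F. \<not> (AE x in \<nu>. f x = 0)}. rayleigh \<nu> f)"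

end

theory Submission imports Defs "HOL-Library.Diagonal_Subsequence" begin

text \<open>
  Everything rests on one fact: there is a map \<open>T\<close> that does not increase distances and carries
  \<open>\<mu> \<star> \<gamma>\<close> to \<open>\<mu>\<close>, where \<open>\<gamma>\<close> is the Gaussian measure. Given \<open>T\<close>, a test function \<open>f\<close> for \<open>\<mu>\<close> is
  replaced by \<open>f \<circ> T\<close>. Its law under \<open>\<mu> \<star> \<gamma>\<close> is the law of \<open>f\<close> under \<open>\<mu>\<close>, and
  \<open>|\<nabla>(f \<circ> T)| \<le> |\<nabla>f| \<circ> T\<close>, so variances and \<open>L\<^sup>2\<close>-norms are kept and energies do not grow. Hence the
  Poincare constant and all min-max values compare as claimed.

  The map comes from running the heat flow backwards. Let \<open>X\<close> have law \<open>\<mu>\<close>, let \<open>Z\<close> be an independent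
  standard Gaussian vector, and put \<open>Y\<^sub>r = X + r Z\<close> and \<open>w\<^sub>r(y) = E[Z | Y\<^sub>r = y]\<close>. The posterior mean
  \<open>y - r w\<^sub>r(y) = E[X | Y\<^sub>r = y]\<close> is the gradient of
  \<open>\<psi>(y) = |y|\<^sup>2 / 2 + r\<^sup>2 ln (E exp (-|y - X|\<^sup>2 / (2 r\<^sup>2)))\<close>. The function \<open>\<psi>\<close> is convex for every \<open>\<mu>\<close> by
  Jensen's inequality (\<open>mass_jensen\<close>). If \<open>\<mu>\<close> is log-concave, then the expectation in \<open>\<psi>\<close> is a log-concave
  function of \<open>y\<close> by the Prekopa-Leindler inequality (\<open>prekopa_leindler\<close>, \<open>gaussian_mixture_midpoint\<close>), so
  \<open>\<psi> - |y|\<^sup>2 / 2\<close> is concave. The gradient of such a \<open>\<psi>\<close> does not increase distances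
  (\<open>convex_gradient_nonexpansive\<close>, \<open>posterior_mean_nonexpansive\<close>). For \<open>0 \<le> h \<le> r\<close> the map
  \<open>y \<mapsto> y - h w\<^sub>r(y)\<close> is a convex combination of the identity and the posterior mean, so it does not increase
  distances either.

  This map takes \<open>Y\<^bsub>r+h\<^esub>\<close> to \<open>Y\<^sub>r\<close> up to an error of order \<open>h\<^bsup>3/2\<^esup>\<close>, for \<open>r\<close> bounded away from zero, when tested against bounded functions with
  Lipschitz constant one (\<open>heat_flow_step\<close>), because \<open>w\<^sub>r(Y\<^sub>r)\<close> is the conditional expectation of \<open>Z\<close> and
  \<open>Y\<^bsub>r+h\<^esub>\<close> is \<open>Y\<^sub>r\<close> plus fresh noise of size \<open>O(\<surd>h)\<close>. Composing about \<open>1/h\<close> such maps leads from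
  \<open>Y\<^sub>1\<close>, which has law \<open>\<mu> \<star> \<gamma>\<close>, to \<open>Y\<^sub>e\<close> for a small \<open>e\<close>, with total error \<open>O(\<surd>h)\<close>, and \<open>Y\<^sub>e\<close> is close
  to \<open>X\<close>. A diagonal argument extracts from these compositions a pointwise limit \<open>T\<close>
  (\<open>reverse_heat_flow_map\<close>).

  For the Poincare constant, local Lipschitz constants make \<open>|\<nabla>(f \<circ> T)| \<le> |\<nabla>f| \<circ> T\<close> true at every point
  (\<open>grad_norm_comp_nonexpansive\<close>). For the min-max values, elements of \<open>H\<^sup>1\<close> have only weak gradients, so a
  frame of \<open>H\<^sup>1(\<mu>)\<close> is first replaced by bounded continuously differentiable functions \<open>\<Phi>\<^sub>i\<close> that are close to it
  in \<open>H\<^sup>1(\<mu>)\<close> (\<open>H1_smooth_approx\<close>), and \<open>T\<close> by one of the differentiable maps \<open>S\<^sub>n\<close> converging to it. The Gram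
  matrices of the functions \<open>\<Phi>\<^sub>i \<circ> S\<^sub>n\<close> and of the fields \<open>(\<nabla>\<Phi>\<^sub>i) \<circ> S\<^sub>n\<close> are then close to those of the frame and of its
  weak gradients. The second of them bounds the energies of the functions \<open>\<Phi>\<^sub>i \<circ> S\<^sub>n\<close>, and small changes of the matrices
  perturb the largest Rayleigh quotient only slightly (\<open>quadratic_form_perturbation\<close>, \<open>eigval_nonexpansive_image\<close>).
\<close>

section \<open>The Prekopa-Leindler inequality\<close>

text \<open>
  The set \<open>C\<close> contains the two half-size copies \<open>(A + b)/2\<close> and \<open>(a + B)/2\<close>. If \<open>a\<close> is close to the supremum of
  \<open>A\<close> and \<open>b\<close> to the infimum of \<open>B\<close>, these copies overlap in a short interval only.
\<close>
lemma emeasure_midpoint_bounded: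
  fixes A B C :: "real set"
  assumes m[measurable]: "A \<in> sets borel" "B \<in> sets borel" "C \<in> sets borel"
    and ne: "A \<noteq> {}" "B \<noteq> {}" and bd: "bdd_above A" "bdd_below B"
    and sub: "\<And>a b. a \<in> A \<Longrightarrow> b \<in> B \<Longrightarrow> (a + b) / 2 \<in> C"
  shows "emeasure lborel A + emeasure lborel B \<le> 2 * emeasure lborel C"
proof (rule ennreal_le_epsilon)
  fix e :: real assume e: "0 < e"
  obtain a where a: "a \<in> A" "Sup A - e/2 < a"
    using less_cSupD[OF ne(1), of "Sup A - e/2"] e by auto
  obtain b where b: "b \<in> B" "b < Inf B + e/2"
    using cInf_lessD[OF ne(2), of "Inf B + e/2"] e by auto
  have meas: "(\<lambda>x. 2 * x - c) -` S \<in> sets borel" if S: "S \<in> sets borel" for S :: "real set" and c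
  proof -
    have "(\<lambda>x. 2 * x - c) \<in> borel_measurable borel" by measurable
    from measurable_sets[OF this S] show ?thesis by simp
  qed
  have aff: "emeasure lborel ((\<lambda>x. 2 * x - c) -` S) = emeasure lborel S / 2" if [measurable]: "S \<in> sets borel" for S :: "real set" and c
  proof -
    have "emeasure lborel S = emeasure (density (distr lborel borel (\<lambda>x. -c + 2 * x)) (\<lambda>_. ennreal \<bar>2\<bar>)) S"
      by (subst lborel_real_affine[of 2 "-c"]) simp_all
    also have "\<dots> = 2 * emeasure lborel ((\<lambda>x. 2 * x - c) -` S)"
      by (subst emeasure_density_const) (simp_all add: emeasure_distr)
    finally show ?thesis by (simp add: ennreal_mult_divide_eq mult.commute[of 2])
  qed
  let ?A = "(\<lambda>x. 2 * x - b) -` A" and ?B = "(\<lambda>x. 2 * x - a) -` B"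
  have mA[measurable]: "?A \<in> sets borel" "?B \<in> sets borel"
    by (rule meas, rule m)+
  have "?A \<subseteq> C" "?B \<subseteq> C"
    using sub[OF _ b(1)] sub[OF a(1)] by force+
  have "?A \<inter> ?B \<subseteq> {(Inf B + a)/2 .. (Sup A + b)/2}"
    using cSup_upper[OF _ bd(1)] cInf_lower[OF _ bd(2)] by force
  then have "emeasure lborel (?A \<inter> ?B) \<le> emeasure lborel {(Inf B + a)/2 .. (Sup A + b)/2}"
    by (intro emeasure_mono) auto
  also have "\<dots> \<le> ennreal (e/2)"
  proof -
    have "(Inf B + a)/2 \<le> (Sup A + b)/2" using cSup_upper[OF a(1) bd(1)] cInf_lower[OF b(1) bd(2)] by simp
    then show ?thesis using a b by (subst emeasure_lborel_Icc) (auto intro!: ennreal_leI simp: field_simps)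
  qed
  finally have int: "emeasure lborel (?A \<inter> ?B) \<le> ennreal (e/2)" .
  have "emeasure lborel ?A + emeasure lborel ?B = emeasure lborel (?A \<union> ?B) + emeasure lborel (?A \<inter> ?B)"
    by (intro emeasure_Un_Int) auto
  also have "\<dots> \<le> emeasure lborel C + ennreal (e/2)"
    using \<open>?A \<subseteq> C\<close> \<open>?B \<subseteq> C\<close> by (intro add_mono int emeasure_mono) auto
  finally have "emeasure lborel A / 2 + emeasure lborel B / 2 \<le> emeasure lborel C + ennreal (e/2)"
    by (simp add: aff)
  then have "2 * (emeasure lborel A / 2 + emeasure lborel B / 2) \<le> 2 * (emeasure lborel C + ennreal (e/2))"
    by (intro mult_left_mono) auto
  moreover have "2 * (x / 2) = x" for x :: ennreal
    by (simp add: ennreal_times_divide mult.commute[of 2] ennreal_mult_divide_eq)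
  moreover have "2 * ennreal (e/2) = ennreal e" using e
    by (simp add: ennreal_numeral[symmetric] ennreal_mult[symmetric] del: ennreal_numeral)
  ultimately show "emeasure lborel A + emeasure lborel B \<le> 2 * emeasure lborel C + ennreal e"
    by (simp add: distrib_left)
qed

lemma emeasure_midpoint:
  fixes A B C :: "real set"
  assumes m[measurable]: "A \<in> sets borel" "B \<in> sets borel" "C \<in> sets borel"
    and ne: "A \<noteq> {}" "B \<noteq> {}"
    and sub: "\<And>a b. a \<in> A \<Longrightarrow> b \<in> B \<Longrightarrow> (a + b) / 2 \<in> C"
  shows "emeasure lborel A + emeasure lborel B \<le> 2 * emeasure lborel C"
proof -
  obtain a b where ab: "a \<in> A" "b \<in> B" using ne by auto
  let ?A = "\<lambda>n::nat. A \<inter> {..a + real n}" and ?B = "\<lambda>n::nat. B \<inter> {b - real n..}"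
  have "(\<lambda>n. emeasure lborel (?A n)) \<longlonglongrightarrow> emeasure lborel (\<Union>n. ?A n)"
    by (intro Lim_emeasure_incseq) (auto simp: incseq_def)
  moreover have "(\<Union>n. ?A n) = A"
  proof -
    { fix x obtain n where "x - a \<le> real n" using real_arch_simple by blast
      then have "x \<le> a + real n" by simp then have "\<exists>n. x \<le> a + real n" by blast }
    then show ?thesis by auto
  qed
  moreover have "(\<lambda>n. emeasure lborel (?B n)) \<longlonglongrightarrow> emeasure lborel (\<Union>n. ?B n)"
    by (intro Lim_emeasure_incseq) (auto simp: incseq_def)
  moreover have "(\<Union>n. ?B n) = B"
  proof -
    { fix x obtain n where "b - x \<le> real n" using real_arch_simple by blast
      then have "b - real n \<le> x" by simp then have "\<exists>n. b - real n \<le> x" by blast }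
    then show ?thesis by auto
  qed
  ultimately have "(\<lambda>n. emeasure lborel (?A n) + emeasure lborel (?B n)) \<longlonglongrightarrow> emeasure lborel A + emeasure lborel B"
    by (auto intro!: tendsto_add)
  moreover have "emeasure lborel (?A n) + emeasure lborel (?B n) \<le> 2 * emeasure lborel C" for n
    using ab by (intro emeasure_midpoint_bounded) (auto intro: sub)
  ultimately show ?thesis by (intro LIMSEQ_le_const2) auto
qed

text \<open>
  Tonelli's theorem for the region below the graph of \<open>f\<close>.
\<close>
lemma nn_integral_layer_cake:
  fixes f :: "real \<Rightarrow> ennreal"
  assumes [measurable]: "f \<in> borel_measurable borel"
  shows "(\<integral>\<^sup>+x. f x \<partial>lborel) = (\<integral>\<^sup>+l. indicator {0..} l * emeasure lborel {x. ennreal l < f x} \<partial>lborel)"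
proof -
  have 1: "(\<integral>\<^sup>+l. indicator {0..} l * indicator {l. ennreal l < c} l \<partial>lborel) = c" for c
  proof (cases c)
    case (real r)
    have "(\<integral>\<^sup>+l. indicator {0..} l * indicator {l. ennreal l < c} l \<partial>lborel) = (\<integral>\<^sup>+l. indicator {0..<r} l \<partial>lborel)"
      using real by (intro nn_integral_cong) (auto simp: indicator_def ennreal_less_iff)
    then show ?thesis using real by simp
  next
    case top
    have "(\<integral>\<^sup>+l. indicator {0..} l * indicator {l. ennreal l < c} l \<partial>lborel) = (\<integral>\<^sup>+l. indicator {0::real..} l \<partial>lborel)"
      using top by (intro nn_integral_cong) (auto simp: indicator_def)
    also have "\<dots> = emeasure lborel {0::real..}" by simp
    also have "\<dots> = \<infinity>"
    proof -
      have "ennreal (real n) \<le> emeasure lborel {0::real..}" for n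
        using emeasure_mono[of "{0..real n}" "{0..}" lborel] by simp
      then show ?thesis by (metis ennreal_of_nat_eq_real_of_nat ennreal_SUP_of_nat_eq_top SUP_least infinity_ennreal_def top.extremum_uniqueI)
    qed
    finally show ?thesis using top by simp
  qed
  have "(\<integral>\<^sup>+x. f x \<partial>lborel) = (\<integral>\<^sup>+x. \<integral>\<^sup>+l. indicator {0..} l * indicator {l. ennreal l < f x} l \<partial>lborel \<partial>lborel)"
    by (simp add: 1)
  also have "\<dots> = (\<integral>\<^sup>+l. \<integral>\<^sup>+x. indicator {0..} l * indicator {l. ennreal l < f x} l \<partial>lborel \<partial>lborel)"
    by (intro lborel_pair.Fubini') measurable
  also have "\<dots> = (\<integral>\<^sup>+l. indicator {0..} l * (\<integral>\<^sup>+x. indicator {x. ennreal l < f x} x \<partial>lborel) \<partial>lborel)"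
    by (subst nn_integral_cmult[symmetric]) (auto simp: indicator_def)
  finally show ?thesis by simp
qed

text \<open>
  After division by their suprema \<open>a\<close> and \<open>b\<close>, the functions \<open>f\<close> and \<open>g\<close> have nonempty superlevel sets at exactly
  the same levels in \<open>[0, 1)\<close>. At each such level the midpoints of the two sets lie in a superlevel set of
  \<open>h/\<surd>(ab)\<close>, so \<open>emeasure_midpoint\<close> and integration over the levels give
  \<open>\<integral>f/a + \<integral>g/b \<le> 2 \<integral>h/\<surd>(ab)\<close>. The inequality between arithmetic and geometric means turns the sum into the product.
\<close>
lemma prekopa_leindler_1d_bounded:
  fixes f g h :: "real \<Rightarrow> ennreal"
  assumes m[measurable]: "f \<in> borel_measurable borel" "g \<in> borel_measurable borel" "h \<in> borel_measurable borel"
    and bd: "(SUP x. f x) < \<infinity>" "(SUP x. g x) < \<infinity>"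
    and le: "\<And>x y. f x * g y \<le> (h ((x + y) / 2))\<^sup>2"
  shows "(\<integral>\<^sup>+x. f x \<partial>lborel) * (\<integral>\<^sup>+x. g x \<partial>lborel) \<le> (\<integral>\<^sup>+x. h x \<partial>lborel)\<^sup>2"
proof -
  obtain a where a: "(SUP x. f x) = ennreal a" "0 \<le> a" using bd(1) by (cases "SUP x. f x") auto
  obtain b where b: "(SUP x. g x) = ennreal b" "0 \<le> b" using bd(2) by (cases "SUP x. g x") auto
  have fa: "f x \<le> ennreal a" for x unfolding a(1)[symmetric] by (rule SUP_upper) simp
  have gb: "g x \<le> ennreal b" for x unfolding b(1)[symmetric] by (rule SUP_upper) simp
  show ?thesis
  proof (cases "a = 0 \<or> b = 0")
    case True
    then have "(\<forall>x. f x = 0) \<or> (\<forall>x. g x = 0)" using fa gb by auto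
    then show ?thesis by auto
  next
    case False
    then have pos: "0 < a" "0 < b" using a b by auto
    define c where "c = sqrt (a * b)"
    have c: "0 < c" "c\<^sup>2 = a * b" using pos by (auto simp: c_def)
    have lc: "(\<integral>\<^sup>+x. u x / ennreal s \<partial>lborel) = (\<integral>\<^sup>+l. indicator {0..} l * emeasure lborel {x. ennreal (l * s) < u x} \<partial>lborel)"
      if [measurable]: "u \<in> borel_measurable borel" and s: "0 < s" for u :: "real \<Rightarrow> ennreal" and s
    proof -
      have "ennreal l < y / ennreal s \<longleftrightarrow> ennreal (l * s) < y" if "0 \<le> l" for l y
        using s that by (cases y) (auto simp: divide_ennreal ennreal_less_iff field_simps ennreal_top_divide)
      then show ?thesis
        by (subst nn_integral_layer_cake) (auto intro!: nn_integral_cong simp: indicator_def)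
    qed
    have one: "indicator {0..} l * emeasure lborel {x. ennreal (l * s) < u x} = indicator {0..<1} l * emeasure lborel {x. ennreal (l * s) < u x}"
      if "\<And>x. u x \<le> ennreal s" "0 < s" for u :: "real \<Rightarrow> ennreal" and s l
    proof (cases "0 \<le> l \<and> \<not> l < 1")
      case True
      then have "ennreal s \<le> ennreal (l * s)" using that(2) by (intro ennreal_leI) auto
      then have "{x. ennreal (l * s) < u x} = {}" using that(1) by (auto simp: not_less intro: order_trans)
      then show ?thesis by simp
    qed (auto simp: indicator_def)
    have key: "emeasure lborel {x. ennreal (l * a) < f x} + emeasure lborel {x. ennreal (l * b) < g x}
        \<le> 2 * emeasure lborel {x. ennreal (l * c) < h x}" if l: "0 \<le> l" "l < 1" for l
    proof (rule emeasure_midpoint)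
      have "ennreal (l * a) < (SUP x. f x)" using l pos by (simp add: a ennreal_less_iff)
      then show "{x. ennreal (l * a) < f x} \<noteq> {}" by (auto simp: less_SUP_iff)
      have "ennreal (l * b) < (SUP x. g x)" using l pos by (simp add: b ennreal_less_iff)
      then show "{x. ennreal (l * b) < g x} \<noteq> {}" by (auto simp: less_SUP_iff)
      fix x y assume "x \<in> {x. ennreal (l * a) < f x}" "y \<in> {x. ennreal (l * b) < g x}"
      then have xy: "ennreal (l * a) < f x" "ennreal (l * b) < g y" by auto
      have "ennreal ((l*c)\<^sup>2) = ennreal (l * a) * ennreal (l * b)" using l pos
        by (subst ennreal_mult[symmetric]) (auto simp: power_mult_distrib c(2) power2_eq_square[of l] mult_ac)
      also have "\<dots> < f x * g y"
      proof -
        obtain p q where pq: "f x = ennreal p" "0 \<le> p" "g y = ennreal q" "0 \<le> q"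
          using fa[of x] gb[of y] by (cases "f x"; cases "g y") (auto simp: top_unique)
        with xy l pos have "l * a < p" "l * b < q" by (auto simp: ennreal_less_iff)
        then have "(l * a) * (l * b) < p * q" using l pos by (intro mult_strict_mono') auto
        then show ?thesis using pq l pos by (simp add: ennreal_mult[symmetric] ennreal_less_iff)
      qed
      also have "\<dots> \<le> (h ((x+y)/2))\<^sup>2" by (rule le)
      finally have "ennreal (l * c) ^ 2 < (h ((x+y)/2))^2" using l c by (simp add: ennreal_power)
      then have "ennreal (l * c) < h ((x+y)/2)"
        by (metis power_mono not_le zero_le)
      then show "(x + y) / 2 \<in> {x. ennreal (l * c) < h x}" by simp
    qed simp_all
    have "(\<integral>\<^sup>+x. f x / ennreal a \<partial>lborel) + (\<integral>\<^sup>+x. g x / ennreal b \<partial>lborel)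
      = (\<integral>\<^sup>+l. indicator {0..<1} l * emeasure lborel {x. ennreal (l * a) < f x} + indicator {0..<1} l * emeasure lborel {x. ennreal (l * b) < g x} \<partial>lborel)"
      by (simp add: lc pos one fa gb nn_integral_add)
    also have "\<dots> \<le> (\<integral>\<^sup>+l. 2 * (indicator {0..} l * emeasure lborel {x. ennreal (l * c) < h x}) \<partial>lborel)"
      using key by (intro nn_integral_mono) (auto simp: indicator_def)
    also have "\<dots> = 2 * (\<integral>\<^sup>+x. h x / ennreal c \<partial>lborel)"
      by (simp add: nn_integral_cmult lc c)
    finally have main: "(\<integral>\<^sup>+x. f x \<partial>lborel) / a + (\<integral>\<^sup>+x. g x \<partial>lborel) / b \<le> 2 * ((\<integral>\<^sup>+x. h x \<partial>lborel) / c)"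
      by (simp add: nn_integral_divide)
    show ?thesis
    proof (cases "(\<integral>\<^sup>+x. h x \<partial>lborel)")
      case top then show ?thesis by simp
    next
      case (real H)
      have fin: "(\<integral>\<^sup>+x. f x \<partial>lborel) / a + (\<integral>\<^sup>+x. g x \<partial>lborel) / b \<le> ennreal (2 * (H / c))"
        using main real c by (simp add: divide_ennreal ennreal_mult[symmetric] ennreal_numeral[symmetric] del: ennreal_numeral)
      have "(\<integral>\<^sup>+x. f x \<partial>lborel) / a \<noteq> \<top>" "(\<integral>\<^sup>+x. g x \<partial>lborel) / b \<noteq> \<top>"
        using fin by (auto simp: top_unique)
      then obtain F G where FG: "(\<integral>\<^sup>+x. f x \<partial>lborel) = ennreal F" "0 \<le> F" "(\<integral>\<^sup>+x. g x \<partial>lborel) = ennreal G" "0 \<le> G"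
        using pos by (cases "\<integral>\<^sup>+x. f x \<partial>lborel"; cases "\<integral>\<^sup>+x. g x \<partial>lborel") (auto simp: ennreal_top_divide)
      then have r: "F / a + G / b \<le> 2 * (H / c)" using fin pos c real
        by (simp add: divide_ennreal ennreal_plus[symmetric] del: ennreal_plus)
      have nn: "0 \<le> F / a" "0 \<le> G / b" using FG pos by auto
      have "4 * (F / a * (G / b)) \<le> (F/a + G/b)\<^sup>2"
        using zero_le_power2[of "F/a - G/b"] unfolding power2_diff power2_sum by linarith
      also have "\<dots> \<le> (2 * (H / c))\<^sup>2" using r nn by (intro power_mono) auto
      finally have "F * G / (a * b) \<le> H\<^sup>2 / c\<^sup>2" by (simp add: power_mult_distrib power_divide)
      then have "F * G \<le> H\<^sup>2" using pos unfolding c(2) by (simp add: divide_le_cancel)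
      then show ?thesis using FG real by (simp add: ennreal_mult[symmetric] ennreal_power ennreal_leI)
    qed
  qed
qed

lemma prekopa_leindler_1d:
  fixes f g h :: "real \<Rightarrow> ennreal"
  assumes m[measurable]: "f \<in> borel_measurable borel" "g \<in> borel_measurable borel" "h \<in> borel_measurable borel"
    and le: "\<And>x y. f x * g y \<le> (h ((x + y) / 2))\<^sup>2"
  shows "(\<integral>\<^sup>+x. f x \<partial>lborel) * (\<integral>\<^sup>+x. g x \<partial>lborel) \<le> (\<integral>\<^sup>+x. h x \<partial>lborel)\<^sup>2"
proof -
  have min_of_nat: "(SUP n. min (c::ennreal) (of_nat n)) = c" for c
    by (subst inf_min[symmetric], subst inf_SUP[symmetric]) (simp add: ennreal_SUP_of_nat_eq_top)
  have lim: "(\<integral>\<^sup>+x. u x \<partial>lborel) = (SUP n. \<integral>\<^sup>+x. min (u x) (of_nat n) \<partial>lborel)"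
    if [measurable]: "u \<in> borel_measurable borel" for u :: "real \<Rightarrow> ennreal"
  proof -
    have "(\<integral>\<^sup>+x. u x \<partial>lborel) = (\<integral>\<^sup>+x. (SUP n. min (u x) (of_nat n)) \<partial>lborel)" by (simp add: min_of_nat)
    also have "\<dots> = (SUP n. \<integral>\<^sup>+x. min (u x) (of_nat n) \<partial>lborel)"
      by (intro nn_integral_monotone_convergence_SUP) (auto simp: incseq_def le_fun_def intro: min.coboundedI2)
    finally show ?thesis .
  qed
  have bd: "(SUP x. min (u x) (of_nat n)) < (\<infinity>::ennreal)" for u :: "real \<Rightarrow> ennreal" and n
  proof -
    have "(SUP x. min (u x) (of_nat n)) \<le> (of_nat n :: ennreal)" by (intro SUP_least) simp
    also have "\<dots> < \<infinity>" by (simp add: of_nat_less_top)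
    finally show ?thesis .
  qed
  have "(\<integral>\<^sup>+x. min (f x) (of_nat i) \<partial>lborel) * (\<integral>\<^sup>+x. min (g x) (of_nat j) \<partial>lborel) \<le> (\<integral>\<^sup>+x. h x \<partial>lborel)\<^sup>2" for i j
    by (intro prekopa_leindler_1d_bounded bd order_trans[OF mult_mono le]) auto
  then show ?thesis
    unfolding lim[OF m(1)] lim[OF m(2)] SUP_mult_right_ennreal SUP_mult_left_ennreal
    by (auto intro!: SUP_least)
qed

text \<open>
  Tensorisation: for fixed first coordinates the one-dimensional inequality applies to the last coordinate, and it says that
  the marginals of \<open>f\<close>, \<open>g\<close>, \<open>h\<close> satisfy the hypothesis in one dimension less.
\<close>
lemma prekopa_leindler:
  fixes f g h :: "(nat \<Rightarrow> real) \<Rightarrow> ennreal"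
  assumes "f \<in> borel_measurable (lborel_pow k)" "g \<in> borel_measurable (lborel_pow k)" "h \<in> borel_measurable (lborel_pow k)"
    and "\<And>x y. x \<in> space (lborel_pow k) \<Longrightarrow> y \<in> space (lborel_pow k) \<Longrightarrow> f x * g y \<le> (h (segment_pt k (1/2) x y))\<^sup>2"
  shows "(\<integral>\<^sup>+x. f x \<partial>lborel_pow k) * (\<integral>\<^sup>+x. g x \<partial>lborel_pow k) \<le> (\<integral>\<^sup>+x. h x \<partial>lborel_pow k)\<^sup>2"
  using assms
proof (induction k arbitrary: f g h)
  case 0
  have "segment_pt 0 (1/2) (\<lambda>_. undefined) (\<lambda>_. undefined) = (\<lambda>_. undefined)" by (simp add: segment_pt_def)
  moreover have "(\<lambda>_. undefined) \<in> space (lborel_pow 0)" by (simp add: lborel_pow_def space_PiM)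
  ultimately show ?case using 0(4)[of "\<lambda>_. undefined" "\<lambda>_. undefined"]
    by (simp add: lborel_pow_def PiM_empty nn_integral_count_space_finite)
next
  case (Suc k)
  interpret product_sigma_finite "\<lambda>_::nat. lborel :: real measure"
    by unfold_locales
  have ins: "{..<Suc k} = insert k {..<k}" by auto
  have pw: "lborel_pow (Suc k) = PiM (insert k {..<k}) (\<lambda>_. lborel)" by (simp add: lborel_pow_def ins)
  note [measurable] = Suc.prems(1-3)[unfolded pw]
  have dec: "(\<integral>\<^sup>+x. u x \<partial>lborel_pow (Suc k)) = (\<integral>\<^sup>+x. (\<integral>\<^sup>+y. u (x(k := y)) \<partial>lborel) \<partial>lborel_pow k)"
    if "u \<in> borel_measurable (lborel_pow (Suc k))" for u :: "(nat \<Rightarrow> real) \<Rightarrow> ennreal"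
    unfolding pw unfolding lborel_pow_def
    by (rule product_nn_integral_insert) (use that[unfolded pw] in auto)
  have sl: "(\<lambda>y. u (x(k := y))) \<in> borel_measurable borel"
    if "u \<in> borel_measurable (lborel_pow (Suc k))" "x \<in> space (lborel_pow k)" for u :: "(nat \<Rightarrow> real) \<Rightarrow> ennreal" and x
  proof -
    have "(\<lambda>y. x(k := y)) \<in> measurable lborel (PiM (insert k {..<k}) (\<lambda>_. lborel))"
      using that(2) by (intro measurable_fun_upd[where J="{..<k}"]) (auto simp: lborel_pow_def)
    from measurable_compose[OF this that(1)[unfolded pw]] show ?thesis by simp
  qed
  have ms: "(\<lambda>x. \<integral>\<^sup>+y. u (x(k := y)) \<partial>lborel) \<in> borel_measurable (lborel_pow k)"
    if u: "u \<in> borel_measurable (lborel_pow (Suc k))" for u :: "(nat \<Rightarrow> real) \<Rightarrow> ennreal"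
  proof -
    have "(\<lambda>(x, y). x(k := y)) \<in> measurable (lborel_pow k \<Otimes>\<^sub>M lborel) (PiM (insert k {..<k}) (\<lambda>_. lborel))"
      unfolding lborel_pow_def by (rule measurable_add_dim)
    from measurable_compose[OF this u[unfolded pw]] show ?thesis
      by (intro lborel.borel_measurable_nn_integral) (simp add: case_prod_beta')
  qed
  show ?case
    unfolding dec[OF Suc.prems(1)] dec[OF Suc.prems(2)] dec[OF Suc.prems(3)]
  proof (rule Suc.IH[OF ms[OF Suc.prems(1)] ms[OF Suc.prems(2)] ms[OF Suc.prems(3)]])
    fix x x' assume x: "x \<in> space (lborel_pow k)" and x': "x' \<in> space (lborel_pow k)"
    have sp: "segment_pt k (1/2) x x' \<in> space (lborel_pow k)" by (auto simp: segment_pt_def lborel_pow_def space_PiM)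
    show "(\<integral>\<^sup>+y. f (x(k := y)) \<partial>lborel) * (\<integral>\<^sup>+y. g (x'(k := y)) \<partial>lborel)
       \<le> (\<integral>\<^sup>+y. h ((segment_pt k (1/2) x x')(k := y)) \<partial>lborel)\<^sup>2"
    proof (rule prekopa_leindler_1d[OF sl[OF Suc.prems(1) x] sl[OF Suc.prems(2) x'] sl[OF Suc.prems(3) sp]])
      fix y y' :: real
      have up: "x(k := y) \<in> space (lborel_pow (Suc k))" "x'(k := y') \<in> space (lborel_pow (Suc k))"
        using x x' by (auto simp: lborel_pow_def space_PiM PiE_def extensional_def)
      have "segment_pt (Suc k) (1/2) (x(k := y)) (x'(k := y')) = (segment_pt k (1/2) x x')(k := (y + y')/2)"
        by (auto simp: segment_pt_def fun_eq_iff less_Suc_eq field_simps)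
      from Suc.prems(4)[OF up, unfolded this]
      show "f (x(k := y)) * g (x'(k := y')) \<le> (h ((segment_pt k (1/2) x x')(k := (y + y')/2)))\<^sup>2" .
    qed
  qed
qed

section \<open>Log-concave measures smoothed by a Gaussian\<close>

lemma log_concave_fun_midpoint:
  assumes \<rho>: "log_concave_fun k \<rho>" and x: "x \<in> space (lborel_pow k)" "y \<in> space (lborel_pow k)"
  shows "\<rho> x * \<rho> y \<le> (\<rho> (segment_pt k (1/2) x y))\<^sup>2"
proof (cases "\<rho> x > 0 \<and> \<rho> y > 0")
  case True
  have t: "1/2 \<in> {0..1::real}" by simp
  have K: "segment_pt k (1/2) x y \<in> space (lborel_pow k) \<and> \<rho> (segment_pt k (1/2) x y) > 0"
    and l: "(1 - 1/2) * ln (\<rho> x) + 1/2 * ln (\<rho> y) \<le> ln (\<rho> (segment_pt k (1/2) x y))"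
    using \<rho> x True t unfolding log_concave_fun_def Let_def by blast+
  have "ln (\<rho> x * \<rho> y) \<le> ln ((\<rho> (segment_pt k (1/2) x y))\<^sup>2)"
    using l True K by (simp add: ln_mult ln_realpow)
  then show ?thesis using True K by (subst (asm) ln_le_cancel_iff) auto
next
  case False
  then have "\<rho> x * \<rho> y = 0" using \<rho> x unfolding log_concave_fun_def by (auto simp: not_less intro!: antisym)
  then show ?thesis by (metis zero_le_power2)
qed

lemma affine_map_midpoint:
  "affine_map k b v (segment_pt k (1/2) x y) = (1/2) *\<^sub>R (affine_map k b v x + affine_map k b v y)"
proof -
  have "(\<Sum>i<k. segment_pt k (1/2) x y i *\<^sub>R v i) = (\<Sum>i<k. (1/2) *\<^sub>R (x i *\<^sub>R v i + y i *\<^sub>R v i))"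
    by (intro sum.cong) (auto simp: segment_pt_def scaleR_add_left scaleR_add_right)
  also have "\<dots> = (1/2) *\<^sub>R ((\<Sum>i<k. x i *\<^sub>R v i) + (\<Sum>i<k. y i *\<^sub>R v i))"
    by (simp only: scaleR_sum_right[symmetric] sum.distrib)
  finally have 1: "(\<Sum>i<k. segment_pt k (1/2) x y i *\<^sub>R v i) = (1/2) *\<^sub>R ((\<Sum>i<k. x i *\<^sub>R v i) + (\<Sum>i<k. y i *\<^sub>R v i))" .
  have 2: "b + (1/2) *\<^sub>R (p + q) = (1/2) *\<^sub>R (b + p + (b + q))" for p q
  proof -
    have "(1/2) *\<^sub>R (b + p + (b + q)) = (1/2) *\<^sub>R ((b + b) + (p + q))" by (simp only: ac_simps)
    also have "\<dots> = b + (1/2) *\<^sub>R (p + q)" by (subst scaleR_add_right) (simp only: scaleR_half_double)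
    finally show ?thesis by simp
  qed
  show ?thesis unfolding affine_map_def 1 by (rule 2)
qed

lemma affine_map_measurable[measurable]:
  fixes b :: "'a::euclidean_space"
  shows "affine_map k b v \<in> borel_measurable (lborel_pow k)"
  unfolding affine_map_def[abs_def] lborel_pow_def by measurable

lemma prob_space_log_concave_measure: "log_concave_measure \<mu> \<Longrightarrow> prob_space \<mu>"
  and sets_log_concave_measure: "log_concave_measure \<mu> \<Longrightarrow> sets \<mu> = sets borel"
  by (auto simp: log_concave_measure_def ac_log_concave_measure_def intro!: prob_space.prob_space_distr)

text \<open>
  The integrals are values of the convolution of \<open>\<mu>\<close> with the function \<open>exp (-c |x|\<^sup>2)\<close>. Pulled back to \<open>\<real>\<^sup>k\<close> along the affine
  parametrisation of \<open>\<mu>\<close>, the integrand is a product of a log-concave density and a log-concave function of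
  \<open>y\<close> and the integration variable jointly, so the Prekopa-Leindler inequality applies; it also covers measures carried by a proper affine
  subspace.
\<close>
lemma gaussian_mixture_midpoint:
  fixes \<mu> :: "(real ^ 'n) measure"
  assumes \<mu>: "log_concave_measure \<mu>" and c: "0 \<le> (c::real)"
  shows "(\<integral>x. exp (- c * (norm (y - x))\<^sup>2) \<partial>\<mu>) * (\<integral>x. exp (- c * (norm (z - x))\<^sup>2) \<partial>\<mu>)
     \<le> (\<integral>x. exp (- c * (norm ((1/2) *\<^sub>R (y + z) - x))\<^sup>2) \<partial>\<mu>)\<^sup>2"
proof -
  obtain k \<kappa> b v where k: "ac_log_concave_measure k \<kappa>" and d: "\<mu> = distr \<kappa> borel (affine_map k b v)"
    using \<mu> unfolding log_concave_measure_def by blast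
  obtain \<rho> where \<rho>[measurable]: "\<rho> \<in> borel_measurable (lborel_pow k)" and lc: "log_concave_fun k \<rho>"
    and \<kappa>: "\<kappa> = density (lborel_pow k) (\<lambda>x. ennreal (\<rho> x))"
    using k unfolding ac_log_concave_measure_def by blast
  interpret prob_space \<mu> by (rule prob_space_log_concave_measure[OF \<mu>])
  let ?A = "affine_map k b v"
  let ?f = "\<lambda>y x. ennreal (exp (- c * (norm (y - x))\<^sup>2))"
  have eq: "ennreal (\<integral>x. exp (- c * (norm (y - x))\<^sup>2) \<partial>\<mu>) = (\<integral>\<^sup>+x. ennreal (\<rho> x) * ?f y (?A x) \<partial>lborel_pow k)" for y
  proof -
    have "integrable \<mu> (\<lambda>x. exp (- c * (norm (y - x))\<^sup>2))"
      using c by (intro integrable_const_bound[where B=1]) (auto simp: d)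
    then have "ennreal (\<integral>x. exp (- c * (norm (y - x))\<^sup>2) \<partial>\<mu>) = (\<integral>\<^sup>+x. ?f y x \<partial>\<mu>)"
      by (simp add: nn_integral_eq_integral)
    also have "\<dots> = (\<integral>\<^sup>+x. ?f y (?A x) \<partial>\<kappa>)" unfolding d \<kappa> by (subst nn_integral_distr) auto
    also have "\<dots> = (\<integral>\<^sup>+x. ennreal (\<rho> x) * ?f y (?A x) \<partial>lborel_pow k)"
      unfolding \<kappa> by (subst nn_integral_density) auto
    finally show ?thesis .
  qed
  have "(\<integral>\<^sup>+x. ennreal (\<rho> x) * ?f y (?A x) \<partial>lborel_pow k) * (\<integral>\<^sup>+x. ennreal (\<rho> x) * ?f z (?A x) \<partial>lborel_pow k)
    \<le> (\<integral>\<^sup>+x. ennreal (\<rho> x) * ?f ((1/2) *\<^sub>R (y + z)) (?A x) \<partial>lborel_pow k)\<^sup>2"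
  proof (rule prekopa_leindler, measurable)
    fix x x' assume x: "x \<in> space (lborel_pow k)" "x' \<in> space (lborel_pow k)"
    let ?m = "segment_pt k (1/2) x x'"
    have sm: "?m \<in> space (lborel_pow k)" by (auto simp: segment_pt_def lborel_pow_def space_PiM)
    have nn: "0 \<le> \<rho> x" "0 \<le> \<rho> x'" "0 \<le> \<rho> ?m" using lc x sm unfolding log_concave_fun_def by auto
    have par: "2 * (norm ((1/2) *\<^sub>R (p + q)))\<^sup>2 \<le> (norm p)\<^sup>2 + (norm q)\<^sup>2" for p q :: "real ^ 'n"
    proof -
      have "2 * (norm ((1/2) *\<^sub>R (p + q)))\<^sup>2 = (norm p)\<^sup>2 + (norm q)\<^sup>2 - (norm (p - q))\<^sup>2 / 2"
        by (simp add: power2_norm_eq_inner inner_simps inner_commute field_simps)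
      then show ?thesis by (smt (verit) zero_le_power2 divide_nonneg_pos)
    qed
    have e: "(1/2) *\<^sub>R (y + z) - ?A ?m = (1/2) *\<^sub>R ((y - ?A x) + (z - ?A x'))"
      by (simp add: affine_map_midpoint algebra_simps)
    have "c * (2 * (norm ((1/2) *\<^sub>R (y + z) - ?A ?m))\<^sup>2) \<le> c * ((norm (y - ?A x))\<^sup>2 + (norm (z - ?A x'))\<^sup>2)"
      unfolding e using par c by (intro mult_left_mono) auto
    then have "exp (- c * (norm (y - ?A x))\<^sup>2) * exp (- c * (norm (z - ?A x'))\<^sup>2) \<le> (exp (- c * (norm ((1/2) *\<^sub>R (y + z) - ?A ?m))\<^sup>2))\<^sup>2"
      by (simp add: exp_add[symmetric] power2_eq_square algebra_simps)
    then have "(\<rho> x * \<rho> x') * (exp (- c * (norm (y - ?A x))\<^sup>2) * exp (- c * (norm (z - ?A x'))\<^sup>2))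
       \<le> (\<rho> ?m)\<^sup>2 * (exp (- c * (norm ((1/2) *\<^sub>R (y + z) - ?A ?m))\<^sup>2))\<^sup>2"
      using log_concave_fun_midpoint[OF lc x] nn by (intro mult_mono) auto
    then show "ennreal (\<rho> x) * ?f y (?A x) * (ennreal (\<rho> x') * ?f z (?A x')) \<le> (ennreal (\<rho> ?m) * ?f ((1/2) *\<^sub>R (y + z)) (?A ?m))\<^sup>2"
      using nn by (simp add: ennreal_mult[symmetric] ennreal_power ennreal_leI power_mult_distrib mult_ac)
  qed
  then show ?thesis unfolding eq[symmetric]
    by (simp add: ennreal_mult[symmetric] ennreal_power)
qed

section \<open>Gaussian measures and additive Gaussian noise\<close>

definition gauss :: "real \<Rightarrow> 'a::euclidean_space \<Rightarrow> real" where
  "gauss r z = (\<Prod>b\<in>Basis. normal_density 0 r (z \<bullet> b))"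

lemma gauss_eq:
  fixes z :: "'a::euclidean_space"
  assumes "0 < r"
  shows "gauss r z = (1 / (sqrt (2 * pi) * r)) ^ DIM('a) * exp (- (norm z)\<^sup>2 / (2 * r\<^sup>2))"
proof -
  have "gauss r z = (\<Prod>b\<in>(Basis::'a set). (1 / (sqrt (2 * pi) * r)) * exp (- (z \<bullet> b)\<^sup>2 / (2 * r\<^sup>2)))"
    unfolding gauss_def normal_density_def using assms by (simp add: real_sqrt_mult)
  also have "\<dots> = (1 / (sqrt (2 * pi) * r)) ^ DIM('a) * exp (\<Sum>b\<in>Basis. - (z \<bullet> b)\<^sup>2 / (2 * r\<^sup>2))"
    by (subst prod.distrib) (simp add: exp_sum)
  also have "(\<Sum>b\<in>Basis. - (z \<bullet> b)\<^sup>2 / (2 * r\<^sup>2)) = - (norm z)\<^sup>2 / (2 * r\<^sup>2)"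
    unfolding sum_divide_distrib[symmetric] sum_negf norm_eq_sqrt_inner
    by (subst (2) euclidean_inner) (simp add: power2_eq_square sum_nonneg)
  finally show ?thesis .
qed

lemma gauss_nonneg[simp]: "0 \<le> gauss r z"
  unfolding gauss_def by (intro prod_nonneg) simp

lemma gauss_measurable[measurable]: "gauss r \<in> borel_measurable borel"
  unfolding gauss_def[abs_def] by measurable

lemma nn_integral_gauss:
  assumes "0 < r"
  shows "(\<integral>\<^sup>+z. ennreal (gauss r (z::'a::euclidean_space)) \<partial>lborel) = 1"
proof -
  have "(\<integral>\<^sup>+z. ennreal (gauss r (z::'a)) \<partial>lborel) = (\<integral>\<^sup>+z. (\<Prod>b\<in>(Basis::'a set). ennreal (normal_density 0 r (z \<bullet> b))) \<partial>lborel)"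
    unfolding gauss_def by (simp add: prod_ennreal)
  also have "\<dots> = (\<Prod>b\<in>(Basis::'a set). \<integral>\<^sup>+x. ennreal (normal_density 0 r x) \<partial>lborel)"
    by (rule nn_integral_lborel_prod) auto
  also have "(\<integral>\<^sup>+x. ennreal (normal_density 0 r x) \<partial>lborel) = 1"
    using assms by (subst nn_integral_eq_integral) auto
  finally show ?thesis by simp
qed

lemma integrable_gauss[simp]: "0 < r \<Longrightarrow> integrable lborel (gauss r :: 'a::euclidean_space \<Rightarrow> real)"
  by (intro integrableI_nonneg) (auto simp: nn_integral_gauss)

definition gauss_measure :: "'a::euclidean_space measure" where
  "gauss_measure = density lborel (\<lambda>z. ennreal (gauss 1 z))"

lemma std_gaussian_eq: "(std_gaussian :: (real ^ 'n) measure) = gauss_measure"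
proof -
  have "(2 * pi) powr (- real CARD('n) / 2) = ((2 * pi) powr (- 1 / 2)) powr real CARD('n)"
    by (simp add: powr_powr)
  also have "\<dots> = ((2 * pi) powr (- 1 / 2)) ^ CARD('n)"
    by (rule powr_realpow) simp
  also have "(2 * pi) powr (- 1 / 2) = 1 / sqrt (2 * pi)"
    using powr_minus[of "2 * pi" "1/2"] powr_half_sqrt[of "2 * pi"] by (simp add: inverse_eq_divide)
  finally have "(2 * pi) powr (- real CARD('n) / 2) = (1 / sqrt (2 * pi)) ^ CARD('n)" .
  then show ?thesis unfolding std_gaussian_def gauss_measure_def by (simp add: gauss_eq)
qed

lemma sets_gauss_measure[simp, measurable_cong]: "sets gauss_measure = sets borel"
  and space_gauss_measure[simp]: "space gauss_measure = UNIV"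
  by (simp_all add: gauss_measure_def)

interpretation gauss: prob_space "gauss_measure :: 'a::euclidean_space measure"
  by (rule prob_spaceI) (simp add: gauss_measure_def emeasure_density nn_integral_gauss)

lemma gauss_translate_scale:
  fixes z :: "'a::euclidean_space"
  assumes "0 < r"
  shows "gauss r (r *\<^sub>R z) * r ^ DIM('a) = gauss 1 z"
  using assms by (simp add: gauss_eq power_divide power_mult_distrib)

lemma integrable_scaleR_iff:
  fixes f :: "'c \<Rightarrow> 'b::{banach, second_countable_topology}"
  assumes "c \<noteq> 0"
  shows "integrable M (\<lambda>x. c *\<^sub>R f x) \<longleftrightarrow> integrable M f"
proof
  assume "integrable M (\<lambda>x. c *\<^sub>R f x)"
  then have "integrable M (\<lambda>x. inverse c *\<^sub>R (c *\<^sub>R f x))" by (rule integrable_scaleR_right)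
  then show "integrable M f" using assms by simp
qed simp

lemma integral_lborel_affine:
  fixes f :: "'a::euclidean_space \<Rightarrow> 'b::{banach, second_countable_topology}"
  assumes "0 < r" and [measurable]: "f \<in> borel_measurable borel"
  shows "(\<integral>y. f y \<partial>lborel) = r ^ DIM('a) *\<^sub>R (\<integral>z. f (x + r *\<^sub>R z) \<partial>lborel)"
    and "integrable lborel (\<lambda>z. f (x + r *\<^sub>R z)) \<longleftrightarrow> integrable lborel f"
proof -
  have e: "(lborel :: 'a measure) = density (distr lborel borel (\<lambda>z. x + r *\<^sub>R z)) (\<lambda>_. ennreal (r ^ DIM('a)))"
    using lborel_affine[of r x] assms(1) by simp
  show "(\<integral>y. f y \<partial>lborel) = r ^ DIM('a) *\<^sub>R (\<integral>z. f (x + r *\<^sub>R z) \<partial>lborel)"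
    using assms(1) by (subst e, subst integral_density) (auto simp: integral_distr)
  have "integrable lborel f \<longleftrightarrow> integrable lborel (\<lambda>z. r ^ DIM('a) *\<^sub>R f (x + r *\<^sub>R z))"
    using assms(1) by (subst e, subst integrable_density) (auto simp: integrable_distr_eq)
  then show "integrable lborel (\<lambda>z. f (x + r *\<^sub>R z)) \<longleftrightarrow> integrable lborel f"
    using assms(1) by (simp add: integrable_scaleR_iff)
qed

text \<open>
  Since \<open>|z| \<le> 2 exp (|z|\<^sup>2 / 4)\<close>, the density of variance two dominates the integrand up to a constant.
\<close>
lemma integrable_norm_gauss: "integrable (gauss_measure :: 'a::euclidean_space measure) (\<lambda>z. norm z)"
proof -
  have "integrable lborel (\<lambda>z::'a. sqrt 2 ^ DIM('a) * 2 * gauss (sqrt 2) z)" by simp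
  then have "integrable lborel (\<lambda>z::'a. gauss 1 z *\<^sub>R norm z)"
  proof (rule Bochner_Integration.integrable_bound)
    show "AE z in lborel. norm (gauss 1 (z::'a) *\<^sub>R norm z) \<le> norm (sqrt 2 ^ DIM('a) * 2 * gauss (sqrt 2) z)"
    proof (rule AE_I2)
      fix z :: 'a
      have "norm z \<le> 1 + (norm z)\<^sup>2 / 4"
        using zero_le_power2[of "norm z / 2 - 1"] by (simp add: power2_diff power_divide)
      also have "\<dots> \<le> exp ((norm z)\<^sup>2 / 4)" by (rule exp_ge_add_one_self)
      finally have n: "norm z \<le> 2 * exp ((norm z)\<^sup>2 / 4)" by (smt (verit) exp_gt_zero)
      have "exp (- (norm z)\<^sup>2 / 2) * norm z \<le> exp (- (norm z)\<^sup>2 / 2) * (2 * exp ((norm z)\<^sup>2 / 4))"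
        using n by (intro mult_left_mono) auto
      also have "\<dots> = 2 * exp (- (norm z)\<^sup>2 / 4)" by (simp add: exp_add[symmetric])
      finally show "norm (gauss 1 z *\<^sub>R norm z) \<le> norm (sqrt 2 ^ DIM('a) * 2 * gauss (sqrt 2) z)"
        by (simp add: gauss_eq abs_mult power_divide power_mult_distrib divide_simps mult_ac)
    qed
  qed simp
  then show ?thesis unfolding gauss_measure_def by (subst integrable_density) auto
qed

text \<open>
  Completing the square. Read as densities, the left-hand side is the joint law of a standard Gaussian \<open>z\<close> and
  \<open>y = r0 z + t u\<close> with \<open>u\<close> an independent standard Gaussian; the right-hand side disintegrates this law along \<open>y\<close>.
\<close>
lemma gauss_product:
  fixes y z :: "'a::euclidean_space"
  assumes r0: "0 < r0" and t: "0 < t" and r: "0 < r" "r\<^sup>2 = r0\<^sup>2 + t\<^sup>2"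
  shows "gauss 1 z * gauss t (y - r0 *\<^sub>R z) = gauss r y * gauss (t / r) (z - (r0 / r\<^sup>2) *\<^sub>R y)"
proof -
  have 1: "(norm (y - r0 *\<^sub>R z))\<^sup>2 = (norm y)\<^sup>2 - 2 * r0 * (y \<bullet> z) + r0\<^sup>2 * (norm z)\<^sup>2"
    unfolding power2_norm_eq_inner by (simp add: inner_simps inner_commute power2_eq_square algebra_simps)
  have 2: "(norm (z - (r0 / r\<^sup>2) *\<^sub>R y))\<^sup>2 = (norm z)\<^sup>2 - 2 * (r0 / r\<^sup>2) * (y \<bullet> z) + (r0 / r\<^sup>2)\<^sup>2 * (norm y)\<^sup>2"
    unfolding power2_norm_eq_inner by (simp add: inner_simps inner_commute power2_eq_square algebra_simps)
  have "(norm z)\<^sup>2 / 2 + (norm (y - r0 *\<^sub>R z))\<^sup>2 / (2 * t\<^sup>2) = (norm y)\<^sup>2 / (2 * r\<^sup>2) + (norm (z - (r0 / r\<^sup>2) *\<^sub>R y))\<^sup>2 / (2 * (t / r)\<^sup>2)"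
  proof -
    have t2: "t\<^sup>2 = r\<^sup>2 - r0\<^sup>2" using r by simp
    have ne: "t\<^sup>2 \<noteq> 0" "r\<^sup>2 \<noteq> 0" using t r by auto
    define R S T where "R = r\<^sup>2" and "S = r0\<^sup>2" and "T = t\<^sup>2"
    have RS: "R = S + T" "R \<noteq> 0" "T \<noteq> 0" using r ne by (auto simp: R_def S_def T_def)
    have "(Z / 2 + (Y - 2 * r0 * P + S * Z) / (2 * T)) = Y / (2 * R) + (Z - 2 * (r0 / R) * P + S / R\<^sup>2 * Y) / (2 * (T / R))" for Z Y P
    proof -
      have "Z / 2 + (Y - 2 * r0 * P + S * Z) / (2 * T) = (R * Z + Y - 2 * r0 * P) / (2 * T)"
        using RS(3) unfolding RS(1) by (simp add: divide_simps) (simp add: algebra_simps)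
      also have "\<dots> = Y / (2 * R) + (Z * R - 2 * r0 * P + S / R * Y) / (2 * T)"
      proof -
        have "Y / (2 * R) + S / R * Y / (2 * T) = Y * (T + S) / (2 * R * T)"
          using RS(2,3) by (simp add: divide_simps) (simp add: algebra_simps)
        also have "\<dots> = Y * R / (2 * R * T)" using RS(1) by (simp add: add.commute)
        also have "\<dots> = Y / (2 * T)" using RS(2,3) by simp
        finally show ?thesis by (simp add: add_divide_distrib diff_divide_distrib mult.commute)
      qed
      also have "(Z * R - 2 * r0 * P + S / R * Y) / (2 * T) = (Z - 2 * (r0 / R) * P + S / R\<^sup>2 * Y) / (2 * (T / R))"
        using RS(2,3) by (simp add: divide_simps power2_eq_square)
      finally show ?thesis .
    qed
    then show ?thesis unfolding 1 2 by (simp add: R_def S_def T_def power_divide)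
  qed
  then have e: "exp (- (norm z)\<^sup>2 / 2) * exp (- (norm (y - r0 *\<^sub>R z))\<^sup>2 / (2 * t\<^sup>2)) = exp (- (norm y)\<^sup>2 / (2 * r\<^sup>2)) * exp (- (norm (z - (r0 / r\<^sup>2) *\<^sub>R y))\<^sup>2 / (2 * (t / r)\<^sup>2))"
    by (simp add: exp_add[symmetric])
  have c: "(1 / (sqrt (2 * pi))) ^ DIM('a) * (1 / (sqrt (2 * pi) * t)) ^ DIM('a) = (1 / (sqrt (2 * pi) * r)) ^ DIM('a) * (1 / (sqrt (2 * pi) * (t / r))) ^ DIM('a)"
    using r t by (simp add: power_mult_distrib[symmetric])
  have "gauss 1 z * gauss t (y - r0 *\<^sub>R z) = ((1 / (sqrt (2 * pi))) ^ DIM('a) * (1 / (sqrt (2 * pi) * t)) ^ DIM('a)) * (exp (- (norm z)\<^sup>2 / 2) * exp (- (norm (y - r0 *\<^sub>R z))\<^sup>2 / (2 * t\<^sup>2)))"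
    using t by (simp add: gauss_eq)
  also have "\<dots> = gauss r y * gauss (t / r) (z - (r0 / r\<^sup>2) *\<^sub>R y)"
    unfolding c e using t r by (simp add: gauss_eq)
  finally show ?thesis .
qed

lemma nn_integral_gauss_measure:
  fixes f :: "'a::euclidean_space \<Rightarrow> ennreal"
  assumes r: "0 < r" and [measurable]: "f \<in> borel_measurable borel"
  shows "(\<integral>\<^sup>+z. f (x + r *\<^sub>R z) \<partial>gauss_measure) = (\<integral>\<^sup>+y. ennreal (gauss r (y - x)) * f y \<partial>lborel)"
proof -
  have e: "(lborel :: 'a measure) = density (distr lborel borel (\<lambda>z. x + r *\<^sub>R z)) (\<lambda>_. ennreal (r ^ DIM('a)))"
    using lborel_affine[of r x] r by simp
  have "(\<integral>\<^sup>+y. ennreal (gauss r (y - x)) * f y \<partial>lborel)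
     = (\<integral>\<^sup>+z. ennreal (r ^ DIM('a)) * (ennreal (gauss r (r *\<^sub>R z)) * f (x + r *\<^sub>R z)) \<partial>lborel)"
    by (subst e, subst nn_integral_density) (auto simp: nn_integral_distr)
  also have "\<dots> = (\<integral>\<^sup>+z. ennreal (gauss 1 z) * f (x + r *\<^sub>R z) \<partial>lborel)"
    using r by (intro nn_integral_cong)
      (simp add: mult.assoc[symmetric] ennreal_mult[symmetric] gauss_translate_scale[OF r, symmetric] mult.commute)
  also have "\<dots> = (\<integral>\<^sup>+z. f (x + r *\<^sub>R z) \<partial>gauss_measure)"
    unfolding gauss_measure_def by (subst nn_integral_density) auto
  finally show ?thesis by simp
qed

text \<open>
  An orthogonal change of the variables \<open>(z, u)\<close>, which preserves the product of the two Gaussian measures, turns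
  \<open>r0 z + t u\<close> into \<open>r z\<close>.
\<close>
lemma gauss_rotation:
  fixes f :: "'a::euclidean_space \<times> 'a \<Rightarrow> ennreal"
  assumes r0: "0 < r0" and t: "0 < t" and r: "0 < r" "r\<^sup>2 = r0\<^sup>2 + t\<^sup>2"
    and [measurable]: "f \<in> borel_measurable (borel \<Otimes>\<^sub>M borel)"
  shows "(\<integral>\<^sup>+z. \<integral>\<^sup>+u. f (z, r0 *\<^sub>R z + t *\<^sub>R u) \<partial>gauss_measure \<partial>gauss_measure)
       = (\<integral>\<^sup>+z. \<integral>\<^sup>+u. f ((r0 / r) *\<^sub>R z + (t / r) *\<^sub>R u, r *\<^sub>R z) \<partial>gauss_measure \<partial>gauss_measure)"
proof -
  have "(\<integral>\<^sup>+z. \<integral>\<^sup>+u. f (z, r0 *\<^sub>R z + t *\<^sub>R u) \<partial>gauss_measure \<partial>gauss_measure)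
     = (\<integral>\<^sup>+z. \<integral>\<^sup>+y. ennreal (gauss t (y - r0 *\<^sub>R z)) * f (z, y) \<partial>lborel \<partial>gauss_measure)"
    by (intro nn_integral_cong nn_integral_gauss_measure t) simp
  also have "\<dots> = (\<integral>\<^sup>+z. ennreal (gauss 1 z) * (\<integral>\<^sup>+y. ennreal (gauss t (y - r0 *\<^sub>R z)) * f (z, y) \<partial>lborel) \<partial>lborel)"
    unfolding gauss_measure_def by (subst nn_integral_density) auto
  also have "\<dots> = (\<integral>\<^sup>+z. (\<integral>\<^sup>+y. ennreal (gauss 1 z * gauss t (y - r0 *\<^sub>R z)) * f (z, y) \<partial>lborel) \<partial>lborel)"
    by (subst nn_integral_cmult[symmetric]) (auto simp: ennreal_mult mult.assoc)
  also have "\<dots> = (\<integral>\<^sup>+y. (\<integral>\<^sup>+z. ennreal (gauss 1 z * gauss t (y - r0 *\<^sub>R z)) * f (z, y) \<partial>lborel) \<partial>lborel)"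
    by (rule lborel_pair.Fubini') simp
  also have "\<dots> = (\<integral>\<^sup>+y. (\<integral>\<^sup>+z. ennreal (gauss r y * gauss (t / r) (z - (r0 / r\<^sup>2) *\<^sub>R y)) * f (z, y) \<partial>lborel) \<partial>lborel)"
    by (simp add: gauss_product[OF r0 t r])
  also have "\<dots> = (\<integral>\<^sup>+y. ennreal (gauss r (y - 0)) * (\<integral>\<^sup>+z. ennreal (gauss (t / r) (z - (r0 / r\<^sup>2) *\<^sub>R y)) * f (z, y) \<partial>lborel) \<partial>lborel)"
    by (subst nn_integral_cmult[symmetric]) (auto simp: ennreal_mult mult.assoc)
  also have "\<dots> = (\<integral>\<^sup>+y. ennreal (gauss r (y - 0)) * (\<integral>\<^sup>+u. f ((r0 / r\<^sup>2) *\<^sub>R y + (t / r) *\<^sub>R u, y) \<partial>gauss_measure) \<partial>lborel)"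
    using t r by (subst nn_integral_gauss_measure[symmetric]) auto
  also have "\<dots> = (\<integral>\<^sup>+z. (\<integral>\<^sup>+u. f ((r0 / r\<^sup>2) *\<^sub>R (0 + r *\<^sub>R z) + (t / r) *\<^sub>R u, 0 + r *\<^sub>R z) \<partial>gauss_measure) \<partial>gauss_measure)"
    using r by (subst nn_integral_gauss_measure[symmetric]) auto
  finally show ?thesis using r by (simp add: power2_eq_square)
qed

lemma distr_uminus_gauss_measure: "distr gauss_measure borel uminus = (gauss_measure :: 'a::euclidean_space measure)"
proof (rule measure_eqI)
  fix A :: "'a set" assume "A \<in> sets (distr gauss_measure borel uminus)"
  then have [measurable]: "A \<in> sets borel" by simp
  have g: "gauss 1 (- z) = gauss 1 z" for z :: 'a by (simp add: gauss_eq)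
  have "emeasure (distr gauss_measure borel uminus) A = (\<integral>\<^sup>+z. indicator A (- z) \<partial>(gauss_measure :: 'a measure))"
    by (subst nn_integral_distr[symmetric, of uminus gauss_measure borel]) auto
  also have "\<dots> = (\<integral>\<^sup>+z. ennreal (gauss 1 (- z)) * indicator A (- z) \<partial>(lborel :: 'a measure))"
    unfolding gauss_measure_def by (subst nn_integral_density) (auto simp: g)
  also have "\<dots> = (\<integral>\<^sup>+z. ennreal (gauss 1 z) * indicator A z \<partial>distr (lborel :: 'a measure) borel uminus)"
    by (subst nn_integral_distr) auto
  also have "distr (lborel :: 'a measure) borel uminus = lborel"
    using lborel_affine[of "-1" "0::'a"] by (simp add: density_1)
  also have "(\<integral>\<^sup>+z. ennreal (gauss 1 z) * indicator A z \<partial>lborel) = emeasure gauss_measure A"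
    unfolding gauss_measure_def by (subst emeasure_density) auto
  finally show "emeasure (distr gauss_measure borel uminus) A = emeasure gauss_measure A" .
qed simp

lemma integral_gauss_measure_id: "(\<integral>z. v \<bullet> z \<partial>(gauss_measure :: 'a::euclidean_space measure)) = 0"
proof -
  have "(\<integral>z. v \<bullet> z \<partial>(gauss_measure :: 'a measure)) = (\<integral>z. v \<bullet> z \<partial>(distr gauss_measure borel uminus :: 'a measure))"
    by (simp add: distr_uminus_gauss_measure)
  also have "\<dots> = (\<integral>z. - (v \<bullet> z) \<partial>(gauss_measure :: 'a measure))"
    by (subst integral_distr) auto
  finally show ?thesis by simp
qed

text \<open>
  The probability space \<open>P\<close> carries a point \<open>x\<close> of law \<open>\<mu>\<close> and an independent standard Gaussian \<open>z\<close>; the noisy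
  observation at level \<open>r\<close> is \<open>x + r z\<close>. The product with a further Gaussian factor serves to increase the noise level.
\<close>
locale noisy = prob_space \<mu> for \<mu> :: "'a::euclidean_space measure" +
  assumes sets_mu[simp, measurable_cong]: "sets \<mu> = sets borel"
begin

lemma space_mu[simp]: "space \<mu> = UNIV"
  using sets_eq_imp_space_eq[OF sets_mu] by simp

abbreviation P :: "('a \<times> 'a) measure" where "P \<equiv> \<mu> \<Otimes>\<^sub>M gauss_measure"

sublocale P: pair_prob_space \<mu> "gauss_measure :: 'a measure" ..
sublocale PL: pair_sigma_finite \<mu> "lborel :: 'a measure" ..
sublocale Q: pair_prob_space P "gauss_measure :: 'a measure" ..

lemma distr_noise:
  assumes r: "0 < r"
  shows "distr P (\<mu> \<Otimes>\<^sub>M lborel) (\<lambda>(x, z). (x, x + r *\<^sub>R z)) = density (\<mu> \<Otimes>\<^sub>M lborel) (\<lambda>q. ennreal (gauss r (snd q - fst q)))"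
proof (rule measure_eqI)
  fix A assume A0: "A \<in> sets (distr P (\<mu> \<Otimes>\<^sub>M lborel) (\<lambda>(x, z). (x, x + r *\<^sub>R z)))"
  then have A1[measurable]: "A \<in> sets (borel \<Otimes>\<^sub>M borel)"
    using sets_pair_measure_cong[of \<mu> borel lborel borel] by simp
  have "emeasure (distr P (\<mu> \<Otimes>\<^sub>M lborel) (\<lambda>(x, z). (x, x + r *\<^sub>R z))) A
     = (\<integral>\<^sup>+p. indicator A p \<partial>distr P (\<mu> \<Otimes>\<^sub>M lborel) (\<lambda>(x, z). (x, x + r *\<^sub>R z)))"
    by (rule nn_integral_indicator[OF A0, symmetric])
  also have "\<dots> = (\<integral>\<^sup>+p. indicator A (fst p, fst p + r *\<^sub>R snd p) \<partial>P)"
    by (subst nn_integral_distr) (auto simp: case_prod_beta')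
  also have "\<dots> = (\<integral>\<^sup>+x. \<integral>\<^sup>+z. indicator A (x, x + r *\<^sub>R z) \<partial>gauss_measure \<partial>\<mu>)"
    by (subst gauss.nn_integral_fst[symmetric]) auto
  also have "\<dots> = (\<integral>\<^sup>+x. \<integral>\<^sup>+y. ennreal (gauss r (y - x)) * indicator A (x, y) \<partial>lborel \<partial>\<mu>)"
    by (intro nn_integral_cong nn_integral_gauss_measure r) simp
  also have "\<dots> = (\<integral>\<^sup>+p. ennreal (gauss r (snd p - fst p)) * indicator A p \<partial>(\<mu> \<Otimes>\<^sub>M lborel))"
    by (subst lborel.nn_integral_fst[symmetric]) auto
  also have "\<dots> = emeasure (density (\<mu> \<Otimes>\<^sub>M lborel) (\<lambda>q. ennreal (gauss r (snd q - fst q)))) A"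
    using A0 A1 by (subst emeasure_density) auto
  finally show "emeasure (distr P (\<mu> \<Otimes>\<^sub>M lborel) (\<lambda>(x, z). (x, x + r *\<^sub>R z))) A = \<dots>" .
qed simp

lemma integral_noise:
  fixes f :: "'a \<times> 'a \<Rightarrow> 'b::{banach, second_countable_topology}"
  assumes r: "0 < r" and [measurable]: "f \<in> borel_measurable (borel \<Otimes>\<^sub>M borel)"
  shows "(\<integral>p. f (fst p, fst p + r *\<^sub>R snd p) \<partial>P) = (\<integral>q. gauss r (snd q - fst q) *\<^sub>R f q \<partial>(\<mu> \<Otimes>\<^sub>M lborel))"
    and "integrable P (\<lambda>p. f (fst p, fst p + r *\<^sub>R snd p)) \<longleftrightarrow> integrable (\<mu> \<Otimes>\<^sub>M lborel) (\<lambda>q. gauss r (snd q - fst q) *\<^sub>R f q)"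
proof -
  have m[measurable]: "f \<in> borel_measurable (\<mu> \<Otimes>\<^sub>M lborel)"
    using assms(2) by (subst measurable_cong_sets[OF sets_pair_measure_cong refl]) auto
  let ?T = "\<lambda>(x, z). (x, x + r *\<^sub>R z)"
  have "(\<integral>p. f (fst p, fst p + r *\<^sub>R snd p) \<partial>P) = (\<integral>q. f q \<partial>distr P (\<mu> \<Otimes>\<^sub>M lborel) ?T)"
    by (subst integral_distr) (auto simp: case_prod_beta')
  also have "\<dots> = (\<integral>q. gauss r (snd q - fst q) *\<^sub>R f q \<partial>(\<mu> \<Otimes>\<^sub>M lborel))"
    unfolding distr_noise[OF r] by (subst integral_density) (auto simp: case_prod_beta')
  finally show "(\<integral>p. f (fst p, fst p + r *\<^sub>R snd p) \<partial>P) = (\<integral>q. gauss r (snd q - fst q) *\<^sub>R f q \<partial>(\<mu> \<Otimes>\<^sub>M lborel))" .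
  have "integrable P (\<lambda>p. f (fst p, fst p + r *\<^sub>R snd p)) \<longleftrightarrow> integrable (distr P (\<mu> \<Otimes>\<^sub>M lborel) ?T) f"
    by (subst integrable_distr_eq) (auto simp: case_prod_beta')
  also have "\<dots> \<longleftrightarrow> integrable (\<mu> \<Otimes>\<^sub>M lborel) (\<lambda>q. gauss r (snd q - fst q) *\<^sub>R f q)"
    unfolding distr_noise[OF r] by (subst integrable_density) (auto simp: case_prod_beta')
  finally show "integrable P (\<lambda>p. f (fst p, fst p + r *\<^sub>R snd p)) \<longleftrightarrow> integrable (\<mu> \<Otimes>\<^sub>M lborel) (\<lambda>q. gauss r (snd q - fst q) *\<^sub>R f q)" .
qed

text \<open>
  Adding independent noise of size \<open>t\<close> to the observation at level \<open>r0\<close> gives the observation at level \<open>r\<close>. The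
  original noise \<open>z\<close> then becomes the fraction \<open>r0 / r\<close> of the total noise plus an independent remainder.
\<close>
lemma distr_two_noises:
  assumes r0: "0 < r0" and t: "0 < t" and r: "0 < r" "r\<^sup>2 = r0\<^sup>2 + t\<^sup>2"
  shows "distr (P \<Otimes>\<^sub>M gauss_measure) (borel \<Otimes>\<^sub>M borel) (\<lambda>q. (fst (fst q) + r0 *\<^sub>R snd (fst q) + t *\<^sub>R snd q, snd (fst q)))
    = distr (P \<Otimes>\<^sub>M gauss_measure) (borel \<Otimes>\<^sub>M borel) (\<lambda>q. (fst (fst q) + r *\<^sub>R snd (fst q), (r0 / r) *\<^sub>R snd (fst q) + (t / r) *\<^sub>R snd q))"
    (is "distr ?Q ?B ?F = distr ?Q ?B ?G")
proof (rule measure_eqI)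
  fix A assume "A \<in> sets (distr ?Q ?B ?F)"
  then have [measurable]: "A \<in> sets ?B" by simp
  have it: "(\<integral>\<^sup>+q. f q \<partial>?Q) = (\<integral>\<^sup>+x. \<integral>\<^sup>+z. \<integral>\<^sup>+u. f ((x, z), u) \<partial>gauss_measure \<partial>gauss_measure \<partial>\<mu>)"
    if [measurable]: "f \<in> borel_measurable ?Q" for f
    by (subst gauss.nn_integral_fst[symmetric], simp, subst gauss.nn_integral_fst[symmetric]) auto
  have "emeasure (distr ?Q ?B ?F) A = (\<integral>\<^sup>+p. indicator A p \<partial>distr ?Q ?B ?F)" by simp
  also have "\<dots> = (\<integral>\<^sup>+q. indicator A (?F q) \<partial>?Q)" by (subst nn_integral_distr) auto
  also have "\<dots> = (\<integral>\<^sup>+x. \<integral>\<^sup>+z. \<integral>\<^sup>+u. (\<lambda>p. indicator A (x + snd p, fst p)) (z, r0 *\<^sub>R z + t *\<^sub>R u) \<partial>gauss_measure \<partial>gauss_measure \<partial>\<mu>)"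
    by (subst it) (auto simp: add.assoc)
  also have "\<dots> = (\<integral>\<^sup>+x. \<integral>\<^sup>+z. \<integral>\<^sup>+u. (\<lambda>p. indicator A (x + snd p, fst p)) ((r0 / r) *\<^sub>R z + (t / r) *\<^sub>R u, r *\<^sub>R z) \<partial>gauss_measure \<partial>gauss_measure \<partial>\<mu>)"
    by (intro nn_integral_cong gauss_rotation[OF r0 t r]) simp
  also have "\<dots> = (\<integral>\<^sup>+q. indicator A (?G q) \<partial>?Q)" by (subst it) auto
  also have "\<dots> = (\<integral>\<^sup>+p. indicator A p \<partial>distr ?Q ?B ?G)" by (subst nn_integral_distr) auto
  finally show "emeasure (distr ?Q ?B ?F) A = emeasure (distr ?Q ?B ?G) A" by simp
qed simp

end

section \<open>Derivatives, convolutions and convex functions\<close>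

lemma directional_derivative_tendsto:
  fixes f :: "'a::real_normed_vector \<Rightarrow> 'b::real_normed_vector"
  assumes D: "(f has_derivative D) (at z)"
  shows "((\<lambda>t. (f (z + t *\<^sub>R h) - f z) /\<^sub>R t) \<longlongrightarrow> D h) (at 0)"
proof (cases "h = 0")
  case True
  then show ?thesis using linear_0[OF has_derivative_linear[OF D]] by simp
next
  case False
  have lin: "linear D" by (rule has_derivative_linear[OF D])
  have "((\<lambda>u. norm (f (z + u) - f z - D u) / norm u) \<longlongrightarrow> 0) (at 0)"
    using D unfolding has_derivative_at by simp
  moreover have "filterlim (\<lambda>t. t *\<^sub>R h) (at 0) (at 0)"
  proof -
    have "((\<lambda>t. t *\<^sub>R h) \<longlongrightarrow> 0) (at 0)" by (rule tendsto_eq_intros refl)+ simp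
    then show ?thesis using False by (auto simp: filterlim_at eventually_at_filter)
  qed
  ultimately have "((\<lambda>t. norm (f (z + t *\<^sub>R h) - f z - D (t *\<^sub>R h)) / norm (t *\<^sub>R h)) \<longlongrightarrow> 0) (at 0)"
    by (rule filterlim_compose)
  then have "((\<lambda>t. norm h * (norm (f (z + t *\<^sub>R h) - f z - D (t *\<^sub>R h)) / norm (t *\<^sub>R h))) \<longlongrightarrow> 0) (at 0)"
    by (rule tendsto_mult_right_zero)
  then have "((\<lambda>t. norm ((f (z + t *\<^sub>R h) - f z) /\<^sub>R t - D h)) \<longlongrightarrow> 0) (at 0)"
  proof (rule Lim_transform_eventually)
    have "norm h * (norm (f (z + t *\<^sub>R h) - f z - D (t *\<^sub>R h)) / norm (t *\<^sub>R h)) = norm ((f (z + t *\<^sub>R h) - f z) /\<^sub>R t - D h)"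
      if "t \<noteq> 0" for t
    proof -
      have "(f (z + t *\<^sub>R h) - f z) /\<^sub>R t - D h = (f (z + t *\<^sub>R h) - f z - D (t *\<^sub>R h)) /\<^sub>R t"
        using that by (simp add: linear_scale[OF lin] scaleR_diff_right)
      then show ?thesis using that False by (simp add: divide_inverse)
    qed
    then show "\<forall>\<^sub>F t in at 0. norm h * (norm (f (z + t *\<^sub>R h) - f z - D (t *\<^sub>R h)) / norm (t *\<^sub>R h)) = norm ((f (z + t *\<^sub>R h) - f z) /\<^sub>R t - D h)"
      by (auto simp: eventually_at_filter)
  qed
  then show ?thesis using tendsto_norm_zero_iff Lim_null by blast
qed

lemma directional_derivative_LIMSEQ:
  fixes f :: "'a::real_normed_vector \<Rightarrow> 'b::real_normed_vector"
  assumes D: "(f has_derivative D) (at z)"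
  shows "(\<lambda>n. real (Suc n) *\<^sub>R (f (z + (1 / real (Suc n)) *\<^sub>R h) - f z)) \<longlonglongrightarrow> D h"
proof -
  have "(\<lambda>n. (f (z + (1 / real (Suc n)) *\<^sub>R h) - f z) /\<^sub>R (1 / real (Suc n))) \<longlonglongrightarrow> D h"
  proof (rule filterlim_compose[OF directional_derivative_tendsto[OF D]])
    have "(\<lambda>n. 1 / real (Suc n)) \<longlonglongrightarrow> 0"
      using LIMSEQ_inverse_real_of_nat by (simp add: inverse_eq_divide del: of_nat_Suc)
    then show "filterlim (\<lambda>n. 1 / real (Suc n)) (at 0) sequentially"
      by (auto simp: filterlim_at simp del: of_nat_Suc)
  qed
  then show ?thesis by simp
qed

lemma derivative_norm_le_lipschitz:
  fixes f :: "'a::real_normed_vector \<Rightarrow> 'b::real_normed_vector"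
  assumes D: "(f has_derivative D) (at z)" and lip: "\<And>z h. norm (f (z + h) - f z) \<le> B * norm h"
  shows "norm (D h) \<le> B * norm h"
proof (rule LIMSEQ_le_const2[OF tendsto_norm[OF directional_derivative_LIMSEQ[OF D]]], intro exI allI impI)
  fix n
  have "norm (real (Suc n) *\<^sub>R (f (z + (1 / real (Suc n)) *\<^sub>R h) - f z)) = real (Suc n) * norm (f (z + (1 / real (Suc n)) *\<^sub>R h) - f z)"
    by simp
  also have "\<dots> \<le> real (Suc n) * (B * norm ((1 / real (Suc n)) *\<^sub>R h))"
    by (intro mult_left_mono lip) simp
  also have "\<dots> = B * norm h" by simp
  finally show "norm (real (Suc n) *\<^sub>R (f (z + (1 / real (Suc n)) *\<^sub>R h) - f z)) \<le> B * norm h" .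
qed

text \<open>
  Differentiation under the integral sign: the Lipschitz bound on \<open>K\<close> dominates its difference quotients.
\<close>
lemma has_derivative_convolution:
  fixes K :: "'a::euclidean_space \<Rightarrow> 'b::{banach, second_countable_topology}" and g :: "'a \<Rightarrow> real"
  assumes [measurable_cong]: "sets M = sets borel"
    and g: "integrable M g"
    and K: "\<And>z. (K has_derivative K' z) (at z)"
    and bd: "\<And>z. norm (K z) \<le> C"
    and lip: "\<And>z h. norm (K (z + h) - K z) \<le> B * norm h"
  shows "((\<lambda>y. \<integral>x. g x *\<^sub>R K (y - x) \<partial>M) has_derivative (\<lambda>h. \<integral>x. g x *\<^sub>R K' (y - x) h \<partial>M)) (at y)"
proof -
  have gm[measurable]: "g \<in> borel_measurable borel" using borel_measurable_integrable[OF g] by measurable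
  have cont: "continuous_on UNIV K"
    by (meson K has_derivative_continuous continuous_at_imp_continuous_on)
  have [measurable]: "K \<in> borel_measurable borel" using cont by (rule borel_measurable_continuous_onI)
  have lin: "bounded_linear (K' z)" for z using K by (rule has_derivative_bounded_linear)
  have seq: "(\<lambda>n. real (Suc n) *\<^sub>R (K (z + (1 / real (Suc n)) *\<^sub>R h) - K z)) \<longlonglongrightarrow> K' z h" for z h
    using K by (rule directional_derivative_LIMSEQ)
  have nK': "norm (K' z h) \<le> B * norm h" for z h
    using K lip by (rule derivative_norm_le_lipschitz)
  have mK'[measurable]: "(\<lambda>z. K' z h) \<in> borel_measurable borel" for h
    by (rule borel_measurable_LIMSEQ_metric[OF _ seq]) simp
  have B: "0 \<le> B" using lip[of 0 "SOME b. b \<in> Basis"] norm_ge_zero order_trans SOME_Basis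
    by (metis norm_some_Basis mult_1_right)
  have iK: "integrable M (\<lambda>x. g x *\<^sub>R K (y - x))" for y
    by (rule Bochner_Integration.integrable_bound[where f="\<lambda>x. \<bar>g x\<bar> * C"])
       (use g in \<open>auto simp: abs_mult intro!: AE_I2 mult_left_mono order_trans[OF bd abs_ge_self]\<close>)
  have iK': "integrable M (\<lambda>x. g x *\<^sub>R K' (y - x) h)" for y h
    by (rule Bochner_Integration.integrable_bound[where f="\<lambda>x. \<bar>g x\<bar> * (B * norm h)"])
       (use g B in \<open>auto simp: abs_mult intro!: AE_I2 mult_left_mono nK'\<close>)
  have bl: "bounded_linear (\<lambda>h. \<integral>x. g x *\<^sub>R K' (y - x) h \<partial>M)"
  proof (rule bounded_linear_intro[where K="B * (\<integral>x. \<bar>g x\<bar> \<partial>M)"])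
    fix h k r
    show "(\<integral>x. g x *\<^sub>R K' (y - x) (h + k) \<partial>M) = (\<integral>x. g x *\<^sub>R K' (y - x) h \<partial>M) + (\<integral>x. g x *\<^sub>R K' (y - x) k \<partial>M)"
      by (subst Bochner_Integration.integral_add[symmetric, OF iK' iK']) (simp add: linear_add[OF bounded_linear.linear[OF lin]] scaleR_add_right)
    show "(\<integral>x. g x *\<^sub>R K' (y - x) (r *\<^sub>R h) \<partial>M) = r *\<^sub>R (\<integral>x. g x *\<^sub>R K' (y - x) h \<partial>M)"
      by (subst integral_scaleR_right[symmetric]) (simp add: linear_scale[OF bounded_linear.linear[OF lin]] mult.commute)
    have "norm (\<integral>x. g x *\<^sub>R K' (y - x) h \<partial>M) \<le> (\<integral>x. norm (g x *\<^sub>R K' (y - x) h) \<partial>M)" by (rule integral_norm_bound)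
    also have "\<dots> \<le> (\<integral>x. \<bar>g x\<bar> * (B * norm h) \<partial>M)"
      using g nK' iK' by (intro integral_mono integrable_norm integrable_mult_left integrable_abs) (auto intro!: mult_left_mono)
    also have "\<dots> = norm h * (B * (\<integral>x. \<bar>g x\<bar> \<partial>M))" by simp
    finally show "norm (\<integral>x. g x *\<^sub>R K' (y - x) h \<partial>M) \<le> norm h * (B * (\<integral>x. \<bar>g x\<bar> \<partial>M))" .
  qed
  let ?R = "\<lambda>h x. g x *\<^sub>R ((K (y - x + h) - K (y - x) - K' (y - x) h) /\<^sub>R norm h)"
  have "((\<lambda>h. \<integral>x. ?R h x \<partial>M) \<longlongrightarrow> 0) (at 0)"
    unfolding tendsto_at_iff_sequentially comp_def
  proof (intro allI impI)
    fix X :: "nat \<Rightarrow> 'a" assume X: "\<forall>i. X i \<in> UNIV - {0}" "X \<longlonglongrightarrow> 0"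
    have "(\<lambda>n. \<integral>x. ?R (X n) x \<partial>M) \<longlonglongrightarrow> (\<integral>x. 0 \<partial>M)"
    proof (rule integral_dominated_convergence[where w="\<lambda>x. \<bar>g x\<bar> * (2 * B)"])
      show "integrable M (\<lambda>x. \<bar>g x\<bar> * (2 * B))" using g by auto
      show "AE x in M. (\<lambda>i. ?R (X i) x) \<longlonglongrightarrow> 0"
      proof (rule AE_I2)
        fix x
        have "((\<lambda>h. norm (K (y - x + h) - K (y - x) - K' (y - x) h) / norm h) \<longlongrightarrow> 0) (at 0)"
          using K[of "y - x"] unfolding has_derivative_at by simp
        then have "((\<lambda>h. (K (y - x + h) - K (y - x) - K' (y - x) h) /\<^sub>R norm h) \<longlongrightarrow> 0) (at 0)"
          by (subst tendsto_norm_zero_iff[symmetric]) (simp add: divide_inverse mult.commute)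
        then have "(\<lambda>n. (K (y - x + X n) - K (y - x) - K' (y - x) (X n)) /\<^sub>R norm (X n)) \<longlonglongrightarrow> 0"
          using X unfolding tendsto_at_iff_sequentially comp_def by blast
        from tendsto_scaleR[OF tendsto_const[of "g x"] this] show "(\<lambda>i. ?R (X i) x) \<longlonglongrightarrow> 0" by simp
      qed
      fix n
      show "AE x in M. norm (?R (X n) x) \<le> \<bar>g x\<bar> * (2 * B)"
      proof (rule AE_I2)
        fix x
        have "norm (K (y - x + X n) - K (y - x) - K' (y - x) (X n)) \<le> norm (K (y - x + X n) - K (y - x)) + norm (K' (y - x) (X n))"
          by (rule norm_triangle_ineq4)
        also have "\<dots> \<le> 2 * B * norm (X n)" using lip[of "y - x" "X n"] nK'[of "y - x" "X n"] by simp
        finally have "norm ((K (y - x + X n) - K (y - x) - K' (y - x) (X n)) /\<^sub>R norm (X n)) \<le> 2 * B"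
          using X(1) by (simp add: divide_simps)
        then show "norm (?R (X n) x) \<le> \<bar>g x\<bar> * (2 * B)" by (simp only: norm_scaleR real_norm_def) (intro mult_left_mono, auto)
      qed
    qed simp_all
    then show "(\<lambda>n. \<integral>x. ?R (X n) x \<partial>M) \<longlonglongrightarrow> 0" by simp
  qed
  moreover have "(\<integral>x. ?R h x \<partial>M) = ((\<integral>x. g x *\<^sub>R K (y + h - x) \<partial>M) - (\<integral>x. g x *\<^sub>R K (y - x) \<partial>M) - (\<integral>x. g x *\<^sub>R K' (y - x) h \<partial>M)) /\<^sub>R norm h" for h
  proof -
    have "(\<integral>x. ?R h x \<partial>M) = (\<integral>x. (g x *\<^sub>R K (y + h - x) - g x *\<^sub>R K (y - x) - g x *\<^sub>R K' (y - x) h) /\<^sub>R norm h \<partial>M)"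
      by (intro Bochner_Integration.integral_cong refl) (simp add: scaleR_diff_right algebra_simps)
    then show ?thesis using iK iK' by (simp add: Bochner_Integration.integral_diff)
  qed
  ultimately have "((\<lambda>h. norm ((\<integral>x. g x *\<^sub>R K (y + h - x) \<partial>M) - (\<integral>x. g x *\<^sub>R K (y - x) \<partial>M) - (\<integral>x. g x *\<^sub>R K' (y - x) h \<partial>M)) / norm h) \<longlongrightarrow> 0) (at 0)"
    by (subst (asm) tendsto_norm_zero_iff[symmetric]) (simp add: divide_inverse mult.commute)
  then show ?thesis using bl unfolding has_derivative_at by simp
qed

text \<open>
  Repeated halving of the segment from \<open>z\<close> towards \<open>y\<close> yields the chord inequality for the dyadic fractions
  \<open>1/2\<^sup>n\<close>, and their difference quotients at \<open>y\<close> converge to the derivative.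
\<close>
lemma midpoint_concave_gradient:
  fixes F :: "'a::real_normed_vector \<Rightarrow> real"
  assumes mid: "\<And>y z. F y + F z \<le> 2 * F ((1/2) *\<^sub>R (y + z))"
    and D: "(F has_derivative F') (at y)"
  shows "F z \<le> F y + F' (z - y)"
proof -
  define v where "v = z - y"
  have it: "F y + (1 / 2 ^ n) * (F z - F y) \<le> F (y + (1 / 2 ^ n) *\<^sub>R v)" for n
  proof (induction n)
    case 0 show ?case by (simp add: v_def)
  next
    case (Suc n)
    have h: "(1/2) *\<^sub>R (y + (y + (1 / 2 ^ n) *\<^sub>R v)) = y + (1 / 2 ^ Suc n) *\<^sub>R v"
    proof -
      have "(1/2) *\<^sub>R (y + (y + (1 / 2 ^ n) *\<^sub>R v)) = (1/2) *\<^sub>R ((y + y) + (1 / 2 ^ n) *\<^sub>R v)" by (simp only: add.assoc)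
      also have "\<dots> = y + (1/2) *\<^sub>R ((1 / 2 ^ n) *\<^sub>R v)" by (subst scaleR_add_right) (simp only: scaleR_half_double)
      finally show ?thesis by simp
    qed
    have m: "F y + F (y + (1 / 2 ^ n) *\<^sub>R v) \<le> 2 * F (y + (1 / 2 ^ Suc n) *\<^sub>R v)"
      using mid[of y "y + (1 / 2 ^ n) *\<^sub>R v"] unfolding h .
    have e: "(1 / 2 ^ Suc n) * (F z - F y) = (1 / 2 ^ n) * (F z - F y) / 2" by simp
    define q p where "q = (1 / 2 ^ n) * (F z - F y)" and "p = F (y + (1 / 2 ^ n) *\<^sub>R v)"
    have "F y + q \<le> p" using Suc by (simp add: q_def p_def)
    then show ?case unfolding e using m unfolding q_def[symmetric] p_def[symmetric] by linarith
  qed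
  have lin: "linear F'" using D by (simp add: has_derivative_linear)
  have "((\<lambda>t. (F (y + t *\<^sub>R v) - F y) / t) \<longlongrightarrow> F' v) (at 0)"
    using directional_derivative_tendsto[OF D, of v] by (simp add: divide_inverse mult.commute)
  moreover have "filterlim (\<lambda>n. 1 / 2 ^ n) (at (0::real)) sequentially"
    using LIMSEQ_power_zero[of "1/2::real"] by (auto simp: filterlim_at power_one_over)
  ultimately have "(\<lambda>n. (F (y + (1 / 2 ^ n) *\<^sub>R v) - F y) / (1 / 2 ^ n)) \<longlonglongrightarrow> F' v"
    by (rule filterlim_compose)
  moreover have "F z - F y \<le> (F (y + (1 / 2 ^ n) *\<^sub>R v) - F y) / (1 / 2 ^ n)" for n
    using it[of n] by (simp add: field_simps)
  ultimately have "F z - F y \<le> F' v" by (intro LIMSEQ_le_const) auto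
  then show ?thesis by (simp add: v_def)
qed

text \<open>
  The Baillon-Haddad theorem. The hypotheses say that \<open>\<psi>\<close> is convex with subgradient \<open>m\<close> and that
  \<open>\<psi> - |y|\<^sup>2/2\<close> lies below its tangents. Using the lower bound from \<open>x\<close> and the upper bound from \<open>y\<close> at the same point
  \<open>y - (m y - m x)\<close> shows that \<open>m\<close> is firmly nonexpansive: \<open>|m x - m y|\<^sup>2 \<le> (m x - m y) \<bullet> (x - y)\<close>.
\<close>
lemma convex_gradient_nonexpansive:
  fixes \<psi> :: "'a::real_inner \<Rightarrow> real" and m :: "'a \<Rightarrow> 'a"
  assumes lo: "\<And>y z. \<psi> y + m y \<bullet> (z - y) \<le> \<psi> z"
    and up: "\<And>y z. \<psi> z \<le> \<psi> y + m y \<bullet> (z - y) + (norm (z - y))\<^sup>2 / 2"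
  shows "norm (m x - m y) \<le> norm (x - y)"
proof -
  have half: "(norm (m y - m x))\<^sup>2 / 2 \<le> \<psi> y - \<psi> x - m x \<bullet> (y - x)" for x y
  proof -
    define d where "d = m y - m x"
    have "\<psi> x + m x \<bullet> (y - d - x) \<le> \<psi> (y - d)" by (rule lo)
    also have "\<dots> \<le> \<psi> y + m y \<bullet> (y - d - y) + (norm (y - d - y))\<^sup>2 / 2" by (rule up)
    finally have "m y \<bullet> d - m x \<bullet> d - (norm d)\<^sup>2 / 2 \<le> \<psi> y - \<psi> x - m x \<bullet> (y - x)"
      by (simp add: inner_diff_right)
    moreover have "m y \<bullet> d - m x \<bullet> d = (norm d)\<^sup>2" by (simp add: d_def power2_norm_eq_inner inner_diff_left)
    ultimately show ?thesis by (simp add: d_def)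
  qed
  have "(norm (m x - m y))\<^sup>2 \<le> (m x - m y) \<bullet> (x - y)"
    using half[of x y] half[of y x] by (simp add: norm_minus_commute inner_diff_left inner_diff_right)
  also have "\<dots> \<le> norm (m x - m y) * norm (x - y)" by (rule norm_cauchy_schwarz)
  finally show ?thesis by (cases "m x = m y") (auto simp: power2_eq_square)
qed

section \<open>The posterior mean under Gaussian noise\<close>

text \<open>
  The Gaussian density without its normalising constant, which cancels in all conditional expectations.
\<close>
definition bell :: "real \<Rightarrow> 'a::euclidean_space \<Rightarrow> real" where
  "bell r z = exp (- (norm z)\<^sup>2 / (2 * r\<^sup>2))"

lemma gauss_eq_bell: "0 < r \<Longrightarrow> gauss r z = (1 / (sqrt (2 * pi) * r)) ^ DIM('a) * bell r z" for z :: "'a::euclidean_space"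
  by (simp add: gauss_eq bell_def)

lemma bell_pos: "0 < bell r z" and bell_le_1: "bell r z \<le> 1"
  by (auto simp: bell_def divide_nonneg_nonneg)

lemma bell_measurable[measurable]: "bell r \<in> borel_measurable borel"
  unfolding bell_def[abs_def] by measurable

lemma bell_norm_sq_le:
  assumes "0 < r" shows "bell r z * (norm z)\<^sup>2 \<le> 2 * r\<^sup>2"
proof -
  have "(norm z)\<^sup>2 / (2 * r\<^sup>2) \<le> exp ((norm z)\<^sup>2 / (2 * r\<^sup>2))"
    using exp_ge_add_one_self[of "(norm z)\<^sup>2 / (2 * r\<^sup>2)"] by linarith
  then have "bell r z * ((norm z)\<^sup>2 / (2 * r\<^sup>2)) \<le> bell r z * exp ((norm z)\<^sup>2 / (2 * r\<^sup>2))"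
    by (intro mult_left_mono) (auto simp: bell_def)
  also have "\<dots> = 1" by (simp add: bell_def exp_add[symmetric])
  finally show ?thesis using assms by (simp add: field_simps)
qed

lemma bell_norm_le:
  assumes "0 < r" shows "bell r z * norm z \<le> 1 + 2 * r\<^sup>2"
proof -
  have "norm z \<le> 1 + (norm z)\<^sup>2"
    using zero_le_power2[of "norm z - 1"] by (simp add: power2_diff) (smt (verit) norm_ge_zero)
  then have "bell r z * norm z \<le> bell r z * (1 + (norm z)\<^sup>2)" using bell_pos[of r z] by (intro mult_left_mono) auto
  then show ?thesis using bell_norm_sq_le[OF assms, of z] bell_le_1[of r z] by (simp add: distrib_left)
qed

lemma bell_has_derivative:
  assumes "0 < r"
  shows "(bell r has_derivative (\<lambda>h. - bell r z * (z \<bullet> h) / r\<^sup>2)) (at z)"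
proof -
  have "((\<lambda>z. (- 1 / (2 * r\<^sup>2)) * (z \<bullet> z)) has_derivative (\<lambda>h. (- 1 / (2 * r\<^sup>2)) * (z \<bullet> h + h \<bullet> z))) (at z)"
    by (intro has_derivative_mult_right has_derivative_inner has_derivative_ident)
  from has_derivative_exp[OF this]
  have "((\<lambda>z. exp (- (z \<bullet> z) / (2 * r\<^sup>2))) has_derivative (\<lambda>h. exp (- (z \<bullet> z) / (2 * r\<^sup>2)) * ((- 1 / (2 * r\<^sup>2)) * (z \<bullet> h + h \<bullet> z)))) (at z)" by (simp add: mult.commute)
  then show ?thesis unfolding bell_def[abs_def] power2_norm_eq_inner
    by (rule has_derivative_eq_rhs) (use assms in \<open>auto simp: fun_eq_iff inner_commute field_simps\<close>)
qed

lemma bell_id_has_derivative: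
  assumes "0 < r"
  shows "((\<lambda>z. bell r z *\<^sub>R z) has_derivative (\<lambda>h. bell r z *\<^sub>R h - (bell r z * (z \<bullet> h) / r\<^sup>2) *\<^sub>R z)) (at z)"
  by (rule derivative_eq_intros bell_has_derivative[OF assms] refl)+ (auto simp: fun_eq_iff)

lemma lipschitz_from_derivative:
  fixes f :: "'a::euclidean_space \<Rightarrow> 'b::real_inner"
  assumes "\<And>z. (f has_derivative f' z) (at z)" "\<And>z h. norm (f' z h) \<le> B * norm h"
  shows "norm (f (z + h) - f z) \<le> B * norm h"
proof -
  have "norm (f (z + h) - f z) \<le> B * norm (z + h - z)"
    by (rule differentiable_bound[where S=UNIV and f'=f']) (auto intro!: onorm_le assms)
  then show ?thesis by simp
qed

lemma bell_lipschitz: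
  assumes "0 < r" shows "\<exists>B. \<forall>z h. norm (bell r (z + h) - bell r (z::'a::euclidean_space)) \<le> B * norm h"
proof (intro exI allI)
  fix z h :: 'a
  show "norm (bell r (z + h) - bell r z) \<le> ((1 + 2 * r\<^sup>2) / r\<^sup>2) * norm h"
  proof (rule lipschitz_from_derivative[OF bell_has_derivative[OF assms]])
    fix z h :: 'a
    have "norm (- bell r z * (z \<bullet> h) / r\<^sup>2) \<le> bell r z * (norm z * norm h) / r\<^sup>2"
      using bell_pos[of r z] Cauchy_Schwarz_ineq2[of z h] by (simp add: abs_mult divide_right_mono)
    also have "\<dots> = (bell r z * norm z) / r\<^sup>2 * norm h" by simp
    also have "\<dots> \<le> ((1 + 2 * r\<^sup>2) / r\<^sup>2) * norm h" using bell_norm_le[OF assms, of z] assms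
      by (intro mult_right_mono divide_right_mono) auto
    finally show "norm (- bell r z * (z \<bullet> h) / r\<^sup>2) \<le> ((1 + 2 * r\<^sup>2) / r\<^sup>2) * norm h" .
  qed
qed

lemma bell_id_lipschitz:
  assumes "0 < r" shows "\<exists>B. \<forall>z h. norm (bell r (z + h) *\<^sub>R (z + h) - bell r z *\<^sub>R (z::'a::euclidean_space)) \<le> B * norm h"
proof (intro exI allI)
  fix z h :: 'a
  show "norm (bell r (z + h) *\<^sub>R (z + h) - bell r z *\<^sub>R z) \<le> 3 * norm h"
  proof (rule lipschitz_from_derivative[OF bell_id_has_derivative[OF assms]])
    fix z h :: 'a
    have "norm (bell r z *\<^sub>R h - (bell r z * (z \<bullet> h) / r\<^sup>2) *\<^sub>R z) \<le> bell r z * norm h + bell r z * \<bar>z \<bullet> h\<bar> / r\<^sup>2 * norm z"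
      using bell_pos[of r z] by (intro order_trans[OF norm_triangle_ineq4]) (simp add: abs_mult)
    also have "\<dots> \<le> 1 * norm h + bell r z * (norm z * norm h) / r\<^sup>2 * norm z"
      using bell_pos[of r z] bell_le_1[of r z] Cauchy_Schwarz_ineq2[of z h]
      by (intro add_mono mult_right_mono divide_right_mono mult_left_mono) auto
    also have "bell r z * (norm z * norm h) / r\<^sup>2 * norm z = (bell r z * (norm z)\<^sup>2) / r\<^sup>2 * norm h"
      by (simp add: power2_eq_square)
    also have "\<dots> \<le> 2 * r\<^sup>2 / r\<^sup>2 * norm h" using bell_norm_sq_le[OF assms, of z]
      by (intro mult_right_mono divide_right_mono) auto
    finally show "norm (bell r z *\<^sub>R h - (bell r z * (z \<bullet> h) / r\<^sup>2) *\<^sub>R z) \<le> 3 * norm h" using assms by simp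
  qed
qed

context noisy begin

text \<open>
  Up to a constant factor, the density of the observation \<open>x + r z\<close>.
\<close>
definition mass :: "real \<Rightarrow> 'a \<Rightarrow> real" where
  "mass r y = (\<integral>x. bell r (y - x) \<partial>\<mu>)"

text \<open>
  The conditional expectation of the noise \<open>z\<close> given \<open>x + r z = y\<close>, by Bayes' formula; \<open>y - r drift r y\<close> is the
  posterior mean of \<open>x\<close>.
\<close>
definition drift :: "real \<Rightarrow> 'a \<Rightarrow> 'a" where
  "drift r y = (\<integral>x. bell r (y - x) *\<^sub>R (y - x) \<partial>\<mu>) /\<^sub>R (r * mass r y)"

lemma integrable_bell: "integrable \<mu> (\<lambda>x. bell r (y - x))"
  by (rule integrable_const_bound[where B=1]) (auto simp: bell_le_1 less_imp_le[OF bell_pos])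

lemma integrable_bell_id: "0 < r \<Longrightarrow> integrable \<mu> (\<lambda>x. bell r (y - x) *\<^sub>R (y - x))"
  by (rule integrable_const_bound[where B="1 + 2 * r\<^sup>2"]) (auto simp: bell_norm_le less_imp_le[OF bell_pos])

lemma mass_pos: "0 < mass r y"
proof -
  have "0 \<le> mass r y" unfolding mass_def by (intro integral_nonneg_AE) (auto simp: less_imp_le[OF bell_pos])
  moreover have "mass r y \<noteq> 0"
  proof
    assume "mass r y = 0"
    then have "AE x in \<mu>. bell r (y - x) = 0" unfolding mass_def
      by (subst (asm) integral_nonneg_eq_0_iff_AE[OF integrable_bell]) (auto simp: less_imp_le[OF bell_pos])
    then have "AE x in \<mu>. False" by eventually_elim (use bell_pos less_irrefl in metis)
    then show False by simp
  qed
  ultimately show ?thesis by simp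
qed

lemma integral_bell_id:
  assumes "0 < r"
  shows "(\<integral>x. bell r (y - x) *\<^sub>R (y - x) \<partial>\<mu>) = (r * mass r y) *\<^sub>R drift r y"
proof -
  have "r * mass r y \<noteq> 0" using assms mass_pos[of r y] by simp
  then show ?thesis unfolding drift_def scaleR_scaleR by (subst right_inverse) simp_all
qed

lemma mass_has_derivative:
  assumes r: "0 < r"
  shows "(mass r has_derivative (\<lambda>h. - mass r y * (drift r y \<bullet> h) / r)) (at y)"
proof -
  obtain B where B: "\<And>z h. norm (bell r (z + h) - bell r (z::'a)) \<le> B * norm h" using bell_lipschitz[OF r] by blast
  have "((\<lambda>y. \<integral>x. 1 *\<^sub>R bell r (y - x) \<partial>\<mu>) has_derivative (\<lambda>h. \<integral>x. 1 *\<^sub>R (- bell r (y - x) * ((y - x) \<bullet> h) / r\<^sup>2) \<partial>\<mu>)) (at y)"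
    by (rule has_derivative_convolution[where C=1 and B=B]) (use bell_has_derivative[OF r] bell_le_1 B in \<open>auto simp: less_imp_le[OF bell_pos]\<close>)
  moreover have "(\<integral>x. 1 *\<^sub>R (- bell r (y - x) * ((y - x) \<bullet> h) / r\<^sup>2) \<partial>\<mu>) = - mass r y * (drift r y \<bullet> h) / r" for h
  proof -
    have "(\<integral>x. 1 *\<^sub>R (- bell r (y - x) * ((y - x) \<bullet> h) / r\<^sup>2) \<partial>\<mu>) = (\<integral>x. (- 1 / r\<^sup>2) * ((bell r (y - x) *\<^sub>R (y - x)) \<bullet> h) \<partial>\<mu>)"
      by (intro Bochner_Integration.integral_cong) auto
    also have "\<dots> = (- 1 / r\<^sup>2) * ((\<integral>x. bell r (y - x) *\<^sub>R (y - x) \<partial>\<mu>) \<bullet> h)"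
      using integrable_bell_id[OF r] by (subst integral_mult_right_zero, subst integral_inner_left) auto
    also have "(\<integral>x. bell r (y - x) *\<^sub>R (y - x) \<partial>\<mu>) = (r * mass r y) *\<^sub>R drift r y"
      by (rule integral_bell_id[OF r])
    finally show ?thesis using r by (simp add: power2_eq_square)
  qed
  ultimately show ?thesis by (simp add: mass_def[abs_def])
qed

lemma drift_differentiable:
  assumes r: "0 < r"
  shows "drift r differentiable (at y)"
proof -
  obtain B where B: "\<And>z h. norm (bell r (z + h) *\<^sub>R (z + h) - bell r z *\<^sub>R (z::'a)) \<le> B * norm h" using bell_id_lipschitz[OF r] by blast
  have "((\<lambda>y. \<integral>x. 1 *\<^sub>R (bell r (y - x) *\<^sub>R (y - x)) \<partial>\<mu>) has_derivative
     (\<lambda>h. \<integral>x. 1 *\<^sub>R (bell r (y - x) *\<^sub>R h - (bell r (y - x) * ((y - x) \<bullet> h) / r\<^sup>2) *\<^sub>R (y - x)) \<partial>\<mu>)) (at y)"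
    by (rule has_derivative_convolution[where K="\<lambda>z. bell r z *\<^sub>R z" and C="1 + 2 * r\<^sup>2" and B=B])
       (auto simp: bell_id_has_derivative[OF r] bell_norm_le[OF r] less_imp_le[OF bell_pos] B)
  then have 1: "(\<lambda>y. \<integral>x. bell r (y - x) *\<^sub>R (y - x) \<partial>\<mu>) differentiable (at y)"
    unfolding differentiable_def by auto
  have 2: "mass r differentiable (at y)" using mass_has_derivative[OF r] unfolding differentiable_def by blast
  have "(\<lambda>y. inverse (r * mass r y)) differentiable (at y)"
    using mass_pos[of r y] r by (intro differentiable_inverse differentiable_mult 2 differentiable_const) auto
  then show ?thesis unfolding drift_def[abs_def] by (intro differentiable_scaleR 1)
qed

text \<open>
  Jensen's inequality for the exponential function and the probability density proportional to \<open>bell r (y - x)\<close>. It expresses the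
  convexity of \<open>|y|\<^sup>2/2 + r\<^sup>2 ln (mass r y)\<close>, which is \<open>r\<^sup>2\<close> times the logarithm of the Laplace
  transform, at \<open>y / r\<^sup>2\<close>, of a measure that does not depend on \<open>y\<close>.
\<close>
lemma mass_jensen:
  assumes r: "0 < r"
  shows "ln (mass r y) - ((z - y) \<bullet> drift r y * r + (norm (z - y))\<^sup>2 / 2) / r\<^sup>2 \<le> ln (mass r z)"
proof -
  \<comment> \<open>the posterior average of \<open>u\<close>; the exponential is bounded below by its tangent at this point\<close>
  define c where "c = - ((z - y) \<bullet> drift r y * r + (norm (z - y))\<^sup>2 / 2) / r\<^sup>2"
  define u where "u = (\<lambda>x. - ((z - y) \<bullet> (y - x) + (norm (z - y))\<^sup>2 / 2) / r\<^sup>2)"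
  have pt: "bell r (y - x) * (exp c * (1 + (u x - c))) \<le> bell r (z - x)" for x
  proof -
    have sq: "(norm (z - x))\<^sup>2 = (norm (y - x))\<^sup>2 + 2 * ((z - y) \<bullet> (y - x)) + (norm (z - y))\<^sup>2"
      by (simp add: power2_norm_eq_inner inner_diff_left inner_diff_right inner_commute)
    have "- (norm (z - x))\<^sup>2 / (2 * r\<^sup>2) = - (norm (y - x))\<^sup>2 / (2 * r\<^sup>2) + u x"
      unfolding sq u_def using r by (simp add: field_simps)
    then have "bell r (z - x) = bell r (y - x) * exp (u x)" by (simp only: bell_def exp_add)
    moreover have "exp c * (1 + (u x - c)) \<le> exp (u x)"
    proof -
      have "exp c * (1 + (u x - c)) \<le> exp c * exp (u x - c)" by (intro mult_left_mono exp_ge_add_one_self) auto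
      then show ?thesis by (simp add: exp_add[symmetric])
    qed
    ultimately show ?thesis using bell_pos[of r "y - x"] by (simp add: mult_left_mono)
  qed
  define k0 where "k0 = 1 - (norm (z - y))\<^sup>2 / (2 * r\<^sup>2) - c"
  have e: "bell r (y - x) * (exp c * (1 + (u x - c))) = exp c * (k0 * bell r (y - x) - (z - y) \<bullet> (bell r (y - x) *\<^sub>R (y - x)) / r\<^sup>2)" for x
  proof -
    have "1 + (u x - c) = k0 - ((z - y) \<bullet> (y - x)) / r\<^sup>2"
      unfolding u_def k0_def by (simp add: add_divide_distrib diff_divide_distrib del: inner_diff_right inner_diff_left)
    then show ?thesis unfolding inner_scaleR_right by (simp add: right_diff_distrib del: inner_diff_right inner_diff_left)
  qed
  have i2: "integrable \<mu> (\<lambda>x. (z - y) \<bullet> (bell r (y - x) *\<^sub>R (y - x)))"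
    by (intro integrable_inner_right integrable_bell_id r)
  have dr: "(\<integral>x. bell r (y - x) *\<^sub>R (y - x) \<partial>\<mu>) = (r * mass r y) *\<^sub>R drift r y"
    by (rule integral_bell_id[OF r])
  have "exp c * mass r y = exp c * (k0 * mass r y - (z - y) \<bullet> ((r * mass r y) *\<^sub>R drift r y) / r\<^sup>2)"
    using r by (simp add: k0_def c_def field_simps)
  also have "\<dots> = (\<integral>x. bell r (y - x) * (exp c * (1 + (u x - c))) \<partial>\<mu>)"
  proof -
    have "(\<integral>x. (z - y) \<bullet> (bell r (y - x) *\<^sub>R (y - x)) \<partial>\<mu>) = (z - y) \<bullet> ((r * mass r y) *\<^sub>R drift r y)"
      unfolding dr[symmetric] by (rule integral_inner_right) (rule integrable_bell_id[OF r])
    moreover have "(\<integral>x. exp c * (k0 * bell r (y - x) - (z - y) \<bullet> (bell r (y - x) *\<^sub>R (y - x)) / r\<^sup>2) \<partial>\<mu>)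
       = exp c * (k0 * mass r y - (\<integral>x. (z - y) \<bullet> (bell r (y - x) *\<^sub>R (y - x)) \<partial>\<mu>) / r\<^sup>2)"
      using i2 integrable_bell unfolding mass_def
      by (subst integral_mult_right_zero, subst Bochner_Integration.integral_diff) (auto simp del: inner_scaleR_right)
    ultimately show ?thesis unfolding e by simp
  qed
  also have "\<dots> \<le> mass r z" unfolding mass_def
  proof (rule integral_mono[OF _ integrable_bell pt])
    show "integrable \<mu> (\<lambda>x. bell r (y - x) * (exp c * (1 + (u x - c))))"
      unfolding e using i2 integrable_bell by (intro integrable_mult_right Bochner_Integration.integrable_diff integrable_divide)
  qed
  finally have "ln (exp c * mass r y) \<le> ln (mass r z)" using mass_pos[of r y] mass_pos[of r z] by (subst ln_le_cancel_iff) auto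
  then have "c + ln (mass r y) \<le> ln (mass r z)" using mass_pos[of r y] by (simp add: ln_mult)
  moreover have "c = - (((z - y) \<bullet> drift r y * r + (norm (z - y))\<^sup>2 / 2) / r\<^sup>2)"
    by (simp only: c_def minus_divide_left)
  ultimately show ?thesis by linarith
qed

text \<open>
  The posterior mean is the gradient of \<open>\<psi>\<close>. Convexity of \<open>\<psi>\<close> is \<open>mass_jensen\<close>, and the upper bound by the tangent
  paraboloid is the midpoint log-concavity of \<open>mass\<close>.
\<close>
lemma posterior_mean_nonexpansive:
  assumes r: "0 < r"
    and mid: "\<And>y z. mass r y * mass r z \<le> (mass r ((1/2) *\<^sub>R (y + z)))\<^sup>2"
  shows "norm ((x - r *\<^sub>R drift r x) - (y - r *\<^sub>R drift r y)) \<le> norm (x - y)"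
proof -
  define \<psi> where "\<psi> = (\<lambda>y. (norm y)\<^sup>2 / 2 + r\<^sup>2 * ln (mass r y))"
  have sq: "(norm z)\<^sup>2 = (norm y)\<^sup>2 + 2 * (y \<bullet> (z - y)) + (norm (z - y))\<^sup>2" for y z :: 'a
    by (simp add: power2_norm_eq_inner inner_simps inner_commute)
  have lo: "\<psi> y + (y - r *\<^sub>R drift r y) \<bullet> (z - y) \<le> \<psi> z" for y z
  proof -
    have "r\<^sup>2 * (ln (mass r y) - ((z - y) \<bullet> drift r y * r + (norm (z - y))\<^sup>2 / 2) / r\<^sup>2) \<le> r\<^sup>2 * ln (mass r z)"
      by (intro mult_left_mono mass_jensen r) auto
    then have "r\<^sup>2 * ln (mass r y) - (r * (drift r y \<bullet> (z - y)) + (norm (z - y))\<^sup>2 / 2) \<le> r\<^sup>2 * ln (mass r z)"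
      using r by (simp add: right_diff_distrib inner_commute mult.commute)
    then show ?thesis using sq[of z y] unfolding \<psi>_def inner_diff_left[of y] inner_scaleR_left by linarith
  qed
  have up: "\<psi> z \<le> \<psi> y + (y - r *\<^sub>R drift r y) \<bullet> (z - y) + (norm (z - y))\<^sup>2 / 2" for y z
  proof -
    have D: "((\<lambda>y. ln (mass r y)) has_derivative (\<lambda>h. - (drift r y \<bullet> h) / r)) (at y)"
      using mass_pos[of r y] r
      by (auto intro!: derivative_eq_intros mass_has_derivative[OF r] simp: fun_eq_iff field_simps)
    have "ln (mass r z) \<le> ln (mass r y) + - (drift r y \<bullet> (z - y)) / r"
    proof (rule midpoint_concave_gradient[OF _ D])
      fix y z
      have "ln (mass r y * mass r z) \<le> ln ((mass r ((1/2) *\<^sub>R (y + z)))\<^sup>2)"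
        using mid mass_pos[of r y] mass_pos[of r z] mass_pos[of r "(1/2) *\<^sub>R (y + z)"] by (subst ln_le_cancel_iff) auto
      then show "ln (mass r y) + ln (mass r z) \<le> 2 * ln (mass r ((1/2) *\<^sub>R (y + z)))"
        using mass_pos[of r y] mass_pos[of r z] mass_pos[of r "(1/2) *\<^sub>R (y + z)"] by (simp add: ln_mult ln_realpow)
    qed
    then have "r\<^sup>2 * ln (mass r z) \<le> r\<^sup>2 * (ln (mass r y) + - (drift r y \<bullet> (z - y)) / r)"
      by (intro mult_left_mono) auto
    then have "r\<^sup>2 * ln (mass r z) \<le> r\<^sup>2 * ln (mass r y) - r * (drift r y \<bullet> (z - y))"
      using r by (simp add: right_diff_distrib power2_eq_square)
    then show ?thesis using sq[of z y] unfolding \<psi>_def inner_diff_left[of y] inner_scaleR_left by linarith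
  qed
  show ?thesis
    by (rule convex_gradient_nonexpansive[of \<psi> "\<lambda>y. y - r *\<^sub>R drift r y", OF lo up])
qed

end

section \<open>The noise and its conditional expectation\<close>

lemma (in pair_prob_space) integrable_fst_comp:
  fixes f :: "'a \<Rightarrow> 'c::{banach, second_countable_topology}"
  assumes f: "integrable M1 f"
  shows "integrable (M1 \<Otimes>\<^sub>M M2) (\<lambda>q. f (fst q))" "(\<integral>q. f (fst q) \<partial>(M1 \<Otimes>\<^sub>M M2)) = (\<integral>x. f x \<partial>M1)"
proof -
  have [measurable]: "f \<in> borel_measurable M1" using f by (rule borel_measurable_integrable)
  show i: "integrable (M1 \<Otimes>\<^sub>M M2) (\<lambda>q. f (fst q))"
    by (rule Fubini_integrable) (use f in \<open>auto simp: M2.prob_space\<close>)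
  show "(\<integral>q. f (fst q) \<partial>(M1 \<Otimes>\<^sub>M M2)) = (\<integral>x. f x \<partial>M1)"
    by (subst integral_fst'[OF i, symmetric]) (simp add: M2.prob_space)
qed

lemma (in pair_prob_space) integrable_snd_comp:
  fixes f :: "'b \<Rightarrow> 'c::{banach, second_countable_topology}"
  assumes f: "integrable M2 f"
  shows "integrable (M1 \<Otimes>\<^sub>M M2) (\<lambda>q. f (snd q))" "(\<integral>q. f (snd q) \<partial>(M1 \<Otimes>\<^sub>M M2)) = (\<integral>x. f x \<partial>M2)"
proof -
  have [measurable]: "f \<in> borel_measurable M2" using f by (rule borel_measurable_integrable)
  show i: "integrable (M1 \<Otimes>\<^sub>M M2) (\<lambda>q. f (snd q))"
    by (rule Fubini_integrable) (use f in auto)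
  show "(\<integral>q. f (snd q) \<partial>(M1 \<Otimes>\<^sub>M M2)) = (\<integral>x. f x \<partial>M2)"
    by (subst integral_fst'[OF i, symmetric]) (simp add: M1.prob_space)
qed

lemma has_real_derivative_integral:
  fixes f :: "real \<Rightarrow> 'c \<Rightarrow> real"
  assumes r: "r \<in> S" and S: "convex S"
    and der: "\<And>x s. s \<in> S \<Longrightarrow> ((\<lambda>s. f s x) has_real_derivative f' s x) (at s within S)"
    and meas: "f' r \<in> borel_measurable M"
    and int: "\<And>s. s \<in> S \<Longrightarrow> integrable M (f s)"
    and bd: "\<And>x s. s \<in> S \<Longrightarrow> \<bar>f' s x\<bar> \<le> D x" and D: "integrable M D"
  shows "((\<lambda>s. \<integral>x. f s x \<partial>M) has_real_derivative (\<integral>x. f' r x \<partial>M)) (at r within S)"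
  unfolding has_field_derivative_iff tendsto_at_iff_sequentially comp_def
proof (intro allI impI)
  fix X :: "nat \<Rightarrow> real" assume X: "\<forall>i. X i \<in> S - {r}" "X \<longlonglongrightarrow> r"
  have "(\<lambda>n. \<integral>x. (f (X n) x - f r x) / (X n - r) \<partial>M) \<longlonglongrightarrow> (\<integral>x. f' r x \<partial>M)"
  proof (rule integral_dominated_convergence[where w=D])
    show "(\<lambda>x. (f (X n) x - f r x) / (X n - r)) \<in> borel_measurable M" for n
      using int[of "X n"] int[OF r] X by (intro borel_measurable_divide borel_measurable_diff) auto
    show "AE x in M. (\<lambda>n. (f (X n) x - f r x) / (X n - r)) \<longlonglongrightarrow> f' r x"
    proof (rule AE_I2)
      fix x show "(\<lambda>n. (f (X n) x - f r x) / (X n - r)) \<longlonglongrightarrow> f' r x"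
        using der[OF r, of x] X unfolding has_field_derivative_iff tendsto_at_iff_sequentially comp_def by blast
    qed
    fix n show "AE x in M. norm ((f (X n) x - f r x) / (X n - r)) \<le> D x"
    proof (rule AE_I2)
      fix x
      have "norm (f (X n) x - f r x) \<le> D x * norm (X n - r)"
        by (rule field_differentiable_bound[OF S der]) (use X r bd in auto)
      then show "norm ((f (X n) x - f r x) / (X n - r)) \<le> D x" using X by (simp add: divide_le_eq)
    qed
  qed (use meas D in auto)
  then show "(\<lambda>n. ((\<integral>x. f (X n) x \<partial>M) - (\<integral>x. f r x \<partial>M)) / (X n - r)) \<longlonglongrightarrow> (\<integral>x. f' r x \<partial>M)"
    using int X r by (simp add: Bochner_Integration.integral_diff)
qed

text \<open>
  This class contains both the approximate transport maps and, with real values, the test functions against which they are judged.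
  It is closed under composition, so errors of successive maps add up.
\<close>
definition diff_contraction :: "('a::euclidean_space \<Rightarrow> 'b::real_normed_vector) \<Rightarrow> bool" where
  "diff_contraction \<phi> \<longleftrightarrow> (\<forall>y. \<phi> differentiable (at y)) \<and> (\<forall>x y. norm (\<phi> x - \<phi> y) \<le> norm (x - y))"

lemma diff_contraction_continuous: "diff_contraction \<phi> \<Longrightarrow> continuous_on UNIV \<phi>"
  unfolding diff_contraction_def by (meson differentiable_imp_continuous_within continuous_at_imp_continuous_on)

lemma diff_contraction_measurable: "diff_contraction \<phi> \<Longrightarrow> \<phi> \<in> borel_measurable borel"
  by (intro borel_measurable_continuous_onI diff_contraction_continuous)

lemma diff_contraction_comp: "diff_contraction \<phi> \<Longrightarrow> diff_contraction T \<Longrightarrow> diff_contraction (\<phi> \<circ> T)"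
  unfolding diff_contraction_def by (auto intro: differentiable_chain_at) (metis order_trans)

lemma prob_gauss_UNIV: "measure (gauss_measure :: 'a::euclidean_space measure) UNIV = 1"
  using gauss.prob_space by simp

context noisy begin

definition mean_noise :: real where "mean_noise = (\<integral>p. norm (snd p) \<partial>P)"

lemma integrable_noise_norm: "integrable P (\<lambda>p. norm (snd p))" "(\<integral>p. norm (snd p) \<partial>P) = mean_noise"
  by (rule P.integrable_snd_comp[OF integrable_norm_gauss]) (simp add: mean_noise_def)

lemma mean_noise_eq: "(\<integral>z. norm (z::'a) \<partial>gauss_measure) = mean_noise"
  unfolding mean_noise_def by (rule P.integrable_snd_comp(2)[OF integrable_norm_gauss, symmetric])

lemma drift_continuous: "0 < r \<Longrightarrow> continuous_on UNIV (drift r)"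
  using drift_differentiable by (meson differentiable_imp_continuous_within continuous_at_imp_continuous_on)

lemma drift_measurable[measurable]: "0 < r \<Longrightarrow> drift r \<in> borel_measurable borel"
  by (intro borel_measurable_continuous_onI drift_continuous)

lemma gauss_mass:
  assumes r: "0 < r"
  shows "(\<integral>x. gauss r (y - x) \<partial>\<mu>) = (1 / (sqrt (2 * pi) * r)) ^ DIM('a) * mass r y"
    and "(\<integral>x. gauss r (y - x) *\<^sub>R ((1 / r) *\<^sub>R (y - x)) \<partial>\<mu>) = ((1 / (sqrt (2 * pi) * r)) ^ DIM('a) * mass r y) *\<^sub>R drift r y"
    and "integrable \<mu> (\<lambda>x. gauss r (y - x))"
    and "integrable \<mu> (\<lambda>x. gauss r (y - x) *\<^sub>R ((1 / r) *\<^sub>R (y - x)))"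
proof -
  let ?c = "(1 / (sqrt (2 * pi) * r)) ^ DIM('a)"
  show "(\<integral>x. gauss r (y - x) \<partial>\<mu>) = ?c * mass r y"
    unfolding mass_def by (simp add: gauss_eq_bell[OF r])
  show "integrable \<mu> (\<lambda>x. gauss r (y - x))"
    by (simp add: gauss_eq_bell[OF r] integrable_bell)
  have e: "gauss r (y - x) *\<^sub>R ((1 / r) *\<^sub>R (y - x)) = (?c / r) *\<^sub>R (bell r (y - x) *\<^sub>R (y - x))" for x
    by (simp add: gauss_eq_bell[OF r])
  show "integrable \<mu> (\<lambda>x. gauss r (y - x) *\<^sub>R ((1 / r) *\<^sub>R (y - x)))"
    unfolding e by (intro integrable_scaleR_right integrable_bell_id r)
  show "(\<integral>x. gauss r (y - x) *\<^sub>R ((1 / r) *\<^sub>R (y - x)) \<partial>\<mu>) = (?c * mass r y) *\<^sub>R drift r y"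
    unfolding e integral_scaleR_right integral_bell_id[OF r] using r by simp
qed

text \<open>
  A conditional expectation has at most the mean norm of the variable: by the triangle inequality for the integral over \<open>x\<close>, the
  norm of \<open>drift\<close> is bounded by the conditional mean of the norm of the noise.
\<close>
lemma integrable_drift:
  assumes r: "0 < r"
  shows "integrable P (\<lambda>p. drift r (fst p + r *\<^sub>R snd p))"
proof -
  note [measurable] = drift_measurable[OF r]
  have i0: "integrable (\<mu> \<Otimes>\<^sub>M lborel) (\<lambda>q. gauss r (snd q - fst q) *\<^sub>R ((1 / r) *\<^sub>R (snd q - fst q)))"
    using integral_noise(2)[OF r, of "\<lambda>q. (1 / r) *\<^sub>R (snd q - fst q)"] integrable_noise_norm(1) r
    by (simp add: integrable_norm_iff)
  have "integrable (\<mu> \<Otimes>\<^sub>M lborel) (\<lambda>q. gauss r (snd q - fst q) *\<^sub>R drift r (snd q))"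
  proof (rule integrableI_bounded)
    show "(\<lambda>q. gauss r (snd q - fst q) *\<^sub>R drift r (snd q)) \<in> borel_measurable (\<mu> \<Otimes>\<^sub>M lborel)" by measurable
    have "(\<integral>\<^sup>+q. ennreal (norm (gauss r (snd q - fst q) *\<^sub>R drift r (snd q))) \<partial>(\<mu> \<Otimes>\<^sub>M lborel))
       = (\<integral>\<^sup>+y. \<integral>\<^sup>+x. ennreal (norm (gauss r (y - x) *\<^sub>R drift r y)) \<partial>\<mu> \<partial>lborel)"
      by (subst PL.nn_integral_snd[symmetric]) auto
    also have "\<dots> \<le> (\<integral>\<^sup>+y. \<integral>\<^sup>+x. ennreal (norm (gauss r (y - x) *\<^sub>R ((1 / r) *\<^sub>R (y - x)))) \<partial>\<mu> \<partial>lborel)"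
    proof (rule nn_integral_mono)
      fix y
      have "(\<integral>\<^sup>+x. ennreal (norm (gauss r (y - x) *\<^sub>R drift r y)) \<partial>\<mu>) = ennreal ((\<integral>x. gauss r (y - x) \<partial>\<mu>) * norm (drift r y))"
        using gauss_mass(3)[OF r, of y] by (subst nn_integral_eq_integral) auto
      also have "(\<integral>x. gauss r (y - x) \<partial>\<mu>) * norm (drift r y) = norm (\<integral>x. gauss r (y - x) *\<^sub>R ((1 / r) *\<^sub>R (y - x)) \<partial>\<mu>)"
        unfolding gauss_mass(1,2)[OF r] using mass_pos[of r y] r by simp
      also have "ennreal \<dots> \<le> ennreal (\<integral>x. norm (gauss r (y - x) *\<^sub>R ((1 / r) *\<^sub>R (y - x))) \<partial>\<mu>)"
        by (intro ennreal_leI integral_norm_bound)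
      also have "\<dots> = (\<integral>\<^sup>+x. ennreal (norm (gauss r (y - x) *\<^sub>R ((1 / r) *\<^sub>R (y - x)))) \<partial>\<mu>)"
        by (rule nn_integral_eq_integral[symmetric, OF integrable_norm[OF gauss_mass(4)[OF r]]]) auto
      finally show "(\<integral>\<^sup>+x. ennreal (norm (gauss r (y - x) *\<^sub>R drift r y)) \<partial>\<mu>) \<le> \<dots>" .
    qed
    also have "\<dots> = (\<integral>\<^sup>+q. ennreal (norm (gauss r (snd q - fst q) *\<^sub>R ((1 / r) *\<^sub>R (snd q - fst q)))) \<partial>(\<mu> \<Otimes>\<^sub>M lborel))"
      by (subst PL.nn_integral_snd[symmetric]) auto
    also have "\<dots> < \<infinity>" using i0 unfolding integrable_iff_bounded by blast
    finally show "(\<integral>\<^sup>+q. ennreal (norm (gauss r (snd q - fst q) *\<^sub>R drift r (snd q))) \<partial>(\<mu> \<Otimes>\<^sub>M lborel)) < \<infinity>" .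
  qed
  then show ?thesis using integral_noise(2)[OF r, of "\<lambda>q. drift r (snd q)"] by simp
qed

lemma integrable_bounded_inner:
  fixes A :: "'c \<Rightarrow> 'a" and B :: "'c \<Rightarrow> 'a"
  assumes [measurable]: "A \<in> borel_measurable M" and bd: "\<And>y. norm (A y) \<le> C" and B: "integrable M B"
  shows "integrable M (\<lambda>p. A p \<bullet> B p)"
proof (rule Bochner_Integration.integrable_bound[where f="\<lambda>p. C * norm (B p)"])
  have [measurable]: "B \<in> borel_measurable M" using B by (rule borel_measurable_integrable)
  show "(\<lambda>p. A p \<bullet> B p) \<in> borel_measurable M" by measurable
  show "integrable M (\<lambda>p. C * norm (B p))" using B by simp
  have "0 \<le> C" using bd[of undefined] norm_ge_zero order_trans by blast
  show "AE p in M. norm (A p \<bullet> B p) \<le> norm (C * norm (B p))"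
  proof (rule AE_I2)
    fix p have "\<bar>A p \<bullet> B p\<bar> \<le> norm (A p) * norm (B p)" by (rule Cauchy_Schwarz_ineq2)
    also have "\<dots> \<le> C * norm (B p)" by (intro mult_right_mono bd) auto
    finally show "norm (A p \<bullet> B p) \<le> norm (C * norm (B p))" using \<open>0 \<le> C\<close> by simp
  qed
qed

lemma integrable_noise_vec: "integrable P (\<lambda>p. snd p)"
  using integrable_noise_norm(1) by (subst (asm) integrable_norm_iff) auto

text \<open>
  Both sides are integrals over \<open>(x, y)\<close> with density \<open>gauss r (y - x)\<close>; integrating over \<open>x\<close> first replaces the
  noise \<open>(y - x)/r\<close> by its average \<open>drift r y\<close>.
\<close>
lemma drift_conditional_expectation:
  fixes A :: "'a \<Rightarrow> 'a"
  assumes r: "0 < r" and [measurable]: "A \<in> borel_measurable borel" and bd: "\<And>y. norm (A y) \<le> C"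
  shows "(\<integral>p. A (fst p + r *\<^sub>R snd p) \<bullet> snd p \<partial>P) = (\<integral>p. A (fst p + r *\<^sub>R snd p) \<bullet> drift r (fst p + r *\<^sub>R snd p) \<partial>P)"
proof -
  note [measurable] = drift_measurable[OF r]
  let ?f = "\<lambda>q. A (snd q) \<bullet> ((1 / r) *\<^sub>R (snd q - fst q))" and ?g = "\<lambda>q. A (snd q) \<bullet> drift r (snd q)"
  have f: "?f (fst p, fst p + r *\<^sub>R snd p) = A (fst p + r *\<^sub>R snd p) \<bullet> snd p" for p
    using r by simp
  have if0: "integrable P (\<lambda>p. A (fst p + r *\<^sub>R snd p) \<bullet> snd p)"
    by (rule integrable_bounded_inner[OF _ bd integrable_noise_vec]) measurable
  have ig0: "integrable P (\<lambda>p. A (fst p + r *\<^sub>R snd p) \<bullet> drift r (fst p + r *\<^sub>R snd p))"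
    by (rule integrable_bounded_inner[OF _ bd integrable_drift[OF r]]) measurable
  have "(\<integral>p. A (fst p + r *\<^sub>R snd p) \<bullet> snd p \<partial>P) = (\<integral>q. gauss r (snd q - fst q) *\<^sub>R ?f q \<partial>(\<mu> \<Otimes>\<^sub>M lborel))"
    using integral_noise(1)[OF r, of ?f] unfolding f by simp
  also have "\<dots> = (\<integral>y. \<integral>x. gauss r (y - x) *\<^sub>R (A y \<bullet> ((1 / r) *\<^sub>R (y - x))) \<partial>\<mu> \<partial>lborel)"
    using integral_noise(2)[OF r, of ?f] if0 unfolding f by (subst PL.integral_snd) (auto simp: case_prod_beta')
  also have "\<dots> = (\<integral>y. \<integral>x. gauss r (y - x) *\<^sub>R (A y \<bullet> drift r y) \<partial>\<mu> \<partial>lborel)"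
  proof (rule Bochner_Integration.integral_cong[OF refl])
    fix y
    have "(\<integral>x. gauss r (y - x) *\<^sub>R (A y \<bullet> ((1 / r) *\<^sub>R (y - x))) \<partial>\<mu>) = (\<integral>x. A y \<bullet> (gauss r (y - x) *\<^sub>R ((1 / r) *\<^sub>R (y - x))) \<partial>\<mu>)"
      by simp
    also have "\<dots> = A y \<bullet> (\<integral>x. gauss r (y - x) *\<^sub>R ((1 / r) *\<^sub>R (y - x)) \<partial>\<mu>)"
      by (rule integral_inner_right) (rule gauss_mass(4)[OF r])
    also have "\<dots> = (\<integral>x. gauss r (y - x) *\<^sub>R (A y \<bullet> drift r y) \<partial>\<mu>)"
      unfolding gauss_mass(2)[OF r] using gauss_mass(1,3)[OF r, of y] by simp
    finally show "(\<integral>x. gauss r (y - x) *\<^sub>R (A y \<bullet> ((1 / r) *\<^sub>R (y - x))) \<partial>\<mu>) = \<dots>" .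
  qed
  also have "\<dots> = (\<integral>q. gauss r (snd q - fst q) *\<^sub>R ?g q \<partial>(\<mu> \<Otimes>\<^sub>M lborel))"
    using integral_noise(2)[OF r, of ?g] ig0 by (subst PL.integral_snd) (auto simp: case_prod_beta')
  also have "\<dots> = (\<integral>p. A (fst p + r *\<^sub>R snd p) \<bullet> drift r (fst p + r *\<^sub>R snd p) \<partial>P)"
    using integral_noise(1)[OF r, of ?g] by simp
  finally show ?thesis .
qed

text \<open>
  At level \<open>r = r0\<close> the difference vanishes by \<open>drift_conditional_expectation\<close>. For \<open>r > r0\<close>, write the observation at
  level \<open>r\<close> as \<open>Y = Y0 + t u\<close> with \<open>Y0\<close> the observation at level \<open>r0\<close> and fresh noise \<open>u\<close>, where \<open>t\<^sup>2 = r\<^sup>2 - r0\<^sup>2\<close>.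
  Averaging over \<open>u\<close> reduces to the level \<open>r0\<close>, and replacing \<open>drift r0 Y0\<close> by \<open>drift r0 Y\<close> costs \<open>L t E|u|\<close>. The
  term \<open>1 - r0/r\<close> appears because the noise contained in \<open>Y0\<close> is the fraction \<open>r0/r\<close> of the total noise of \<open>Y\<close>, up
  to a part that is independent of \<open>Y\<close>.
\<close>
lemma noise_vs_drift:
  fixes a :: "'a \<Rightarrow> 'a"
  assumes r0: "0 < r0" and r: "r0 \<le> r" and [measurable]: "a \<in> borel_measurable borel" and bd: "\<And>y. norm (a y) \<le> 1"
    and lip: "\<And>x y. norm (drift r0 x - drift r0 y) \<le> L * norm (x - y)"
  shows "\<bar>(\<integral>p. a (fst p + r *\<^sub>R snd p) \<bullet> snd p \<partial>P) - (\<integral>p. a (fst p + r *\<^sub>R snd p) \<bullet> drift r0 (fst p + r *\<^sub>R snd p) \<partial>P)\<bar>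
     \<le> ((1 - r0 / r) + L * sqrt (r\<^sup>2 - r0\<^sup>2)) * mean_noise"
proof (cases "r = r0")
  case True
  then show ?thesis using drift_conditional_expectation[OF r0 assms(3) bd] r0 by simp
next
  case False
  then have r0r: "r0 < r" "0 < r" using r r0 by auto
  define t where "t = sqrt (r\<^sup>2 - r0\<^sup>2)"
  have "r0\<^sup>2 < r\<^sup>2" using r0r r0 by (intro power_strict_mono) auto
  then have t: "0 < t" "r\<^sup>2 = r0\<^sup>2 + t\<^sup>2" by (auto simp: t_def)
  note [measurable] = drift_measurable[OF r0]
  let ?Q = "P \<Otimes>\<^sub>M (gauss_measure :: 'a measure)"
  define w where "w = drift r0"
  have wm[measurable]: "w \<in> borel_measurable borel" by (simp add: w_def)
  define Y0 where "Y0 = (\<lambda>q :: ('a \<times> 'a) \<times> 'a. fst (fst q) + r0 *\<^sub>R snd (fst q))"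
  define Y where "Y = (\<lambda>q :: ('a \<times> 'a) \<times> 'a. fst (fst q) + r0 *\<^sub>R snd (fst q) + t *\<^sub>R snd q)"
  have [measurable]: "Y0 \<in> borel_measurable ?Q" "Y \<in> borel_measurable ?Q" unfolding Y0_def Y_def by measurable
  have Lnn: "0 \<le> L"
  proof -
    have "0 \<le> norm (drift r0 (SOME b. b \<in> Basis) - drift r0 0)" by simp
    also have "\<dots> \<le> L" using lip[of "SOME b. b \<in> Basis" 0] by simp
    finally show ?thesis .
  qed
  have rot: "(\<integral>q. g (Y q, snd (fst q)) \<partial>?Q) = (\<integral>q. g (fst (fst q) + r *\<^sub>R snd (fst q), (r0 / r) *\<^sub>R snd (fst q) + (t / r) *\<^sub>R snd q) \<partial>?Q)"
    if [measurable]: "g \<in> borel_measurable (borel \<Otimes>\<^sub>M borel)" for g :: "'a \<times> 'a \<Rightarrow> real"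
  proof -
    have "(\<integral>q. g (Y q, snd (fst q)) \<partial>?Q) = (\<integral>s. g s \<partial>distr ?Q (borel \<Otimes>\<^sub>M borel) (\<lambda>q. (fst (fst q) + r0 *\<^sub>R snd (fst q) + t *\<^sub>R snd q, snd (fst q))))"
      unfolding Y_def by (subst integral_distr) auto
    then show ?thesis unfolding distr_two_noises[OF r0 t(1) r0r(2) t(2)] by (subst (asm) integral_distr) auto
  qed
  have z1: "integrable ?Q (\<lambda>q. snd (fst q))" using Q.integrable_fst_comp(1)[OF integrable_noise_vec] by simp
  have iu: "integrable ?Q (\<lambda>q. snd q)"
    using integrable_norm_gauss by (intro Q.integrable_snd_comp(1)) (subst (asm) integrable_norm_iff, auto)
  have w0: "integrable ?Q (\<lambda>q. w (Y0 q))" using Q.integrable_fst_comp(1)[OF integrable_drift[OF r0]] by (simp add: Y0_def w_def)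
  have wY: "integrable ?Q (\<lambda>q. w (Y q))"
  proof (rule Bochner_Integration.integrable_bound[where f="\<lambda>q. norm (w (Y0 q)) + L * t * norm (snd q)"])
    show "integrable ?Q (\<lambda>q. norm (w (Y0 q)) + L * t * norm (snd q))" using w0 iu by auto
    show "AE q in ?Q. norm (w (Y q)) \<le> norm (norm (w (Y0 q)) + L * t * norm (snd q))"
    proof (rule AE_I2)
      fix q
      have "norm (w (Y q)) \<le> norm (w (Y0 q)) + norm (w (Y q) - w (Y0 q))" by norm
      also have "norm (w (Y q) - w (Y0 q)) \<le> L * (t * norm (snd q))" using lip[of "Y q" "Y0 q"] t by (simp add: Y_def Y0_def w_def)
      finally show "norm (w (Y q)) \<le> norm (norm (w (Y0 q)) + L * t * norm (snd q))" using Lnn t by simp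
    qed
  qed measurable
  have b: "norm (a (Y q)) \<le> 1" for q by (rule bd)
  have ia: "integrable ?Q (\<lambda>q. a (Y q) \<bullet> B q)" if "integrable ?Q B" for B :: "_ \<Rightarrow> 'a"
    by (rule integrable_bounded_inner[OF _ b that]) measurable
  \<comment> \<open>averaging over the fresh noise leaves a bounded function of the observation at level \<open>r0\<close>\<close>
  define A where "A = (\<lambda>y. \<integral>u. a (y + t *\<^sub>R u) \<partial>gauss_measure)"
  have Am[measurable]: "A \<in> borel_measurable borel" unfolding A_def
    by (rule gauss.borel_measurable_lebesgue_integral) measurable
  have iau: "integrable gauss_measure (\<lambda>u. a (y + t *\<^sub>R u))" for y
    by (rule gauss.integrable_const_bound[where B=1]) (auto simp: bd)
  have Abd: "norm (A y) \<le> 1" for y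
  proof -
    have "norm (A y) \<le> (\<integral>u. norm (a (y + t *\<^sub>R u)) \<partial>gauss_measure)" unfolding A_def by (rule integral_norm_bound)
    also have "\<dots> \<le> (\<integral>u. 1 \<partial>(gauss_measure :: 'a measure))" by (intro integral_mono integrable_norm iau) (auto simp: bd)
    finally show ?thesis by (simp add: prob_gauss_UNIV)
  qed
  have avg: "(\<integral>q. a (Y q) \<bullet> b (fst q) \<partial>?Q) = (\<integral>p. A (fst p + r0 *\<^sub>R snd p) \<bullet> b p \<partial>P)"
    if ib: "integrable ?Q (\<lambda>q. a (Y q) \<bullet> b (fst q))" for b :: "_ \<Rightarrow> 'a"
  proof -
    have "(\<integral>q. a (Y q) \<bullet> b (fst q) \<partial>?Q) = (\<integral>p. \<integral>u. a (fst p + r0 *\<^sub>R snd p + t *\<^sub>R u) \<bullet> b p \<partial>gauss_measure \<partial>P)"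
      by (subst Q.integral_fst'[OF ib, symmetric]) (simp add: Y_def)
    also have "\<dots> = (\<integral>p. A (fst p + r0 *\<^sub>R snd p) \<bullet> b p \<partial>P)"
      unfolding A_def by (intro Bochner_Integration.integral_cong refl integral_inner_left iau)
    finally show ?thesis .
  qed
  let ?Z = "\<integral>p. a (fst p + r *\<^sub>R snd p) \<bullet> snd p \<partial>P" and ?W = "\<integral>p. a (fst p + r *\<^sub>R snd p) \<bullet> w (fst p + r *\<^sub>R snd p) \<partial>P"
  have I1: "(\<integral>q. a (Y q) \<bullet> snd (fst q) \<partial>?Q) = (r0 / r) * ?Z"
  proof -
    have ap: "integrable P (\<lambda>p. a (fst p + r *\<^sub>R snd p) \<bullet> snd p)"
      by (rule integrable_bounded_inner[OF _ bd integrable_noise_vec]) measurable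
    have j1: "integrable ?Q (\<lambda>q. a (fst (fst q) + r *\<^sub>R snd (fst q)) \<bullet> snd (fst q))"
      using Q.integrable_fst_comp(1)[OF ap] by simp
    have j2: "integrable ?Q (\<lambda>q. a (fst (fst q) + r *\<^sub>R snd (fst q)) \<bullet> snd q)"
      by (rule integrable_bounded_inner[OF _ bd iu]) measurable
    have "(\<integral>q. a (Y q) \<bullet> snd (fst q) \<partial>?Q) = (\<integral>q. a (fst (fst q) + r *\<^sub>R snd (fst q)) \<bullet> ((r0 / r) *\<^sub>R snd (fst q) + (t / r) *\<^sub>R snd q) \<partial>?Q)"
      using rot[of "\<lambda>s. a (fst s) \<bullet> snd s"] by simp
    also have "\<dots> = (r0 / r) * (\<integral>q. a (fst (fst q) + r *\<^sub>R snd (fst q)) \<bullet> snd (fst q) \<partial>?Q) + (t / r) * (\<integral>q. a (fst (fst q) + r *\<^sub>R snd (fst q)) \<bullet> snd q \<partial>?Q)"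
      unfolding inner_add_right inner_scaleR_right using j1 j2 by (subst Bochner_Integration.integral_add) auto
    also have "(\<integral>q. a (fst (fst q) + r *\<^sub>R snd (fst q)) \<bullet> snd (fst q) \<partial>?Q) = ?Z"
      using Q.integrable_fst_comp(2)[OF ap] by simp
    also have "(\<integral>q. a (fst (fst q) + r *\<^sub>R snd (fst q)) \<bullet> snd q \<partial>?Q) = 0"
      by (subst Q.integral_fst'[OF j2, symmetric]) (simp add: integral_gauss_measure_id)
    finally show ?thesis by simp
  qed
  have I3: "(\<integral>q. a (Y q) \<bullet> snd (fst q) \<partial>?Q) = (\<integral>q. a (Y q) \<bullet> w (Y0 q) \<partial>?Q)"
  proof -
    have "(\<integral>q. a (Y q) \<bullet> snd (fst q) \<partial>?Q) = (\<integral>p. A (fst p + r0 *\<^sub>R snd p) \<bullet> snd p \<partial>P)"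
      by (rule avg) (rule ia[OF z1])
    also have "\<dots> = (\<integral>p. A (fst p + r0 *\<^sub>R snd p) \<bullet> w (fst p + r0 *\<^sub>R snd p) \<partial>P)"
      unfolding w_def by (rule drift_conditional_expectation[OF r0 Am Abd])
    also have "\<dots> = (\<integral>q. a (Y q) \<bullet> w (Y0 q) \<partial>?Q)"
      using avg[of "\<lambda>p. w (fst p + r0 *\<^sub>R snd p)"] ia[OF w0] by (simp add: Y0_def)
    finally show ?thesis .
  qed
  have I4: "\<bar>(\<integral>q. a (Y q) \<bullet> w (Y0 q) \<partial>?Q) - (\<integral>q. a (Y q) \<bullet> w (Y q) \<partial>?Q)\<bar> \<le> L * t * mean_noise"
  proof -
    have "\<bar>(\<integral>q. a (Y q) \<bullet> w (Y0 q) \<partial>?Q) - (\<integral>q. a (Y q) \<bullet> w (Y q) \<partial>?Q)\<bar> = \<bar>\<integral>q. a (Y q) \<bullet> w (Y0 q) - a (Y q) \<bullet> w (Y q) \<partial>?Q\<bar>"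
      by (subst Bochner_Integration.integral_diff[OF ia[OF w0] ia[OF wY]]) simp
    also have "\<dots> \<le> (\<integral>q. L * t * norm (snd q) \<partial>?Q)"
    proof (rule order_trans[OF integral_abs_bound integral_mono])
      show "integrable ?Q (\<lambda>q. \<bar>a (Y q) \<bullet> w (Y0 q) - a (Y q) \<bullet> w (Y q)\<bar>)" using ia[OF w0] ia[OF wY] by auto
      show "integrable ?Q (\<lambda>q. L * t * norm (snd q))" using iu by auto
      fix q
      have "\<bar>a (Y q) \<bullet> w (Y0 q) - a (Y q) \<bullet> w (Y q)\<bar> = \<bar>a (Y q) \<bullet> (w (Y0 q) - w (Y q))\<bar>" by (simp add: inner_diff_right)
      also have "\<dots> \<le> norm (a (Y q)) * norm (w (Y0 q) - w (Y q))" by (rule Cauchy_Schwarz_ineq2)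
      also have "\<dots> \<le> 1 * (L * norm (Y0 q - Y q))" unfolding w_def by (intro mult_mono bd lip) auto
      also have "\<dots> = L * t * norm (snd q)" using t by (simp add: Y_def Y0_def)
      finally show "\<bar>a (Y q) \<bullet> w (Y0 q) - a (Y q) \<bullet> w (Y q)\<bar> \<le> L * t * norm (snd q)" .
    qed
    also have "\<dots> = L * t * mean_noise" using Q.integrable_snd_comp(2)[OF integrable_norm_gauss] by (simp add: mean_noise_eq)
    finally show ?thesis .
  qed
  have I5: "(\<integral>q. a (Y q) \<bullet> w (Y q) \<partial>?Q) = ?W"
  proof -
    have ap: "integrable P (\<lambda>p. a (fst p + r *\<^sub>R snd p) \<bullet> w (fst p + r *\<^sub>R snd p))"
    proof (rule integrable_bounded_inner[OF _ bd])
      show "integrable P (\<lambda>p. w (fst p + r *\<^sub>R snd p))"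
      proof (rule Bochner_Integration.integrable_bound[where f="\<lambda>p. norm (w (fst p + r0 *\<^sub>R snd p)) + L * (r - r0) * norm (snd p)"])
        show "integrable P (\<lambda>p. norm (w (fst p + r0 *\<^sub>R snd p)) + L * (r - r0) * norm (snd p))"
          using integrable_drift[OF r0] integrable_noise_norm(1) by (auto simp: w_def)
        show "AE p in P. norm (w (fst p + r *\<^sub>R snd p)) \<le> norm (norm (w (fst p + r0 *\<^sub>R snd p)) + L * (r - r0) * norm (snd p))"
        proof (rule AE_I2)
          fix p :: "'a \<times> 'a"
          have "norm (w (fst p + r *\<^sub>R snd p)) \<le> norm (w (fst p + r0 *\<^sub>R snd p)) + norm (w (fst p + r *\<^sub>R snd p) - w (fst p + r0 *\<^sub>R snd p))" by norm
          also have "norm (w (fst p + r *\<^sub>R snd p) - w (fst p + r0 *\<^sub>R snd p)) \<le> L * norm ((r - r0) *\<^sub>R snd p)"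
            using lip[of "fst p + r *\<^sub>R snd p" "fst p + r0 *\<^sub>R snd p"] by (simp add: w_def scaleR_diff_left)
          finally show "norm (w (fst p + r *\<^sub>R snd p)) \<le> norm (norm (w (fst p + r0 *\<^sub>R snd p)) + L * (r - r0) * norm (snd p))"
            using Lnn r by simp
        qed
      qed measurable
    qed measurable
    show ?thesis using rot[of "\<lambda>s. a (fst s) \<bullet> w (fst s)"] Q.integrable_fst_comp(2)[OF ap] by simp
  qed
  have Zb: "\<bar>?Z\<bar> \<le> mean_noise"
  proof -
    have "\<bar>?Z\<bar> \<le> (\<integral>p. norm (snd p) \<partial>P)"
    proof (rule order_trans[OF integral_abs_bound integral_mono])
      show "integrable P (\<lambda>p. \<bar>a (fst p + r *\<^sub>R snd p) \<bullet> snd p\<bar>)"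
        by (intro integrable_abs integrable_bounded_inner[OF _ bd integrable_noise_vec]) measurable
      fix p :: "'a \<times> 'a"
      have "\<bar>a (fst p + r *\<^sub>R snd p) \<bullet> snd p\<bar> \<le> norm (a (fst p + r *\<^sub>R snd p)) * norm (snd p)" by (rule Cauchy_Schwarz_ineq2)
      also have "\<dots> \<le> 1 * norm (snd p)" by (intro mult_right_mono bd) auto
      finally show "\<bar>a (fst p + r *\<^sub>R snd p) \<bullet> snd p\<bar> \<le> norm (snd p)" by simp
    qed (rule integrable_noise_norm)
    then show ?thesis by (simp add: integrable_noise_norm(2))
  qed
  have "\<bar>?Z - ?W\<bar> \<le> \<bar>(1 - r0 / r) * ?Z\<bar> + \<bar>(r0 / r) * ?Z - ?W\<bar>"
    by (rule order_trans[OF eq_refl abs_triangle_ineq]) (simp add: left_diff_distrib)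
  also have "\<bar>(1 - r0 / r) * ?Z\<bar> \<le> (1 - r0 / r) * mean_noise"
    using Zb r0r r0 by (simp add: abs_mult mult_left_mono)
  also have "\<bar>(r0 / r) * ?Z - ?W\<bar> \<le> L * t * mean_noise" using I4 unfolding I3[symmetric] I1 I5 .
  finally show ?thesis by (simp add: t_def w_def algebra_simps)
qed

end

section \<open>One step of the reverse heat flow\<close>

context noisy begin

text \<open>
  Interpolate by \<open>s \<mapsto> \<phi>(Y\<^sub>s - (s - r0) w(Y\<^sub>s))\<close> between the two sides, where \<open>Y\<^sub>s = x + s z\<close> and \<open>w = drift r0\<close>. Its derivative is
  \<open>a \<bullet> (z - w(Y\<^sub>s) - (s - r0) Dw(Y\<^sub>s) z)\<close> with a vector \<open>a\<close> of norm at most one depending on \<open>Y\<^sub>s\<close> only. In the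
  mean, \<open>z\<close> and \<open>w(Y\<^sub>s)\<close> almost cancel by \<open>noise_vs_drift\<close>, and the last term has the small factor \<open>s - r0\<close>. Every
  contribution is at most a multiple of \<open>E|z| \<surd>(r1\<^sup>2 - r0\<^sup>2)\<close>; with Lipschitz constant \<open>2/r0\<close> of \<open>w\<close> the three
  coefficients \<open>1/r0\<close>, \<open>2/r0\<close>, \<open>2/r0\<close> add up to \<open>5/r0\<close>.
\<close>
lemma heat_flow_step:
  fixes \<phi> :: "'a \<Rightarrow> real"
  assumes r0: "0 < r0" and r1: "r0 < r1" and \<phi>: "diff_contraction \<phi>" and bd: "\<And>y. \<bar>\<phi> y\<bar> \<le> C"
    and lip: "\<And>x y. norm (drift r0 x - drift r0 y) \<le> (2 / r0) * norm (x - y)"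
  shows "\<bar>(\<integral>p. \<phi> (fst p + r1 *\<^sub>R snd p - (r1 - r0) *\<^sub>R drift r0 (fst p + r1 *\<^sub>R snd p)) \<partial>P) - (\<integral>p. \<phi> (fst p + r0 *\<^sub>R snd p) \<partial>P)\<bar>
     \<le> (5 / r0) * mean_noise * sqrt (r1\<^sup>2 - r0\<^sup>2) * (r1 - r0)"
proof -
  define w where "w = drift r0"
  define L where "L = 2 / r0"
  have L: "0 \<le> L" using r0 by (simp add: L_def)
  have wl: "norm (w x - w y) \<le> L * norm (x - y)" for x y using lip by (simp add: w_def L_def)
  have wl': "norm (w (y + h) - w y) \<le> L * norm h" for y h using wl[of "y + h" y] by simp
  obtain W where W: "\<And>y. (w has_derivative W y) (at y)"
    using drift_differentiable[OF r0] unfolding w_def differentiable_def by metis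
  obtain \<Phi> where \<Phi>: "\<And>y. (\<phi> has_derivative \<Phi> y) (at y)"
    using \<phi> unfolding diff_contraction_def differentiable_def by metis
  have phl: "\<bar>\<phi> (y + h) - \<phi> y\<bar> \<le> 1 * norm h" for y h using \<phi> unfolding diff_contraction_def by (metis add_diff_cancel_left' mult_1 real_norm_def)
  have nW: "norm (W y h) \<le> L * norm h" for y h by (rule derivative_norm_le_lipschitz[OF W wl'])
  have n\<Phi>: "\<bar>\<Phi> y h\<bar> \<le> norm h" for y h using derivative_norm_le_lipschitz[OF \<Phi>, of 1 y h] phl by simp
  have linW: "linear (W y)" for y by (rule has_derivative_linear[OF W])
  have lin\<Phi>: "linear (\<Phi> y)" for y by (rule has_derivative_linear[OF \<Phi>])
  have [measurable]: "w \<in> borel_measurable borel" unfolding w_def by (rule drift_measurable[OF r0])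
  have [measurable]: "\<phi> \<in> borel_measurable borel" by (rule diff_contraction_measurable[OF \<phi>])
  define G where "G = (\<lambda>r y. y - (r - r0) *\<^sub>R w y)"
  have [measurable]: "G r \<in> borel_measurable borel" for r unfolding G_def by measurable
  \<comment> \<open>the gradient of \<open>\<phi>\<close> at the moved point\<close>
  define a where "a = (\<lambda>r y. \<Sum>b\<in>Basis. \<Phi> (G r y) b *\<^sub>R b)"
  have a: "a r y \<bullet> v = \<Phi> (G r y) v" for r y v
  proof -
    have "\<Phi> (G r y) v = \<Phi> (G r y) (\<Sum>b\<in>Basis. (v \<bullet> b) *\<^sub>R b)" by (simp add: euclidean_representation)
    also have "\<dots> = (\<Sum>b\<in>Basis. (v \<bullet> b) * \<Phi> (G r y) b)" by (simp add: linear_sum[OF lin\<Phi>] linear_scale[OF lin\<Phi>])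
    also have "\<dots> = a r y \<bullet> v" unfolding a_def inner_sum_left by (intro sum.cong) (auto simp: inner_commute)
    finally show ?thesis by simp
  qed
  have an: "norm (a r y) \<le> 1" for r y
  proof -
    have "(norm (a r y))\<^sup>2 = \<Phi> (G r y) (a r y)" by (simp add: a[symmetric] power2_norm_eq_inner)
    also have "\<dots> \<le> norm (a r y)" using n\<Phi>[of "G r y" "a r y"] by simp
    finally have le: "norm (a r y) * norm (a r y) \<le> norm (a r y)" by (simp add: power2_eq_square)
    show ?thesis
    proof (rule ccontr)
      assume "\<not> norm (a r y) \<le> 1"
      then have g: "1 < norm (a r y)" by simp
      then have "norm (a r y) * 1 < norm (a r y) * norm (a r y)" by (intro mult_strict_left_mono) auto
      with le show False by simp
    qed
  qed
  have [measurable]: "(\<lambda>y. \<Phi> (G r y) b) \<in> borel_measurable borel" for r b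
    by (rule borel_measurable_LIMSEQ_metric[OF _ directional_derivative_LIMSEQ[OF \<Phi>]]) measurable
  have am[measurable]: "a r \<in> borel_measurable borel" for r unfolding a_def by measurable
  have [measurable]: "(\<lambda>y. W y b) \<in> borel_measurable borel" for b
    by (rule borel_measurable_LIMSEQ_metric[OF _ directional_derivative_LIMSEQ[OF W]]) measurable
  have Wsum: "W y z = (\<Sum>b\<in>Basis. (z \<bullet> b) *\<^sub>R W y b)" for y z
  proof -
    have "W y z = W y (\<Sum>b\<in>Basis. (z \<bullet> b) *\<^sub>R b)" by (simp add: euclidean_representation)
    then show ?thesis by (simp add: linear_sum[OF linW] linear_scale[OF linW])
  qed
  have Wm[measurable]: "(\<lambda>p. W (fst p + r *\<^sub>R snd p) (snd p)) \<in> borel_measurable P" for r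
    unfolding Wsum[of _ "snd _"] by measurable
  define Y where "Y = (\<lambda>r p. fst p + r *\<^sub>R snd p :: 'a)"
  have Ym[measurable]: "Y r \<in> borel_measurable P" for r unfolding Y_def by measurable
  define f where "f = (\<lambda>r p. \<phi> (G r (Y r p)))"
  define f' where "f' = (\<lambda>r p. a r (Y r p) \<bullet> (snd p - w (Y r p) - (r - r0) *\<^sub>R W (Y r p) (snd p)))"
  have der: "((\<lambda>s. f s p) has_real_derivative f' r p) (at r within S)" for r p S
  proof -
    have 1: "((\<lambda>s. Y s p) has_derivative (\<lambda>h. h *\<^sub>R snd p)) (at r)"
      unfolding Y_def by (auto intro!: derivative_eq_intros)
    have 2: "((\<lambda>s. w (Y s p)) has_derivative (\<lambda>h. W (Y r p) (h *\<^sub>R snd p))) (at r)"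
      using diff_chain_at[OF 1 W] by (simp add: o_def)
    have 3: "((\<lambda>s. G s (Y s p)) has_derivative (\<lambda>h. h *\<^sub>R snd p - ((r - r0) *\<^sub>R W (Y r p) (h *\<^sub>R snd p) + h *\<^sub>R w (Y r p)))) (at r)"
      unfolding G_def by (rule derivative_eq_intros 1 2 refl)+ simp
    have 4: "((\<lambda>s. \<phi> (G s (Y s p))) has_derivative (\<lambda>h. \<Phi> (G r (Y r p)) (h *\<^sub>R snd p - ((r - r0) *\<^sub>R W (Y r p) (h *\<^sub>R snd p) + h *\<^sub>R w (Y r p))))) (at r)"
      using diff_chain_at[OF 3 \<Phi>] by (simp add: o_def)
    have "\<Phi> (G r (Y r p)) (h *\<^sub>R snd p - ((r - r0) *\<^sub>R W (Y r p) (h *\<^sub>R snd p) + h *\<^sub>R w (Y r p))) = f' r p * h" for h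
    proof -
      have "h *\<^sub>R snd p - ((r - r0) *\<^sub>R W (Y r p) (h *\<^sub>R snd p) + h *\<^sub>R w (Y r p)) = h *\<^sub>R (snd p - w (Y r p) - (r - r0) *\<^sub>R W (Y r p) (snd p))"
        by (simp add: linear_scale[OF linW] scaleR_diff_right)
      then show ?thesis by (simp only: f'_def a linear_scale[OF lin\<Phi>] real_scaleR_def mult.commute)
    qed
    then have "((\<lambda>s. f s p) has_derivative (*) (f' r p)) (at r)" using 4 by (simp add: f_def)
    then show ?thesis unfolding has_field_derivative_def by (rule has_derivative_at_withinI)
  qed
  have f'm: "f' r \<in> borel_measurable P" for r unfolding f'_def Y_def by measurable
  have fi: "integrable P (f r)" for r
    by (rule P.integrable_const_bound[where B=C]) (auto simp: f_def bd)
  have wb: "norm (w (Y r p)) \<le> norm (w (Y r0 p)) + L * (r1 - r0) * norm (snd p)" if "r \<in> {r0..r1}" for r p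
  proof -
    have "norm (w (Y r p)) \<le> norm (w (Y r0 p)) + norm (w (Y r p) - w (Y r0 p))" by norm
    also have "norm (w (Y r p) - w (Y r0 p)) \<le> L * norm (Y r p - Y r0 p)" by (rule wl)
    also have "Y r p - Y r0 p = (r - r0) *\<^sub>R snd p" by (simp add: Y_def scaleR_diff_left)
    also have "L * norm ((r - r0) *\<^sub>R snd p) \<le> L * ((r1 - r0) * norm (snd p))"
      using that by (auto intro!: mult_left_mono mult_right_mono L)
    finally show ?thesis by (simp add: mult.assoc)
  qed
  define D where "D = (\<lambda>p. norm (snd p) + (norm (w (Y r0 p)) + L * (r1 - r0) * norm (snd p)) + (r1 - r0) * (L * norm (snd p)))"
  have f'b: "\<bar>f' r p\<bar> \<le> D p" if r: "r \<in> {r0..r1}" for r p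
  proof -
    have "\<bar>f' r p\<bar> \<le> norm (a r (Y r p)) * norm (snd p - w (Y r p) - (r - r0) *\<^sub>R W (Y r p) (snd p))"
      unfolding f'_def by (rule Cauchy_Schwarz_ineq2)
    also have "\<dots> \<le> 1 * norm (snd p - w (Y r p) - (r - r0) *\<^sub>R W (Y r p) (snd p))" by (intro mult_right_mono an) auto
    also have "\<dots> \<le> norm (snd p) + norm (w (Y r p)) + norm ((r - r0) *\<^sub>R W (Y r p) (snd p))"
      using norm_triangle_ineq4[of "snd p - w (Y r p)" "(r - r0) *\<^sub>R W (Y r p) (snd p)"] norm_triangle_ineq4[of "snd p" "w (Y r p)"]
      by linarith
    also have "norm ((r - r0) *\<^sub>R W (Y r p) (snd p)) \<le> (r1 - r0) * (L * norm (snd p))"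
      using r nW by (auto intro!: mult_mono)
    finally show ?thesis using wb[OF r, of p] unfolding D_def by linarith
  qed
  have iw0: "integrable P (\<lambda>p. w (Y r0 p))" using integrable_drift[OF r0] by (simp add: w_def Y_def)
  have Di: "integrable P D" unfolding D_def using iw0 integrable_noise_norm(1) by auto
  have F': "((\<lambda>s. \<integral>p. f s p \<partial>P) has_real_derivative (\<integral>p. f' r p \<partial>P)) (at r within {r0..r1})" if "r \<in> {r0..r1}" for r
    by (rule has_real_derivative_integral[OF that _ der f'm fi f'b Di]) auto
  have F'b: "\<bar>\<integral>p. f' r p \<partial>P\<bar> \<le> (5 / r0) * mean_noise * sqrt (r1\<^sup>2 - r0\<^sup>2)" if r: "r \<in> {r0..r1}" for r
  proof -
    have i1: "integrable P (\<lambda>p. a r (Y r p) \<bullet> snd p)"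
      by (rule integrable_bounded_inner[OF _ an integrable_noise_vec]) measurable
    have i2: "integrable P (\<lambda>p. a r (Y r p) \<bullet> w (Y r p))"
    proof (rule integrable_bounded_inner[OF _ an])
      show "integrable P (\<lambda>p. w (Y r p))"
        by (rule Bochner_Integration.integrable_bound[where f="\<lambda>p. norm (w (Y r0 p)) + L * (r1 - r0) * norm (snd p)"])
           (use iw0 integrable_noise_norm(1) in \<open>auto intro!: AE_I2 order_trans[OF wb[OF r]]\<close>)
    qed measurable
    have i3: "integrable P (\<lambda>p. W (Y r p) (snd p))"
      by (rule Bochner_Integration.integrable_bound[where f="\<lambda>p. L * norm (snd p)"])
         (use integrable_noise_norm(1) Wm[of r] L in \<open>auto simp: Y_def intro!: AE_I2 order_trans[OF nW]\<close>)
    have i3': "integrable P (\<lambda>p. a r (Y r p) \<bullet> W (Y r p) (snd p))"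
      by (rule integrable_bounded_inner[OF _ an i3]) measurable
    have i3b: "\<bar>\<integral>p. a r (Y r p) \<bullet> W (Y r p) (snd p) \<partial>P\<bar> \<le> L * mean_noise"
    proof -
      have "\<bar>\<integral>p. a r (Y r p) \<bullet> W (Y r p) (snd p) \<partial>P\<bar> \<le> (\<integral>p. L * norm (snd p) \<partial>P)"
      proof (rule order_trans[OF integral_abs_bound integral_mono])
        show "integrable P (\<lambda>p. \<bar>a r (Y r p) \<bullet> W (Y r p) (snd p)\<bar>)" using i3' by simp
        show "integrable P (\<lambda>p. L * norm (snd p))" using integrable_noise_norm(1) by simp
        fix p
        have "\<bar>a r (Y r p) \<bullet> W (Y r p) (snd p)\<bar> \<le> norm (a r (Y r p)) * norm (W (Y r p) (snd p))" by (rule Cauchy_Schwarz_ineq2)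
        also have "\<dots> \<le> 1 * (L * norm (snd p))" by (intro mult_mono an nW) auto
        finally show "\<bar>a r (Y r p) \<bullet> W (Y r p) (snd p)\<bar> \<le> L * norm (snd p)" by simp
      qed
      then show ?thesis by (simp add: integrable_noise_norm(2))
    qed
    have e: "(\<integral>p. f' r p \<partial>P) = ((\<integral>p. a r (Y r p) \<bullet> snd p \<partial>P) - (\<integral>p. a r (Y r p) \<bullet> w (Y r p) \<partial>P)) - (r - r0) * (\<integral>p. a r (Y r p) \<bullet> W (Y r p) (snd p) \<partial>P)"
      unfolding f'_def inner_diff_right inner_scaleR_right using i1 i2 i3'
      by (subst Bochner_Integration.integral_diff, simp, simp, subst Bochner_Integration.integral_diff) auto
    have k: "\<bar>(\<integral>p. a r (Y r p) \<bullet> snd p \<partial>P) - (\<integral>p. a r (Y r p) \<bullet> w (Y r p) \<partial>P)\<bar> \<le> ((1 - r0 / r) + L * sqrt (r\<^sup>2 - r0\<^sup>2)) * mean_noise"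
      unfolding Y_def w_def by (rule noise_vs_drift[OF r0 _ am an]) (use r lip in \<open>auto simp: L_def\<close>)
    have M: "0 \<le> mean_noise" unfolding mean_noise_def by simp
    have rr: "r0 \<le> r" "r \<le> r1" using r by auto
    have s1: "r - r0 \<le> sqrt (r\<^sup>2 - r0\<^sup>2)"
    proof (rule real_le_rsqrt)
      have "(r - r0) * (r - r0) \<le> (r - r0) * (r + r0)" using rr r0 by (intro mult_left_mono) auto
      then show "(r - r0)\<^sup>2 \<le> r\<^sup>2 - r0\<^sup>2" by (simp add: power2_eq_square algebra_simps)
    qed
    have s2: "sqrt (r\<^sup>2 - r0\<^sup>2) \<le> sqrt (r1\<^sup>2 - r0\<^sup>2)" using rr r0 by (auto intro!: power_mono)
    have s3: "1 - r0 / r \<le> (1 / r0) * (r - r0)"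
    proof -
      have "(r - r0) * (1 / r) \<le> (r - r0) * (1 / r0)" using rr r0 by (intro mult_left_mono divide_left_mono) auto
      moreover have "1 - r0 / r = (r - r0) * (1 / r)" using rr r0 by (simp add: field_simps)
      ultimately show ?thesis by (simp add: mult.commute)
    qed
    let ?t = "sqrt (r1\<^sup>2 - r0\<^sup>2)"
    have "\<bar>\<integral>p. f' r p \<partial>P\<bar> \<le> \<bar>(\<integral>p. a r (Y r p) \<bullet> snd p \<partial>P) - (\<integral>p. a r (Y r p) \<bullet> w (Y r p) \<partial>P)\<bar> + \<bar>(r - r0) * (\<integral>p. a r (Y r p) \<bullet> W (Y r p) (snd p) \<partial>P)\<bar>"
      unfolding e by (rule abs_triangle_ineq4)
    also have "\<dots> \<le> ((1 - r0 / r) + L * sqrt (r\<^sup>2 - r0\<^sup>2)) * mean_noise + (r - r0) * (L * mean_noise)"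
      using k i3b rr by (intro add_mono) (auto simp: abs_mult intro!: mult_left_mono)
    also have "\<dots> \<le> ((1 / r0) * ?t + L * ?t) * mean_noise + ?t * (L * mean_noise)"
    proof (intro add_mono mult_right_mono mult_left_mono L M s2 mult_nonneg_nonneg)
      show "1 - r0 / r \<le> (1 / r0) * ?t"
        by (rule order_trans[OF s3 mult_left_mono[OF order_trans[OF s1 s2]]]) (use r0 in simp)
      show "r - r0 \<le> ?t" using s1 s2 by linarith
    qed
    also have "\<dots> = (5 / r0) * mean_noise * ?t" by (simp add: L_def algebra_simps)
    finally show ?thesis .
  qed
  have "norm ((\<integral>p. f r1 p \<partial>P) - (\<integral>p. f r0 p \<partial>P)) \<le> (5 / r0) * mean_noise * sqrt (r1\<^sup>2 - r0\<^sup>2) * norm (r1 - r0)"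
    by (rule field_differentiable_bound[OF _ F']) (use F'b r1 in auto)
  moreover have "f r1 p = \<phi> (fst p + r1 *\<^sub>R snd p - (r1 - r0) *\<^sub>R drift r0 (fst p + r1 *\<^sub>R snd p))" "f r0 p = \<phi> (fst p + r0 *\<^sub>R snd p)" for p
    by (auto simp: f_def G_def Y_def w_def)
  ultimately show ?thesis using r1 by simp
qed

text \<open>
  Each step \<open>y \<mapsto> y - h drift r y\<close> with \<open>h \<le> r\<close> is a convex combination of the identity and the posterior mean. The errors
  of the steps add up because precomposing a test function with the maps already built keeps it a test function.
\<close>
lemma reverse_heat_flow_chain:
  assumes ne: "\<And>r x y. 0 < r \<Longrightarrow> norm ((x - r *\<^sub>R drift r x) - (y - r *\<^sub>R drift r y)) \<le> norm (x - y)"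
    and e: "0 < e" and h: "0 < h" "h \<le> e" and j: "e + real j * h \<le> 1"
  shows "\<exists>T. diff_contraction T \<and> (\<forall>(\<phi> :: 'a \<Rightarrow> real) C. diff_contraction \<phi> \<and> (\<forall>y. \<bar>\<phi> y\<bar> \<le> C) \<longrightarrow>
     \<bar>(\<integral>p. \<phi> (T (fst p + (e + real j * h) *\<^sub>R snd p)) \<partial>P) - (\<integral>p. \<phi> (fst p + e *\<^sub>R snd p) \<partial>P)\<bar> \<le> real j * h * ((5 / e) * mean_noise * sqrt (2 * h)))"
  using j
proof (induction j)
  case 0
  have "diff_contraction (\<lambda>x::'a. x)" by (auto simp: diff_contraction_def)
  then show ?case by (intro exI[of _ "\<lambda>x. x"]) auto
next
  case (Suc j)
  define r0 r1 where "r0 = e + real j * h" and "r1 = e + real (Suc j) * h"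
  have r: "0 < r0" "r0 < r1" "r1 - r0 = h" "r1 \<le> 1" "h \<le> r0" "e \<le> r0"
  proof -
    have "0 \<le> real j * h" using h by simp
    then show "0 < r0" "r0 < r1" "r1 - r0 = h" "r1 \<le> 1" "h \<le> r0" "e \<le> r0"
      using e h Suc.prems unfolding r0_def r1_def of_nat_Suc distrib_right mult_1_left by linarith+
  qed
  have "e + real j * h \<le> 1" using r by (simp add: r0_def)
  from Suc.IH[OF this] obtain T where T: "diff_contraction T" and TT: "\<And>\<phi> C. diff_contraction \<phi> \<Longrightarrow> (\<forall>y. \<bar>\<phi> y\<bar> \<le> C) \<Longrightarrow>
     \<bar>(\<integral>p. \<phi> (T (fst p + r0 *\<^sub>R snd p)) \<partial>P) - (\<integral>p. \<phi> (fst p + e *\<^sub>R snd p) \<partial>P)\<bar> \<le> real j * h * ((5 / e) * mean_noise * sqrt (2 * h))"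
    unfolding r0_def by blast
  define S where "S = (\<lambda>y. y - (r1 - r0) *\<^sub>R drift r0 y)"
  have lip: "norm (drift r0 x - drift r0 y) \<le> (2 / r0) * norm (x - y)" for x y
  proof -
    have "r0 * norm (drift r0 x - drift r0 y) = norm (r0 *\<^sub>R drift r0 x - r0 *\<^sub>R drift r0 y)"
      using r by (simp add: scaleR_diff_right[symmetric])
    also have "\<dots> = norm ((x - y) - ((x - r0 *\<^sub>R drift r0 x) - (y - r0 *\<^sub>R drift r0 y)))" by (simp add: algebra_simps)
    also have "\<dots> \<le> norm (x - y) + norm ((x - r0 *\<^sub>R drift r0 x) - (y - r0 *\<^sub>R drift r0 y))" by (rule norm_triangle_ineq4)
    also have "\<dots> \<le> 2 * norm (x - y)" using ne[OF r(1), of x y] by simp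
    finally show ?thesis using r(1) by (simp add: field_simps)
  qed
  have S: "diff_contraction S" unfolding diff_contraction_def
  proof (intro conjI allI)
    fix y show "S differentiable (at y)" unfolding S_def
      by (intro differentiable_diff differentiable_scaleR differentiable_const differentiable_ident drift_differentiable r)
  next
    fix x y
    \<comment> \<open>weight of the posterior mean in the convex combination\<close>
    define c where "c = h / r0"
    have c: "0 \<le> c" "c \<le> 1" using r h by (auto simp: c_def)
    have s: "S y = (1 - c) *\<^sub>R y + c *\<^sub>R (y - r0 *\<^sub>R drift r0 y)" for y
      using r by (simp add: S_def c_def algebra_simps)
    have "S x - S y = (1 - c) *\<^sub>R (x - y) + c *\<^sub>R ((x - r0 *\<^sub>R drift r0 x) - (y - r0 *\<^sub>R drift r0 y))"
      unfolding s by (simp add: algebra_simps)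
    then have "norm (S x - S y) \<le> norm ((1 - c) *\<^sub>R (x - y)) + norm (c *\<^sub>R ((x - r0 *\<^sub>R drift r0 x) - (y - r0 *\<^sub>R drift r0 y)))"
      by (simp only: norm_triangle_ineq)
    also have "\<dots> \<le> (1 - c) * norm (x - y) + c * norm (x - y)"
      using c ne[OF r(1), of x y] by (auto intro!: add_mono mult_left_mono)
    finally show "norm (S x - S y) \<le> norm (x - y)" by (simp add: algebra_simps)
  qed
  show ?case
  proof (intro exI[of _ "T \<circ> S"] conjI allI impI)
    show "diff_contraction (T \<circ> S)" by (rule diff_contraction_comp[OF T S])
    fix \<phi> C assume \<phi>: "diff_contraction (\<phi> :: 'a \<Rightarrow> real) \<and> (\<forall>y. \<bar>\<phi> y\<bar> \<le> C)"
    have 1: "\<bar>(\<integral>p. (\<phi> \<circ> T) (fst p + r1 *\<^sub>R snd p - (r1 - r0) *\<^sub>R drift r0 (fst p + r1 *\<^sub>R snd p)) \<partial>P) - (\<integral>p. (\<phi> \<circ> T) (fst p + r0 *\<^sub>R snd p) \<partial>P)\<bar>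
     \<le> (5 / r0) * mean_noise * sqrt (r1\<^sup>2 - r0\<^sup>2) * (r1 - r0)"
      by (rule heat_flow_step[OF r(1,2) diff_contraction_comp _ lip]) (use \<phi> T in auto)
    have M: "0 \<le> mean_noise" unfolding mean_noise_def by simp
    have "r1\<^sup>2 - r0\<^sup>2 = (r1 + r0) * h" using r(3) by (simp add: power2_eq_square algebra_simps flip: r(3))
    also have "\<dots> \<le> 2 * h" using r h by (intro mult_right_mono) auto
    finally have sq: "r1\<^sup>2 - r0\<^sup>2 \<le> 2 * h" .
    have "(5 / r0) * mean_noise * sqrt (r1\<^sup>2 - r0\<^sup>2) * (r1 - r0) \<le> (5 / e) * mean_noise * sqrt (2 * h) * h"
      unfolding r(3) using r e M sq h by (intro mult_right_mono mult_mono divide_left_mono) auto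
    with 1 have 2: "\<bar>(\<integral>p. \<phi> (T (S (fst p + r1 *\<^sub>R snd p))) \<partial>P) - (\<integral>p. \<phi> (T (fst p + r0 *\<^sub>R snd p)) \<partial>P)\<bar> \<le> (5 / e) * mean_noise * sqrt (2 * h) * h"
      by (simp add: S_def)
    have 3: "\<bar>(\<integral>p. \<phi> (T (fst p + r0 *\<^sub>R snd p)) \<partial>P) - (\<integral>p. \<phi> (fst p + e *\<^sub>R snd p) \<partial>P)\<bar> \<le> real j * h * ((5 / e) * mean_noise * sqrt (2 * h))"
      using TT \<phi> by blast
    have "real (Suc j) * h * K = K * h + real j * h * K" for K by (simp add: algebra_simps)
    note this[of "(5 / e) * mean_noise * sqrt (2 * h)"]
    with 2 3 show "\<bar>(\<integral>p. \<phi> ((T \<circ> S) (fst p + (e + real (Suc j) * h) *\<^sub>R snd p)) \<partial>P) - (\<integral>p. \<phi> (fst p + e *\<^sub>R snd p) \<partial>P)\<bar>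
       \<le> real (Suc j) * h * ((5 / e) * mean_noise * sqrt (2 * h))"
      unfolding r1_def[symmetric] by (simp del: of_nat_Suc)
  qed
qed

text \<open>
  Run the chain from level one down to a small level \<open>e\<close>. The chain costs at most a multiple of \<open>\<surd>h / e\<close>, which is
  small once the step \<open>h\<close> is small compared to \<open>e\<^sup>2\<close>, and removing the remaining noise of size \<open>e\<close> costs \<open>e E|z|\<close>.
\<close>
lemma approximate_contraction:
  assumes ne: "\<And>r x y. 0 < r \<Longrightarrow> norm ((x - r *\<^sub>R drift r x) - (y - r *\<^sub>R drift r y)) \<le> norm (x - y)"
    and d: "0 < d"
  shows "\<exists>T. diff_contraction T \<and> (\<forall>(\<phi> :: 'a \<Rightarrow> real) C. diff_contraction \<phi> \<and> (\<forall>y. \<bar>\<phi> y\<bar> \<le> C) \<longrightarrow>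
     \<bar>(\<integral>p. \<phi> (T (fst p + snd p)) \<partial>P) - (\<integral>x. \<phi> x \<partial>\<mu>)\<bar> \<le> d)"
proof -
  have M: "0 \<le> mean_noise" unfolding mean_noise_def by simp
  define e where "e = min (1/2) (d / (2 * (mean_noise + 1)))"
  have e: "0 < e" "e \<le> 1/2" "e * mean_noise \<le> d / 2"
  proof -
    show "0 < e" using d M by (auto simp: e_def)
    show "e \<le> 1/2" unfolding e_def by (rule min.cobounded1)
    have "e * mean_noise \<le> (d / (2 * (mean_noise + 1))) * mean_noise" using M by (intro mult_right_mono) (auto simp: e_def)
    also have "\<dots> = (d / 2) * (mean_noise / (mean_noise + 1))" using M by (simp add: field_simps)
    also have "\<dots> \<le> (d / 2) * 1" using d M by (intro mult_left_mono) auto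
    finally show "e * mean_noise \<le> d / 2" by simp
  qed
  have "((\<lambda>n. (5 / e) * mean_noise * sqrt (2 * ((1 - e) / real (Suc n)))) \<longlonglongrightarrow> (5 / e) * mean_noise * sqrt (2 * 0))"
    by (intro tendsto_intros LIMSEQ_Suc[OF lim_const_over_n])
  then have ev1: "\<forall>\<^sub>F n in sequentially. (5 / e) * mean_noise * sqrt (2 * ((1 - e) / real (Suc n))) < d / 2"
    by (rule order_tendstoD(2)) (use d in auto)
  have "(\<lambda>n. (1 - e) / real (Suc n)) \<longlonglongrightarrow> 0" by (intro LIMSEQ_Suc[OF lim_const_over_n])
  then have ev2: "\<forall>\<^sub>F n in sequentially. (1 - e) / real (Suc n) < e"
    by (rule order_tendstoD(2)) (use e in auto)
  obtain n where n: "(5 / e) * mean_noise * sqrt (2 * ((1 - e) / real (Suc n))) < d / 2" "(1 - e) / real (Suc n) < e"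
    using eventually_conj[OF ev1 ev2] by (auto simp: eventually_sequentially simp del: of_nat_Suc)
  define h where "h = (1 - e) / real (Suc n)"
  have h: "0 < h" "h \<le> e" "real (Suc n) * h = 1 - e" using e n(2) by (auto simp: h_def)
  obtain T where T: "diff_contraction T" and TT: "\<And>\<phi> C. diff_contraction \<phi> \<Longrightarrow> (\<forall>y. \<bar>\<phi> y\<bar> \<le> C) \<Longrightarrow>
     \<bar>(\<integral>p. \<phi> (T (fst p + (e + real (Suc n) * h) *\<^sub>R snd p)) \<partial>P) - (\<integral>p. \<phi> (fst p + e *\<^sub>R snd p) \<partial>P)\<bar> \<le> real (Suc n) * h * ((5 / e) * mean_noise * sqrt (2 * h))"
    using reverse_heat_flow_chain[OF ne e(1) h(1,2), of "Suc n"] h(3) by auto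
  show ?thesis
  proof (intro exI[of _ T] conjI allI impI T)
    fix \<phi> C assume \<phi>: "diff_contraction (\<phi> :: 'a \<Rightarrow> real) \<and> (\<forall>y. \<bar>\<phi> y\<bar> \<le> C)"
    have [measurable]: "\<phi> \<in> borel_measurable borel" using \<phi> diff_contraction_measurable by blast
    have 1: "\<bar>(\<integral>p. \<phi> (T (fst p + snd p)) \<partial>P) - (\<integral>p. \<phi> (fst p + e *\<^sub>R snd p) \<partial>P)\<bar> \<le> (1 - e) * ((5 / e) * mean_noise * sqrt (2 * h))"
      using TT[of \<phi> C] \<phi> unfolding h(3) by simp
    also have "\<dots> \<le> 1 * ((5 / e) * mean_noise * sqrt (2 * h))" using e M h by (intro mult_right_mono) auto
    also have "\<dots> < d / 2" using n(1) by (simp add: h_def)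
    finally have A: "\<bar>(\<integral>p. \<phi> (T (fst p + snd p)) \<partial>P) - (\<integral>p. \<phi> (fst p + e *\<^sub>R snd p) \<partial>P)\<bar> < d / 2" .
    have i: "integrable P (\<lambda>p. \<phi> (fst p + e *\<^sub>R snd p))"
      by (rule P.integrable_const_bound[where B=C]) (use \<phi> in auto)
    have i': "integrable \<mu> \<phi>" by (rule integrable_const_bound[where B=C]) (use \<phi> in auto)
    have "\<bar>(\<integral>p. \<phi> (fst p + e *\<^sub>R snd p) \<partial>P) - (\<integral>p. \<phi> (fst p) \<partial>P)\<bar> = \<bar>\<integral>p. \<phi> (fst p + e *\<^sub>R snd p) - \<phi> (fst p) \<partial>P\<bar>"
      using i P.integrable_fst_comp(1)[OF i'] by (subst Bochner_Integration.integral_diff) auto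
    also have "\<dots> \<le> (\<integral>p. e * norm (snd p) \<partial>P)"
    proof (rule order_trans[OF integral_abs_bound integral_mono])
      show "integrable P (\<lambda>p. \<bar>\<phi> (fst p + e *\<^sub>R snd p) - \<phi> (fst p)\<bar>)" using i P.integrable_fst_comp(1)[OF i'] by auto
      show "integrable P (\<lambda>p. e * norm (snd p))" using integrable_noise_norm(1) by auto
      fix p :: "'a \<times> 'a"
      have "norm (\<phi> (fst p + e *\<^sub>R snd p) - \<phi> (fst p)) \<le> norm (fst p + e *\<^sub>R snd p - fst p)"
        using \<phi> unfolding diff_contraction_def by blast
      then show "\<bar>\<phi> (fst p + e *\<^sub>R snd p) - \<phi> (fst p)\<bar> \<le> e * norm (snd p)" using e by simp
    qed
    also have "\<dots> \<le> d / 2" using e by (simp add: integrable_noise_norm(2))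
    finally have "\<bar>(\<integral>p. \<phi> (fst p + e *\<^sub>R snd p) \<partial>P) - (\<integral>p. \<phi> (fst p) \<partial>P)\<bar> \<le> d / 2" .
    with A show "\<bar>(\<integral>p. \<phi> (T (fst p + snd p)) \<partial>P) - (\<integral>x. \<phi> x \<partial>\<mu>)\<bar> \<le> d"
      unfolding P.integrable_fst_comp(2)[OF i'] by linarith
  qed
qed

end

section \<open>The limiting transport map\<close>

text \<open>
  The indicator function of a closed set is the limit of the continuous functions \<open>max 0 (1 - k dist(x, C))\<close>, and closed sets generate the Borel sets.
\<close>
lemma measure_eqI_continuous:
  fixes M N :: "'a::metric_space measure"
  assumes "prob_space M" "prob_space N" and s[simp, measurable_cong]: "sets M = sets borel" "sets N = sets borel"
    and eq: "\<And>f. continuous_on UNIV f \<Longrightarrow> (\<And>x. 0 \<le> f x \<and> f x \<le> (1::real)) \<Longrightarrow> (\<integral>x. f x \<partial>M) = (\<integral>x. f x \<partial>N)"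
  shows "M = N"
proof (rule measure_eqI_generator_eq[where E="Collect closed" and \<Omega>=UNIV and A="\<lambda>_::nat. UNIV"])
  interpret M: prob_space M by fact
  interpret N: prob_space N by fact
  have lim: "(\<lambda>k. \<integral>x. max 0 (1 - real k * infdist x C) \<partial>L) \<longlonglongrightarrow> measure L C"
    if C: "closed C" "C \<noteq> {}" and L: "prob_space L" and sL[measurable_cong]: "sets L = sets borel" for C :: "'a set" and L
  proof -
    interpret L: prob_space L by fact
    have "(\<lambda>k. \<integral>x. max 0 (1 - real k * infdist x C) \<partial>L) \<longlonglongrightarrow> (\<integral>x. indicator C x \<partial>L)"
    proof (rule integral_dominated_convergence[where w="\<lambda>_. 1"])
      show "(\<lambda>x. indicat_real C x) \<in> borel_measurable L"
        using C by (intro borel_measurable_indicator) (simp add: sL)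
      show "(\<lambda>x. max 0 (1 - real k * infdist x C)) \<in> borel_measurable L" for k
      proof -
        have "(\<lambda>x. max 0 (1 - real k * infdist x C)) \<in> borel_measurable borel"
          by (intro borel_measurable_continuous_onI continuous_intros)
        then show ?thesis by measurable
      qed
      show "AE x in L. (\<lambda>k. max 0 (1 - real k * infdist x C)) \<longlonglongrightarrow> indicat_real C x"
      proof (rule AE_I2)
        fix x
        show "(\<lambda>k. max 0 (1 - real k * infdist x C)) \<longlonglongrightarrow> indicat_real C x"
        proof (cases "x \<in> C")
          case True then show ?thesis by simp
        next
          case False
          then have p: "0 < infdist x C" using C by (metis in_closed_iff_infdist_zero infdist_nonneg less_eq_real_def)
          obtain m where m: "1 < real m * infdist x C" using p reals_Archimedean3 by blast
          have "max 0 (1 - real k * infdist x C) = 0" if "m \<le> k" for k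
          proof -
            have "real m * infdist x C \<le> real k * infdist x C" using that p by (intro mult_right_mono) auto
            then show ?thesis using m by simp
          qed
          then have "\<forall>\<^sub>F k in sequentially. max 0 (1 - real k * infdist x C) = 0" unfolding eventually_sequentially by blast
          then show ?thesis using False by (simp add: tendsto_eventually)
        qed
      qed
      show "AE x in L. norm (max 0 (1 - real k * infdist x C)) \<le> 1" for k
        by (rule AE_I2) (auto simp: infdist_nonneg)
    qed simp
    then show ?thesis using C by (simp add: sets_eq_imp_space_eq[OF sL])
  qed
  show "emeasure M X = emeasure N X" if "X \<in> Collect closed" for X
  proof (cases "X = {}")
    case False
    have "(\<integral>x. max 0 (1 - real k * infdist x X) \<partial>M) = (\<integral>x. max 0 (1 - real k * infdist x X) \<partial>N)" for k
      by (rule eq) (auto intro!: continuous_intros simp: infdist_nonneg)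
    then have "(\<lambda>k. \<integral>x. max 0 (1 - real k * infdist x X) \<partial>M) \<longlonglongrightarrow> measure N X"
      using lim[of X N] that False assms(2) by simp
    then have "measure M X = measure N X"
      using lim[of X M] that False assms(1) LIMSEQ_unique by auto
    then show ?thesis by (simp add: M.emeasure_eq_measure N.emeasure_eq_measure)
  qed simp
  show "Int_stable (Collect closed)" by (auto simp: Int_stable_def)
  show "sets M = sigma_sets UNIV (Collect closed)" "sets N = sigma_sets UNIV (Collect closed)"
    by (auto simp: borel_eq_closed)
  show "emeasure M UNIV \<noteq> \<infinity>" by simp
qed auto

text \<open>
  The integrals of \<open>bell\<close> determine the density of \<open>x + r z\<close> for every \<open>r > 0\<close>, hence the integrals of \<open>f(x + r z)\<close>, and these tend to
  the integral of \<open>f\<close> as \<open>r\<close> tends to zero.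
\<close>
lemma measure_eqI_bell:
  fixes M N :: "'a::euclidean_space measure"
  assumes M: "noisy M" and N: "noisy N"
    and eq: "\<And>r a. 0 < r \<Longrightarrow> (\<integral>x. bell r (a - x) \<partial>M) = (\<integral>x. bell r (a - x) \<partial>N)"
  shows "M = N"
proof (rule measure_eqI_continuous)
  interpret M: noisy M by fact
  interpret N: noisy N by fact
  show "prob_space M" "prob_space N" "sets M = sets borel" "sets N = sets borel"
    by (auto intro: M.prob_space_axioms N.prob_space_axioms)
  fix f :: "'a \<Rightarrow> real" assume f: "continuous_on UNIV f" and b: "\<And>x. 0 \<le> f x \<and> f x \<le> 1"
  have fm[measurable]: "f \<in> borel_measurable borel" by (rule borel_measurable_continuous_onI[OF f])
  have sm: "(\<integral>p. f (fst p + r *\<^sub>R snd p) \<partial>(L \<Otimes>\<^sub>M gauss_measure)) = (\<integral>y. (1 / (sqrt (2 * pi) * r)) ^ DIM('a) * (\<integral>x. bell r (y - x) \<partial>L) * f y \<partial>lborel)"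
    if L: "noisy L" and r: "0 < r" for L :: "'a measure" and r
  proof -
    interpret L: noisy L by fact
    have i: "integrable L.P (\<lambda>p. f (fst p + r *\<^sub>R snd p))"
      by (rule L.P.integrable_const_bound[where B=1]) (auto simp: b)
    have "(\<integral>p. f (fst p + r *\<^sub>R snd p) \<partial>L.P) = (\<integral>q. gauss r (snd q - fst q) *\<^sub>R f (snd q) \<partial>(L \<Otimes>\<^sub>M lborel))"
      using L.integral_noise(1)[OF r, of "\<lambda>q. f (snd q)"] by simp
    also have "\<dots> = (\<integral>y. \<integral>x. gauss r (y - x) *\<^sub>R f y \<partial>L \<partial>lborel)"
      using L.integral_noise(2)[OF r, of "\<lambda>q. f (snd q)"] i by (subst L.PL.integral_snd) (auto simp: case_prod_beta')
    also have "\<dots> = (\<integral>y. (1 / (sqrt (2 * pi) * r)) ^ DIM('a) * (\<integral>x. bell r (y - x) \<partial>L) * f y \<partial>lborel)"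
      using L.gauss_mass(1,3)[OF r] by (simp add: L.mass_def)
    finally show ?thesis .
  qed
  have lim: "(\<lambda>n. \<integral>p. f (fst p + (1 / real (Suc n)) *\<^sub>R snd p) \<partial>(L \<Otimes>\<^sub>M gauss_measure)) \<longlonglongrightarrow> (\<integral>x. f x \<partial>L)"
    if L: "noisy L" for L :: "'a measure"
  proof -
    interpret L: noisy L by fact
    have "(\<lambda>n. \<integral>p. f (fst p + (1 / real (Suc n)) *\<^sub>R snd p) \<partial>L.P) \<longlonglongrightarrow> (\<integral>p. f (fst p) \<partial>L.P)"
    proof (rule integral_dominated_convergence[where w="\<lambda>_. 1"])
      show "AE p in L.P. (\<lambda>n. f (fst p + (1 / real (Suc n)) *\<^sub>R snd p)) \<longlonglongrightarrow> f (fst p)"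
      proof (rule AE_I2)
        fix p :: "'a \<times> 'a"
        have "(\<lambda>n. 1 / real (Suc n)) \<longlonglongrightarrow> 0"
          using LIMSEQ_inverse_real_of_nat by (simp add: inverse_eq_divide del: of_nat_Suc)
        then have "(\<lambda>n. fst p + (1 / real (Suc n)) *\<^sub>R snd p) \<longlonglongrightarrow> fst p + 0 *\<^sub>R snd p" by (intro tendsto_intros)
        then show "(\<lambda>n. f (fst p + (1 / real (Suc n)) *\<^sub>R snd p)) \<longlonglongrightarrow> f (fst p)"
          using f by (auto intro!: continuous_on_tendsto_compose[OF f])
      qed
    qed (auto simp: b)
    also have "(\<integral>p. f (fst p) \<partial>L.P) = (\<integral>x. f x \<partial>L)"
      by (rule L.P.integrable_fst_comp(2)) (rule L.integrable_const_bound[where B=1], auto simp: b)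
    finally show ?thesis .
  qed
  have "(\<integral>p. f (fst p + (1 / real (Suc n)) *\<^sub>R snd p) \<partial>(M \<Otimes>\<^sub>M gauss_measure)) = (\<integral>p. f (fst p + (1 / real (Suc n)) *\<^sub>R snd p) \<partial>(N \<Otimes>\<^sub>M gauss_measure))" for n
    by (subst (1 2) sm) (auto simp: M N eq simp del: of_nat_Suc)
  then show "(\<integral>x. f x \<partial>M) = (\<integral>x. f x \<partial>N)"
    using lim[OF M] lim[OF N] LIMSEQ_unique by simp
qed

text \<open>
  A form of the Arzela-Ascoli theorem: a diagonal subsequence converges on a countable dense set, and the common Lipschitz constant carries
  the convergence over to all points.
\<close>
lemma nonexpansive_subsequence:
  fixes T :: "nat \<Rightarrow> 'a::euclidean_space \<Rightarrow> 'b::euclidean_space"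
  assumes ne: "\<And>n x y. norm (T n x - T n y) \<le> norm (x - y)" and bd: "\<And>n. norm (T n 0) \<le> K"
  shows "\<exists>s T'. strict_mono s \<and> (\<forall>x. (\<lambda>n. T (s n) x) \<longlonglongrightarrow> T' x)"
proof -
  obtain D :: "'a set" where D: "countable D" "\<And>S. open S \<Longrightarrow> S \<noteq> {} \<Longrightarrow> \<exists>d\<in>D. d \<in> S"
    using countable_dense_exists by blast
  then have Dne: "D \<noteq> {}" by blast
  define q where "q = from_nat_into D"
  have q: "range q = D" unfolding q_def by (rule range_from_nat_into[OF Dne D(1)])
  have nT: "norm (T n x) \<le> K + norm x" for n x
    using norm_triangle_ineq4[of "T n x - T n 0" "- T n 0"] ne[of n x 0] bd[of n] by simp
  interpret subseqs "\<lambda>i s. convergent (\<lambda>n. T (s n) (q i))"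
  proof unfold_locales
    fix i and s :: "nat \<Rightarrow> nat" assume "strict_mono s"
    have "bounded (range (\<lambda>n. T (s n) (q i)))" using nT by (auto simp: bounded_iff intro!: exI[of _ "K + norm (q i)"])
    from bounded_imp_convergent_subsequence[OF this] obtain l r where "strict_mono r" "((\<lambda>n. T (s n) (q i)) \<circ> r) \<longlonglongrightarrow> l" by blast
    then show "\<exists>r. strict_mono r \<and> convergent (\<lambda>n. T ((s \<circ> r) n) (q i))" by (auto simp: convergent_def o_def)
  qed
  have "convergent (\<lambda>n. T (diagseq n) (q i))" for i
  proof -
    have "convergent (\<lambda>n. T ((diagseq \<circ> (+) (Suc i)) n) (q i))"
    proof (rule diagseq_holds)
      fix x s r assume "strict_mono (r :: nat \<Rightarrow> nat)" "convergent (\<lambda>n. T (s n) (q x))"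
      then show "convergent (\<lambda>n. T ((s \<circ> r) n) (q x))"
        using convergent_subseq_convergent[of "\<lambda>n. T (s n) (q x)" r] by (simp add: o_def)
    qed
    then obtain l where "(\<lambda>n. T (diagseq (n + Suc i)) (q i)) \<longlonglongrightarrow> l" by (auto simp: convergent_def o_def add.commute)
    then have "(\<lambda>n. T (diagseq n) (q i)) \<longlonglongrightarrow> l" by (rule LIMSEQ_offset)
    then show ?thesis by (auto simp: convergent_def)
  qed
  then have cD: "Cauchy (\<lambda>n. T (diagseq n) d)" if "d \<in> D" for d using that q Cauchy_convergent_iff by blast
  have "Cauchy (\<lambda>n. T (diagseq n) x)" for x
    unfolding Cauchy_def
  proof (intro allI impI)
    fix e :: real assume e: "0 < e"
    obtain d where d: "d \<in> D" "d \<in> ball x (e/3)" using D(2)[of "ball x (e/3)"] e by auto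
    obtain M where M: "\<And>m n. m \<ge> M \<Longrightarrow> n \<ge> M \<Longrightarrow> dist (T (diagseq m) d) (T (diagseq n) d) < e / 3"
      using metric_CauchyD[OF cD[OF d(1)], of "e/3"] e by auto
    have nd: "dist (T n x) (T n d) < e / 3" for n
      using ne[of n x d] d(2) by (simp add: dist_norm)
    show "\<exists>M. \<forall>m\<ge>M. \<forall>n\<ge>M. dist (T (diagseq m) x) (T (diagseq n) x) < e"
    proof (intro exI[of _ M] allI impI)
      fix m n assume "M \<le> m" "M \<le> n"
      then show "dist (T (diagseq m) x) (T (diagseq n) x) < e"
        using M[of m n] nd[of "diagseq m"] nd[of "diagseq n"]
          dist_triangle[of "T (diagseq m) x" "T (diagseq n) x" "T (diagseq m) d"]
          dist_triangle[of "T (diagseq m) d" "T (diagseq n) x" "T (diagseq n) d"]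
        by (simp add: dist_commute)
    qed
  qed
  then have "\<forall>x. (\<lambda>n. T (diagseq n) x) \<longlonglongrightarrow> lim (\<lambda>n. T (diagseq n) x)"
    by (simp add: convergent_LIMSEQ_iff Cauchy_convergent_iff)
  then show ?thesis
    by (intro exI[of _ diagseq] exI[of _ "\<lambda>x. lim (\<lambda>n. T (diagseq n) x)"] conjI subseq_diagseq)
qed

context noisy begin

text \<open>
  The maps \<open>U n\<close> carry the law of \<open>x + z\<close> to \<open>\<mu>\<close> with error \<open>1/(n + 1)\<close>. Their values at the origin are bounded: along a subsequence
  escaping to infinity the whole image would escape, since distances do not grow, while \<open>bell\<close> integrates to a positive number
  under \<open>\<mu>\<close>. So a subsequence converges pointwise, and its limit \<open>T\<close> transports the law of \<open>x + z\<close> to \<open>\<mu>\<close>. The approximating maps are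
  part of the conclusion because they are differentiable everywhere, whereas \<open>T\<close> is only Lipschitz.
\<close>
theorem reverse_heat_flow_map:
  assumes ne: "\<And>r x y. 0 < r \<Longrightarrow> norm ((x - r *\<^sub>R drift r x) - (y - r *\<^sub>R drift r y)) \<le> norm (x - y)"
  obtains T S where "\<And>n. diff_contraction (S n :: 'a \<Rightarrow> 'a)" "\<And>x. (\<lambda>n. S n x) \<longlonglongrightarrow> T x"
    "\<And>x y. norm (T x - T y) \<le> norm (x - y)" "distr P borel (\<lambda>p. T (fst p + snd p)) = \<mu>"
proof -
  have "\<forall>n. \<exists>T. diff_contraction T \<and> (\<forall>(\<phi> :: 'a \<Rightarrow> real) C. diff_contraction \<phi> \<and> (\<forall>y. \<bar>\<phi> y\<bar> \<le> C) \<longrightarrow>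
     \<bar>(\<integral>p. \<phi> (T (fst p + snd p)) \<partial>P) - (\<integral>x. \<phi> x \<partial>\<mu>)\<bar> \<le> 1 / real (Suc n))"
    using approximate_contraction[OF ne] by simp
  then obtain U where U: "\<And>n. diff_contraction (U n)" and UU: "\<And>n (\<phi> :: 'a \<Rightarrow> real) C. diff_contraction \<phi> \<Longrightarrow> (\<And>y. \<bar>\<phi> y\<bar> \<le> C) \<Longrightarrow>
     \<bar>(\<integral>p. \<phi> (U n (fst p + snd p)) \<partial>P) - (\<integral>x. \<phi> x \<partial>\<mu>)\<bar> \<le> 1 / real (Suc n)"
    by metis
  have Um[measurable]: "U n \<in> borel_measurable borel" for n using U by (rule diff_contraction_measurable)
  have Une: "norm (U n x - U n y) \<le> norm (x - y)" for n x y using U unfolding diff_contraction_def by blast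
  have inv0: "(\<lambda>n. 1 / real (Suc n)) \<longlonglongrightarrow> 0"
    using LIMSEQ_inverse_real_of_nat by (simp add: inverse_eq_divide del: of_nat_Suc)
  have conv: "(\<lambda>n. \<integral>p. bell r (a - U (s n) (fst p + snd p)) \<partial>P) \<longlonglongrightarrow> (\<integral>x. bell r (a - x) \<partial>\<mu>)"
    if r: "0 < r" and s: "\<And>n. n \<le> s n" for r a s
  proof -
    obtain B where B: "\<And>z h. norm (bell r (z + h) - bell r (z::'a)) \<le> B * norm h" using bell_lipschitz[OF r] by blast
    \<comment> \<open>scales \<open>bell\<close> down to Lipschitz constant one\<close>
    define c where "c = 1 / (\<bar>B\<bar> + 1)"
    have c: "0 < c" "c * B \<le> 1" by (auto simp: c_def divide_simps)
    define \<phi> where "\<phi> = (\<lambda>x. c * bell r (a - x))"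
    have \<phi>: "diff_contraction \<phi>" unfolding diff_contraction_def
    proof (intro conjI allI)
      fix y
      have "bell r differentiable (at (a - y))" using bell_has_derivative[OF r] unfolding differentiable_def by blast
      moreover have "(\<lambda>x. a - x) differentiable (at y)" by (intro differentiable_diff differentiable_const differentiable_ident)
      ultimately have "(bell r \<circ> (\<lambda>x. a - x)) differentiable (at y)" by (intro differentiable_chain_at)
      then show "\<phi> differentiable (at y)" unfolding \<phi>_def o_def by (intro differentiable_mult differentiable_const)
    next
      fix x y
      have "norm (\<phi> x - \<phi> y) = c * \<bar>bell r ((a - y) + (y - x)) - bell r (a - y)\<bar>"
        using c by (simp add: \<phi>_def abs_mult flip: right_diff_distrib)
      also have "\<dots> \<le> c * (B * norm (y - x))" using B[of "a - y" "y - x"] c by (intro mult_left_mono) auto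
      also have "\<dots> = (c * B) * norm (x - y)" by (simp add: norm_minus_commute)
      also have "\<dots> \<le> 1 * norm (x - y)" using c by (intro mult_right_mono) auto
      finally show "norm (\<phi> x - \<phi> y) \<le> norm (x - y)" by simp
    qed
    have \<phi>b: "\<bar>\<phi> y\<bar> \<le> c" for y using c bell_le_1[of r "a - y"] bell_pos[of r "a - y"] by (simp add: \<phi>_def abs_mult)
    have "(\<lambda>n. (\<integral>p. \<phi> (U (s n) (fst p + snd p)) \<partial>P) - (\<integral>x. \<phi> x \<partial>\<mu>)) \<longlonglongrightarrow> 0"
    proof (rule Lim_null_comparison[OF _ inv0], intro always_eventually allI)
      fix n
      have "1 / real (Suc (s n)) \<le> 1 / real (Suc n)" using s[of n] by (simp add: frac_le)
      then show "norm ((\<integral>p. \<phi> (U (s n) (fst p + snd p)) \<partial>P) - (\<integral>x. \<phi> x \<partial>\<mu>)) \<le> 1 / real (Suc n)"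
        using UU[OF \<phi> \<phi>b, of "s n"] by (simp del: of_nat_Suc)
    qed
    then have "(\<lambda>n. \<integral>p. \<phi> (U (s n) (fst p + snd p)) \<partial>P) \<longlonglongrightarrow> (\<integral>x. \<phi> x \<partial>\<mu>)" by (simp add: LIM_zero_iff)
    then have "(\<lambda>n. (1 / c) * (\<integral>p. \<phi> (U (s n) (fst p + snd p)) \<partial>P)) \<longlonglongrightarrow> (1 / c) * (\<integral>x. \<phi> x \<partial>\<mu>)" by (intro tendsto_intros)
    then show ?thesis using c by (simp add: \<phi>_def)
  qed
  have "\<exists>K. \<forall>n. norm (U n 0) \<le> K"
  proof (rule ccontr)
    assume nb: "\<not> (\<exists>K. \<forall>n. norm (U n 0) \<le> K)"
    have "\<exists>n\<ge>k. real k < norm (U n 0)" for k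
    proof (rule ccontr)
      assume "\<not> (\<exists>n\<ge>k. real k < norm (U n 0))"
      then have "norm (U n 0) \<le> max (real k) (Max ((\<lambda>n. norm (U n 0)) ` {..k}))" for n
        by (cases "k \<le> n") (auto simp: not_less le_max_iff_disj intro!: disjI2 Max_ge)
      then show False using nb by blast
    qed
    then obtain s where s: "\<And>k. k \<le> s k" "\<And>k. real k < norm (U (s k) 0)" by metis
    have "(\<lambda>n. \<integral>p. bell 1 (0 - U (s n) (fst p + snd p)) \<partial>P) \<longlonglongrightarrow> (\<integral>p. 0 \<partial>P)"
    proof (rule integral_dominated_convergence[where w="\<lambda>_. 1"])
      show "AE p in P. (\<lambda>n. bell 1 (0 - U (s n) (fst p + snd p))) \<longlonglongrightarrow> 0"
      proof (rule AE_I2)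
        fix p
        have big: "filterlim (\<lambda>n. norm (U (s n) (fst p + snd p))) at_top sequentially"
        proof (rule filterlim_at_top_mono)
          show "filterlim (\<lambda>n. - norm (fst p + snd p) + real n) at_top sequentially"
            by (rule filterlim_tendsto_add_at_top[OF tendsto_const filterlim_real_sequentially])
          show "\<forall>\<^sub>F n in sequentially. - norm (fst p + snd p) + real n \<le> norm (U (s n) (fst p + snd p))"
          proof (intro always_eventually allI)
            fix n
            have "norm (U (s n) 0) - norm (U (s n) (fst p + snd p)) \<le> norm (U (s n) 0 - U (s n) (fst p + snd p))" by (rule norm_triangle_ineq2)
            also have "\<dots> \<le> norm (fst p + snd p)" using Une[of "s n" 0 "fst p + snd p"] unfolding diff_0 norm_minus_cancel .
            finally show "- norm (fst p + snd p) + real n \<le> norm (U (s n) (fst p + snd p))" using s(2)[of n] by simp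
          qed
        qed
        have "(\<lambda>n. 2 * inverse (norm (U (s n) (fst p + snd p)))) \<longlonglongrightarrow> 2 * 0"
          by (intro tendsto_mult tendsto_const tendsto_inverse_0_at_top big)
        then have z: "(\<lambda>n. 2 * inverse (norm (U (s n) (fst p + snd p)))) \<longlonglongrightarrow> 0" by simp
        show "(\<lambda>n. bell 1 (0 - U (s n) (fst p + snd p))) \<longlonglongrightarrow> 0"
        proof (rule Lim_null_comparison[OF _ z])
          have "bell 1 (0 - u) \<le> 2 * inverse (norm u)" if "1 \<le> norm u" for u :: 'a
          proof -
            have "bell 1 (0 - u) * norm u \<le> bell 1 (0 - u) * (norm (0 - u))\<^sup>2"
            proof (intro mult_left_mono)
              have "norm u * 1 \<le> norm u * norm u" using that by (intro mult_left_mono) auto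
              then show "norm u \<le> (norm (0 - u))\<^sup>2" by (simp add: power2_eq_square)
            qed (simp add: less_imp_le[OF bell_pos])
            also have "\<dots> \<le> 2" using bell_norm_sq_le[of 1 "0 - u"] by simp
            finally show ?thesis using that by (subst (asm) pos_le_divide_eq[symmetric]) (auto simp: divide_inverse)
          qed
          moreover have "\<forall>\<^sub>F n in sequentially. 1 \<le> norm (U (s n) (fst p + snd p))"
            using big by (simp add: filterlim_at_top)
          ultimately show "\<forall>\<^sub>F n in sequentially. norm (bell 1 (0 - U (s n) (fst p + snd p))) \<le> 2 * inverse (norm (U (s n) (fst p + snd p)))"
            by (auto elim!: eventually_mono simp: less_imp_le[OF bell_pos])
        qed
      qed
    qed (auto simp: bell_le_1 less_imp_le[OF bell_pos])
    then have "(\<integral>x. bell 1 (0 - x) \<partial>\<mu>) = 0" using conv[of 1 s 0] s(1) LIMSEQ_unique by fastforce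
    then show False using mass_pos[of 1 0] by (simp add: mass_def)
  qed
  then obtain K where K: "\<And>n. norm (U n 0) \<le> K" by blast
  obtain s T where s: "strict_mono s" and T: "\<And>x. (\<lambda>n. U (s n) x) \<longlonglongrightarrow> T x"
    using nonexpansive_subsequence[of U, OF Une K] by blast
  have Tne: "norm (T x - T y) \<le> norm (x - y)" for x y
    by (rule LIMSEQ_le_const2[OF tendsto_norm[OF tendsto_diff[OF T T]]]) (auto simp: Une)
  have Tm[measurable]: "T \<in> borel_measurable borel" by (rule borel_measurable_LIMSEQ_metric[OF _ T]) simp
  let ?N = "distr P borel (\<lambda>p. T (fst p + snd p))"
  have N: "noisy ?N" unfolding noisy_def noisy_axioms_def by (auto intro!: P.prob_space_distr)
  have "?N = \<mu>"
  proof (rule measure_eqI_bell[OF N])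
    show "noisy \<mu>" by unfold_locales
    fix r :: real and a :: 'a assume r: "0 < r"
    have "(\<lambda>n. \<integral>p. bell r (a - U (s n) (fst p + snd p)) \<partial>P) \<longlonglongrightarrow> (\<integral>p. bell r (a - T (fst p + snd p)) \<partial>P)"
    proof (rule integral_dominated_convergence[where w="\<lambda>_. 1"])
      show "AE p in P. (\<lambda>n. bell r (a - U (s n) (fst p + snd p))) \<longlonglongrightarrow> bell r (a - T (fst p + snd p))"
      proof (rule AE_I2)
        fix p
        have "isCont (bell r) z" for z :: 'a using bell_has_derivative[OF r] by (rule has_derivative_continuous)
        then show "(\<lambda>n. bell r (a - U (s n) (fst p + snd p))) \<longlonglongrightarrow> bell r (a - T (fst p + snd p))"
          by (rule isCont_tendsto_compose) (intro tendsto_intros T)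
      qed
    qed (auto simp: bell_le_1 less_imp_le[OF bell_pos])
    then have "(\<integral>p. bell r (a - T (fst p + snd p)) \<partial>P) = (\<integral>x. bell r (a - x) \<partial>\<mu>)"
      using conv[OF r, of s a] strict_mono_imp_increasing[OF s] LIMSEQ_unique by blast
    then show "(\<integral>x. bell r (a - x) \<partial>?N) = (\<integral>x. bell r (a - x) \<partial>\<mu>)" by (subst integral_distr) auto
  qed
  then show thesis using that[of "\<lambda>n. U (s n)" T] U T Tne by blast
qed

end

section \<open>Poincare constants under maps that do not increase distances\<close>

definition lip_quot :: "('a::metric_space \<Rightarrow> real) \<Rightarrow> 'a \<Rightarrow> 'a \<Rightarrow> ennreal" where
  "lip_quot f x y = ennreal (\<bar>f y - f x\<bar> / dist y x)"

lemma frechet_derivative_eq_gradient: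
  fixes f :: "real ^ 'n \<Rightarrow> real"
  assumes "f differentiable (at x)"
  shows "frechet_derivative f (at x) h = gradient f x \<bullet> h"
proof -
  have lin: "linear (frechet_derivative f (at x))"
    using assms frechet_derivative_works has_derivative_linear by blast
  have "frechet_derivative f (at x) h = frechet_derivative f (at x) (\<Sum>i\<in>UNIV. h $ i *\<^sub>R axis i 1)"
    by (simp add: basis_expansion flip: scalar_mult_eq_scaleR)
  also have "\<dots> = (\<Sum>i\<in>UNIV. h $ i * frechet_derivative f (at x) (axis i 1))"
    by (simp add: linear_sum[OF lin] linear_scale[OF lin])
  also have "\<dots> = gradient f x \<bullet> h"
    by (simp add: inner_vec_def gradient_def partial_def mult.commute)
  finally show ?thesis .
qed

lemma has_derivative_gradient:
  fixes f :: "real ^ 'n \<Rightarrow> real"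
  assumes "f differentiable (at x)"
  shows "(f has_derivative (\<lambda>h. gradient f x \<bullet> h)) (at x)"
  using assms frechet_derivative_works frechet_derivative_eq_gradient[OF assms] by (metis (no_types, lifting) ext)

lemma gradient_unique:
  fixes f :: "real ^ 'n \<Rightarrow> real"
  assumes "(f has_derivative (\<lambda>h. g \<bullet> h)) (at x)"
  shows "gradient f x = g"
proof -
  have "(\<lambda>h. gradient f x \<bullet> h) = (\<lambda>h. g \<bullet> h)"
    using has_derivative_unique[OF has_derivative_gradient assms] assms differentiableI by blast
  then have "\<And>h. (gradient f x - g) \<bullet> h = 0" by (simp add: inner_diff_left fun_eq_iff)
  then have "(gradient f x - g) \<bullet> (gradient f x - g) = 0" by blast
  then show ?thesis by simp
qed

text \<open>
  At a point of differentiability the gradient direction realises the upper limit of the difference quotients, so the two cases of the definition of \<open>grad_norm\<close>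
  coincide. The uniform description is what behaves well under composition.
\<close>
lemma grad_norm_eq_Limsup:
  fixes f :: "real ^ 'n \<Rightarrow> real"
  shows "grad_norm f x = Limsup (at x) (lip_quot f x)"
proof (cases "f differentiable (at x)")
  case False then show ?thesis by (simp add: grad_norm_def lip_quot_def[abs_def])
next
  case True
  define g where "g = gradient f x"
  have D: "(f has_derivative (\<lambda>h. g \<bullet> h)) (at x)" using has_derivative_gradient[OF True] by (simp add: g_def)
  have "ennreal (norm g) = Limsup (at x) (lip_quot f x)"
  proof (rule antisym)
    show "Limsup (at x) (lip_quot f x) \<le> ennreal (norm g)"
    proof (rule ennreal_le_epsilon)
      fix e :: real assume e: "0 < e"
      have "((\<lambda>y. norm (f y - f x - g \<bullet> (y - x)) / norm (y - x)) \<longlongrightarrow> 0) (at x)"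
        using D unfolding has_derivative_iff_norm by blast
      then have "\<forall>\<^sub>F y in at x. norm (f y - f x - g \<bullet> (y - x)) / norm (y - x) < e"
        by (rule order_tendstoD) (rule e)
      then have "\<forall>\<^sub>F y in at x. lip_quot f x y \<le> ennreal (norm g) + ennreal e"
        unfolding eventually_at_filter
      proof (rule eventually_mono, intro impI)
        fix y assume a: "y \<noteq> x \<longrightarrow> y \<in> UNIV \<longrightarrow> norm (f y - f x - g \<bullet> (y - x)) / norm (y - x) < e" and n: "y \<noteq> x"
        then have "norm (f y - f x - g \<bullet> (y - x)) < e * norm (y - x)" by (simp add: divide_less_eq)
        moreover have "\<bar>g \<bullet> (y - x)\<bar> \<le> norm g * norm (y - x)" by (rule Cauchy_Schwarz_ineq2)
        ultimately have "\<bar>f y - f x\<bar> \<le> (norm g + e) * norm (y - x)" by (simp add: distrib_right)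
        then have "\<bar>f y - f x\<bar> / dist y x \<le> norm g + e" using n by (simp add: dist_norm divide_le_eq)
        then have "lip_quot f x y \<le> ennreal (norm g + e)"
          unfolding lip_quot_def by (rule ennreal_leI)
        then show "lip_quot f x y \<le> ennreal (norm g) + ennreal e" using e by simp
      qed
      then show "Limsup (at x) (lip_quot f x) \<le> ennreal (norm g) + ennreal e" by (rule Limsup_bounded)
    qed
    show "ennreal (norm g) \<le> Limsup (at x) (lip_quot f x)"
    proof (cases "g = 0")
      case True then show ?thesis by simp
    next
      case False
      have "((\<lambda>t. (f (x + t *\<^sub>R g) - f x) /\<^sub>R t) \<longlongrightarrow> g \<bullet> g) (at 0)" by (rule directional_derivative_tendsto[OF D])
      then have "((\<lambda>t. ennreal (\<bar>(f (x + t *\<^sub>R g) - f x) /\<^sub>R t\<bar> / norm g)) \<longlongrightarrow> ennreal (\<bar>g \<bullet> g\<bar> / norm g)) (at 0)"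
        using False by (intro tendsto_intros) auto
      moreover have "\<bar>g \<bullet> g\<bar> / norm g = norm g" by (simp add: power2_norm_eq_inner[symmetric] power2_eq_square)
      ultimately have lim: "((\<lambda>t. ennreal (\<bar>(f (x + t *\<^sub>R g) - f x) /\<^sub>R t\<bar> / norm g)) \<longlongrightarrow> ennreal (norm g)) (at 0)" by simp
      have fl: "filterlim (\<lambda>t. x + t *\<^sub>R g) (at x) (at 0)"
      proof -
        have "((\<lambda>t. x + t *\<^sub>R g) \<longlongrightarrow> x + 0 *\<^sub>R g) (at 0)" by (intro tendsto_intros)
        then show ?thesis using False by (auto simp: filterlim_at eventually_at_filter)
      qed
      show ?thesis unfolding Limsup_def
      proof (rule INF_greatest)
        fix Q assume "Q \<in> {Q. eventually Q (at x)}"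
        then have ev: "\<forall>\<^sub>F t in at 0. Q (x + t *\<^sub>R g)" using fl by (simp add: filterlim_iff)
        have "\<forall>\<^sub>F t in at 0. ennreal (\<bar>(f (x + t *\<^sub>R g) - f x) /\<^sub>R t\<bar> / norm g) \<le> Sup (lip_quot f x ` Collect Q)"
          using ev unfolding eventually_at_filter
        proof (rule eventually_mono, intro impI)
          fix t :: real assume "t \<noteq> 0 \<longrightarrow> t \<in> UNIV \<longrightarrow> Q (x + t *\<^sub>R g)" and t: "t \<noteq> 0"
          then have q: "Q (x + t *\<^sub>R g)" by simp
          have "ennreal (\<bar>(f (x + t *\<^sub>R g) - f x) /\<^sub>R t\<bar> / norm g) = lip_quot f x (x + t *\<^sub>R g)"
            unfolding lip_quot_def using t by (simp add: dist_norm abs_mult divide_inverse mult_ac)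
          also have "\<dots> \<le> Sup (lip_quot f x ` Collect Q)" using q by (intro Sup_upper) auto
          finally show "ennreal (\<bar>(f (x + t *\<^sub>R g) - f x) /\<^sub>R t\<bar> / norm g) \<le> Sup (lip_quot f x ` Collect Q)" .
        qed
        then show "ennreal (norm g) \<le> Sup (lip_quot f x ` Collect Q)"
          by (intro tendsto_upperbound[OF lim]) auto
      qed
    qed
  qed
  then show ?thesis using True by (simp add: grad_norm_def g_def)
qed

text \<open>
  Writing the punctured neighbourhoods of \<open>x\<close> as \<open>x + v\<close> with \<open>v\<close> in a set that does not depend on \<open>x\<close> makes the measurability in \<open>x\<close>
  visible.
\<close>
lemma Limsup_at_eq_INF:
  fixes u :: "'a::real_normed_vector \<Rightarrow> ennreal"
  shows "Limsup (at x) u = (INF n. SUP v\<in>{v::'a. v \<noteq> 0 \<and> norm v < 1 / real (Suc n)}. u (x + v))"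
proof (rule antisym)
  show "Limsup (at x) u \<le> (INF n. SUP v\<in>{v::'a. v \<noteq> 0 \<and> norm v < 1 / real (Suc n)}. u (x + v))"
  proof (rule INF_greatest)
    fix n :: nat
    have "\<forall>\<^sub>F y in at x. u y \<le> (SUP v\<in>{v::'a. v \<noteq> 0 \<and> norm v < 1 / real (Suc n)}. u (x + v))"
      unfolding eventually_at
    proof (intro exI[of _ "1 / real (Suc n)"] conjI ballI impI)
      fix y assume "y \<noteq> x \<and> dist y x < 1 / real (Suc n)"
      then have "u (x + (y - x)) \<le> (SUP v\<in>{v::'a. v \<noteq> 0 \<and> norm v < 1 / real (Suc n)}. u (x + v))"
        by (intro SUP_upper) (auto simp: dist_norm)
      then show "u y \<le> (SUP v\<in>{v::'a. v \<noteq> 0 \<and> norm v < 1 / real (Suc n)}. u (x + v))" by simp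
    qed simp
    then show "Limsup (at x) u \<le> (SUP v\<in>{v::'a. v \<noteq> 0 \<and> norm v < 1 / real (Suc n)}. u (x + v))" by (rule Limsup_bounded)
  qed
  show "(INF n. SUP v\<in>{v::'a. v \<noteq> 0 \<and> norm v < 1 / real (Suc n)}. u (x + v)) \<le> Limsup (at x) u"
    unfolding Limsup_def
  proof (rule INF_greatest)
    fix Q assume "Q \<in> {Q. eventually Q (at x)}"
    then obtain d where d: "0 < d" "\<And>y. y \<noteq> x \<Longrightarrow> dist y x < d \<Longrightarrow> Q y" unfolding eventually_at by auto
    obtain n where n: "1 / real (Suc n) < d" using d(1) nat_approx_posE by blast
    have "(SUP v\<in>{v::'a. v \<noteq> 0 \<and> norm v < 1 / real (Suc n)}. u (x + v)) \<le> Sup (u ` Collect Q)"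
    proof (rule SUP_least)
      fix v assume "v \<in> {v::'a. v \<noteq> 0 \<and> norm v < 1 / real (Suc n)}"
      then have "Q (x + v)" using n d(2)[of "x + v"] by (simp add: dist_norm)
      then show "u (x + v) \<le> Sup (u ` Collect Q)" by (intro Sup_upper) auto
    qed
    then show "(INF n. SUP v\<in>{v::'a. v \<noteq> 0 \<and> norm v < 1 / real (Suc n)}. u (x + v)) \<le> Sup (u ` Collect Q)"
      by (rule INF_lower2[OF UNIV_I])
  qed
qed

text \<open>
  For fixed \<open>n\<close> the supremum over small \<open>v\<close> is a supremum of continuous functions of \<open>x\<close>, hence lower semicontinuous; this deals with the
  uncountable family of \<open>v\<close>.
\<close>
lemma grad_norm_measurable:
  fixes f :: "real ^ 'n \<Rightarrow> real"
  assumes f: "continuous_on UNIV f"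
  shows "grad_norm f \<in> borel_measurable borel"
proof -
  let ?V = "\<lambda>n. {v :: real ^ 'n. v \<noteq> 0 \<and> norm v < 1 / real (Suc n)}"
  have "(\<lambda>x. SUP v\<in>?V n. lip_quot f x (x + v)) \<in> borel_measurable borel" for n
  proof (rule borel_measurableI_greater)
    fix c
    have "{x \<in> space borel. c < (SUP v\<in>?V n. lip_quot f x (x + v))} = (\<Union>v\<in>?V n. {x. c < lip_quot f x (x + v)})"
      by (auto simp: less_SUP_iff)
    moreover have "open {x. c < lip_quot f x (x + v)}" if "v \<in> ?V n" for v
    proof -
      have e: "lip_quot f x (x + v) = ennreal (\<bar>f (x + v) - f x\<bar> / norm v)" for x by (simp add: lip_quot_def dist_norm)
      have "continuous_on UNIV (\<lambda>x. \<bar>f (x + v) - f x\<bar> / norm v)"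
        using that by (intro continuous_intros continuous_on_compose2[OF f]) auto
      then have "continuous_on UNIV (\<lambda>x. ennreal (\<bar>f (x + v) - f x\<bar> / norm v))"
        by (intro continuous_on_ennreal)
      then show ?thesis unfolding e by (intro open_Collect_less continuous_on_const)
    qed
    ultimately show "{x \<in> space borel. c < (SUP v\<in>?V n. lip_quot f x (x + v))} \<in> sets borel"
      by (metis (no_types, lifting) borel_open open_UN)
  qed
  then show ?thesis unfolding grad_norm_eq_Limsup[abs_def] Limsup_at_eq_INF by measurable
qed

lemma grad_norm_comp_nonexpansive:
  fixes T :: "real ^ 'm \<Rightarrow> real ^ 'n" and f :: "real ^ 'n \<Rightarrow> real"
  assumes ne: "\<And>x y. norm (T x - T y) \<le> norm (x - y)"
  shows "grad_norm (f \<circ> T) y \<le> grad_norm f (T y)"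
  unfolding grad_norm_eq_Limsup Limsup_def[of "at (T y)"]
proof (rule INF_greatest)
  fix Q assume "Q \<in> {Q. eventually Q (at (T y))}"
  then obtain d where d: "0 < d" "\<And>z. z \<noteq> T y \<Longrightarrow> dist z (T y) < d \<Longrightarrow> Q z" unfolding eventually_at by auto
  have "\<forall>\<^sub>F z in at y. lip_quot (f \<circ> T) y z \<le> Sup (lip_quot f (T y) ` Collect Q)"
    unfolding eventually_at
  proof (intro exI[of _ d] conjI ballI impI d(1))
    fix z assume z: "z \<noteq> y \<and> dist z y < d"
    have dT: "dist (T z) (T y) \<le> dist z y" using ne by (simp add: dist_norm)
    show "lip_quot (f \<circ> T) y z \<le> Sup (lip_quot f (T y) ` Collect Q)"
    proof (cases "T z = T y")
      case True then show ?thesis by (simp add: lip_quot_def)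
    next
      case False
      have "lip_quot (f \<circ> T) y z \<le> lip_quot f (T y) (T z)"
        unfolding lip_quot_def o_def using z False dT by (intro ennreal_leI divide_left_mono) auto
      also have "\<dots> \<le> Sup (lip_quot f (T y) ` Collect Q)" using d(2)[OF False] dT z by (intro Sup_upper) auto
      finally show ?thesis .
    qed
  qed
  then show "Limsup (at y) (lip_quot (f \<circ> T) y) \<le> Sup (lip_quot f (T y) ` Collect Q)" by (rule Limsup_bounded)
qed

lemma locally_lipschitz_continuous:
  assumes "locally_lipschitz f" shows "continuous_on UNIV f"
proof (rule continuous_at_imp_continuous_on, intro ballI)
  fix x
  obtain r C where "0 < r" "C-lipschitz_on (ball x r) f" using assms unfolding locally_lipschitz_def by blast
  then show "isCont f x" using lipschitz_on_continuous_on[of C "ball x r" f] by (simp add: continuous_on_eq_continuous_at)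
qed

text \<open>
  Testing with \<open>f \<circ> T\<close> shows that every constant admissible for \<open>\<nu>\<close> is admissible for its image.
\<close>
theorem poincare_constant_nonexpansive_image:
  fixes T :: "real ^ 'm \<Rightarrow> real ^ 'n"
  assumes s[measurable_cong]: "sets \<nu> = sets borel" and ne: "\<And>x y. norm (T x - T y) \<le> norm (x - y)"
  shows "poincare_constant (distr \<nu> borel T) \<le> poincare_constant \<nu>"
  unfolding poincare_constant_def
proof (rule Inf_superset_mono, clarify)
  let ?\<mu> = "distr \<nu> borel T"
  fix C :: real
  assume C: "0 \<le> C" and P: "\<forall>f. locally_lipschitz f \<and> L2 \<nu> f \<longrightarrow> ennreal (Var \<nu> f) \<le> ennreal C * (\<integral>\<^sup>+x. (grad_norm f x)\<^sup>2 \<partial>\<nu>)"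
  have "1-lipschitz_on UNIV T" using ne by (intro lipschitz_onI) (auto simp: dist_norm)
  then have Tc: "continuous_on UNIV T" by (rule lipschitz_on_continuous_on)
  then have [measurable]: "T \<in> borel_measurable borel" by (rule borel_measurable_continuous_onI)
  have "ennreal (Var ?\<mu> f) \<le> ennreal C * (\<integral>\<^sup>+x. (grad_norm f x)\<^sup>2 \<partial>?\<mu>)" if f: "locally_lipschitz f" "L2 ?\<mu> f" for f
  proof -
    have fm[measurable]: "f \<in> borel_measurable borel"
      by (rule borel_measurable_continuous_onI[OF locally_lipschitz_continuous[OF f(1)]])
    have [measurable]: "grad_norm f \<in> borel_measurable borel"
      by (rule grad_norm_measurable[OF locally_lipschitz_continuous[OF f(1)]])
    have 1: "locally_lipschitz (f \<circ> T)" unfolding locally_lipschitz_def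
    proof
      fix y
      obtain r K where r: "0 < r" and K: "K-lipschitz_on (ball (T y) r) f" using f(1) unfolding locally_lipschitz_def by blast
      have "K-lipschitz_on (ball y r) (f \<circ> T)"
      proof (rule lipschitz_onI)
        fix a b assume ab: "a \<in> ball y r" "b \<in> ball y r"
        have "T a \<in> ball (T y) r" "T b \<in> ball (T y) r"
          using ab ne[of y a] ne[of y b] by (auto simp: dist_norm)
        then have "dist (f (T a)) (f (T b)) \<le> K * dist (T a) (T b)" by (rule lipschitz_onD[OF K])
        also have "\<dots> \<le> K * dist a b" using ne lipschitz_on_nonneg[OF K] by (intro mult_left_mono) (auto simp: dist_norm)
        finally show "dist ((f \<circ> T) a) ((f \<circ> T) b) \<le> K * dist a b" by simp
      qed (rule lipschitz_on_nonneg[OF K])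
      then show "\<exists>r>0. \<exists>C. C-lipschitz_on (ball y r) (f \<circ> T)" using r by blast
    qed
    have 2: "L2 \<nu> (f \<circ> T)" using f(2) unfolding L2_def by (auto simp: integrable_distr_eq o_def)
    have "Var ?\<mu> f = Var \<nu> (f \<circ> T)" unfolding Var_def by (simp add: integral_distr o_def)
    then have "ennreal (Var ?\<mu> f) \<le> ennreal C * (\<integral>\<^sup>+x. (grad_norm (f \<circ> T) x)\<^sup>2 \<partial>\<nu>)" using P 1 2 by simp
    also have "\<dots> \<le> ennreal C * (\<integral>\<^sup>+x. (grad_norm f (T x))\<^sup>2 \<partial>\<nu>)"
      by (intro mult_left_mono nn_integral_mono power_mono grad_norm_comp_nonexpansive ne) auto
    also have "(\<integral>\<^sup>+x. (grad_norm f (T x))\<^sup>2 \<partial>\<nu>) = (\<integral>\<^sup>+x. (grad_norm f x)\<^sup>2 \<partial>?\<mu>)"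
      by (subst nn_integral_distr) auto
    finally show ?thesis .
  qed
  then show "\<exists>C'. ennreal C = ennreal C' \<and> 0 \<le> C' \<and> (\<forall>f. locally_lipschitz f \<and> L2 ?\<mu> f \<longrightarrow> ennreal (Var ?\<mu> f) \<le> ennreal C' * (\<integral>\<^sup>+x. (grad_norm f x)\<^sup>2 \<partial>?\<mu>))"
    using C by blast
qed

section \<open>Smooth functions of compact support\<close>

text \<open>
  The functions \<open>p(1/x) exp(-1/x)\<close>, extended by zero to \<open>x \<le> 0\<close>, with \<open>p\<close> a polynomial: a class closed under
  differentiation, which makes the smoothness of \<open>exp(-1/x)\<close> an induction.
\<close>
definition flat_exp :: "real poly \<Rightarrow> real \<Rightarrow> real" where
  "flat_exp p x = (if 0 < x then poly p (1 / x) * exp (- 1 / x) else 0)"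

lemma poly_times_exp_tendsto_0: "((\<lambda>y. poly p y * exp (- y)) \<longlongrightarrow> (0::real)) at_top"
proof -
  have "((\<lambda>y. \<Sum>i\<le>degree p. coeff p i * (y ^ i / exp y)) \<longlongrightarrow> (\<Sum>i\<le>degree p. coeff p i * 0)) at_top"
    by (intro tendsto_intros tendsto_power_div_exp_0)
  moreover have "(\<Sum>i\<le>degree p. coeff p i * (y ^ i / exp y)) = poly p y * exp (- y)" for y
    by (simp add: poly_altdef sum_distrib_right exp_minus divide_inverse mult.assoc)
  ultimately show ?thesis by simp
qed

lemma flat_exp_tendsto_0: "(flat_exp p \<longlongrightarrow> 0) (at 0)"
proof -
  have "((\<lambda>x. poly p (inverse x) * exp (- inverse x)) \<longlongrightarrow> 0) (at_right 0)"
    by (rule filterlim_compose[OF poly_times_exp_tendsto_0 filterlim_inverse_at_top_right])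
  then have "(flat_exp p \<longlongrightarrow> 0) (at_right 0)"
    by (rule Lim_transform_eventually) (auto simp: eventually_at_right_less flat_exp_def inverse_eq_divide eventually_at_filter)
  moreover have "(flat_exp p \<longlongrightarrow> 0) (at_left 0)"
    by (rule tendsto_eventually) (auto simp: flat_exp_def eventually_at_filter)
  ultimately show ?thesis by (simp add: filterlim_split_at_real)
qed

text \<open>
  At zero, the difference quotient of \<open>flat_exp p\<close> is again of this form, with \<open>p\<close> multiplied by the variable, so it tends to zero.
\<close>
lemma flat_exp_has_derivative:
  "(flat_exp p has_real_derivative flat_exp (monom 1 2 * (p - pderiv p)) x) (at x)"
proof -
  consider "0 < x" | "x < 0" | "x = 0" by linarith
  then show ?thesis
  proof cases
    case 1
    have "((\<lambda>x. poly p (1 / x) * exp (- 1 / x)) has_real_derivative flat_exp (monom 1 2 * (p - pderiv p)) x) (at x)"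
      using 1 by (auto intro!: derivative_eq_intros poly_DERIV[THEN DERIV_chain2] simp: flat_exp_def poly_monom field_simps power2_eq_square)
    then show ?thesis
      by (rule DERIV_cong_ev[OF refl _ refl, THEN iffD1, rotated])
         (use 1 in \<open>auto simp: flat_exp_def intro!: eventually_mono[OF eventually_nhds_in_open[of "{0<..}"]]\<close>)
  next
    case 2
    have "((\<lambda>x. 0) has_real_derivative flat_exp (monom 1 2 * (p - pderiv p)) x) (at x)" using 2 by (simp add: flat_exp_def)
    then show ?thesis
      by (rule DERIV_cong_ev[OF refl _ refl, THEN iffD1, rotated])
         (use 2 in \<open>auto simp: flat_exp_def intro!: eventually_mono[OF eventually_nhds_in_open[of "{..<0}"]]\<close>)
  next
    case 3
    have "(flat_exp ([:0, 1:] * p) \<longlongrightarrow> 0) (at 0)" by (rule flat_exp_tendsto_0)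
    then have "((\<lambda>h. (flat_exp p (0 + h) - flat_exp p 0) / h) \<longlongrightarrow> 0) (at 0)"
      by (rule Lim_transform_eventually) (auto simp: eventually_at_filter flat_exp_def field_simps)
    then show ?thesis using 3 by (simp add: DERIV_def flat_exp_def)
  qed
qed

lemma partial_eq:
  "(f has_derivative D) (at x) \<Longrightarrow> partial i f x = D (axis i 1)"
  unfolding partial_def by (simp add: frechet_derivative_at[symmetric])

lemma partial_eq_gradient: "partial i f x = gradient f x $ i"
  by (simp add: gradient_def)

lemma Ck_const: "Ck k (\<lambda>x :: real ^ 'n. c)"
proof (induction k arbitrary: c)
  case (Suc k)
  have "partial i (\<lambda>x :: real ^ 'n. c) = (\<lambda>x. 0)" for i by (rule ext) (simp add: partial_eq[OF has_derivative_const])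
  then show ?case using Suc by simp
qed simp

lemma Ck_Suc_imp: "Ck (Suc k) f \<Longrightarrow> Ck k f"
proof (induction k arbitrary: f)
  case 0
  then show ?case by (auto intro!: continuous_at_imp_continuous_on differentiable_imp_continuous_within)
qed simp

lemma differentiable_partial:
  "f differentiable (at x) \<Longrightarrow> g differentiable (at x) \<Longrightarrow> partial i (\<lambda>x. f x + g x) x = partial i f x + partial i g x"
  "f differentiable (at x) \<Longrightarrow> g differentiable (at x) \<Longrightarrow> partial i (\<lambda>x. f x * g x) x = f x * partial i g x + partial i f x * g x"
proof -
  assume *: "f differentiable (at x)" "g differentiable (at x)"
  then have D: "(f has_derivative frechet_derivative f (at x)) (at x)" "(g has_derivative frechet_derivative g (at x)) (at x)"
    using frechet_derivative_works by blast+
  show "partial i (\<lambda>x. f x + g x) x = partial i f x + partial i g x"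
    by (subst partial_eq[OF has_derivative_add[OF D]]) (simp add: partial_def)
  show "partial i (\<lambda>x. f x * g x) x = f x * partial i g x + partial i f x * g x"
    by (subst partial_eq[OF has_derivative_mult[OF D]]) (simp add: partial_def)
qed

lemma Ck_add: "Ck k f \<Longrightarrow> Ck k g \<Longrightarrow> Ck k (\<lambda>x. f x + g x)"
proof (induction k arbitrary: f g)
  case (Suc k)
  then have "partial i (\<lambda>x. f x + g x) = (\<lambda>x. partial i f x + partial i g x)" for i
    by (intro ext differentiable_partial) auto
  then show ?case using Suc by (auto intro: differentiable_add)
qed (auto intro: continuous_intros)

lemma Ck_mult: "Ck k f \<Longrightarrow> Ck k g \<Longrightarrow> Ck k (\<lambda>x. f x * g x)"
proof (induction k arbitrary: f g)
  case (Suc k)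
  have p: "partial i (\<lambda>x. f x * g x) = (\<lambda>x. f x * partial i g x + partial i f x * g x)" for i
    using Suc.prems by (intro ext differentiable_partial) auto
  have "Ck k f" "Ck k g" using Suc.prems Ck_Suc_imp by blast+
  then have "Ck k (\<lambda>x. f x * partial i g x + partial i f x * g x)" for i
    using Suc.prems by (intro Ck_add Suc.IH) auto
  then show ?case using Suc.prems by (auto simp: p intro: differentiable_mult)
qed (auto intro: continuous_intros)

lemma Ck_prod: "finite I \<Longrightarrow> (\<And>i. i \<in> I \<Longrightarrow> Ck k (f i)) \<Longrightarrow> Ck k (\<lambda>x. \<Prod>i\<in>I. f i x)"
  by (induction I rule: finite_induct) (auto intro: Ck_const Ck_mult)

lemma Ck_affine: "Ck k f \<Longrightarrow> Ck k (\<lambda>x. f (y + c *\<^sub>R x))"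
proof (induction k arbitrary: f)
  case 0
  then show ?case by (auto intro!: continuous_on_compose2[of UNIV f] continuous_intros)
next
  case (Suc k)
  have A: "((\<lambda>x. y + c *\<^sub>R x) has_derivative (\<lambda>h. c *\<^sub>R h)) (at x)" for x by (auto intro!: derivative_eq_intros)
  have D: "((\<lambda>x. f (y + c *\<^sub>R x)) has_derivative (\<lambda>h. frechet_derivative f (at (y + c *\<^sub>R x)) (c *\<^sub>R h))) (at x)" for x
    using diff_chain_at[OF A, of f "frechet_derivative f (at (y + c *\<^sub>R x))" x] Suc.prems frechet_derivative_works
    by (auto simp: o_def)
  have "partial i (\<lambda>x. f (y + c *\<^sub>R x)) = (\<lambda>x. c * partial i f (y + c *\<^sub>R x))" for i
  proof
    fix x
    have lin: "linear (frechet_derivative f (at (y + c *\<^sub>R x)))"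
      using Suc.prems frechet_derivative_works has_derivative_linear by (metis Ck.simps(2))
    show "partial i (\<lambda>x. f (y + c *\<^sub>R x)) x = c * partial i f (y + c *\<^sub>R x)"
      by (subst partial_eq[OF D]) (simp add: linear_scale[OF lin] partial_def)
  qed
  then show ?case using Suc D by (auto simp: differentiable_def intro!: Ck_mult Ck_const)
qed

lemma partial_affine:
  assumes "f differentiable (at (y + c *\<^sub>R x))"
  shows "partial i (\<lambda>x. f (y + c *\<^sub>R x)) x = c * partial i f (y + c *\<^sub>R x)"
proof -
  have A: "((\<lambda>x. y + c *\<^sub>R x) has_derivative (\<lambda>h. c *\<^sub>R h)) (at x)" for x by (auto intro!: derivative_eq_intros)
  have f: "(f has_derivative frechet_derivative f (at (y + c *\<^sub>R x))) (at (y + c *\<^sub>R x))" using assms frechet_derivative_works by blast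
  have D: "((\<lambda>x. f (y + c *\<^sub>R x)) has_derivative (\<lambda>h. frechet_derivative f (at (y + c *\<^sub>R x)) (c *\<^sub>R h))) (at x)"
    using diff_chain_at[OF A f] by (simp add: o_def)
  show ?thesis
    by (subst partial_eq[OF D]) (simp add: linear_scale[OF has_derivative_linear[OF f]] partial_def)
qed

lemma Ck_flat_exp: "Ck k (\<lambda>x::real ^ 'n. a * flat_exp p (c + d * x $ i))"
proof (induction k arbitrary: a p)
  case 0
  have "continuous_on UNIV (flat_exp p)" using flat_exp_has_derivative DERIV_isCont continuous_at_imp_continuous_on by blast
  then show ?case by (auto intro!: continuous_intros continuous_on_compose2[of UNIV "flat_exp p"])
next
  case (Suc k)
  let ?q = "monom 1 2 * (p - pderiv p)"
  have D: "((\<lambda>x::real ^ 'n. a * flat_exp p (c + d * x $ i)) has_derivative (\<lambda>h. a * (flat_exp ?q (c + d * x $ i) * (d * h $ i)))) (at x)" for x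
  proof -
    have 1: "((\<lambda>x::real ^ 'n. c + d * x $ i) has_derivative (\<lambda>h. d * h $ i)) (at x)"
      by (auto intro!: derivative_eq_intros bounded_linear.has_derivative[OF bounded_linear_vec_nth])
    have 2: "(flat_exp p has_derivative (\<lambda>h. flat_exp ?q (c + d * x $ i) * h)) (at (c + d * x $ i))"
      using flat_exp_has_derivative unfolding has_field_derivative_def by blast
    have "((\<lambda>x::real ^ 'n. flat_exp p (c + d * x $ i)) has_derivative (\<lambda>h. flat_exp ?q (c + d * x $ i) * (d * h $ i))) (at x)"
      using diff_chain_at[OF 1 2] by (simp add: o_def)
    then show ?thesis by (rule has_derivative_mult_right)
  qed
  have "partial j (\<lambda>x::real ^ 'n. a * flat_exp p (c + d * x $ i)) = (\<lambda>x. (a * d * axis j 1 $ i) * flat_exp ?q (c + d * x $ i))" for j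
    by (rule ext) (simp add: partial_eq[OF D] mult_ac)
  then show ?case using Suc D[THEN differentiableI] by auto
qed

text \<open>
  Positive exactly on the box from \<open>a\<close> to \<open>b\<close>. As \<open>k\<close> grows, the transition layer at the boundary becomes thinner and the
  function tends to the indicator function of the box.
\<close>
definition bump :: "real \<Rightarrow> real ^ 'n \<Rightarrow> real ^ 'n \<Rightarrow> real ^ 'n \<Rightarrow> real" where
  "bump k a b x = (\<Prod>i\<in>UNIV. flat_exp 1 (k * (x $ i - a $ i)) * flat_exp 1 (k * (b $ i - x $ i)))"

lemma flat_exp_1_bounds: "0 \<le> flat_exp 1 x" "flat_exp 1 x \<le> 1"
  by (auto simp: flat_exp_def divide_nonpos_pos)

lemma bump_bounds: "0 \<le> bump k a b x" "bump k a b x \<le> 1"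
  unfolding bump_def by (auto intro!: prod_nonneg prod_le_1 mult_nonneg_nonneg mult_le_one flat_exp_1_bounds)

lemma bump_pos: "0 < k \<Longrightarrow> x \<in> box a b \<Longrightarrow> 0 < bump k a b x"
  unfolding bump_def by (auto intro!: prod_pos mult_pos_pos simp: flat_exp_def mem_box_cart)

lemma bump_eq_0:
  assumes k: "0 < k" and x: "x \<notin> box a b" shows "bump k a b x = 0"
proof -
  obtain i where "\<not> (a $ i < x $ i \<and> x $ i < b $ i)" using x by (auto simp: mem_box_cart)
  then have "flat_exp 1 (k * (x $ i - a $ i)) * flat_exp 1 (k * (b $ i - x $ i)) = 0"
    using k by (auto simp: flat_exp_def zero_less_mult_iff)
  then show ?thesis unfolding bump_def by (intro prod_zero) auto
qed

lemma Ck_bump: "Ck m (bump k a b)"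
proof -
  have "Ck m (\<lambda>x. flat_exp 1 (k * (x $ i - a $ i)) * flat_exp 1 (k * (b $ i - x $ i)))" for i
    using Ck_mult[OF Ck_flat_exp[of m 1 1 "- (k * a $ i)" k i] Ck_flat_exp[of m 1 1 "k * b $ i" "- k" i]]
    by (simp add: algebra_simps)
  then show ?thesis unfolding bump_def[abs_def] by (intro Ck_prod) auto
qed

lemma test_funI:
  fixes f :: "real ^ 'n \<Rightarrow> real"
  assumes "\<And>k. Ck k f" "\<And>x. x \<notin> S \<Longrightarrow> f x = 0" "bounded S"
  shows "test_fun f"
proof -
  have "{x. f x \<noteq> 0} \<subseteq> S" using assms(2) by auto
  then have "bounded {x. f x \<noteq> 0}" using assms(3) bounded_subset by blast
  then show ?thesis using assms(1) by (simp add: test_fun_def smooth_def compact_eq_bounded_closed bounded_closure)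
qed

lemma test_fun_bump: "0 < k \<Longrightarrow> test_fun (bump k a b)"
  by (rule test_funI[where S="box a b"]) (auto simp: Ck_bump bump_eq_0)

lemma bump_tendsto_indicator: "(\<lambda>n. bump (real (Suc n)) a b x) \<longlonglongrightarrow> indicator (box a b) x"
proof (cases "x \<in> box a b")
  case False
  then show ?thesis by (simp add: bump_eq_0)
next
  case True
  have f1: "(\<lambda>n. flat_exp 1 (real (Suc n) * c)) \<longlonglongrightarrow> 1" if c: "0 < c" for c
  proof -
    have "(\<lambda>n. exp (- (1 / c) * inverse (real (Suc n)))) \<longlonglongrightarrow> exp (- (1 / c) * 0)"
      by (intro tendsto_intros LIMSEQ_inverse_real_of_nat)
    moreover have "exp (- (1 / c) * inverse (real (Suc n))) = flat_exp 1 (real (Suc n) * c)" for n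
      using c by (simp add: flat_exp_def inverse_eq_divide field_simps del: of_nat_Suc)
    ultimately show ?thesis by simp
  qed
  have "(\<lambda>n. bump (real (Suc n)) a b x) \<longlonglongrightarrow> (\<Prod>i\<in>(UNIV::'a set). 1 * 1)"
    unfolding bump_def using True by (intro tendsto_prod tendsto_mult f1) (auto simp: mem_box_cart)
  then show ?thesis using True by simp
qed

lemma test_fun_mult: "test_fun f \<Longrightarrow> smooth g \<Longrightarrow> test_fun (\<lambda>x. f x * g x)"
  by (rule test_funI[where S="closure {x. f x \<noteq> 0}"])
     (auto simp: test_fun_def smooth_def intro: Ck_mult compact_imp_bounded closure_subset[THEN subsetD])

lemma test_fun_affine:
  fixes f :: "real ^ 'n \<Rightarrow> real"
  assumes f: "test_fun f" and c: "c \<noteq> 0" shows "test_fun (\<lambda>x. f (y + c *\<^sub>R x))"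
proof (rule test_funI)
  let ?S = "(\<lambda>z. (1 / c) *\<^sub>R (z - y)) ` closure {x. f x \<noteq> 0}"
  show "Ck k (\<lambda>x. f (y + c *\<^sub>R x))" for k using f by (intro Ck_affine) (auto simp: test_fun_def smooth_def)
  show "bounded ?S"
    using f by (intro compact_imp_bounded compact_continuous_image continuous_intros) (auto simp: test_fun_def)
  show "f (y + c *\<^sub>R x) = 0" if "x \<notin> ?S" for x
  proof (rule ccontr)
    assume "f (y + c *\<^sub>R x) \<noteq> 0"
    then have "y + c *\<^sub>R x \<in> closure {x. f x \<noteq> 0}" using closure_subset by fastforce
    moreover have "x = (1 / c) *\<^sub>R ((y + c *\<^sub>R x) - y)" using c by simp
    ultimately show False using that by blast
  qed
qed

lemma test_fun_cmult: "test_fun f \<Longrightarrow> test_fun (\<lambda>x. c * f x)"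
  using test_fun_mult[of f "\<lambda>x. c"] by (simp add: smooth_def Ck_const mult.commute)

lemma test_fun_smooth: "test_fun f \<Longrightarrow> smooth f" by (simp add: test_fun_def)

lemma smooth_differentiable: "smooth f \<Longrightarrow> f differentiable (at x)"
  unfolding smooth_def by (metis Ck.simps(2))

lemma smooth_partial_continuous: "smooth f \<Longrightarrow> continuous_on UNIV (partial i f)"
  unfolding smooth_def by (metis Ck.simps)

lemma smooth_continuous: "smooth f \<Longrightarrow> continuous_on UNIV f"
  unfolding smooth_def by (metis Ck.simps(1))

lemma test_fun_eq_0:
  assumes f: "test_fun f" and x: "x \<notin> closure {x. f x \<noteq> 0}" shows "f x = 0" "partial i f x = 0"
proof -
  let ?U = "- closure {x. f x \<noteq> 0}"
  have z: "f y = 0" if "y \<in> ?U" for y using that closure_subset[of "{x. f x \<noteq> 0}"] by blast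
  show "f x = 0" by (rule z) (use x in blast)
  have "(f has_derivative (\<lambda>h. 0)) (at x)"
    by (rule has_derivative_transform_within_open[OF has_derivative_const, of ?U])
       (use x in \<open>auto intro!: z[symmetric]\<close>)
  then show "partial i f x = 0" by (simp add: partial_eq)
qed

lemma bounded_if_continuous_compact_support:
  fixes g :: "'a::metric_space \<Rightarrow> real"
  assumes "continuous_on UNIV g" "compact K" "\<And>x. x \<notin> K \<Longrightarrow> g x = 0"
  shows "\<exists>C\<ge>0. \<forall>x. \<bar>g x\<bar> \<le> C"
proof -
  have "compact (g ` K)" using assms by (intro compact_continuous_image) (auto intro: continuous_on_subset)
  then have "bounded (g ` K)" by (rule compact_imp_bounded)
  then obtain C where C: "\<And>x. x \<in> K \<Longrightarrow> \<bar>g x\<bar> \<le> C" unfolding bounded_iff by auto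
  have "\<bar>g x\<bar> \<le> max C 0" for x using C[of x] assms(3)[of x] by (cases "x \<in> K") auto
  then show ?thesis by (intro exI[of _ "max C 0"]) auto
qed

lemma test_fun_bounded:
  assumes f: "test_fun f" shows "\<exists>C\<ge>0. \<forall>x. \<bar>f x\<bar> \<le> C"
proof (rule bounded_if_continuous_compact_support)
  show "compact (closure {x. f x \<noteq> 0})" using f by (simp only: test_fun_def)
qed (rule smooth_continuous[OF test_fun_smooth[OF f]] test_fun_eq_0(1)[OF f], assumption?)+

lemma test_fun_partial_bounded:
  assumes f: "test_fun f" shows "\<exists>C\<ge>0. \<forall>x. \<bar>partial i f x\<bar> \<le> C"
proof (rule bounded_if_continuous_compact_support)
  show "compact (closure {x. f x \<noteq> 0})" using f by (simp only: test_fun_def)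
qed (rule smooth_partial_continuous[OF test_fun_smooth[OF f]] test_fun_eq_0(2)[OF f], assumption?)+

lemma test_fun_gradient_bounded:
  assumes f: "test_fun f" shows "\<exists>C\<ge>0. \<forall>x. norm (gradient f x) \<le> C"
proof -
  have "\<forall>i. \<exists>C. C \<ge> 0 \<and> (\<forall>x. \<bar>partial i f x\<bar> \<le> C)" using test_fun_partial_bounded[OF f] by blast
  from choice[OF this] obtain C where C: "\<And>i. C i \<ge> 0" "\<And>i x. \<bar>partial i f x\<bar> \<le> C i" by blast
  have "norm (gradient f x) \<le> (\<Sum>i\<in>UNIV. C i)" for x
    by (rule order_trans[OF norm_le_l1_cart sum_mono]) (simp add: C gradient_def)
  then show ?thesis using C(1) by (intro exI[of _ "\<Sum>i\<in>UNIV. C i"]) (auto intro: sum_nonneg)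
qed

lemma lipschitz_from_gradient:
  fixes f :: "real ^ 'n \<Rightarrow> real"
  assumes "\<And>x. f differentiable (at x)" "\<And>x. norm (gradient f x) \<le> B"
  shows "\<bar>f (x + h) - f x\<bar> \<le> B * norm h"
proof -
  have "norm (gradient f z \<bullet> h) \<le> B * norm h" for z h
    unfolding real_norm_def by (rule order_trans[OF Cauchy_Schwarz_ineq2 mult_right_mono[OF assms(2) norm_ge_zero]])
  then have "norm (f (x + h) - f x) \<le> B * norm h"
    by (rule lipschitz_from_derivative[OF has_derivative_gradient[OF assms(1)]])
  then show ?thesis by simp
qed

section \<open>Weak gradients\<close>

lemma vec_nth_measurable[measurable]: "(\<lambda>x :: real ^ 'n. x $ i) \<in> borel_measurable borel"
  by (intro borel_measurable_continuous_onI continuous_intros)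

lemma borel_measurable_vec_lambda:
  fixes f :: "'a \<Rightarrow> 'n::finite \<Rightarrow> real"
  assumes "\<And>i. (\<lambda>x. f x i) \<in> borel_measurable M"
  shows "(\<lambda>x. (\<chi> i. f x i) :: real ^ 'n) \<in> borel_measurable M"
  by (subst borel_measurable_euclidean_space) (auto simp: Basis_vec_def inner_axis assms)

lemma locally_integrable_mult_bounded:
  fixes f :: "real ^ 'n \<Rightarrow> 'b::{banach, second_countable_topology}"
  assumes f: "locally_integrable f" and [measurable]: "\<phi> \<in> borel_measurable borel"
    and bd: "\<And>x. \<bar>\<phi> x\<bar> \<le> C" and K: "compact K" "\<And>x. x \<notin> K \<Longrightarrow> \<phi> x = 0"
  shows "integrable lborel (\<lambda>x. \<phi> x *\<^sub>R f x)"
proof (rule Bochner_Integration.integrable_bound[where f="\<lambda>x. C *\<^sub>R (indicat_real K x *\<^sub>R f x)"])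
  have [measurable]: "f \<in> borel_measurable borel" using f by (simp add: locally_integrable_def)
  show "integrable lborel (\<lambda>x. C *\<^sub>R (indicat_real K x *\<^sub>R f x))"
    using f K unfolding locally_integrable_def set_integrable_def by (intro integrable_scaleR_right) blast
  show "(\<lambda>x. \<phi> x *\<^sub>R f x) \<in> borel_measurable lborel" by measurable
  have C: "0 \<le> C" using bd[of 0] by linarith
  show "AE x in lborel. norm (\<phi> x *\<^sub>R f x) \<le> norm (C *\<^sub>R (indicat_real K x *\<^sub>R f x))"
    using bd K(2) C by (auto intro!: AE_I2 mult_right_mono simp: indicator_def)
qed

lemma locally_integrable_component:
  fixes G :: "real ^ 'n \<Rightarrow> real ^ 'm"
  assumes "locally_integrable G" shows "locally_integrable (\<lambda>x. G x $ i)"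
  unfolding locally_integrable_def
proof (intro conjI allI impI)
  have [measurable]: "G \<in> borel_measurable borel" using assms by (simp add: locally_integrable_def)
  show "(\<lambda>x. G x $ i) \<in> borel_measurable borel" by measurable
  fix K :: "(real ^ 'n) set" assume "compact K"
  then have "integrable lborel (\<lambda>x. indicat_real K x *\<^sub>R G x)"
    using assms unfolding locally_integrable_def set_integrable_def by blast
  from integrable_bounded_linear[OF bounded_linear_vec_nth this, of i]
  show "set_integrable lborel K (\<lambda>x. G x $ i)" unfolding set_integrable_def by simp
qed

lemma locally_integrable_add:
  fixes f g :: "real ^ 'n \<Rightarrow> 'b::{banach, second_countable_topology}"
  shows "locally_integrable f \<Longrightarrow> locally_integrable g \<Longrightarrow> locally_integrable (\<lambda>x. f x + g x)"
  unfolding locally_integrable_def by (auto intro: set_integral_add)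

lemma locally_integrable_scaleR:
  fixes f :: "real ^ 'n \<Rightarrow> 'b::{banach, second_countable_topology}"
  shows "locally_integrable f \<Longrightarrow> locally_integrable (\<lambda>x. c *\<^sub>R f x)"
proof -
  assume f: "locally_integrable f"
  have "integrable lborel (\<lambda>x. c *\<^sub>R (indicat_real K x *\<^sub>R f x))" if "compact K" for K
    using f that unfolding locally_integrable_def set_integrable_def by (intro integrable_scaleR_right) blast
  then show ?thesis using f unfolding locally_integrable_def set_integrable_def
    by (auto simp only: scaleR_left_commute[of c] intro: borel_measurable_scaleR borel_measurable_const)
qed

lemma locally_integrable_mult:
  fixes f :: "real ^ 'n \<Rightarrow> 'b::{banach, second_countable_topology}"
  assumes f: "locally_integrable f" and m[measurable]: "\<phi> \<in> borel_measurable borel" and bd: "\<And>x. \<bar>\<phi> x\<bar> \<le> C"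
  shows "locally_integrable (\<lambda>x. \<phi> x *\<^sub>R f x)"
  unfolding locally_integrable_def
proof (intro conjI allI impI)
  have [measurable]: "f \<in> borel_measurable borel" using assms by (simp add: locally_integrable_def)
  show "(\<lambda>x. \<phi> x *\<^sub>R f x) \<in> borel_measurable borel" by measurable
  fix K :: "(real ^ 'n) set" assume K: "compact K"
  then have [measurable]: "K \<in> sets borel" by (simp add: borel_closed compact_imp_closed)
  have C: "0 \<le> C" using bd[of 0] by linarith
  have "integrable lborel (\<lambda>x. (indicat_real K x * \<phi> x) *\<^sub>R f x)"
    by (rule locally_integrable_mult_bounded[OF f _ _ K, of _ C]) (use bd C in \<open>auto simp: indicator_def\<close>)
  then show "set_integrable lborel K (\<lambda>x. \<phi> x *\<^sub>R f x)" unfolding set_integrable_def by simp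
qed

lemma locally_integrable_bounded:
  fixes f :: "real ^ 'n \<Rightarrow> 'b::{banach, second_countable_topology}"
  assumes m[measurable]: "f \<in> borel_measurable borel" and bd: "\<And>x. norm (f x) \<le> C"
  shows "locally_integrable f"
  unfolding locally_integrable_def
proof (intro conjI allI impI m)
  fix K :: "(real ^ 'n) set" assume K: "compact K"
  have [measurable]: "K \<in> sets borel" using K by (simp add: borel_closed compact_imp_closed)
  have fin: "emeasure lborel K < \<infinity>" using K by (rule emeasure_compact_finite)
  show "set_integrable lborel K f" unfolding set_integrable_def
  proof (rule integrableI_bounded_set_indicator[where B=C])
    show "AE x in lborel. x \<in> K \<longrightarrow> norm (f x) \<le> C" using bd by simp
  qed (use fin in auto)
qed

lemma test_fun_integrable_mult:
  assumes f: "locally_integrable f" and \<phi>: "test_fun \<phi>"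
  shows "integrable lborel (\<lambda>x. f x * \<phi> x)" "integrable lborel (\<lambda>x. f x * partial i \<phi> x)"
proof -
  let ?K = "closure {x. \<phi> x \<noteq> 0}"
  have K: "compact ?K" using \<phi> by (simp only: test_fun_def)
  obtain C where C: "\<And>x. \<bar>\<phi> x\<bar> \<le> C" using test_fun_bounded[OF \<phi>] by blast
  obtain D where D: "\<And>x. \<bar>partial i \<phi> x\<bar> \<le> D" using test_fun_partial_bounded[OF \<phi>] by blast
  have "integrable lborel (\<lambda>x. \<phi> x *\<^sub>R f x)"
    by (rule locally_integrable_mult_bounded[OF f _ C K test_fun_eq_0(1)[OF \<phi>]])
       (rule borel_measurable_continuous_onI[OF smooth_continuous[OF test_fun_smooth[OF \<phi>]]])
  then show "integrable lborel (\<lambda>x. f x * \<phi> x)" by (simp add: mult.commute)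
  have "integrable lborel (\<lambda>x. partial i \<phi> x *\<^sub>R f x)"
    by (rule locally_integrable_mult_bounded[OF f _ D K test_fun_eq_0(2)[OF \<phi>]])
       (rule borel_measurable_continuous_onI[OF smooth_partial_continuous[OF test_fun_smooth[OF \<phi>]]])
  then show "integrable lborel (\<lambda>x. f x * partial i \<phi> x)" by (simp add: mult.commute)
qed

text \<open>
  The fundamental lemma of the calculus of variations. Bump functions tend to indicator functions of boxes, so \<open>g\<close> integrates to zero over every
  box. Hence the measures with densities the positive and the negative part of \<open>g\<close>, cut off to a box to be finite, agree on boxes and thus
  everywhere.
\<close>
lemma AE_eq_0_if_test_integrals_eq_0:
  fixes g :: "real ^ 'n \<Rightarrow> real"
  assumes g: "locally_integrable g" and z: "\<And>\<phi>. test_fun \<phi> \<Longrightarrow> (\<integral>x. g x * \<phi> x \<partial>lborel) = 0"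
  shows "AE x in lborel. g x = 0"
proof -
  have [measurable]: "g \<in> borel_measurable borel" using g by (simp add: locally_integrable_def)
  have ib: "integrable lborel (\<lambda>x. indicat_real (cbox a b) x * g x)" for a b
    using g compact_cbox[of a b] unfolding locally_integrable_def set_integrable_def by auto
  have box0: "(\<integral>x. indicat_real (box a b) x * g x \<partial>lborel) = 0" for a b
  proof -
    have "(\<lambda>n. \<integral>x. bump (real (Suc n)) a b x * g x \<partial>lborel) \<longlonglongrightarrow> (\<integral>x. indicat_real (box a b) x * g x \<partial>lborel)"
    proof (rule integral_dominated_convergence[where w="\<lambda>x. \<bar>indicat_real (cbox a b) x * g x\<bar>"])
      show "integrable lborel (\<lambda>x. \<bar>indicat_real (cbox a b) x * g x\<bar>)" using ib by auto
      show "(\<lambda>x. bump (real (Suc n)) a b x * g x) \<in> borel_measurable lborel" for n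
        using borel_measurable_continuous_onI[OF smooth_continuous[OF test_fun_smooth[OF test_fun_bump[of "real (Suc n)" a b]]]]
        by (simp del: of_nat_Suc)
      show "AE x in lborel. (\<lambda>n. bump (real (Suc n)) a b x * g x) \<longlonglongrightarrow> indicat_real (box a b) x * g x"
        by (intro AE_I2 tendsto_mult bump_tendsto_indicator tendsto_const)
      show "AE x in lborel. norm (bump (real (Suc n)) a b x * g x) \<le> \<bar>indicat_real (cbox a b) x * g x\<bar>" for n
      proof (rule AE_I2)
        fix x
        show "norm (bump (real (Suc n)) a b x * g x) \<le> \<bar>indicat_real (cbox a b) x * g x\<bar>"
        proof (cases "x \<in> box a b")
          case True
          then have "x \<in> cbox a b" using box_subset_cbox by blast
          then show ?thesis using bump_bounds[of "real (Suc n)" a b x] by (simp add: abs_mult mult_left_le_one_le del: of_nat_Suc)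
        next
          case False
          then show ?thesis by (simp add: bump_eq_0)
        qed
      qed
    qed measurable
    moreover have "(\<integral>x. bump (real (Suc n)) a b x * g x \<partial>lborel) = 0" for n
      using z[OF test_fun_bump[of "real (Suc n)" a b]] by (simp add: mult.commute del: of_nat_Suc)
    ultimately show ?thesis by (simp add: LIMSEQ_const_iff)
  qed
  have AEbox: "AE x in lborel. x \<in> box c d \<longrightarrow> g x = 0" for c d
  proof -
    let ?p = "\<lambda>x. ennreal (indicat_real (box c d) x * max 0 (g x))" and ?m = "\<lambda>x. ennreal (indicat_real (box c d) x * max 0 (- g x))"
    have ip: "integrable lborel (\<lambda>x. indicat_real (box a b) x * max 0 (g x))" "integrable lborel (\<lambda>x. indicat_real (box a b) x * max 0 (- g x))" for a b
      by (rule Bochner_Integration.integrable_bound[OF ib[of a b]], simp, use box_subset_cbox in \<open>fastforce simp: indicator_def intro!: AE_I2\<close>)+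
    have em: "emeasure (density lborel (\<lambda>x. ennreal (indicat_real (box c d) x * max 0 (h x)))) (box a b) = ennreal (\<integral>x. indicat_real (box a b \<inter> box c d) x * max 0 (h x) \<partial>lborel)"
      if [measurable]: "h \<in> borel_measurable borel" and i: "\<And>a b. integrable lborel (\<lambda>x. indicat_real (box a b) x * max 0 (h x))" for h a b
    proof -
      have "emeasure (density lborel (\<lambda>x. ennreal (indicat_real (box c d) x * max 0 (h x)))) (box a b) = (\<integral>\<^sup>+x. ennreal (indicat_real (box a b \<inter> box c d) x * max 0 (h x)) \<partial>lborel)"
        by (subst emeasure_density) (auto intro!: nn_integral_cong simp: indicator_def)
      also have "\<dots> = ennreal (\<integral>x. indicat_real (box a b \<inter> box c d) x * max 0 (h x) \<partial>lborel)"
        unfolding box_Int_box by (subst nn_integral_eq_integral[OF i]) auto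
      finally show ?thesis .
    qed
    have "density lborel ?p = density lborel ?m"
    proof (rule measure_eqI_generator_eq[where E="range (\<lambda>(a, b). box a b)" and \<Omega>=UNIV and A="\<lambda>n::nat. box (- (real n *\<^sub>R One)) (real n *\<^sub>R One)"])
      show "Int_stable (range (\<lambda>(a, b). box a b :: (real ^ 'n) set))" by (auto simp: Int_stable_def box_Int_box)
      show "sets (density lborel ?p) = sigma_sets UNIV (range (\<lambda>(a, b). box a b))" "sets (density lborel ?m) = sigma_sets UNIV (range (\<lambda>(a, b). box a b))"
        by (simp_all add: borel_eq_box)
      show "(\<Union>i. box (- (real i *\<^sub>R One)) (real i *\<^sub>R One)) = (UNIV :: (real ^ 'n) set)" unfolding UN_box_eq_UNIV by auto
      show "emeasure (density lborel ?p) (box (- (real i *\<^sub>R One)) (real i *\<^sub>R One)) \<noteq> \<infinity>" for i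
        by (subst em) (use ip in auto)
      fix X :: "(real ^ 'n) set" assume "X \<in> range (\<lambda>(a, b). box a b)"
      then obtain a b where X: "X = box a b" by auto
      obtain a' b' where I: "box a b \<inter> box c d = box a' b'" using box_Int_box by blast
      have "(\<integral>x. indicat_real (box a' b') x * max 0 (g x) \<partial>lborel) - (\<integral>x. indicat_real (box a' b') x * max 0 (- g x) \<partial>lborel) = (\<integral>x. indicat_real (box a' b') x * g x \<partial>lborel)"
        by (subst Bochner_Integration.integral_diff[symmetric, OF ip]) (auto intro!: Bochner_Integration.integral_cong simp: max_def algebra_simps)
      then have "(\<integral>x. indicat_real (box a' b') x * max 0 (g x) \<partial>lborel) = (\<integral>x. indicat_real (box a' b') x * max 0 (- g x) \<partial>lborel)"
        using box0[of a' b'] by simp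
      then show "emeasure (density lborel ?p) X = emeasure (density lborel ?m) X"
        unfolding X by (subst (1 2) em) (use ip in \<open>auto simp: I\<close>)
    qed auto
    then have "AE x in lborel. ?p x = ?m x"
      by (subst (asm) sigma_finite_measure.density_unique_iff[OF sigma_finite_lborel]) auto
    then show ?thesis by eventually_elim (auto simp: max_def split: if_splits)
  qed
  have "AE x in lborel. \<forall>n. x \<in> box (- (real n *\<^sub>R One)) (real n *\<^sub>R One) \<longrightarrow> g x = 0"
    unfolding AE_all_countable by (intro allI AEbox)
  then show ?thesis
  proof eventually_elim
    fix x assume *: "\<forall>n. x \<in> box (- (real n *\<^sub>R One)) (real n *\<^sub>R One) \<longrightarrow> g x = 0"
    have "x \<in> (\<Union>i. box (- (real i *\<^sub>R One)) (real i *\<^sub>R One))" unfolding UN_box_eq_UNIV by auto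
    then show "g x = 0" using * by blast
  qed
qed

lemma is_weak_gradient_unique:
  fixes f :: "real ^ 'n \<Rightarrow> real"
  assumes G: "is_weak_gradient f G" and H: "is_weak_gradient f H"
  shows "AE x in lborel. G x = H x"
proof -
  have l: "locally_integrable (\<lambda>x. G x $ i)" "locally_integrable (\<lambda>x. H x $ i)" for i
    using G H by (auto simp: is_weak_gradient_def intro: locally_integrable_component)
  have "AE x in lborel. G x $ i + - 1 *\<^sub>R (H x $ i) = 0" for i
  proof (rule AE_eq_0_if_test_integrals_eq_0)
    show "locally_integrable (\<lambda>x. G x $ i + - 1 *\<^sub>R (H x $ i))"
      by (intro locally_integrable_add locally_integrable_scaleR l)
    fix \<phi> :: "real ^ 'n \<Rightarrow> real" assume \<phi>: "test_fun \<phi>"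
    have "(\<integral>x. (G x $ i + - 1 *\<^sub>R (H x $ i)) * \<phi> x \<partial>lborel) = (\<integral>x. G x $ i * \<phi> x \<partial>lborel) - (\<integral>x. H x $ i * \<phi> x \<partial>lborel)"
      by (subst Bochner_Integration.integral_diff[symmetric, OF test_fun_integrable_mult(1)[OF l(1) \<phi>] test_fun_integrable_mult(1)[OF l(2) \<phi>]])
         (simp add: algebra_simps)
    also have "\<dots> = 0" using G H \<phi> unfolding is_weak_gradient_def by (metis (no_types, lifting) diff_self minus_equation_iff)
    finally show "(\<integral>x. (G x $ i + - 1 *\<^sub>R (H x $ i)) * \<phi> x \<partial>lborel) = 0" .
  qed
  then have "AE x in lborel. \<forall>i. G x $ i + - 1 *\<^sub>R (H x $ i) = 0" by (simp add: AE_all_countable)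
  then show ?thesis by eventually_elim (simp add: vec_eq_iff)
qed

lemma weak_gradient_AE:
  assumes "is_weak_gradient f G" shows "AE x in lborel. weak_gradient f x = G x"
proof -
  have "is_weak_gradient f (weak_gradient f)"
    using someI[of "\<lambda>G. is_weak_gradient f G" G, OF assms] by (simp add: weak_gradient_def)
  then show ?thesis using assms by (rule is_weak_gradient_unique)
qed

lemma is_weak_gradient_zero: "is_weak_gradient (\<lambda>x. 0) (\<lambda>x. 0)"
  unfolding is_weak_gradient_def by (auto intro: locally_integrable_bounded[where C=0])

lemma is_weak_gradient_add:
  fixes f g :: "real ^ 'n \<Rightarrow> real"
  assumes G: "is_weak_gradient f G" and H: "is_weak_gradient g H"
  shows "is_weak_gradient (\<lambda>x. f x + c * g x) (\<lambda>x. G x + c *\<^sub>R H x)"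
  unfolding is_weak_gradient_def
proof (intro conjI allI impI)
  have l: "locally_integrable f" "locally_integrable g" "locally_integrable G" "locally_integrable H" using G H by (auto simp: is_weak_gradient_def)
  show "locally_integrable (\<lambda>x. f x + c * g x)" using locally_integrable_add[OF l(1) locally_integrable_scaleR[OF l(2), of c]] by simp
  show "locally_integrable (\<lambda>x. G x + c *\<^sub>R H x)" by (rule locally_integrable_add[OF l(3) locally_integrable_scaleR[OF l(4)]])
  fix \<phi> :: "real ^ 'n \<Rightarrow> real" and i assume \<phi>: "test_fun \<phi>"
  note li = locally_integrable_component[OF l(3), of i] locally_integrable_component[OF l(4), of i]
  have "(\<integral>x. (f x + c * g x) * partial i \<phi> x \<partial>lborel) = (\<integral>x. f x * partial i \<phi> x \<partial>lborel) + c * (\<integral>x. g x * partial i \<phi> x \<partial>lborel)"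
    using test_fun_integrable_mult(2)[OF l(1) \<phi>, of i] test_fun_integrable_mult(2)[OF l(2) \<phi>, of i]
    by (simp add: distrib_right mult.assoc)
  also have "\<dots> = - ((\<integral>x. G x $ i * \<phi> x \<partial>lborel) + c * (\<integral>x. H x $ i * \<phi> x \<partial>lborel))"
    using G H \<phi> unfolding is_weak_gradient_def by simp
  also have "\<dots> = - (\<integral>x. (G x + c *\<^sub>R H x) $ i * \<phi> x \<partial>lborel)"
    using test_fun_integrable_mult(1)[OF li(1) \<phi>] test_fun_integrable_mult(1)[OF li(2) \<phi>]
    by (simp add: distrib_right mult.assoc)
  finally show "(\<integral>x. (f x + c * g x) * partial i \<phi> x \<partial>lborel) = - (\<integral>x. (G x + c *\<^sub>R H x) $ i * \<phi> x \<partial>lborel)" .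
qed

lemma is_weak_gradient_lin_comb:
  assumes "\<And>i. i < m \<Longrightarrow> is_weak_gradient (F i) (G i)"
  shows "is_weak_gradient (lin_comb m c F) (\<lambda>x. \<Sum>i<m. c i *\<^sub>R G i x)"
  using assms
proof (induction m)
  case 0
  then show ?case using is_weak_gradient_zero by (simp add: lin_comb_def[abs_def])
next
  case (Suc m)
  have "lin_comb (Suc m) c F = (\<lambda>x. lin_comb m c F x + c m * F m x)" by (simp add: lin_comb_def fun_eq_iff)
  then show ?case using is_weak_gradient_add[OF Suc.IH Suc.prems[of m], of "c m"] Suc.prems by simp
qed

text \<open>
  The product rule, by using \<open>\<eta> \<phi>\<close> as a test function in the definition for \<open>f\<close>.
\<close>
lemma is_weak_gradient_test_mult:
  fixes f :: "real ^ 'n \<Rightarrow> real"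
  assumes G: "is_weak_gradient f G" and \<eta>: "test_fun \<eta>"
  shows "is_weak_gradient (\<lambda>x. \<eta> x * f x) (\<lambda>x. \<eta> x *\<^sub>R G x + f x *\<^sub>R gradient \<eta> x)"
  unfolding is_weak_gradient_def
proof (intro conjI allI impI)
  have l: "locally_integrable f" "locally_integrable G" using G by (auto simp: is_weak_gradient_def)
  have [measurable]: "f \<in> borel_measurable borel" using l(1) by (simp add: locally_integrable_def)
  have m\<eta>[measurable]: "\<eta> \<in> borel_measurable borel"
    by (rule borel_measurable_continuous_onI[OF smooth_continuous[OF test_fun_smooth[OF \<eta>]]])
  have p\<eta>[measurable]: "partial i \<eta> \<in> borel_measurable borel" for i
    by (rule borel_measurable_continuous_onI[OF smooth_partial_continuous[OF test_fun_smooth[OF \<eta>]]])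
  obtain C where C: "\<And>x. \<bar>\<eta> x\<bar> \<le> C" using test_fun_bounded[OF \<eta>] by blast
  obtain D where D: "\<And>x. norm (gradient \<eta> x) \<le> D" using test_fun_gradient_bounded[OF \<eta>] by blast
  have gm[measurable]: "gradient \<eta> \<in> borel_measurable borel"
    unfolding gradient_def[abs_def] by (intro borel_measurable_vec_lambda) simp
  show "locally_integrable (\<lambda>x. \<eta> x * f x)" using locally_integrable_mult[OF l(1) m\<eta> C] by simp
  have "locally_integrable (\<lambda>x. f x *\<^sub>R gradient \<eta> x)"
    unfolding locally_integrable_def
  proof (intro conjI allI impI)
    show "(\<lambda>x. f x *\<^sub>R gradient \<eta> x) \<in> borel_measurable borel" by measurable
    fix K :: "(real ^ 'n) set" assume K: "compact K"
    have [measurable]: "K \<in> sets borel" using K by (simp add: borel_closed compact_imp_closed)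
    have D0: "0 \<le> D" using D[of 0] norm_ge_zero order_trans by blast
    have "integrable lborel (\<lambda>x. indicat_real K x *\<^sub>R f x)" using l(1) K unfolding locally_integrable_def set_integrable_def by blast
    then have "integrable lborel (\<lambda>x. D * (indicat_real K x *\<^sub>R f x))" by simp
    then show "set_integrable lborel K (\<lambda>x. f x *\<^sub>R gradient \<eta> x)"
      unfolding set_integrable_def
      by (rule Bochner_Integration.integrable_bound)
         (use D D0 in \<open>auto intro!: AE_I2 simp: indicator_def abs_mult mult.commute[of D] intro: mult_left_mono\<close>)
  qed
  then show "locally_integrable (\<lambda>x. \<eta> x *\<^sub>R G x + f x *\<^sub>R gradient \<eta> x)"
    by (intro locally_integrable_add locally_integrable_mult[OF l(2) m\<eta> C])
  fix \<phi> :: "real ^ 'n \<Rightarrow> real" and i assume \<phi>: "test_fun \<phi>"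
  have lG: "locally_integrable (\<lambda>x. G x $ i)" by (rule locally_integrable_component[OF l(2)])
  have \<eta>\<phi>: "test_fun (\<lambda>x. \<eta> x * \<phi> x)" by (rule test_fun_mult[OF \<eta> test_fun_smooth[OF \<phi>]])
  have p: "partial i (\<lambda>x. \<eta> x * \<phi> x) x = \<eta> x * partial i \<phi> x + partial i \<eta> x * \<phi> x" for x
    by (rule differentiable_partial(2)) (intro smooth_differentiable test_fun_smooth \<eta> \<phi>)+
  have p\<phi>: "integrable lborel (\<lambda>x. f x * (partial i \<eta> x * \<phi> x))"
  proof -
    obtain E where E: "\<And>x. \<bar>partial i \<eta> x\<bar> \<le> E" using test_fun_partial_bounded[OF \<eta>] by blast
    have "locally_integrable (\<lambda>x. partial i \<eta> x *\<^sub>R f x)" by (rule locally_integrable_mult[OF l(1) p\<eta> E])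
    from test_fun_integrable_mult(1)[OF this \<phi>] show ?thesis by (simp add: mult_ac)
  qed
  have e1: "(\<integral>x. f x * partial i (\<lambda>x. \<eta> x * \<phi> x) x \<partial>lborel) = - (\<integral>x. G x $ i * (\<eta> x * \<phi> x) \<partial>lborel)"
    using G \<eta>\<phi> unfolding is_weak_gradient_def by blast
  have "(\<integral>x. \<eta> x * f x * partial i \<phi> x \<partial>lborel) = (\<integral>x. f x * partial i (\<lambda>x. \<eta> x * \<phi> x) x - f x * (partial i \<eta> x * \<phi> x) \<partial>lborel)"
    unfolding p by (intro Bochner_Integration.integral_cong) (auto simp: algebra_simps)
  also have "\<dots> = - (\<integral>x. G x $ i * (\<eta> x * \<phi> x) \<partial>lborel) - (\<integral>x. f x * (partial i \<eta> x * \<phi> x) \<partial>lborel)"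
    unfolding e1[symmetric] by (rule Bochner_Integration.integral_diff[OF test_fun_integrable_mult(2)[OF l(1) \<eta>\<phi>] p\<phi>])
  also have "\<dots> = - (\<integral>x. (\<eta> x *\<^sub>R G x + f x *\<^sub>R gradient \<eta> x) $ i * \<phi> x \<partial>lborel)"
  proof -
    have "(\<integral>x. (\<eta> x *\<^sub>R G x + f x *\<^sub>R gradient \<eta> x) $ i * \<phi> x \<partial>lborel) = (\<integral>x. G x $ i * (\<eta> x * \<phi> x) + f x * (partial i \<eta> x * \<phi> x) \<partial>lborel)"
      by (intro Bochner_Integration.integral_cong) (auto simp: partial_eq_gradient algebra_simps)
    also have "\<dots> = (\<integral>x. G x $ i * (\<eta> x * \<phi> x) \<partial>lborel) + (\<integral>x. f x * (partial i \<eta> x * \<phi> x) \<partial>lborel)"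
      by (rule Bochner_Integration.integral_add[OF test_fun_integrable_mult(1)[OF lG \<eta>\<phi>] p\<phi>])
    finally show ?thesis by simp
  qed
  finally show "(\<integral>x. \<eta> x * f x * partial i \<phi> x \<partial>lborel) = - (\<integral>x. (\<eta> x *\<^sub>R G x + f x *\<^sub>R gradient \<eta> x) $ i * \<phi> x \<partial>lborel)" .
qed

lemma partial_measurable:
  fixes f :: "real ^ 'n \<Rightarrow> real"
  assumes "\<And>x. f differentiable (at x)"
  shows "partial i f \<in> borel_measurable borel"
proof -
  have [measurable]: "f \<in> borel_measurable borel"
    by (intro borel_measurable_continuous_onI continuous_at_imp_continuous_on) (auto intro: differentiable_imp_continuous_within assms)
  have "(\<lambda>n. real (Suc n) *\<^sub>R (f (x + (1 / real (Suc n)) *\<^sub>R axis i 1) - f x)) \<longlonglongrightarrow> partial i f x" for x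
    using directional_derivative_LIMSEQ[OF has_derivative_gradient[OF assms], of x "axis i 1"]
    by (simp add: gradient_def inner_axis del: of_nat_Suc)
  then show ?thesis by (rule borel_measurable_LIMSEQ_metric[rotated]) measurable
qed

lemma gradient_measurable:
  fixes f :: "real ^ 'n \<Rightarrow> real"
  assumes "\<And>x. f differentiable (at x)"
  shows "gradient f \<in> borel_measurable borel"
  unfolding gradient_def[abs_def] by (intro borel_measurable_vec_lambda partial_measurable assms)

text \<open>
  The derivative may be discontinuous, so the integral is computed as the limit of integrals of difference quotients. These are zero
  because Lebesgue measure is translation invariant.
\<close>
lemma integral_partial_eq_0:
  fixes h :: "real ^ 'n \<Rightarrow> real"
  assumes d: "\<And>x. h differentiable (at x)" and lip: "\<And>x u. \<bar>h (x + u) - h x\<bar> \<le> L * norm u"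
    and z: "\<And>x. R < norm x \<Longrightarrow> h x = 0"
  shows "(\<integral>x. partial i h x \<partial>lborel) = 0"
proof -
  have c: "continuous_on UNIV h" by (intro continuous_at_imp_continuous_on ballI differentiable_imp_continuous_within d)
  then have [measurable]: "h \<in> borel_measurable borel" by (rule borel_measurable_continuous_onI)
  obtain C where C: "\<And>x. \<bar>h x\<bar> \<le> C"
    using bounded_if_continuous_compact_support[OF c compact_cball[of 0 R]] z by (auto simp: not_le)
  have ih: "integrable lborel h"
  proof -
    have "integrable lborel (\<lambda>x. indicat_real (cball 0 R) x *\<^sub>R h x)"
      using locally_integrable_bounded[of h C] C compact_cball[of 0 R] unfolding locally_integrable_def set_integrable_def by auto
    also have "(\<lambda>x. indicat_real (cball 0 R) x *\<^sub>R h x) = h" using z by (auto simp: indicator_def fun_eq_iff not_le)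
    finally show ?thesis .
  qed
  have L: "0 \<le> L" using lip[of 0 "axis i 1"] by (simp add: norm_axis_1)
  define q where "q = (\<lambda>n x. real (Suc n) *\<^sub>R (h (x + (1 / real (Suc n)) *\<^sub>R axis i 1) - h x))"
  have "(\<lambda>n. \<integral>x. q n x \<partial>lborel) \<longlonglongrightarrow> (\<integral>x. partial i h x \<partial>lborel)"
  proof (rule integral_dominated_convergence[where w="\<lambda>x. L * indicator (cball 0 (\<bar>R\<bar> + 1)) x"])
    show "partial i h \<in> borel_measurable lborel" using partial_measurable[OF d] by simp
    show "q n \<in> borel_measurable lborel" for n unfolding q_def by measurable
    have "emeasure lborel (cball (0 :: real ^ 'n) (\<bar>R\<bar> + 1)) < \<infinity>" by (rule emeasure_compact_finite) simp
    then show "integrable lborel (\<lambda>x :: real ^ 'n. L * indicator (cball 0 (\<bar>R\<bar> + 1)) x :: real)"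
      by (intro integrable_mult_right integrable_real_indicator) auto
    show "AE x in lborel. (\<lambda>n. q n x) \<longlonglongrightarrow> partial i h x"
      using directional_derivative_LIMSEQ[OF has_derivative_gradient[OF d], of _ "axis i 1"]
      by (intro AE_I2) (simp add: q_def gradient_def inner_axis del: of_nat_Suc)
    show "AE x in lborel. norm (q n x) \<le> L * indicator (cball 0 (\<bar>R\<bar> + 1)) x" for n
    proof (rule AE_I2)
      fix x :: "real ^ 'n"
      let ?u = "(1 / real (Suc n)) *\<^sub>R axis i 1 :: real ^ 'n"
      have nu: "norm ?u = 1 / real (Suc n)" by (simp add: norm_axis_1)
      show "norm (q n x) \<le> L * indicator (cball 0 (\<bar>R\<bar> + 1)) x"
      proof (cases "x \<in> cball 0 (\<bar>R\<bar> + 1)")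
        case True
        have "norm (q n x) = real (Suc n) * \<bar>h (x + ?u) - h x\<bar>" by (simp add: q_def abs_mult del: of_nat_Suc)
        also have "\<dots> \<le> real (Suc n) * (L * norm ?u)" by (intro mult_left_mono lip) simp
        also have "\<dots> = L" unfolding nu by simp
        finally show ?thesis using True by simp
      next
        case False
        then have nx: "\<bar>R\<bar> + 1 < norm x" by simp
        have "norm ?u \<le> 1" unfolding nu by simp
        moreover have "norm x \<le> norm (x + ?u) + norm ?u"
          using norm_triangle_ineq4[of "x + ?u" ?u] by (simp only: add_diff_cancel_right')
        ultimately have "R < norm (x + ?u)" using nx by linarith
        then have "q n x = 0" using z[of x] z[of "x + ?u"] nx by (simp add: q_def del: of_nat_Suc)
        then show ?thesis using L by simp
      qed
    qed
  qed
  moreover have "(\<integral>x. q n x \<partial>lborel) = 0" for n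
  proof -
    let ?u = "(1 / real (Suc n)) *\<^sub>R axis i 1 :: real ^ 'n"
    have s: "(\<integral>x. h (x + ?u) \<partial>lborel) = (\<integral>x. h x \<partial>lborel)" "integrable lborel (\<lambda>x. h (x + ?u))"
      using integral_lborel_affine[of 1 h ?u] ih by (simp_all add: add.commute del: of_nat_Suc)
    then show ?thesis using ih unfolding q_def by (subst integral_scaleR_right) (simp add: Bochner_Integration.integral_diff del: of_nat_Suc)
  qed
  ultimately show ?thesis by (simp add: LIMSEQ_const_iff)
qed

text \<open>
  Integration by parts: the partial derivatives of \<open>f \<phi>\<close> integrate to zero.
\<close>
lemma gradient_is_weak_gradient:
  fixes f :: "real ^ 'n \<Rightarrow> real"
  assumes d: "\<And>x. f differentiable (at x)" and C: "\<And>x. \<bar>f x\<bar> \<le> C" and B: "\<And>x. norm (gradient f x) \<le> B"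
  shows "is_weak_gradient f (gradient f)"
  unfolding is_weak_gradient_def
proof (intro conjI allI impI)
  have [measurable]: "f \<in> borel_measurable borel"
    by (intro borel_measurable_continuous_onI continuous_at_imp_continuous_on) (auto intro: differentiable_imp_continuous_within d)
  show lf: "locally_integrable f" by (rule locally_integrable_bounded[where C=C]) (auto simp: C)
  show lg: "locally_integrable (gradient f)" by (rule locally_integrable_bounded[OF gradient_measurable[OF d] B])
  fix \<phi> :: "real ^ 'n \<Rightarrow> real" and i assume \<phi>: "test_fun \<phi>"
  obtain C' where C': "0 \<le> C'" "\<And>x. \<bar>\<phi> x\<bar> \<le> C'" using test_fun_bounded[OF \<phi>] by blast
  obtain B' where B': "0 \<le> B'" "\<And>x. norm (gradient \<phi> x) \<le> B'" using test_fun_gradient_bounded[OF \<phi>] by blast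
  have d': "\<phi> differentiable (at x)" for x by (rule smooth_differentiable[OF test_fun_smooth[OF \<phi>]])
  have "bounded (closure {x. \<phi> x \<noteq> 0})" using \<phi> by (simp add: test_fun_def compact_imp_bounded)
  then obtain R where R: "\<And>x. x \<in> closure {x. \<phi> x \<noteq> 0} \<Longrightarrow> norm x \<le> R" unfolding bounded_iff by blast
  have "(\<integral>x. partial i (\<lambda>x. f x * \<phi> x) x \<partial>lborel) = 0"
  proof (rule integral_partial_eq_0)
    show "(\<lambda>x. f x * \<phi> x) differentiable (at x)" for x by (intro differentiable_mult d d')
    show "f x * \<phi> x = 0" if "R < norm x" for x using test_fun_eq_0(1)[OF \<phi>, of x] R[of x] that by fastforce
    fix x u
    have C0: "0 \<le> C" using C[of 0] by linarith
    have "f (x + u) * \<phi> (x + u) - f x * \<phi> x = f (x + u) * (\<phi> (x + u) - \<phi> x) + (f (x + u) - f x) * \<phi> x" by (simp add: algebra_simps)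
    then have "\<bar>f (x + u) * \<phi> (x + u) - f x * \<phi> x\<bar> \<le> \<bar>f (x + u)\<bar> * \<bar>\<phi> (x + u) - \<phi> x\<bar> + \<bar>f (x + u) - f x\<bar> * \<bar>\<phi> x\<bar>"
      by (metis abs_mult abs_triangle_ineq)
    also have "\<dots> \<le> C * (B' * norm u) + (B * norm u) * C'"
      using C0 C' by (intro add_mono mult_mono C lipschitz_from_gradient d d' B B') (auto intro: order_trans[OF abs_ge_zero lipschitz_from_gradient[OF d B]])
    finally show "\<bar>f (x + u) * \<phi> (x + u) - f x * \<phi> x\<bar> \<le> (C * B' + B * C') * norm u" by (simp add: algebra_simps)
  qed
  moreover have "partial i (\<lambda>x. f x * \<phi> x) x = f x * partial i \<phi> x + gradient f x $ i * \<phi> x" for x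
    using differentiable_partial(2)[OF d d'] by (simp add: partial_eq_gradient)
  ultimately have "(\<integral>x. f x * partial i \<phi> x + gradient f x $ i * \<phi> x \<partial>lborel) = 0" by simp
  then show "(\<integral>x. f x * partial i \<phi> x \<partial>lborel) = - (\<integral>x. gradient f x $ i * \<phi> x \<partial>lborel)"
    using test_fun_integrable_mult(2)[OF lf \<phi>, of i] test_fun_integrable_mult(1)[OF locally_integrable_component[OF lg, of i] \<phi>]
    by (simp add: Bochner_Integration.integral_add)
qed

section \<open>Continuity of translations in the mean square\<close>

definition lipschitz_approximable :: "('a::euclidean_space \<Rightarrow> real) \<Rightarrow> bool" where
  "lipschitz_approximable u \<longleftrightarrow> u \<in> borel_measurable borel \<and> (\<forall>e>0. \<exists>h L R. (\<forall>x y. \<bar>h x - h y\<bar> \<le> L * norm (x - y)) \<and>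
     (\<forall>x. R < norm x \<longrightarrow> h x = 0) \<and> (\<integral>\<^sup>+x. ennreal ((u x - h x)\<^sup>2) \<partial>lborel) \<le> ennreal e)"

lemma lipschitz_approximableE:
  assumes u: "lipschitz_approximable u" and e: "0 < e"
  obtains h L R where "\<And>x y. \<bar>h x - h y\<bar> \<le> L * norm (x - y)" "\<And>x. R < norm x \<Longrightarrow> h x = 0"
    "(\<integral>\<^sup>+x. ennreal ((u x - h x)\<^sup>2) \<partial>lborel) \<le> ennreal e"
proof -
  have "\<exists>h L R. (\<forall>x y. \<bar>h x - h y\<bar> \<le> L * norm (x - y)) \<and>
     (\<forall>x. R < norm x \<longrightarrow> h x = 0) \<and> (\<integral>\<^sup>+x. ennreal ((u x - h x)\<^sup>2) \<partial>lborel) \<le> ennreal e"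
    using conjunct2[OF u[unfolded lipschitz_approximable_def], rule_format, OF e] .
  then obtain h L R where "\<forall>x y. \<bar>h x - h y\<bar> \<le> L * norm (x - y)" "\<forall>x. R < norm x \<longrightarrow> h x = 0"
    "(\<integral>\<^sup>+x. ennreal ((u x - h x)\<^sup>2) \<partial>lborel) \<le> ennreal e" by blast
  then show ?thesis using that[of h L R] by blast
qed

lemma lipschitz_measurable:
  fixes h :: "'a::euclidean_space \<Rightarrow> real"
  assumes "\<And>x y. \<bar>h x - h y\<bar> \<le> L * norm (x - y)"
  shows "h \<in> borel_measurable borel"
proof -
  have "L * norm (x - y) \<le> \<bar>L\<bar> * norm (x - y)" for x y :: 'a by (intro mult_right_mono) auto
  then have "\<bar>L\<bar>-lipschitz_on UNIV h"
    by (intro lipschitz_onI) (simp_all add: dist_norm order_trans[OF assms])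
  then show ?thesis by (intro borel_measurable_continuous_onI lipschitz_on_continuous_on)
qed

lemma square_add_le: "(a + b)\<^sup>2 \<le> 2 * a\<^sup>2 + 2 * (b::real)\<^sup>2"
  using zero_le_power2[of "a - b"] by (simp add: power2_sum power2_diff)

lemma nn_integral_square_add_le:
  fixes f g :: "'a \<Rightarrow> real"
  assumes [measurable]: "f \<in> borel_measurable M" "g \<in> borel_measurable M"
    and f: "(\<integral>\<^sup>+x. ennreal ((f x)\<^sup>2) \<partial>M) \<le> ennreal a" and g: "(\<integral>\<^sup>+x. ennreal ((g x)\<^sup>2) \<partial>M) \<le> ennreal b"
    and ab: "0 \<le> a" "0 \<le> b"
  shows "(\<integral>\<^sup>+x. ennreal ((f x + g x)\<^sup>2) \<partial>M) \<le> ennreal (2 * a + 2 * b)"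
proof -
  have "(\<integral>\<^sup>+x. ennreal ((f x + g x)\<^sup>2) \<partial>M) \<le> (\<integral>\<^sup>+x. 2 * ennreal ((f x)\<^sup>2) + 2 * ennreal ((g x)\<^sup>2) \<partial>M)"
  proof (rule nn_integral_mono)
    fix x
    have "ennreal ((f x + g x)\<^sup>2) \<le> ennreal (2 * (f x)\<^sup>2 + 2 * (g x)\<^sup>2)" by (intro ennreal_leI square_add_le)
    then show "ennreal ((f x + g x)\<^sup>2) \<le> 2 * ennreal ((f x)\<^sup>2) + 2 * ennreal ((g x)\<^sup>2)"
      by (simp add: ennreal_mult)
  qed
  also have "\<dots> = 2 * (\<integral>\<^sup>+x. ennreal ((f x)\<^sup>2) \<partial>M) + 2 * (\<integral>\<^sup>+x. ennreal ((g x)\<^sup>2) \<partial>M)"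
    by (simp add: nn_integral_add nn_integral_cmult)
  also have "\<dots> \<le> 2 * ennreal a + 2 * ennreal b" by (intro add_mono mult_left_mono f g) auto
  also have "\<dots> = ennreal (2 * a + 2 * b)" using ab by (simp add: ennreal_mult)
  finally show ?thesis .
qed

lemma lipschitz_approximable_limit:
  assumes [measurable]: "u \<in> borel_measurable borel"
    and v: "\<And>e. 0 < e \<Longrightarrow> \<exists>v. lipschitz_approximable v \<and> (\<integral>\<^sup>+x. ennreal ((u x - v x)\<^sup>2) \<partial>lborel) \<le> ennreal e"
  shows "lipschitz_approximable u"
  unfolding lipschitz_approximable_def
proof (intro conjI allI impI)
  fix e :: real assume e: "0 < e"
  then obtain v where v1: "lipschitz_approximable v" and v2: "(\<integral>\<^sup>+x. ennreal ((u x - v x)\<^sup>2) \<partial>lborel) \<le> ennreal (e / 4)"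
    using v[of "e / 4"] by auto
  have [measurable]: "v \<in> borel_measurable borel" using v1 by (simp add: lipschitz_approximable_def)
  obtain h L R where h: "\<And>x y. \<bar>h x - h y\<bar> \<le> L * norm (x - y)" "\<And>x. R < norm x \<Longrightarrow> h x = 0"
      "(\<integral>\<^sup>+x. ennreal ((v x - h x)\<^sup>2) \<partial>lborel) \<le> ennreal (e / 4)"
    using lipschitz_approximableE[OF v1, of "e / 4"] e by auto
  have [measurable]: "h \<in> borel_measurable borel" using h(1) by (rule lipschitz_measurable)
  have "(\<integral>\<^sup>+x. ennreal (((u x - v x) + (v x - h x))\<^sup>2) \<partial>lborel) \<le> ennreal (2 * (e / 4) + 2 * (e / 4))"
    by (rule nn_integral_square_add_le[OF _ _ v2 h(3)]) (use e in auto)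
  then show "\<exists>h L R. (\<forall>x y. \<bar>h x - h y\<bar> \<le> L * norm (x - y)) \<and> (\<forall>x. R < norm x \<longrightarrow> h x = 0) \<and> (\<integral>\<^sup>+x. ennreal ((u x - h x)\<^sup>2) \<partial>lborel) \<le> ennreal e"
    using h by (intro exI[of _ h] exI[of _ L] exI[of _ R]) simp
qed simp

lemma lipschitz_approximable_add:
  assumes u: "lipschitz_approximable u" and v: "lipschitz_approximable v"
  shows "lipschitz_approximable (\<lambda>x. u x + v x)"
  unfolding lipschitz_approximable_def
proof (intro conjI allI impI)
  have [measurable]: "u \<in> borel_measurable borel" "v \<in> borel_measurable borel" using u v by (auto simp: lipschitz_approximable_def)
  show "(\<lambda>x. u x + v x) \<in> borel_measurable borel" by measurable
  fix e :: real assume e: "0 < e"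
  obtain h L R where h: "\<And>x y. \<bar>h x - h y\<bar> \<le> L * norm (x - y)" "\<And>x. R < norm x \<Longrightarrow> h x = 0"
      "(\<integral>\<^sup>+x. ennreal ((u x - h x)\<^sup>2) \<partial>lborel) \<le> ennreal (e / 4)"
    using lipschitz_approximableE[OF u, of "e / 4"] e by auto
  obtain k M S where k: "\<And>x y. \<bar>k x - k y\<bar> \<le> M * norm (x - y)" "\<And>x. S < norm x \<Longrightarrow> k x = 0"
      "(\<integral>\<^sup>+x. ennreal ((v x - k x)\<^sup>2) \<partial>lborel) \<le> ennreal (e / 4)"
    using lipschitz_approximableE[OF v, of "e / 4"] e by auto
  have [measurable]: "h \<in> borel_measurable borel" "k \<in> borel_measurable borel"
    by (rule lipschitz_measurable, rule h(1)) (rule lipschitz_measurable, rule k(1))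
  have "(\<integral>\<^sup>+x. ennreal (((u x - h x) + (v x - k x))\<^sup>2) \<partial>lborel) \<le> ennreal (2 * (e / 4) + 2 * (e / 4))"
    by (rule nn_integral_square_add_le[OF _ _ h(3) k(3)]) (use e in auto)
  moreover have "(u x - h x) + (v x - k x) = u x + v x - (h x + k x)" for x by simp
  moreover have "\<bar>h x + k x - (h y + k y)\<bar> \<le> (L + M) * norm (x - y)" for x y
    using h(1)[of x y] k(1)[of x y] by (simp add: distrib_right)
  ultimately show "\<exists>h L R. (\<forall>x y. \<bar>h x - h y\<bar> \<le> L * norm (x - y)) \<and> (\<forall>x. R < norm x \<longrightarrow> h x = 0) \<and> (\<integral>\<^sup>+x. ennreal ((u x + v x - h x)\<^sup>2) \<partial>lborel) \<le> ennreal e"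
    using h(2) k(2) by (intro exI[of _ "\<lambda>x. h x + k x"] exI[of _ "L + M"] exI[of _ "max R S"]) auto
qed

lemma lipschitz_approximable_cmult:
  assumes u: "lipschitz_approximable u"
  shows "lipschitz_approximable (\<lambda>x. c * u x)"
  unfolding lipschitz_approximable_def
proof (intro conjI allI impI)
  have [measurable]: "u \<in> borel_measurable borel" using u by (auto simp: lipschitz_approximable_def)
  show "(\<lambda>x. c * u x) \<in> borel_measurable borel" by measurable
  fix e :: real assume e: "0 < e"
  have "0 < e / (c\<^sup>2 + 1)" using e by (intro divide_pos_pos) (auto simp: add_nonneg_pos)
  then obtain h L R where h: "\<And>x y. \<bar>h x - h y\<bar> \<le> L * norm (x - y)" "\<And>x. R < norm x \<Longrightarrow> h x = 0"
      "(\<integral>\<^sup>+x. ennreal ((u x - h x)\<^sup>2) \<partial>lborel) \<le> ennreal (e / (c\<^sup>2 + 1))"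
    using lipschitz_approximableE[OF u] by blast
  have [measurable]: "h \<in> borel_measurable borel" using h(1) by (auto intro: lipschitz_measurable)
  have "(\<integral>\<^sup>+x. ennreal ((c * u x - c * h x)\<^sup>2) \<partial>lborel) = ennreal (c\<^sup>2) * (\<integral>\<^sup>+x. ennreal ((u x - h x)\<^sup>2) \<partial>lborel)"
    by (subst nn_integral_cmult[symmetric]) (auto simp: ennreal_mult[symmetric] power_mult_distrib[symmetric] right_diff_distrib)
  also have "\<dots> \<le> ennreal (c\<^sup>2) * ennreal (e / (c\<^sup>2 + 1))" by (intro mult_left_mono h) auto
  also have "\<dots> = ennreal (c\<^sup>2 * (e / (c\<^sup>2 + 1)))" using e by (subst ennreal_mult) auto
  also have "\<dots> \<le> ennreal e"
  proof (rule ennreal_leI)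
    have "c\<^sup>2 * e \<le> (c\<^sup>2 + 1) * e" using e by (intro mult_right_mono) auto
    moreover have "0 < c\<^sup>2 + 1" by (simp add: add_nonneg_pos)
    ultimately show "c\<^sup>2 * (e / (c\<^sup>2 + 1)) \<le> e" by (simp add: divide_le_eq mult.commute)
  qed
  finally have 1: "(\<integral>\<^sup>+x. ennreal ((c * u x - c * h x)\<^sup>2) \<partial>lborel) \<le> ennreal e" .
  have "\<bar>c * h x - c * h y\<bar> \<le> (\<bar>c\<bar> * L) * norm (x - y)" for x y
    using mult_left_mono[OF h(1)[of x y], of "\<bar>c\<bar>"] by (simp add: abs_mult[symmetric] right_diff_distrib mult.assoc)
  with 1 show "\<exists>h L R. (\<forall>x y. \<bar>h x - h y\<bar> \<le> L * norm (x - y)) \<and> (\<forall>x. R < norm x \<longrightarrow> h x = 0) \<and> (\<integral>\<^sup>+x. ennreal ((c * u x - h x)\<^sup>2) \<partial>lborel) \<le> ennreal e"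
    using h(2) by (intro exI[of _ "\<lambda>x. c * h x"] exI[of _ "\<bar>c\<bar> * L"] exI[of _ R]) auto
qed

lemma lipschitz_approximable_zero: "lipschitz_approximable (\<lambda>x. 0)"
  unfolding lipschitz_approximable_def by (auto intro!: exI[of _ "\<lambda>x. 0"] exI[of _ "0::real"])

lemma lipschitz_approximable_sum:
  "finite I \<Longrightarrow> (\<And>i. i \<in> I \<Longrightarrow> lipschitz_approximable (u i)) \<Longrightarrow> lipschitz_approximable (\<lambda>x. \<Sum>i\<in>I. u i x)"
  by (induction I rule: finite_induct) (auto intro: lipschitz_approximable_zero lipschitz_approximable_add)

text \<open>
  Outer regularity provides an open set \<open>U\<close> slightly larger than \<open>S\<close>, and \<open>min 1 (k dist(x, -U))\<close> increases to the indicator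
  function of \<open>U\<close> as \<open>k\<close> grows.
\<close>
lemma lipschitz_approximable_indicator:
  fixes S :: "'a::euclidean_space set"
  assumes S[measurable]: "S \<in> sets borel" and bS: "S \<subseteq> ball 0 R"
  shows "lipschitz_approximable (indicat_real S)"
  unfolding lipschitz_approximable_def
proof (intro conjI allI impI)
  show "indicat_real S \<in> borel_measurable borel" by measurable
  fix e :: real assume e: "0 < e"
  obtain U0 where U0: "open U0" "S \<subseteq> U0" "emeasure lborel (U0 - S) < ennreal (e / 4)"
    using outer_regular_lborel[OF S, of "e / 4"] e by auto
  define U where "U = U0 \<inter> ball 0 R"
  have U: "open U" "S \<subseteq> U" "emeasure lborel (U - S) \<le> ennreal (e / 4)" "U \<subseteq> ball 0 R"
  proof -
    have "emeasure lborel (U - S) \<le> emeasure lborel (U0 - S)" using U0 by (intro emeasure_mono) (auto simp: U_def)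
    then show "emeasure lborel (U - S) \<le> ennreal (e / 4)" using U0(3) by simp
  qed (use U0 bS in \<open>auto simp: U_def\<close>)
  have Um[measurable]: "U \<in> sets borel" using U(1) by simp
  have Une: "- U \<noteq> {}"
  proof
    assume "- U = {}" then have "ball (0::'a) R = UNIV" using U(4) by auto
    then show False using not_bounded_UNIV[where 'a='a] bounded_ball by metis
  qed
  have cl: "closed (- U)" using U(1) by (simp add: closed_Compl)
  define h where "h = (\<lambda>k::nat. \<lambda>x. min 1 (real k * infdist x (- U)))"
  have hm[measurable]: "h k \<in> borel_measurable borel" for k
    unfolding h_def by (intro borel_measurable_continuous_onI continuous_intros)
  have fin: "emeasure lborel U < \<infinity>"
  proof -
    have "emeasure lborel U \<le> emeasure lborel (cball (0::'a) R)" using U(4) by (intro emeasure_mono) auto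
    also have "\<dots> < \<infinity>" by (rule emeasure_compact_finite) simp
    finally show ?thesis .
  qed
  have hU: "h k x = 0" if "x \<notin> U" for k x using that by (simp add: h_def)
  have h01: "0 \<le> h k x" "h k x \<le> 1" for k x by (auto simp: h_def infdist_nonneg)
  have "(\<lambda>k. \<integral>x. (indicat_real U x - h k x)\<^sup>2 \<partial>lborel) \<longlonglongrightarrow> (\<integral>x. 0 \<partial>(lborel :: 'a measure))"
  proof (rule integral_dominated_convergence[where w="indicat_real U"])
    show "integrable lborel (indicat_real U)" using fin by (intro integrable_real_indicator) auto
    show "AE x in lborel. (\<lambda>k. (indicat_real U x - h k x)\<^sup>2) \<longlonglongrightarrow> 0"
    proof (rule AE_I2)
      fix x
      show "(\<lambda>k. (indicat_real U x - h k x)\<^sup>2) \<longlonglongrightarrow> 0"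
      proof (cases "x \<in> U")
        case True
        then have p: "0 < infdist x (- U)" using cl Une by (metis Compl_iff in_closed_iff_infdist_zero infdist_nonneg less_eq_real_def)
        obtain m where m: "1 < real m * infdist x (- U)" using p reals_Archimedean3 by blast
        have "(indicat_real U x - h k x)\<^sup>2 = 0" if "m \<le> k" for k
        proof -
          have "real m * infdist x (- U) \<le> real k * infdist x (- U)" using that p by (intro mult_right_mono) auto
          then show ?thesis using m True by (simp add: h_def)
        qed
        then have "\<forall>\<^sub>F k in sequentially. (indicat_real U x - h k x)\<^sup>2 = 0" unfolding eventually_sequentially by blast
        then show ?thesis by (rule tendsto_eventually)
      next
        case False
        then show ?thesis by (simp add: hU)
      qed
    qed
    show "AE x in lborel. norm ((indicat_real U x - h k x)\<^sup>2) \<le> indicat_real U x" for k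
    proof (rule AE_I2)
      fix x show "norm ((indicat_real U x - h k x)\<^sup>2) \<le> indicat_real U x"
      proof (cases "x \<in> U")
        case True
        have "(1 - h k x)\<^sup>2 \<le> 1\<^sup>2" using h01[of k x] by (intro power_mono) auto
        then show ?thesis using True by simp
      qed (simp add: hU)
    qed
  qed measurable
  then have "\<forall>\<^sub>F k in sequentially. (\<integral>x. (indicat_real U x - h k x)\<^sup>2 \<partial>lborel) < e / 4"
    using e by (intro order_tendstoD(2)[where y=0]) auto
  then obtain k where k: "(\<integral>x. (indicat_real U x - h k x)\<^sup>2 \<partial>lborel) < e / 4" by (auto simp: eventually_sequentially)
  have ik: "integrable lborel (\<lambda>x. (indicat_real U x - h k x)\<^sup>2)"
  proof (rule Bochner_Integration.integrable_bound[where f="indicat_real U"])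
    show "integrable lborel (indicat_real U)" using fin by (intro integrable_real_indicator) auto
    show "AE x in lborel. norm ((indicat_real U x - h k x)\<^sup>2) \<le> norm (indicat_real U x)"
    proof (rule AE_I2)
      fix x show "norm ((indicat_real U x - h k x)\<^sup>2) \<le> norm (indicat_real U x)"
      proof (cases "x \<in> U")
        case True
        have "(1 - h k x)\<^sup>2 \<le> 1\<^sup>2" using h01[of k x] by (intro power_mono) auto
        then show ?thesis using True by simp
      qed (simp add: hU)
    qed
  qed measurable
  have 1: "(\<integral>\<^sup>+x. ennreal ((indicat_real U x - h k x)\<^sup>2) \<partial>lborel) \<le> ennreal (e / 4)"
    using k by (subst nn_integral_eq_integral[OF ik]) (auto intro: ennreal_leI)
  have "(\<integral>\<^sup>+x. ennreal ((indicat_real S x - indicat_real U x)\<^sup>2) \<partial>lborel) = (\<integral>\<^sup>+x. indicator (U - S) x \<partial>lborel)"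
    using U(2) by (intro nn_integral_cong) (auto simp: indicator_def)
  also have "\<dots> \<le> ennreal (e / 4)" using U(3) by (subst nn_integral_indicator) auto
  finally have 2: "(\<integral>\<^sup>+x. ennreal ((indicat_real S x - indicat_real U x)\<^sup>2) \<partial>lborel) \<le> ennreal (e / 4)" .
  have "(\<integral>\<^sup>+x. ennreal (((indicat_real S x - indicat_real U x) + (indicat_real U x - h k x))\<^sup>2) \<partial>lborel) \<le> ennreal (2 * (e / 4) + 2 * (e / 4))"
    by (rule nn_integral_square_add_le[OF _ _ 2 1]) (use e in auto)
  then have 3: "(\<integral>\<^sup>+x. ennreal ((indicat_real S x - h k x)\<^sup>2) \<partial>lborel) \<le> ennreal e" by simp
  have lip: "\<bar>h k x - h k y\<bar> \<le> real k * norm (x - y)" for x y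
  proof -
    have "\<bar>h k x - h k y\<bar> \<le> \<bar>real k * infdist x (- U) - real k * infdist y (- U)\<bar>" by (auto simp: h_def min_def)
    also have "\<dots> = real k * \<bar>infdist x (- U) - infdist y (- U)\<bar>" by (simp add: abs_mult flip: right_diff_distrib)
    also have "\<dots> \<le> real k * norm (x - y)" using infdist_triangle_abs[of x "- U" y] by (intro mult_left_mono) (auto simp: dist_norm)
    finally show ?thesis .
  qed
  have "h k x = 0" if "R < norm x" for x using that U(4) by (intro hU) auto
  then show "\<exists>h L R. (\<forall>x y. \<bar>h x - h y\<bar> \<le> L * norm (x - y)) \<and> (\<forall>x. R < norm x \<longrightarrow> h x = 0) \<and> (\<integral>\<^sup>+x. ennreal ((indicat_real S x - h x)\<^sup>2) \<partial>lborel) \<le> ennreal e"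
    using lip 3 by blast
qed

lemma lipschitz_approximable_L2:
  fixes u :: "'a::euclidean_space \<Rightarrow> real"
  assumes um[measurable]: "u \<in> borel_measurable borel" and u2: "integrable lborel (\<lambda>x. (u x)\<^sup>2)" and supp: "\<And>x. R < norm x \<Longrightarrow> u x = 0"
  shows "lipschitz_approximable u"
proof (rule lipschitz_approximable_limit[OF um])
  fix e :: real assume e: "0 < e"
  obtain F where F: "\<And>i. simple_function borel (F i)" "\<And>x. (\<lambda>i. F i x) \<longlonglongrightarrow> u x" "\<And>i x. dist (F i x) 0 \<le> 2 * dist (u x) 0"
    using borel_measurable_implies_sequence_metric[OF um, of 0] by auto
  have Fb: "\<bar>F i x\<bar> \<le> 2 * \<bar>u x\<bar>" for i x using F(3)[of i x] by simp
  have Fm[measurable]: "F i \<in> borel_measurable borel" for i using F(1) by (rule borel_measurable_simple_function)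
  have bnd: "(u x - F i x)\<^sup>2 \<le> 9 * (u x)\<^sup>2" for i x
  proof -
    have "\<bar>u x - F i x\<bar>\<^sup>2 \<le> (3 * \<bar>u x\<bar>)\<^sup>2" using Fb[of i x] by (intro power_mono) auto
    then show ?thesis by (simp add: power_mult_distrib)
  qed
  have "(\<lambda>i. \<integral>x. (u x - F i x)\<^sup>2 \<partial>lborel) \<longlonglongrightarrow> (\<integral>x. 0 \<partial>(lborel :: 'a measure))"
  proof (rule integral_dominated_convergence[where w="\<lambda>x. 9 * (u x)\<^sup>2"])
    show "AE x in lborel. (\<lambda>i. (u x - F i x)\<^sup>2) \<longlonglongrightarrow> 0"
    proof (rule AE_I2)
      fix x have "(\<lambda>i. (u x - F i x)\<^sup>2) \<longlonglongrightarrow> (u x - u x)\<^sup>2" by (intro tendsto_intros F)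
      then show "(\<lambda>i. (u x - F i x)\<^sup>2) \<longlonglongrightarrow> 0" by simp
    qed
  qed (use u2 bnd in auto)
  then have "\<forall>\<^sub>F i in sequentially. (\<integral>x. (u x - F i x)\<^sup>2 \<partial>lborel) < e"
    using e by (intro order_tendstoD(2)[where y=0]) auto
  then obtain i where i: "(\<integral>x. (u x - F i x)\<^sup>2 \<partial>lborel) < e" by (auto simp: eventually_sequentially)
  have ii: "integrable lborel (\<lambda>x. (u x - F i x)\<^sup>2)"
    by (rule Bochner_Integration.integrable_bound[where f="\<lambda>x. 9 * (u x)\<^sup>2"]) (use u2 bnd in auto)
  have 1: "(\<integral>\<^sup>+x. ennreal ((u x - F i x)\<^sup>2) \<partial>lborel) \<le> ennreal e"
    using i by (subst nn_integral_eq_integral[OF ii]) (auto intro: ennreal_leI)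
  let ?S = "\<lambda>y. (F i -` {y}) \<inter> cball 0 R"
  have fin: "finite (range (F i))" using F(1)[of i] by (simp add: simple_function_def)
  have "F i = (\<lambda>x. \<Sum>y\<in>range (F i). y * indicat_real (?S y) x)"
  proof
    fix x
    have "(\<Sum>y\<in>range (F i). y * indicat_real (?S y) x) = (\<Sum>y\<in>range (F i). if y = F i x then y * indicat_real (cball 0 R) x else 0)"
      by (intro sum.cong) (auto simp: indicator_def)
    also have "\<dots> = F i x * indicat_real (cball 0 R) x" using fin by (simp add: sum.delta)
    also have "\<dots> = F i x" using supp[of x] Fb[of i x] by (cases "norm x \<le> R") (auto simp: not_le)
    finally show "F i x = (\<Sum>y\<in>range (F i). y * indicat_real (?S y) x)" by simp
  qed
  moreover have "lipschitz_approximable (\<lambda>x. \<Sum>y\<in>range (F i). y * indicat_real (?S y) x)"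
  proof (intro lipschitz_approximable_sum fin lipschitz_approximable_cmult)
    fix y
    have "F i -` {y} \<in> sets borel" using measurable_sets[OF Fm, of "{y}" i] by simp
    then have "?S y \<in> sets borel" by simp
    moreover have "?S y \<subseteq> ball 0 (R + 1)" by auto
    ultimately show "lipschitz_approximable (indicat_real (?S y))" by (rule lipschitz_approximable_indicator)
  qed
  ultimately have "lipschitz_approximable (F i)" by simp
  then show "\<exists>v. lipschitz_approximable v \<and> (\<integral>\<^sup>+x. ennreal ((u x - v x)\<^sup>2) \<partial>lborel) \<le> ennreal e" using 1 by blast
qed

lemma nn_integral_lborel_translate:
  fixes f :: "'a::euclidean_space \<Rightarrow> ennreal"
  assumes [measurable]: "f \<in> borel_measurable borel"
  shows "(\<integral>\<^sup>+x. f (t + x) \<partial>lborel) = (\<integral>\<^sup>+x. f x \<partial>lborel)"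
proof -
  have "(\<integral>\<^sup>+x. f x \<partial>lborel) = (\<integral>\<^sup>+x. f x \<partial>distr lborel borel ((+) t))" by (simp add: lborel_distr_plus)
  then show ?thesis by (simp add: nn_integral_distr)
qed

text \<open>
  Clear for a Lipschitz function of bounded support, and the general case follows by approximation because translations preserve the \<open>L\<^sup>2\<close>-norm.
\<close>
lemma L2_translation_continuous:
  fixes u :: "'a::euclidean_space \<Rightarrow> real"
  assumes um[measurable]: "u \<in> borel_measurable borel" and u2: "integrable lborel (\<lambda>x. (u x)\<^sup>2)" and supp: "\<And>x. R < norm x \<Longrightarrow> u x = 0"
    and e: "0 < e"
  shows "\<exists>d>0. \<forall>t. norm t < d \<longrightarrow> (\<integral>\<^sup>+x. ennreal ((u (t + x) - u x)\<^sup>2) \<partial>lborel) \<le> ennreal e"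
proof -
  obtain h L S where h: "\<And>x y. \<bar>h x - h y\<bar> \<le> L * norm (x - y)" "\<And>x. S < norm x \<Longrightarrow> h x = 0"
      "(\<integral>\<^sup>+x. ennreal ((u x - h x)\<^sup>2) \<partial>lborel) \<le> ennreal (e / 16)"
    using lipschitz_approximableE[OF lipschitz_approximable_L2[where R=R, OF um u2 supp], of "e / 16"] e by auto
  have [measurable]: "h \<in> borel_measurable borel" using h(1) by (rule lipschitz_measurable)
  define V where "V = measure lborel (cball (0::'a) (\<bar>S\<bar> + 1))"
  have fin: "emeasure lborel (cball (0::'a) (\<bar>S\<bar> + 1)) < \<infinity>" by (rule emeasure_compact_finite) simp
  have V: "emeasure lborel (cball (0::'a) (\<bar>S\<bar> + 1)) = ennreal V" "0 \<le> V"
    using fin unfolding V_def by (auto simp: emeasure_eq_ennreal_measure)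
  define d where "d = min 1 (sqrt (e / (8 * ((L\<^sup>2 + 1) * (V + 1)))))"
  have LV: "0 < 8 * ((L\<^sup>2 + 1) * (V + 1))" using V by (intro mult_pos_pos) (auto simp: add_nonneg_pos)
  have d: "0 < d" "d \<le> 1" using e LV by (auto simp: d_def)
  have hd: "(\<integral>\<^sup>+x. ennreal ((h (t + x) - h x)\<^sup>2) \<partial>lborel) \<le> ennreal (e / 8)" if t: "norm t < d" for t
  proof -
    have pt: "ennreal ((h (t + x) - h x)\<^sup>2) \<le> ennreal (L\<^sup>2 * d\<^sup>2) * indicator (cball 0 (\<bar>S\<bar> + 1)) x" for x
    proof (cases "x \<in> cball 0 (\<bar>S\<bar> + 1)")
      case True
      have "\<bar>h (t + x) - h x\<bar> \<le> L * norm t" using h(1)[of "t + x" x] by simp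
      also have "\<dots> \<le> \<bar>L\<bar> * d" using t by (intro mult_mono) auto
      finally have "\<bar>h (t + x) - h x\<bar>\<^sup>2 \<le> (\<bar>L\<bar> * d)\<^sup>2" by (intro power_mono) auto
      then show ?thesis using True by (simp add: power_mult_distrib ennreal_leI)
    next
      case False
      then have nx: "\<bar>S\<bar> + 1 < norm x" by simp
      have "norm x \<le> norm (t + x) + norm t" using norm_triangle_ineq4[of "t + x" t] by simp
      then have "S < norm (t + x)" using nx t d by linarith
      then have "h (t + x) = 0" "h x = 0" using h(2)[of "t + x"] h(2)[of x] nx by auto
      then show ?thesis by simp
    qed
    have "(\<integral>\<^sup>+x. ennreal ((h (t + x) - h x)\<^sup>2) \<partial>lborel) \<le> ennreal (L\<^sup>2 * d\<^sup>2) * ennreal V"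
      using nn_integral_mono[OF pt, of lborel "\<lambda>x. x"] by (simp add: nn_integral_cmult_indicator V)
    also have "\<dots> = ennreal (L\<^sup>2 * d\<^sup>2 * V)" using V by (simp add: ennreal_mult)
    also have "\<dots> \<le> ennreal (e / 8)"
    proof (rule ennreal_leI)
      have "d\<^sup>2 \<le> (sqrt (e / (8 * ((L\<^sup>2 + 1) * (V + 1)))))\<^sup>2" using d by (intro power_mono) (auto simp: d_def)
      also have "\<dots> = e / (8 * ((L\<^sup>2 + 1) * (V + 1)))" using e LV by (intro real_sqrt_pow2 divide_nonneg_pos) auto
      finally have "d\<^sup>2 * (8 * ((L\<^sup>2 + 1) * (V + 1))) \<le> e" using LV by (simp add: pos_le_divide_eq)
      moreover have "L\<^sup>2 * V \<le> (L\<^sup>2 + 1) * (V + 1)" using V by (intro mult_mono) auto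
      then have "d\<^sup>2 * (8 * (L\<^sup>2 * V)) \<le> d\<^sup>2 * (8 * ((L\<^sup>2 + 1) * (V + 1)))" by (intro mult_left_mono) auto
      ultimately show "L\<^sup>2 * d\<^sup>2 * V \<le> e / 8" by (simp add: mult_ac)
    qed
    finally show ?thesis .
  qed
  have "(\<integral>\<^sup>+x. ennreal ((u (t + x) - u x)\<^sup>2) \<partial>lborel) \<le> ennreal e" if t: "norm t < d" for t
  proof -
    have 1: "(\<integral>\<^sup>+x. ennreal ((u (t + x) - h (t + x))\<^sup>2) \<partial>lborel) \<le> ennreal (e / 16)"
      using h(3) nn_integral_lborel_translate[of "\<lambda>x. ennreal ((u x - h x)\<^sup>2)" t] by simp
    have 2: "(\<integral>\<^sup>+x. ennreal ((h x - u x)\<^sup>2) \<partial>lborel) \<le> ennreal (e / 16)"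
      using h(3) by (simp add: power2_commute)
    have 3: "(\<integral>\<^sup>+x. ennreal (((u (t + x) - h (t + x)) + (h x - u x))\<^sup>2) \<partial>lborel) \<le> ennreal (2 * (e / 16) + 2 * (e / 16))"
      by (rule nn_integral_square_add_le[OF _ _ 1 2]) (use e in auto)
    have "(\<integral>\<^sup>+x. ennreal ((((u (t + x) - h (t + x)) + (h x - u x)) + (h (t + x) - h x))\<^sup>2) \<partial>lborel) \<le> ennreal (2 * (2 * (e / 16) + 2 * (e / 16)) + 2 * (e / 8))"
      by (rule nn_integral_square_add_le[OF _ _ 3 hd[OF t]]) (use e in auto)
    also have "\<dots> \<le> ennreal e" using e by (intro ennreal_leI) simp
    finally show ?thesis by simp
  qed
  then show ?thesis using d by blast
qed

section \<open>Smooth approximation in the weighted Sobolev space\<close>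

lemma exists_mollifier:
  "\<exists>\<eta> r. test_fun (\<eta> :: real ^ 'n \<Rightarrow> real) \<and> (\<forall>x. 0 \<le> \<eta> x) \<and> integrable lborel \<eta> \<and> (\<integral>x. \<eta> x \<partial>lborel) = 1 \<and> 0 < r \<and> (\<forall>x. r < norm x \<longrightarrow> \<eta> x = 0)"
proof -
  let ?b = "bump 1 (vec (- 1)) (vec 1) :: real ^ 'n \<Rightarrow> real"
  have t: "test_fun ?b" by (rule test_fun_bump) simp
  have i: "integrable lborel ?b"
    using test_fun_integrable_mult(1)[OF locally_integrable_bounded[of "\<lambda>_. 1" 1] t] by simp
  have cont: "continuous_on UNIV ?b" by (rule smooth_continuous[OF test_fun_smooth[OF t]])
  have "(\<integral>x. ?b x \<partial>lborel) \<noteq> 0"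
  proof
    assume "(\<integral>x. ?b x \<partial>lborel) = 0"
    then have "AE x in lborel. ?b x = 0"
      by (subst (asm) integral_nonneg_eq_0_iff_AE[OF i]) (auto simp: bump_bounds)
    then have "AE x in lborel. x \<notin> box (vec (- 1)) (vec 1 :: real ^ 'n)"
      by eventually_elim (use bump_pos[of 1] in fastforce)
    then have "emeasure lborel (box (vec (- 1)) (vec 1 :: real ^ 'n)) = 0"
      by (subst (asm) AE_iff_measurable[of "box (vec (- 1)) (vec 1)"]) auto
    moreover have "emeasure lborel (box (vec (- 1)) (vec 1 :: real ^ 'n)) \<noteq> 0"
    proof -
      have b: "(vec 1 - vec (- 1) :: real ^ 'n) \<bullet> b = 2" "(vec (- 1) :: real ^ 'n) \<bullet> b \<le> vec 1 \<bullet> b" if "b \<in> Basis" for b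
        using that by (auto simp: Basis_vec_def inner_axis)
      have "emeasure lborel (box (vec (- 1)) (vec 1 :: real ^ 'n)) = ennreal (\<Prod>b\<in>Basis. (vec 1 - vec (- 1) :: real ^ 'n) \<bullet> b)"
        by (rule emeasure_lborel_box) (rule b(2))
      also have "(\<Prod>b\<in>Basis. (vec 1 - vec (- 1) :: real ^ 'n) \<bullet> b) = (\<Prod>b\<in>(Basis :: (real ^ 'n) set). 2)"
        by (rule prod.cong[OF refl b(1)])
      finally show ?thesis by simp
    qed
    ultimately show False by simp
  qed
  moreover have "0 \<le> (\<integral>x. ?b x \<partial>lborel)" by (intro integral_nonneg_AE) (simp add: bump_bounds)
  ultimately have I: "0 < (\<integral>x. ?b x \<partial>lborel)" by simp
  define \<eta> where "\<eta> = (\<lambda>x. (1 / (\<integral>x. ?b x \<partial>lborel)) * ?b x)"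
  obtain r where r: "0 < r" "box (vec (- 1)) (vec 1 :: real ^ 'n) \<subseteq> ball 0 r"
    using bounded_subset_ballD[OF bounded_box] by blast
  have "?b x = 0" if "r < norm x" for x using r that by (intro bump_eq_0) auto
  moreover have "test_fun \<eta>" unfolding \<eta>_def by (rule test_fun_cmult[OF t])
  ultimately show ?thesis
    using i I r by (intro exI[of _ \<eta>] exI[of _ r]) (auto simp: \<eta>_def bump_bounds)
qed

locale mollifier =
  fixes \<eta> :: "real ^ 'n \<Rightarrow> real" and \<rho>0 :: real
  assumes test: "test_fun \<eta>" and nonneg: "\<And>x. 0 \<le> \<eta> x" and int: "integrable lborel \<eta>" and int1: "(\<integral>x. \<eta> x \<partial>lborel) = 1"
    and \<rho>0: "0 < \<rho>0" and supp: "\<And>x. \<rho>0 < norm x \<Longrightarrow> \<eta> x = 0"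
begin

lemma \<eta>_measurable[measurable]: "\<eta> \<in> borel_measurable borel"
  by (rule borel_measurable_continuous_onI[OF smooth_continuous[OF test_fun_smooth[OF test]]])

text \<open>
  Averages of \<open>u\<close> over the \<open>d\<close>-scaled kernel. With the scaling inside the argument of \<open>u\<close>, the average is an expectation under a
  fixed probability measure \<open>N\<close>; \<open>kern d\<close> is the reflected kernel for which \<open>moll d u\<close> becomes a convolution.
\<close>
definition moll :: "real \<Rightarrow> (real ^ 'n \<Rightarrow> real) \<Rightarrow> real ^ 'n \<Rightarrow> real" where
  "moll d u y = (\<integral>z. \<eta> z * u (y + d *\<^sub>R z) \<partial>lborel)"

definition kern :: "real \<Rightarrow> real ^ 'n \<Rightarrow> real" where
  "kern d t = (1 / d ^ CARD('n)) * \<eta> (0 + (- 1 / d) *\<^sub>R t)"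

definition N :: "(real ^ 'n) measure" where "N = density lborel (\<lambda>x. ennreal (\<eta> x))"

lemma sets_N[simp, measurable_cong]: "sets N = sets borel" by (simp add: N_def)

sublocale N: prob_space N
proof
  have "(\<integral>\<^sup>+x. ennreal (\<eta> x) \<partial>lborel) = 1"
    using nn_integral_eq_integral[OF int] nonneg int1 by simp
  then show "emeasure N (space N) = 1" by (simp add: N_def emeasure_density)
qed

lemma moll_eq_kern:
  assumes d: "0 < d" and [measurable]: "u \<in> borel_measurable borel"
  shows "moll d u y = (\<integral>x. u x * kern d (y - x) \<partial>lborel)"
proof -
  have [measurable]: "kern d \<in> borel_measurable borel" unfolding kern_def by measurable
  have "(\<integral>x. u x * kern d (y - x) \<partial>lborel) = d ^ CARD('n) *\<^sub>R (\<integral>z. u (y + d *\<^sub>R z) * kern d (y - (y + d *\<^sub>R z)) \<partial>lborel)"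
    using integral_lborel_affine(1)[OF d, of "\<lambda>x. u x * kern d (y - x)" y] by simp
  also have "\<dots> = (\<integral>z. d ^ CARD('n) * (u (y + d *\<^sub>R z) * kern d (y - (y + d *\<^sub>R z))) \<partial>lborel)" by simp
  also have "\<dots> = moll d u y" unfolding moll_def kern_def using d
    by (intro Bochner_Integration.integral_cong) auto
  finally show ?thesis by simp
qed

lemma test_kern: "0 < d \<Longrightarrow> test_fun (kern d)"
  unfolding kern_def[abs_def] by (intro test_fun_cmult test_fun_affine test) auto

lemma moll_has_derivative:
  assumes d: "0 < d" and u: "integrable lborel u"
  shows "(moll d u has_derivative (\<lambda>h. \<integral>x. u x * (gradient (kern d) (y - x) \<bullet> h) \<partial>lborel)) (at y)"
proof -
  have [measurable]: "u \<in> borel_measurable borel" using borel_measurable_integrable[OF u] by simp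
  obtain C where C: "\<And>x. \<bar>kern d x\<bar> \<le> C" using test_fun_bounded[OF test_kern[OF d]] by blast
  obtain B where B: "\<And>x. norm (gradient (kern d) x) \<le> B" using test_fun_gradient_bounded[OF test_kern[OF d]] by blast
  have df: "kern d differentiable (at x)" for x by (rule smooth_differentiable[OF test_fun_smooth[OF test_kern[OF d]]])
  have "((\<lambda>y. \<integral>x. u x *\<^sub>R kern d (y - x) \<partial>lborel) has_derivative (\<lambda>h. \<integral>x. u x *\<^sub>R (gradient (kern d) (y - x) \<bullet> h) \<partial>lborel)) (at y)"
  proof (rule has_derivative_convolution[OF _ u has_derivative_gradient[OF df]])
    show "norm (kern d z) \<le> C" for z using C by simp
    show "norm (kern d (z + h) - kern d z) \<le> B * norm h" for z h using lipschitz_from_gradient[OF df B] by simp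
  qed simp
  moreover have "moll d u = (\<lambda>y. \<integral>x. u x *\<^sub>R kern d (y - x) \<partial>lborel)" by (rule ext) (simp add: moll_eq_kern[OF d])
  ultimately show ?thesis by simp
qed

lemma moll_bounded:
  assumes d: "0 < d" and u: "integrable lborel u"
  shows "\<exists>C. \<forall>y. \<bar>moll d u y\<bar> \<le> C"
proof -
  have [measurable]: "u \<in> borel_measurable borel" using borel_measurable_integrable[OF u] by simp
  have [measurable]: "kern d \<in> borel_measurable borel" unfolding kern_def by measurable
  obtain C where C: "0 \<le> C" "\<And>x. \<bar>kern d x\<bar> \<le> C" using test_fun_bounded[OF test_kern[OF d]] by blast
  have "\<bar>moll d u y\<bar> \<le> (\<integral>x. \<bar>u x\<bar> * C \<partial>lborel)" for y
  proof -
    have "\<bar>moll d u y\<bar> \<le> (\<integral>x. \<bar>u x * kern d (y - x)\<bar> \<partial>lborel)"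
      unfolding moll_eq_kern[OF d \<open>u \<in> borel_measurable borel\<close>] by (rule integral_abs_bound)
    also have "\<dots> \<le> (\<integral>x. \<bar>u x\<bar> * C \<partial>lborel)"
    proof (rule integral_mono)
      show i: "integrable lborel (\<lambda>x. \<bar>u x\<bar> * C)" using u by simp
      show "integrable lborel (\<lambda>x. \<bar>u x * kern d (y - x)\<bar>)"
        by (rule Bochner_Integration.integrable_bound[OF i]) (use C in \<open>auto simp: abs_mult intro!: AE_I2 mult_left_mono\<close>)
      show "\<bar>u x * kern d (y - x)\<bar> \<le> \<bar>u x\<bar> * C" for x using C by (auto simp: abs_mult intro!: mult_left_mono)
    qed
    finally show ?thesis .
  qed
  then show ?thesis by blast
qed

lemma moll_eq_0:
  assumes "\<And>x. R < norm x \<Longrightarrow> u x = 0" "0 < d" "R + d * \<rho>0 < norm y"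
  shows "moll d u y = 0"
proof -
  have "\<eta> z * u (y + d *\<^sub>R z) = 0" for z
  proof (cases "norm z \<le> \<rho>0")
    case True
    have "norm y \<le> norm (y + d *\<^sub>R z) + norm (d *\<^sub>R z)" using norm_triangle_ineq4[of "y + d *\<^sub>R z" "d *\<^sub>R z"] by simp
    also have "norm (d *\<^sub>R z) \<le> d * \<rho>0" using True assms(2) by (simp add: mult_left_mono)
    finally have "R < norm (y + d *\<^sub>R z)" using assms(3) by simp
    then show ?thesis using assms(1) by simp
  next
    case False then show ?thesis using supp by simp
  qed
  then have "(\<lambda>z. \<eta> z * u (y + d *\<^sub>R z)) = (\<lambda>z. 0)" by (rule ext)
  then show ?thesis by (simp only: moll_def Bochner_Integration.integral_zero)
qed

text \<open>
  Jensen's inequality bounds \<open>(moll d u - u)\<^sup>2\<close> by the average of the squared increments of \<open>u\<close> over translations shorter than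
  \<open>d \<rho>0\<close>.
\<close>
lemma moll_L2:
  assumes d: "0 < d" and u: "integrable lborel u" and e: "0 \<le> e"
    and tr: "\<And>t. norm t \<le> d * \<rho>0 \<Longrightarrow> (\<integral>\<^sup>+x. ennreal ((u (t + x) - u x)\<^sup>2) \<partial>lborel) \<le> ennreal e"
  shows "(\<integral>\<^sup>+y. ennreal ((moll d u y - u y)\<^sup>2) \<partial>lborel) \<le> ennreal e"
proof -
  have um[measurable]: "u \<in> borel_measurable borel" using borel_measurable_integrable[OF u] by simp
  interpret LN: pair_sigma_finite "lborel :: (real ^ 'n) measure" N ..
  have iN: "integrable N (\<lambda>z. u (y + d *\<^sub>R z))" for y
  proof -
    obtain C where C: "0 \<le> C" "\<And>x. \<bar>\<eta> x\<bar> \<le> C" using test_fun_bounded[OF test] by blast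
    have i: "integrable lborel (\<lambda>z. C * u (y + d *\<^sub>R z))"
      using integral_lborel_affine(2)[OF d um, of y] u by simp
    have "integrable lborel (\<lambda>z. \<eta> z *\<^sub>R u (y + d *\<^sub>R z))"
      by (rule Bochner_Integration.integrable_bound[OF i]) (use C in \<open>auto simp: abs_mult intro!: AE_I2 mult_right_mono\<close>)
    then show ?thesis unfolding N_def by (subst integrable_density) (auto simp: nonneg)
  qed
  have mN: "moll d u y = (\<integral>z. u (y + d *\<^sub>R z) \<partial>N)" for y
    unfolding N_def moll_def by (subst integral_density) (auto simp: nonneg)
  have jensen: "ennreal ((moll d u y - u y)\<^sup>2) \<le> (\<integral>\<^sup>+z. ennreal ((u (y + d *\<^sub>R z) - u y)\<^sup>2) \<partial>N)" for y
  proof (cases "integrable N (\<lambda>z. (u (y + d *\<^sub>R z) - u y)\<^sup>2)")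
    case False
    then have "(\<integral>\<^sup>+z. ennreal ((u (y + d *\<^sub>R z) - u y)\<^sup>2) \<partial>N) = \<infinity>"
      by (subst (asm) integrable_iff_bounded) (auto simp: less_top[symmetric])
    then show ?thesis by simp
  next
    case True
    let ?X = "\<lambda>z. u (y + d *\<^sub>R z) - u y"
    have iX: "integrable N ?X" using iN by simp
    have "0 \<le> N.variance ?X" by (rule N.variance_positive)
    also have "N.variance ?X = (\<integral>z. (?X z)\<^sup>2 \<partial>N) - (\<integral>z. ?X z \<partial>N)\<^sup>2" by (rule N.variance_eq[OF iX True])
    also have "(\<integral>z. ?X z \<partial>N) = moll d u y - u y" using iN N.prob_space by (simp add: mN Bochner_Integration.integral_diff)
    finally have "(moll d u y - u y)\<^sup>2 \<le> (\<integral>z. (?X z)\<^sup>2 \<partial>N)" by simp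
    then show ?thesis by (subst nn_integral_eq_integral[OF True]) (auto intro: ennreal_leI)
  qed
  have "(\<integral>\<^sup>+y. ennreal ((moll d u y - u y)\<^sup>2) \<partial>lborel) \<le> (\<integral>\<^sup>+y. \<integral>\<^sup>+z. ennreal ((u (y + d *\<^sub>R z) - u y)\<^sup>2) \<partial>N \<partial>lborel)"
    by (intro nn_integral_mono jensen)
  also have "\<dots> = (\<integral>\<^sup>+z. \<integral>\<^sup>+y. ennreal ((u (y + d *\<^sub>R z) - u y)\<^sup>2) \<partial>lborel \<partial>N)"
    by (rule LN.Fubini'[symmetric]) measurable
  also have "\<dots> = (\<integral>\<^sup>+z. ennreal (\<eta> z) * (\<integral>\<^sup>+y. ennreal ((u (y + d *\<^sub>R z) - u y)\<^sup>2) \<partial>lborel) \<partial>lborel)"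
    unfolding N_def by (subst nn_integral_density) (auto intro!: lborel.borel_measurable_nn_integral)
  also have "\<dots> \<le> (\<integral>\<^sup>+z. ennreal (\<eta> z) * ennreal e \<partial>lborel)"
  proof (rule nn_integral_mono)
    fix z :: "real ^ 'n"
    show "ennreal (\<eta> z) * (\<integral>\<^sup>+y. ennreal ((u (y + d *\<^sub>R z) - u y)\<^sup>2) \<partial>lborel) \<le> ennreal (\<eta> z) * ennreal e"
    proof (cases "norm z \<le> \<rho>0")
      case True
      then have "norm (d *\<^sub>R z) \<le> d * \<rho>0" using d by (simp add: mult_left_mono)
      from tr[OF this] show ?thesis by (intro mult_left_mono) (auto simp: add.commute)
    next
      case False then show ?thesis using supp by simp
    qed
  qed
  also have "\<dots> = ennreal e"
    using nn_integral_eq_integral[OF int] nonneg int1 by (simp add: nn_integral_multc)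
  finally show ?thesis .
qed

text \<open>
  Differentiate the kernel instead of \<open>u\<close>; as a function of the integration variable the kernel is a test function, so the weak gradient takes the
  derivative back.
\<close>
lemma partial_moll:
  assumes d: "0 < d" and u: "integrable lborel u" and G: "is_weak_gradient u G"
  shows "partial i (moll d u) y = moll d (\<lambda>x. G x $ i) y"
proof -
  have Gm: "(\<lambda>x. G x $ i) \<in> borel_measurable borel"
    using locally_integrable_component[of G i] G unfolding is_weak_gradient_def locally_integrable_def by blast
  have df: "kern d differentiable (at x)" for x by (rule smooth_differentiable[OF test_fun_smooth[OF test_kern[OF d]]])
  let ?\<phi> = "\<lambda>x. kern d (y + (- 1) *\<^sub>R x)"
  have t: "test_fun ?\<phi>" by (rule test_fun_affine[OF test_kern[OF d]]) simp
  have p: "partial i ?\<phi> x = - partial i (kern d) (y - x)" for x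
    using partial_affine[where y=y and c="- 1" and x=x and i=i, OF df] by simp
  have "partial i (moll d u) y = (\<integral>x. u x * (gradient (kern d) (y - x) \<bullet> axis i 1) \<partial>lborel)"
    by (rule partial_eq[OF moll_has_derivative[OF d u]])
  also have "\<dots> = - (\<integral>x. u x * partial i ?\<phi> x \<partial>lborel)"
    unfolding p by (simp add: inner_axis partial_eq_gradient)
  also have "\<dots> = (\<integral>x. G x $ i * ?\<phi> x \<partial>lborel)"
    using G t unfolding is_weak_gradient_def by simp
  also have "\<dots> = moll d (\<lambda>x. G x $ i) y" by (simp add: moll_eq_kern[OF d Gm])
  finally show ?thesis .
qed

end

text \<open>
  The radius \<open>e\<close> bounds the squared distance, which keeps square roots out of the limits below.
\<close>
definition L2_close :: "(real ^ 'n) measure \<Rightarrow> real \<Rightarrow> (real ^ 'n \<Rightarrow> real) \<Rightarrow> (real ^ 'n \<Rightarrow> real) \<Rightarrow> bool" where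
  "L2_close M e f g \<longleftrightarrow> (\<integral>\<^sup>+x. ennreal ((f x - g x)\<^sup>2) \<partial>M) \<le> ennreal e"

definition C1_bounded :: "(real ^ 'n \<Rightarrow> real) \<Rightarrow> bool" where
  "C1_bounded F \<longleftrightarrow> (\<forall>x. F differentiable (at x)) \<and> (\<exists>C. \<forall>x. \<bar>F x\<bar> \<le> C) \<and> (\<exists>B. \<forall>x. norm (gradient F x) \<le> B) \<and> continuous_on UNIV (gradient F)"

text \<open>
  On a ball containing the supports of \<open>u\<close> and of its mollifications, \<open>\<rho>\<close> lies between two positive constants, so there the norm of
  \<open>L\<^sup>2(\<rho>)\<close> is equivalent to that of \<open>L\<^sup>2\<close> of Lebesgue measure, where mollification converges by \<open>L2_translation_continuous\<close>.
\<close>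
lemma compact_support_smooth_approx:
  fixes u :: "real ^ 'n \<Rightarrow> real"
  assumes \<rho>: "continuous_on UNIV \<rho>" "\<And>x. 0 < \<rho> x" and u: "is_weak_gradient u v"
    and u2: "L2 (density_measure \<rho>) u" "\<And>i. L2 (density_measure \<rho>) (\<lambda>x. v x $ i)"
    and zero_out: "\<And>x. R < norm x \<Longrightarrow> u x = 0" "\<And>x. R < norm x \<Longrightarrow> v x = 0" and e: "0 < e"
  shows "\<exists>F. C1_bounded F \<and> L2_close (density_measure \<rho>) e F u \<and> (\<forall>i. L2_close (density_measure \<rho>) e (\<lambda>x. gradient F x $ i) (\<lambda>x. v x $ i))"
proof -
  obtain \<eta> \<rho>0 where "test_fun (\<eta> :: real ^ 'n \<Rightarrow> real)" "\<And>x. 0 \<le> \<eta> x" "integrable lborel \<eta>" "(\<integral>x. \<eta> x \<partial>lborel) = 1" "0 < \<rho>0" "\<And>x. \<rho>0 < norm x \<Longrightarrow> \<eta> x = 0"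
    using exists_mollifier by blast
  then interpret mollifier \<eta> \<rho>0 by unfold_locales
  have [measurable]: "\<rho> \<in> borel_measurable borel" by (rule borel_measurable_continuous_onI[OF \<rho>(1)])
  define R1 where "R1 = \<bar>R\<bar> + \<rho>0"
  have comp: "compact (\<rho> ` cball 0 R1)" using \<rho>(1) by (intro compact_continuous_image) (auto intro: continuous_on_subset)
  have ne: "\<rho> ` cball 0 R1 \<noteq> {}" using \<rho>0 by (auto simp: R1_def)
  obtain c where c: "0 < c" "\<And>x. norm x \<le> R1 \<Longrightarrow> c \<le> \<rho> x"
  proof -
    obtain s where "s \<in> \<rho> ` cball 0 R1" "\<forall>t\<in>\<rho> ` cball 0 R1. s \<le> t" using compact_attains_inf[OF comp ne] by blast
    then show thesis using that[of s] \<rho>(2) by auto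
  qed
  obtain C where C: "0 < C" "\<And>x. norm x \<le> R1 \<Longrightarrow> \<rho> x \<le> C"
  proof -
    obtain s where "s \<in> \<rho> ` cball 0 R1" "\<forall>t\<in>\<rho> ` cball 0 R1. t \<le> s" using compact_attains_sup[OF comp ne] by blast
    then show thesis using that[of s] \<rho>(2) by auto
  qed
  have good: "integrable lborel (\<lambda>x. (f x)\<^sup>2) \<and> integrable lborel f \<and> f \<in> borel_measurable borel"
    if f: "L2 (density_measure \<rho>) f" and z: "\<And>x. R < norm x \<Longrightarrow> f x = 0" for f
  proof -
    have m[measurable]: "f \<in> borel_measurable borel" using f by (simp add: L2_def density_measure_def)
    have "integrable lborel (\<lambda>x. \<rho> x * (f x)\<^sup>2)"
      using f \<rho>(2) unfolding L2_def density_measure_def by (subst (asm) integrable_density) (auto simp: less_imp_le)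
    then have i: "integrable lborel (\<lambda>x. (1 / c) * (\<rho> x * (f x)\<^sup>2))" by simp
    have z': "f x = 0" if "\<not> norm x \<le> R1" for x using that \<rho>0 by (intro z) (auto simp: R1_def)
    have i2: "integrable lborel (\<lambda>x. (f x)\<^sup>2)"
    proof (rule Bochner_Integration.integrable_bound[OF i])
      show "AE x in lborel. norm ((f x)\<^sup>2) \<le> norm ((1 / c) * (\<rho> x * (f x)\<^sup>2))"
      proof (rule AE_I2)
        fix x
        show "norm ((f x)\<^sup>2) \<le> norm ((1 / c) * (\<rho> x * (f x)\<^sup>2))"
        proof (cases "norm x \<le> R1")
          case True
          then have "c * (f x)\<^sup>2 \<le> \<rho> x * (f x)\<^sup>2" by (intro mult_right_mono c) auto
          then show ?thesis using c(1) \<rho>(2)[of x] by (simp add: abs_mult pos_le_divide_eq mult.commute)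
        qed (simp add: z')
      qed
    qed simp
    have "emeasure lborel (cball (0::real ^ 'n) R1) < \<infinity>" by (rule emeasure_compact_finite) simp
    then have "integrable lborel (\<lambda>x :: real ^ 'n. indicat_real (cball 0 R1) x + (f x)\<^sup>2)"
      by (intro Bochner_Integration.integrable_add i2 integrable_real_indicator) auto
    then have "integrable lborel f"
    proof (rule Bochner_Integration.integrable_bound)
      show "AE x in lborel. norm (f x) \<le> norm (indicat_real (cball 0 R1) x + (f x)\<^sup>2)"
      proof (rule AE_I2)
        fix x
        have "\<bar>f x\<bar> \<le> 1 + (f x)\<^sup>2" using zero_le_power2[of "\<bar>f x\<bar> - 1"] by (simp add: power2_diff)
        then show "norm (f x) \<le> norm (indicat_real (cball 0 R1) x + (f x)\<^sup>2)"
          using z'[of x] by (cases "norm x \<le> R1") auto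
      qed
    qed simp
    then show ?thesis using i2 m by simp
  qed
  note gu = good[OF u2(1) zero_out(1)]
  have gv: "integrable lborel (\<lambda>x. (v x $ i)\<^sup>2) \<and> integrable lborel (\<lambda>x. v x $ i) \<and> (\<lambda>x. v x $ i) \<in> borel_measurable borel" for i
    by (rule good[OF u2(2)]) (simp add: zero_out(2))
  have e': "0 < e / C" using e C by simp
  have "\<exists>d>0. \<forall>t. norm t < d \<longrightarrow> (\<integral>\<^sup>+x. ennreal ((u (t + x) - u x)\<^sup>2) \<partial>lborel) \<le> ennreal (e / C)"
    by (rule L2_translation_continuous[where R=R, OF _ _ _ e']) (use gu zero_out(1) in auto)
  then obtain d0 where d0: "0 < d0" "\<And>t. norm t < d0 \<Longrightarrow> (\<integral>\<^sup>+x. ennreal ((u (t + x) - u x)\<^sup>2) \<partial>lborel) \<le> ennreal (e / C)"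
    by blast
  have "\<forall>i. \<exists>d>0. \<forall>t. norm t < d \<longrightarrow> (\<integral>\<^sup>+x. ennreal ((v (t + x) $ i - v x $ i)\<^sup>2) \<partial>lborel) \<le> ennreal (e / C)"
  proof
    fix i
    show "\<exists>d>0. \<forall>t. norm t < d \<longrightarrow> (\<integral>\<^sup>+x. ennreal ((v (t + x) $ i - v x $ i)\<^sup>2) \<partial>lborel) \<le> ennreal (e / C)"
      by (rule L2_translation_continuous[where R=R, OF _ _ _ e']) (use gv[of i] zero_out(2) in auto)
  qed
  from choice[OF this] obtain dd where dd: "\<And>i. 0 < dd i" "\<And>i t. norm t < dd i \<Longrightarrow> (\<integral>\<^sup>+x. ennreal ((v (t + x) $ i - v x $ i)\<^sup>2) \<partial>lborel) \<le> ennreal (e / C)"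
    by blast
  \<comment> \<open>one mollification scale for \<open>u\<close> and for all components of its weak gradient\<close>
  define dm where "dm = min 1 (min d0 (Min (range dd)))"
  have dm: "0 < dm" "dm \<le> 1" "dm \<le> d0" "\<And>i. dm \<le> dd i"
  proof -
    have "0 < Min (range dd)" using dd(1) by simp
    then show "0 < dm" using d0 by (simp add: dm_def)
    show "dm \<le> 1" "dm \<le> d0" by (auto simp: dm_def)
    show "dm \<le> dd i" for i
    proof -
      have "Min (range dd) \<le> dd i" by (rule Min_le) auto
      then show ?thesis by (simp add: dm_def min.coboundedI2)
    qed
  qed
  define d where "d = dm / (2 * (\<rho>0 + 1))"
  have d: "0 < d" "d * \<rho>0 < dm" "d * \<rho>0 \<le> \<rho>0"
  proof -
    show "0 < d" using dm \<rho>0 by (simp add: d_def)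
    have "\<rho>0 / (2 * (\<rho>0 + 1)) < 1" using \<rho>0 by (simp add: divide_less_eq)
    then have "dm * (\<rho>0 / (2 * (\<rho>0 + 1))) < dm * 1" using dm by (intro mult_strict_left_mono) auto
    then show "d * \<rho>0 < dm" by (simp add: d_def)
    have "d \<le> 1" using dm \<rho>0 by (simp add: d_def divide_le_eq)
    then show "d * \<rho>0 \<le> \<rho>0" using \<rho>0 by (simp add: mult_left_le_one_le \<open>0 < d\<close> less_imp_le)
  qed
  have close: "L2_close (density_measure \<rho>) e (moll d f) f"
    if f: "integrable lborel f" and z: "\<And>x. R < norm x \<Longrightarrow> f x = 0"
      and tr: "\<And>t. norm t < dm \<Longrightarrow> (\<integral>\<^sup>+x. ennreal ((f (t + x) - f x)\<^sup>2) \<partial>lborel) \<le> ennreal (e / C)" for f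
  proof -
    have fm[measurable]: "f \<in> borel_measurable borel" using borel_measurable_integrable[OF f] by simp
    have mm[measurable]: "moll d f \<in> borel_measurable borel"
      by (intro borel_measurable_continuous_onI continuous_at_imp_continuous_on ballI) (rule has_derivative_continuous[OF moll_has_derivative[OF d(1) f]])
    have z0: "moll d f x - f x = 0" if "\<not> norm x \<le> R1" for x
    proof -
      have "R < norm x" "R + d * \<rho>0 < norm x" using that d(3) \<rho>0 unfolding R1_def by linarith+
      then show ?thesis using moll_eq_0[OF z d(1)] z by simp
    qed
    have "(\<integral>\<^sup>+x. ennreal ((moll d f x - f x)\<^sup>2) \<partial>density_measure \<rho>) = (\<integral>\<^sup>+x. ennreal (\<rho> x) * ennreal ((moll d f x - f x)\<^sup>2) \<partial>lborel)"
      unfolding density_measure_def by (subst nn_integral_density) auto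
    also have "\<dots> \<le> (\<integral>\<^sup>+x. ennreal C * ennreal ((moll d f x - f x)\<^sup>2) \<partial>lborel)"
    proof (rule nn_integral_mono)
      fix x show "ennreal (\<rho> x) * ennreal ((moll d f x - f x)\<^sup>2) \<le> ennreal C * ennreal ((moll d f x - f x)\<^sup>2)"
        by (cases "norm x \<le> R1") (auto simp: z0 intro!: mult_right_mono ennreal_leI C)
    qed
    also have "\<dots> = ennreal C * (\<integral>\<^sup>+x. ennreal ((moll d f x - f x)\<^sup>2) \<partial>lborel)" by (rule nn_integral_cmult) simp
    also have "\<dots> \<le> ennreal C * ennreal (e / C)"
    proof (intro mult_left_mono moll_L2[OF d(1) f])
      fix t :: "real ^ 'n" assume "norm t \<le> d * \<rho>0"
      then show "(\<integral>\<^sup>+x. ennreal ((f (t + x) - f x)\<^sup>2) \<partial>lborel) \<le> ennreal (e / C)" using d(2) by (intro tr) auto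
    qed (use e' in auto)
    also have "\<dots> = ennreal e" using C e by (simp flip: ennreal_mult)
    finally show ?thesis by (simp add: L2_close_def)
  qed
  define F where "F = moll d u"
  have g: "gradient F x = (\<chi> i. moll d (\<lambda>x. v x $ i) x)" for x
    unfolding gradient_def F_def using partial_moll[OF d(1) _ u] gu by (simp add: vec_eq_iff)
  have "C1_bounded F" unfolding C1_bounded_def
  proof (intro conjI allI)
    show "F differentiable (at x)" for x unfolding F_def using moll_has_derivative[OF d(1), of u] gu differentiableI by blast
    show "\<exists>C. \<forall>x. \<bar>F x\<bar> \<le> C" unfolding F_def using moll_bounded[OF d(1)] gu by blast
    have "\<forall>i. \<exists>K. \<forall>x. \<bar>moll d (\<lambda>x. v x $ i) x\<bar> \<le> K" using moll_bounded[OF d(1)] gv by blast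
    from choice[OF this] obtain K where K: "\<And>i x. \<bar>moll d (\<lambda>x. v x $ i) x\<bar> \<le> K i" by blast
    have "norm (gradient F x) \<le> (\<Sum>i\<in>UNIV. K i)" for x
      by (rule order_trans[OF norm_le_l1_cart sum_mono]) (simp add: g K)
    then show "\<exists>B. \<forall>x. norm (gradient F x) \<le> B" by blast
    have "continuous_on UNIV (moll d (\<lambda>x. v x $ i))" for i
      by (intro continuous_at_imp_continuous_on ballI) (rule has_derivative_continuous[OF moll_has_derivative[OF d(1)]], use gv in blast)
    then show "continuous_on UNIV (gradient F)" unfolding g[abs_def] by (intro continuous_on_vec_lambda)
  qed
  moreover have "L2_close (density_measure \<rho>) e F u"
    unfolding F_def by (rule close) (use gu zero_out(1) d0 dm in auto)
  moreover have "L2_close (density_measure \<rho>) e (\<lambda>x. gradient F x $ i) (\<lambda>x. v x $ i)" for i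
  proof -
    have "L2_close (density_measure \<rho>) e (moll d (\<lambda>x. v x $ i)) (\<lambda>x. v x $ i)"
    proof (rule close)
      fix t :: "real ^ 'n" assume "norm t < dm"
      then show "(\<integral>\<^sup>+x. ennreal ((v (t + x) $ i - v x $ i)\<^sup>2) \<partial>lborel) \<le> ennreal (e / C)"
        using dm(4)[of i] by (intro dd(2)) auto
    qed (use gv[of i] zero_out(2) in auto)
    then show ?thesis by (simp add: g)
  qed
  ultimately show ?thesis by blast
qed

lemma test_fun_support:
  assumes f: "test_fun f" shows "\<exists>R. \<forall>x. R < norm x \<longrightarrow> f x = 0 \<and> gradient f x = 0"
proof -
  have "bounded (closure {x. f x \<noteq> 0})" using f by (simp add: test_fun_def compact_imp_bounded)
  then obtain R where R: "\<And>x. x \<in> closure {x. f x \<noteq> 0} \<Longrightarrow> norm x \<le> R" unfolding bounded_iff by blast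
  have "f x = 0 \<and> gradient f x = 0" if "R < norm x" for x
  proof -
    have x: "x \<notin> closure {x. f x \<noteq> 0}" using R[of x] that by auto
    have "gradient f x = 0" by (simp add: vec_eq_iff gradient_def test_fun_eq_0(2)[OF f x])
    then show ?thesis using test_fun_eq_0(1)[OF f x] by (rule conjI[rotated])
  qed
  then show ?thesis by blast
qed

lemma L2_close_trans:
  assumes m: "f \<in> borel_measurable M" "g \<in> borel_measurable M" "h \<in> borel_measurable M"
    and c: "L2_close M (e / 4) f g" "L2_close M (e / 4) g h" and e: "0 < e"
  shows "L2_close M e f h"
proof -
  have "(\<integral>\<^sup>+x. ennreal (((f x - g x) + (g x - h x))\<^sup>2) \<partial>M) \<le> ennreal (2 * (e / 4) + 2 * (e / 4))"
    by (rule nn_integral_square_add_le) (use m c e in \<open>auto simp: L2_close_def\<close>)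
  then show ?thesis by (simp add: L2_close_def)
qed

text \<open>
  Cut off by \<open>\<kappa> n\<close>, a bump function dilated by the factor \<open>n + 1\<close>: it tends to one, and its gradient is of order \<open>1/(n + 1)\<close>, so by
  dominated convergence the cut-off function and its weak gradient converge in \<open>L\<^sup>2\<close>. The cut-off function has bounded support and can be
  mollified.
\<close>
lemma H1_smooth_approx:
  fixes f :: "real ^ 'n \<Rightarrow> real"
  assumes \<rho>: "continuous_on UNIV \<rho>" "\<And>x. 0 < \<rho> x" and G: "is_weak_gradient f G"
    and f2: "L2 (density_measure \<rho>) f" and G2: "\<And>i. L2 (density_measure \<rho>) (\<lambda>x. G x $ i)" and e: "0 < e"
  shows "\<exists>F. C1_bounded F \<and> L2_close (density_measure \<rho>) e F f \<and> (\<forall>i. L2_close (density_measure \<rho>) e (\<lambda>x. gradient F x $ i) (\<lambda>x. G x $ i))"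
proof -
  let ?M = "density_measure \<rho>"
  let ?b = "bump 1 (vec (- 1)) (vec 1) :: real ^ 'n \<Rightarrow> real"
  have [measurable_cong]: "sets ?M = sets borel" by (simp add: density_measure_def)
  have t: "test_fun ?b" by (rule test_fun_bump) simp
  have b0: "0 < ?b 0" by (rule bump_pos) (auto simp: mem_box_cart)
  \<comment> \<open>normalises the cut-off functions to the value one at the origin\<close>
  define K where "K = 1 / ?b 0"
  have K: "0 < K" using b0 by (simp add: K_def)
  obtain D0 where D0: "0 \<le> D0" "\<And>x. norm (gradient ?b x) \<le> D0" using test_fun_gradient_bounded[OF t] by blast
  define \<kappa> where "\<kappa> = (\<lambda>n::nat. \<lambda>x. K * ?b (0 + (1 / real (Suc n)) *\<^sub>R x))"
  have t\<kappa>: "test_fun (\<kappa> n)" for n unfolding \<kappa>_def by (intro test_fun_cmult test_fun_affine t) auto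
  have \<kappa>b: "0 \<le> \<kappa> n x" "\<kappa> n x \<le> K" for n x
    using K bump_bounds[of 1 "vec (- 1)" "vec 1" "0 + (1 / real (Suc n)) *\<^sub>R x"] unfolding \<kappa>_def
    by (auto simp: mult_left_le simp del: of_nat_Suc)
  have inv0: "(\<lambda>n. 1 / real (Suc n)) \<longlonglongrightarrow> 0"
    using LIMSEQ_inverse_real_of_nat by (simp add: inverse_eq_divide del: of_nat_Suc)
  have \<kappa>1: "(\<lambda>n. \<kappa> n x) \<longlonglongrightarrow> 1" for x
  proof -
    have "(\<lambda>n. 0 + (1 / real (Suc n)) *\<^sub>R x) \<longlonglongrightarrow> 0 + 0 *\<^sub>R x" by (intro tendsto_intros inv0)
    then have "(\<lambda>n. ?b (0 + (1 / real (Suc n)) *\<^sub>R x)) \<longlonglongrightarrow> ?b (0 + 0 *\<^sub>R x)"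
      by (intro continuous_on_tendsto_compose[OF smooth_continuous[OF test_fun_smooth[OF t]]]) auto
    then have "(\<lambda>n. \<kappa> n x) \<longlonglongrightarrow> K * ?b (0 + 0 *\<^sub>R x)" unfolding \<kappa>_def by (intro tendsto_intros)
    then show ?thesis using b0 by (simp add: K_def)
  qed
  have p\<kappa>: "\<bar>gradient (\<kappa> n) x $ i\<bar> \<le> (K * D0) * (1 / real (Suc n))" for n x i
  proof -
    have db: "?b differentiable (at y)" for y by (rule smooth_differentiable[OF test_fun_smooth[OF t]])
    have "\<kappa> n = (\<lambda>x. (\<lambda>x. K) x * (\<lambda>x. ?b (0 + (1 / real (Suc n)) *\<^sub>R x)) x)" by (simp add: \<kappa>_def)
    moreover have "(\<lambda>x. ?b (0 + (1 / real (Suc n)) *\<^sub>R x)) differentiable (at x)"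
      by (rule smooth_differentiable[OF test_fun_smooth[OF test_fun_affine[OF t]]]) simp
    ultimately have "partial i (\<kappa> n) x = K * partial i (\<lambda>x. ?b (0 + (1 / real (Suc n)) *\<^sub>R x)) x"
      using differentiable_partial(2)[of "\<lambda>x. K" x "\<lambda>x. ?b (0 + (1 / real (Suc n)) *\<^sub>R x)" i]
      by (simp add: partial_eq[OF has_derivative_const] del: of_nat_Suc)
    also have "\<dots> = K * ((1 / real (Suc n)) * partial i ?b (0 + (1 / real (Suc n)) *\<^sub>R x))"
      by (subst partial_affine[OF db]) simp
    finally have "\<bar>gradient (\<kappa> n) x $ i\<bar> = K * (1 / real (Suc n)) * \<bar>gradient ?b (0 + (1 / real (Suc n)) *\<^sub>R x) $ i\<bar>"
      using K by (simp add: partial_eq_gradient abs_mult del: of_nat_Suc)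
    also have "\<dots> \<le> K * (1 / real (Suc n)) * D0"
      using K by (intro mult_left_mono order_trans[OF component_le_norm_cart D0(2)]) auto
    finally show ?thesis by (simp add: mult_ac)
  qed
  have p\<kappa>': "\<bar>gradient (\<kappa> n) x $ i\<bar> \<le> K * D0" for n x i
  proof -
    have "(K * D0) * (1 / real (Suc n)) \<le> (K * D0) * 1" using K D0 by (intro mult_left_mono) auto
    then show ?thesis using p\<kappa>[of n x i] by linarith
  qed
  have p\<kappa>0: "(\<lambda>n. gradient (\<kappa> n) x $ i) \<longlonglongrightarrow> 0" for x i
  proof (rule Lim_null_comparison)
    show "\<forall>\<^sub>F n in sequentially. norm (gradient (\<kappa> n) x $ i) \<le> (K * D0) * (1 / real (Suc n))"
      using p\<kappa>[of _ x i] by (intro always_eventually allI) simp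
    show "(\<lambda>n. (K * D0) * (1 / real (Suc n))) \<longlonglongrightarrow> 0" by (rule tendsto_mult_right_zero[OF inv0])
  qed
  have \<kappa>m[measurable]: "\<kappa> n \<in> borel_measurable borel" for n
    by (rule borel_measurable_continuous_onI[OF smooth_continuous[OF test_fun_smooth[OF t\<kappa>]]])
  have g\<kappa>m[measurable]: "(\<lambda>x. gradient (\<kappa> n) x $ i) \<in> borel_measurable borel" for n i
    using borel_measurable_continuous_onI[OF smooth_partial_continuous[OF test_fun_smooth[OF t\<kappa>]], of i n]
    by (simp add: partial_eq_gradient[abs_def])
  have [measurable]: "f \<in> borel_measurable borel" "\<And>i. (\<lambda>x. G x $ i) \<in> borel_measurable borel"
    using f2 G2 by (auto simp: L2_def density_measure_def)
  have fi: "integrable ?M (\<lambda>x. (f x)\<^sup>2)" and Gi: "\<And>i. integrable ?M (\<lambda>x. (G x $ i)\<^sup>2)" using f2 G2 by (auto simp: L2_def)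
  define u where "u = (\<lambda>n x. \<kappa> n x * f x)"
  define v where "v = (\<lambda>n x. \<kappa> n x *\<^sub>R G x + f x *\<^sub>R gradient (\<kappa> n) x)"
  have uv: "is_weak_gradient (u n) (v n)" for n unfolding u_def v_def by (rule is_weak_gradient_test_mult[OF G t\<kappa>])
  have vi: "v n x $ i = \<kappa> n x * G x $ i + f x * gradient (\<kappa> n) x $ i" for n x i by (simp add: v_def)
  have um[measurable]: "u n \<in> borel_measurable borel" for n unfolding u_def by measurable
  have vm[measurable]: "(\<lambda>x. v n x $ i) \<in> borel_measurable borel" for n i unfolding vi by measurable
  have ub: "(u n x)\<^sup>2 \<le> K\<^sup>2 * (f x)\<^sup>2" for n x
    unfolding u_def power_mult_distrib using \<kappa>b by (intro mult_right_mono power_mono) auto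
  have fg: "(f x * gradient (\<kappa> n) x $ i)\<^sup>2 \<le> (K * D0)\<^sup>2 * (f x)\<^sup>2" for n x i
  proof -
    have "(gradient (\<kappa> n) x $ i)\<^sup>2 \<le> (K * D0)\<^sup>2" using p\<kappa>'[of n x i] by (metis abs_le_square_iff abs_of_nonneg abs_ge_zero order_trans)
    then show ?thesis by (subst mult.commute, subst power_mult_distrib) (intro mult_right_mono, auto)
  qed
  have vb: "(v n x $ i)\<^sup>2 \<le> 2 * (K\<^sup>2 * (G x $ i)\<^sup>2) + 2 * ((K * D0)\<^sup>2 * (f x)\<^sup>2)" for n x i
  proof -
    have "(\<kappa> n x * G x $ i)\<^sup>2 \<le> K\<^sup>2 * (G x $ i)\<^sup>2" unfolding power_mult_distrib using \<kappa>b by (intro mult_right_mono power_mono) auto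
    then show ?thesis unfolding vi using square_add_le[of "\<kappa> n x * G x $ i" "f x * gradient (\<kappa> n) x $ i"] fg[of x n i] by linarith
  qed
  have u2: "L2 ?M (u n)" for n unfolding L2_def
  proof
    show "integrable ?M (\<lambda>x. (u n x)\<^sup>2)"
      by (rule Bochner_Integration.integrable_bound[where f="\<lambda>x. K\<^sup>2 * (f x)\<^sup>2"]) (use fi ub in \<open>auto intro!: AE_I2\<close>)
  qed measurable
  have v2: "L2 ?M (\<lambda>x. v n x $ i)" for n i unfolding L2_def
  proof
    show "integrable ?M (\<lambda>x. (v n x $ i)\<^sup>2)"
      by (rule Bochner_Integration.integrable_bound[where f="\<lambda>x. 2 * (K\<^sup>2 * (G x $ i)\<^sup>2) + 2 * ((K * D0)\<^sup>2 * (f x)\<^sup>2)"])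
         (use fi Gi vb in \<open>auto intro!: AE_I2\<close>)
  qed measurable
  have cl: "\<kappa> n x - 1 \<le> K + 1 \<and> - (\<kappa> n x - 1) \<le> K + 1" for n x using \<kappa>b[of n x] K by auto
  have clsq: "(\<kappa> n x - 1)\<^sup>2 \<le> (K + 1)\<^sup>2" for n x
    using cl[of n x] K by (intro abs_le_square_iff[THEN iffD1]) auto
  have lu: "(\<lambda>n. \<integral>x. (u n x - f x)\<^sup>2 \<partial>?M) \<longlonglongrightarrow> (\<integral>x. 0 \<partial>?M)"
  proof (rule integral_dominated_convergence[where w="\<lambda>x. (K + 1)\<^sup>2 * (f x)\<^sup>2"])
    show "integrable ?M (\<lambda>x. (K + 1)\<^sup>2 * (f x)\<^sup>2)" using fi by simp
    show "AE x in ?M. (\<lambda>n. (u n x - f x)\<^sup>2) \<longlonglongrightarrow> 0"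
    proof (rule AE_I2)
      fix x
      have "(\<lambda>n. (\<kappa> n x * f x - f x)\<^sup>2) \<longlonglongrightarrow> (1 * f x - f x)\<^sup>2" by (intro tendsto_intros \<kappa>1)
      then show "(\<lambda>n. (u n x - f x)\<^sup>2) \<longlonglongrightarrow> 0" by (simp add: u_def)
    qed
    show "AE x in ?M. norm ((u n x - f x)\<^sup>2) \<le> (K + 1)\<^sup>2 * (f x)\<^sup>2" for n
    proof (rule AE_I2)
      fix x
      have "u n x - f x = (\<kappa> n x - 1) * f x" by (simp add: u_def algebra_simps)
      then show "norm ((u n x - f x)\<^sup>2) \<le> (K + 1)\<^sup>2 * (f x)\<^sup>2"
        using clsq[of n x] by (simp add: power_mult_distrib mult_right_mono)
    qed
  qed measurable
  have lv: "(\<lambda>n. \<integral>x. (v n x $ i - G x $ i)\<^sup>2 \<partial>?M) \<longlonglongrightarrow> (\<integral>x. 0 \<partial>?M)" for i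
  proof (rule integral_dominated_convergence[where w="\<lambda>x. 2 * ((K + 1)\<^sup>2 * (G x $ i)\<^sup>2) + 2 * ((K * D0)\<^sup>2 * (f x)\<^sup>2)"])
    show "integrable ?M (\<lambda>x. 2 * ((K + 1)\<^sup>2 * (G x $ i)\<^sup>2) + 2 * ((K * D0)\<^sup>2 * (f x)\<^sup>2))" using fi Gi by simp
    show "AE x in ?M. (\<lambda>n. (v n x $ i - G x $ i)\<^sup>2) \<longlonglongrightarrow> 0"
    proof (rule AE_I2)
      fix x
      have "(\<lambda>n. (\<kappa> n x * G x $ i + f x * gradient (\<kappa> n) x $ i - G x $ i)\<^sup>2) \<longlonglongrightarrow> (1 * G x $ i + f x * 0 - G x $ i)\<^sup>2"
        by (intro tendsto_intros \<kappa>1 p\<kappa>0)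
      then show "(\<lambda>n. (v n x $ i - G x $ i)\<^sup>2) \<longlonglongrightarrow> 0" by (simp add: vi)
    qed
    show "AE x in ?M. norm ((v n x $ i - G x $ i)\<^sup>2) \<le> 2 * ((K + 1)\<^sup>2 * (G x $ i)\<^sup>2) + 2 * ((K * D0)\<^sup>2 * (f x)\<^sup>2)" for n
    proof (rule AE_I2)
      fix x
      have e: "v n x $ i - G x $ i = (\<kappa> n x - 1) * G x $ i + f x * gradient (\<kappa> n) x $ i" by (simp add: vi algebra_simps)
      have "((\<kappa> n x - 1) * G x $ i)\<^sup>2 \<le> (K + 1)\<^sup>2 * (G x $ i)\<^sup>2" unfolding power_mult_distrib by (intro mult_right_mono clsq) auto
      then show "norm ((v n x $ i - G x $ i)\<^sup>2) \<le> 2 * ((K + 1)\<^sup>2 * (G x $ i)\<^sup>2) + 2 * ((K * D0)\<^sup>2 * (f x)\<^sup>2)"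
        unfolding e using square_add_le[of "(\<kappa> n x - 1) * G x $ i" "f x * gradient (\<kappa> n) x $ i"] fg[of x n i] by simp
    qed
  qed measurable
  have "\<forall>\<^sub>F n in sequentially. (\<integral>x. (u n x - f x)\<^sup>2 \<partial>?M) < e / 4"
    using lu e by (intro order_tendstoD(2)[where y=0]) auto
  moreover have "\<forall>\<^sub>F n in sequentially. \<forall>i\<in>UNIV. (\<integral>x. (v n x $ i - G x $ i)\<^sup>2 \<partial>?M) < e / 4"
    using lv e by (intro eventually_ball_finite ballI order_tendstoD(2)[where y=0]) auto
  ultimately have "\<forall>\<^sub>F n in sequentially. (\<integral>x. (u n x - f x)\<^sup>2 \<partial>?M) < e / 4 \<and> (\<forall>i\<in>UNIV. (\<integral>x. (v n x $ i - G x $ i)\<^sup>2 \<partial>?M) < e / 4)"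
    by (rule eventually_conj)
  then obtain n where n: "(\<integral>x. (u n x - f x)\<^sup>2 \<partial>?M) < e / 4" "\<And>i. (\<integral>x. (v n x $ i - G x $ i)\<^sup>2 \<partial>?M) < e / 4"
    by (auto simp: eventually_sequentially)
  have toc: "L2_close ?M (e / 4) p q" if "(\<integral>x. (p x - q x)\<^sup>2 \<partial>?M) < e / 4" "L2 ?M p" "L2 ?M q" for p q
  proof -
    have [measurable]: "p \<in> borel_measurable ?M" "q \<in> borel_measurable ?M" using that by (auto simp: L2_def)
    have "integrable ?M (\<lambda>x. (p x - q x)\<^sup>2)"
    proof (rule Bochner_Integration.integrable_bound[where f="\<lambda>x. 2 * (p x)\<^sup>2 + 2 * (q x)\<^sup>2"])
      show "integrable ?M (\<lambda>x. 2 * (p x)\<^sup>2 + 2 * (q x)\<^sup>2)" using that by (auto simp: L2_def)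
      show "AE x in ?M. norm ((p x - q x)\<^sup>2) \<le> norm (2 * (p x)\<^sup>2 + 2 * (q x)\<^sup>2)"
      proof (rule AE_I2)
        fix x show "norm ((p x - q x)\<^sup>2) \<le> norm (2 * (p x)\<^sup>2 + 2 * (q x)\<^sup>2)" using square_add_le[of "p x" "- q x"] by simp
      qed
    qed measurable
    then show ?thesis using that(1) unfolding L2_close_def by (subst nn_integral_eq_integral) (auto intro: ennreal_leI)
  qed
  obtain R where R: "\<And>x. R < norm x \<Longrightarrow> \<kappa> n x = 0" "\<And>x. R < norm x \<Longrightarrow> gradient (\<kappa> n) x = 0"
    using test_fun_support[OF t\<kappa>[of n]] by blast
  have ez: "0 < e / 4" using e by simp
  have uz: "u n x = 0" if "R < norm x" for x using R(1)[OF that] by (simp add: u_def)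
  have vz: "v n x = 0" if "R < norm x" for x using R[OF that] by (simp add: v_def)
  obtain F where F: "C1_bounded F" "L2_close ?M (e / 4) F (u n)" "\<And>i. L2_close ?M (e / 4) (\<lambda>x. gradient F x $ i) (\<lambda>x. v n x $ i)"
    using compact_support_smooth_approx[OF \<rho> uv u2 v2 uz vz ez] by blast
  have Fd: "F differentiable (at x)" for x using F(1) by (simp add: C1_bounded_def)
  have Fm[measurable]: "F \<in> borel_measurable borel"
    by (intro borel_measurable_continuous_onI continuous_at_imp_continuous_on ballI differentiable_imp_continuous_within Fd)
  have gFm[measurable]: "(\<lambda>x. gradient F x $ i) \<in> borel_measurable borel" for i
    using partial_measurable[OF Fd, of i] by (simp add: partial_eq_gradient[abs_def])
  have "L2_close ?M e F f"
    by (rule L2_close_trans[OF _ _ _ F(2) toc[OF n(1) u2 f2] e]) measurable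
  moreover have "L2_close ?M e (\<lambda>x. gradient F x $ i) (\<lambda>x. G x $ i)" for i
    by (rule L2_close_trans[OF _ _ _ F(3) toc[OF n(2) v2 G2] e]) measurable
  ultimately show ?thesis using F(1) by blast
qed

section \<open>Gram matrices and Rayleigh quotients\<close>

definition quad_form :: "nat \<Rightarrow> (nat \<Rightarrow> nat \<Rightarrow> real) \<Rightarrow> (nat \<Rightarrow> real) \<Rightarrow> real" where
  "quad_form m A c = (\<Sum>i<m. \<Sum>j<m. c i * c j * A i j)"

lemma quad_form_scale: "quad_form m A (\<lambda>i. s * c i) = s\<^sup>2 * quad_form m A c"
  by (simp add: quad_form_def sum_distrib_left power2_eq_square mult_ac)

lemma quad_form_tendsto:
  assumes "\<And>i j. i < m \<Longrightarrow> j < m \<Longrightarrow> (\<lambda>n. A n i j) \<longlonglongrightarrow> A' i j" "\<And>i. i < m \<Longrightarrow> (\<lambda>n. c n i) \<longlonglongrightarrow> c' i"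
  shows "(\<lambda>n. quad_form m (A n) (c n)) \<longlonglongrightarrow> quad_form m A' c'"
  unfolding quad_form_def by (intro tendsto_sum tendsto_mult assms) auto

lemma bounded_coordinates_subsequence:
  fixes d :: "nat \<Rightarrow> nat \<Rightarrow> real"
  assumes "\<And>n i. i < m \<Longrightarrow> \<bar>d n i\<bar> \<le> 1"
  shows "\<exists>r \<delta>. strict_mono r \<and> (\<forall>i<m. (\<lambda>n. d (r n) i) \<longlonglongrightarrow> \<delta> i)"
  using assms
proof (induction m)
  case 0
  show ?case by (intro exI[of _ id] exI) (auto simp: strict_mono_def)
next
  case (Suc m)
  then obtain r \<delta> where r: "strict_mono r" "\<And>i. i < m \<Longrightarrow> (\<lambda>n. d (r n) i) \<longlonglongrightarrow> \<delta> i" by (metis less_SucI)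
  have "bounded (range (\<lambda>n. d (r n) m))" using Suc.prems[of m] by (auto simp: bounded_iff)
  from bounded_imp_convergent_subsequence[OF this] obtain l s where s: "strict_mono s" "((\<lambda>n. d (r n) m) \<circ> s) \<longlonglongrightarrow> l" by blast
  show ?case
  proof (intro exI[of _ "r \<circ> s"] exI[of _ "\<delta>(m := l)"] conjI allI impI)
    show "strict_mono (r \<circ> s)" using r(1) s(1) by (rule strict_mono_o)
    fix i assume "i < Suc m"
    then consider "i = m" | "i < m" by linarith
    then show "(\<lambda>n. d ((r \<circ> s) n) i) \<longlonglongrightarrow> (\<delta>(m := l)) i"
    proof cases
      case 1 then show ?thesis using s(2) by (simp add: o_def)
    next
      case 2
      then show ?thesis using LIMSEQ_subseq_LIMSEQ[OF r(2)[OF 2] s(1)] by (simp add: o_def)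
    qed
  qed
qed

text \<open>
  Otherwise there are vectors \<open>c n\<close> violating the inequalities for every \<open>n\<close>. Normalised in the \<open>l\<^sup>1\<close>-norm, they have a limit point
  \<open>\<delta> \<noteq> 0\<close>, where \<open>quad_form m A' \<delta> > 0\<close> and \<open>quad_form m B' \<delta> < (l + e) quad_form m A' \<delta>\<close>; both strict inequalities persist nearby.
\<close>
lemma quadratic_form_perturbation:
  assumes A: "\<And>i j. i < m \<Longrightarrow> j < m \<Longrightarrow> (\<lambda>n. A n i j) \<longlonglongrightarrow> A' i j" and B: "\<And>i j. i < m \<Longrightarrow> j < m \<Longrightarrow> (\<lambda>n. B n i j) \<longlonglongrightarrow> B' i j"
    and pos: "\<And>c. \<exists>i<m. c i \<noteq> 0 \<Longrightarrow> 0 < quad_form m A' c" and le: "\<And>c. \<exists>i<m. c i \<noteq> 0 \<Longrightarrow> quad_form m B' c \<le> l * quad_form m A' c"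
    and e: "0 < e"
  shows "\<exists>n. \<forall>c. (\<exists>i<m. c i \<noteq> 0) \<longrightarrow> 0 < quad_form m (A n) c \<and> quad_form m (B n) c \<le> (l + e) * quad_form m (A n) c"
proof (rule ccontr)
  assume "\<not> ?thesis"
  then have "\<forall>n. \<exists>c. (\<exists>i<m. c i \<noteq> 0) \<and> \<not> (0 < quad_form m (A n) c \<and> quad_form m (B n) c \<le> (l + e) * quad_form m (A n) c)" by blast
  from choice[OF this] obtain c where c: "\<And>n. \<exists>i<m. c n i \<noteq> 0" "\<And>n. \<not> (0 < quad_form m (A n) (c n) \<and> quad_form m (B n) (c n) \<le> (l + e) * quad_form m (A n) (c n))"
    by blast
  define s where "s = (\<lambda>n. 1 / (\<Sum>i<m. \<bar>c n i\<bar>))"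
  have sp: "0 < (\<Sum>i<m. \<bar>c n i\<bar>)" for n
  proof -
    obtain i where i: "i < m" "c n i \<noteq> 0" using c(1) by blast
    have "0 < \<bar>c n i\<bar>" using i by simp
    also have "\<dots> \<le> (\<Sum>i<m. \<bar>c n i\<bar>)" using i by (intro member_le_sum) auto
    finally show ?thesis .
  qed
  then have s: "0 < s n" for n by (simp add: s_def)
  define d where "d = (\<lambda>n i. s n * c n i)"
  have d1: "(\<Sum>i<m. \<bar>d n i\<bar>) = 1" for n
  proof -
    have "(\<Sum>i<m. \<bar>d n i\<bar>) = s n * (\<Sum>i<m. \<bar>c n i\<bar>)"
      using s[of n] by (simp add: d_def abs_mult sum_distrib_left)
    then show ?thesis using sp[of n] by (simp add: s_def)
  qed
  have db: "\<bar>d n i\<bar> \<le> 1" if "i < m" for n i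
    unfolding d1[of n, symmetric] using that by (intro member_le_sum) auto
  have bad: "\<not> (0 < quad_form m (A n) (d n) \<and> quad_form m (B n) (d n) \<le> (l + e) * quad_form m (A n) (d n))" for n
  proof -
    have q: "quad_form m M (d n) = (s n)\<^sup>2 * quad_form m M (c n)" for M unfolding d_def by (rule quad_form_scale)
    have "0 < (s n)\<^sup>2" using s[of n] by simp
    then show ?thesis using c(2)[of n] unfolding q
      by (simp add: zero_less_mult_iff mult.left_commute[of "l + e"] mult_le_cancel_left)
  qed
  obtain r \<delta> where r: "strict_mono r" "\<And>i. i < m \<Longrightarrow> (\<lambda>n. d (r n) i) \<longlonglongrightarrow> \<delta> i"
    using bounded_coordinates_subsequence[of m d, OF db] by blast
  have "(\<lambda>n. \<Sum>i<m. \<bar>d (r n) i\<bar>) \<longlonglongrightarrow> (\<Sum>i<m. \<bar>\<delta> i\<bar>)" by (intro tendsto_intros r(2)) auto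
  then have "(\<Sum>i<m. \<bar>\<delta> i\<bar>) = 1" unfolding d1 by (simp add: LIMSEQ_const_iff)
  then have nz: "\<exists>i<m. \<delta> i \<noteq> 0" by (metis (mono_tags, lifting) abs_zero lessThan_iff sum.neutral zero_neq_one)
  have lA: "(\<lambda>n. quad_form m (A (r n)) (d (r n))) \<longlonglongrightarrow> quad_form m A' \<delta>"
    by (intro quad_form_tendsto r(2) LIMSEQ_subseq_LIMSEQ[OF A r(1), unfolded o_def])
  have lB: "(\<lambda>n. quad_form m (B (r n)) (d (r n))) \<longlonglongrightarrow> quad_form m B' \<delta>"
    by (intro quad_form_tendsto r(2) LIMSEQ_subseq_LIMSEQ[OF B r(1), unfolded o_def])
  have lC: "(\<lambda>n. quad_form m (B (r n)) (d (r n)) - (l + e) * quad_form m (A (r n)) (d (r n))) \<longlonglongrightarrow> quad_form m B' \<delta> - (l + e) * quad_form m A' \<delta>"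
    by (intro tendsto_intros lA lB)
  have neg: "quad_form m B' \<delta> - (l + e) * quad_form m A' \<delta> < 0"
  proof -
    have "0 < e * quad_form m A' \<delta>" using pos[OF nz] e by simp
    then show ?thesis using le[OF nz] by (simp add: distrib_right)
  qed
  have "\<forall>\<^sub>F n in sequentially. 0 < quad_form m (A (r n)) (d (r n)) \<and> quad_form m (B (r n)) (d (r n)) - (l + e) * quad_form m (A (r n)) (d (r n)) < 0"
    using order_tendstoD(1)[OF lA pos[OF nz]] order_tendstoD(2)[OF lC neg] by (rule eventually_conj)
  then obtain n where "0 < quad_form m (A (r n)) (d (r n))" "quad_form m (B (r n)) (d (r n)) - (l + e) * quad_form m (A (r n)) (d (r n)) < 0"
    by (auto simp: eventually_sequentially)
  then show False using bad[of "r n"] by simp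
qed

lemma integral_norm_sq_sum:
  fixes X :: "nat \<Rightarrow> 'a \<Rightarrow> 'b::real_inner"
  assumes "\<And>i j. i < m \<Longrightarrow> j < m \<Longrightarrow> integrable M (\<lambda>x. X i x \<bullet> X j x)"
  shows "integrable M (\<lambda>x. (norm (\<Sum>i<m. c i *\<^sub>R X i x))\<^sup>2)"
    and "(\<integral>x. (norm (\<Sum>i<m. c i *\<^sub>R X i x))\<^sup>2 \<partial>M) = quad_form m (\<lambda>i j. \<integral>x. X i x \<bullet> X j x \<partial>M) c"
proof -
  have e: "(norm (\<Sum>i<m. c i *\<^sub>R X i x))\<^sup>2 = (\<Sum>i<m. \<Sum>j<m. c i * c j * (X i x \<bullet> X j x))" for x
    by (simp add: power2_norm_eq_inner inner_sum_left inner_sum_right sum_distrib_left inner_commute mult_ac)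
  show "integrable M (\<lambda>x. (norm (\<Sum>i<m. c i *\<^sub>R X i x))\<^sup>2)"
    unfolding e using assms by (intro Bochner_Integration.integrable_sum integrable_mult_right) auto
  show "(\<integral>x. (norm (\<Sum>i<m. c i *\<^sub>R X i x))\<^sup>2 \<partial>M) = quad_form m (\<lambda>i j. \<integral>x. X i x \<bullet> X j x \<partial>M) c"
    unfolding e quad_form_def using assms
    by (subst Bochner_Integration.integral_sum, (intro Bochner_Integration.integrable_sum integrable_mult_right, auto)[1],
        intro sum.cong refl, subst Bochner_Integration.integral_sum) auto
qed

lemma L2_mult_integrable:
  assumes "L2 M p" "L2 M q" shows "integrable M (\<lambda>x. p x * q x)"
proof (rule Bochner_Integration.integrable_bound[where f="\<lambda>x. (p x)\<^sup>2 + (q x)\<^sup>2"])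
  show "integrable M (\<lambda>x. (p x)\<^sup>2 + (q x)\<^sup>2)" using assms by (auto simp: L2_def)
  show "(\<lambda>x. p x * q x) \<in> borel_measurable M" using assms by (auto simp: L2_def)
  have "\<bar>p x * q x\<bar> \<le> (p x)\<^sup>2 + (q x)\<^sup>2" for x
  proof -
    have "2 * (\<bar>p x\<bar> * \<bar>q x\<bar>) \<le> (p x)\<^sup>2 + (q x)\<^sup>2" using zero_le_power2[of "\<bar>p x\<bar> - \<bar>q x\<bar>"] by (simp add: power2_diff)
    moreover have "0 \<le> \<bar>p x\<bar> * \<bar>q x\<bar>" by simp
    ultimately show ?thesis unfolding abs_mult by linarith
  qed
  then show "AE x in M. norm (p x * q x) \<le> norm ((p x)\<^sup>2 + (q x)\<^sup>2)" by (intro AE_I2) simp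
qed

text \<open>
  Expand \<open>p' q' - p q\<close> into \<open>(p' - p)(q' - q) + (p' - p) q + (q' - q) p\<close> and apply Young's inequality, with weight \<open>\<surd>e\<close> on the two mixed
  terms.
\<close>
lemma L2_close_mult_integral:
  assumes p: "L2 M p" "L2 M p'" "L2_close M e p' p" and q: "L2 M q" "L2 M q'" "L2_close M e q' q" and e: "0 < e"
  shows "\<bar>(\<integral>x. p' x * q' x \<partial>M) - (\<integral>x. p x * q x \<partial>M)\<bar> \<le> e + sqrt e * (1 + ((\<integral>x. (p x)\<^sup>2 \<partial>M) + (\<integral>x. (q x)\<^sup>2 \<partial>M)) / 2)"
proof -
  have diff: "integrable M (\<lambda>x. (f' x - f x)\<^sup>2)" "(\<integral>x. (f' x - f x)\<^sup>2 \<partial>M) \<le> e" if f: "L2 M f" "L2 M f'" "L2_close M e f' f" for f f'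
  proof -
    have "integrable M (\<lambda>x. (f' x)\<^sup>2 - 2 * (f' x * f x) + (f x)\<^sup>2)"
      using f L2_mult_integrable[OF f(2,1)] by (auto simp: L2_def)
    then show i: "integrable M (\<lambda>x. (f' x - f x)\<^sup>2)" by (simp add: power2_diff algebra_simps)
    have "ennreal (\<integral>x. (f' x - f x)\<^sup>2 \<partial>M) \<le> ennreal e"
      using f(3) unfolding L2_close_def by (subst (asm) nn_integral_eq_integral[OF i]) auto
    then show "(\<integral>x. (f' x - f x)\<^sup>2 \<partial>M) \<le> e" using e by (simp add: ennreal_le_iff)
  qed
  note dp = diff[OF p] and dq = diff[OF q]
  define s where "s = sqrt e"
  have s: "0 < s" "s * s = e" using e by (auto simp: s_def)
  have pt: "\<bar>p' x * q' x - p x * q x\<bar> \<le> ((p' x - p x)\<^sup>2 + (q' x - q x)\<^sup>2) / 2 + ((p' x - p x)\<^sup>2 / s + s * (q x)\<^sup>2) / 2 + ((q' x - q x)\<^sup>2 / s + s * (p x)\<^sup>2) / 2" for x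
  proof -
    have y1: "\<bar>a * b\<bar> \<le> (a\<^sup>2 + b\<^sup>2) / 2" for a b :: real
      using zero_le_power2[of "\<bar>a\<bar> - \<bar>b\<bar>"] by (simp add: power2_diff abs_mult)
    have y2: "\<bar>a * b\<bar> \<le> (a\<^sup>2 / s + s * b\<^sup>2) / 2" for a b :: real
    proof -
      have "\<bar>(a / sqrt s) * (sqrt s * b)\<bar> \<le> ((a / sqrt s)\<^sup>2 + (sqrt s * b)\<^sup>2) / 2" by (rule y1)
      then show ?thesis using s by (simp add: power_divide power_mult_distrib)
    qed
    have "p' x * q' x - p x * q x = (p' x - p x) * (q' x - q x) + (p' x - p x) * q x + (q' x - q x) * p x" by (simp add: algebra_simps)
    then have "\<bar>p' x * q' x - p x * q x\<bar> \<le> \<bar>(p' x - p x) * (q' x - q x)\<bar> + \<bar>(p' x - p x) * q x\<bar> + \<bar>(q' x - q x) * p x\<bar>" by linarith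
    then show ?thesis using y1[of "p' x - p x" "q' x - q x"] y2[of "p' x - p x" "q x"] y2[of "q' x - q x" "p x"] by linarith
  qed
  have ip: "integrable M (\<lambda>x. (p x)\<^sup>2)" "integrable M (\<lambda>x. (q x)\<^sup>2)" using p q by (auto simp: L2_def)
  have i1: "integrable M (\<lambda>x. p' x * q' x)" and i2: "integrable M (\<lambda>x. p x * q x)" using L2_mult_integrable p q by auto
  have "\<bar>(\<integral>x. p' x * q' x \<partial>M) - (\<integral>x. p x * q x \<partial>M)\<bar> = \<bar>\<integral>x. p' x * q' x - p x * q x \<partial>M\<bar>"
    by (subst Bochner_Integration.integral_diff[OF i1 i2]) simp
  also have "\<dots> \<le> (\<integral>x. ((p' x - p x)\<^sup>2 + (q' x - q x)\<^sup>2) / 2 + ((p' x - p x)\<^sup>2 / s + s * (q x)\<^sup>2) / 2 + ((q' x - q x)\<^sup>2 / s + s * (p x)\<^sup>2) / 2 \<partial>M)"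
    by (rule order_trans[OF integral_abs_bound integral_mono[OF _ _ pt]]) (use i1 i2 dp(1) dq(1) ip in auto)
  also have "\<dots> = ((\<integral>x. (p' x - p x)\<^sup>2 \<partial>M) + (\<integral>x. (q' x - q x)\<^sup>2 \<partial>M)) / 2 + ((\<integral>x. (p' x - p x)\<^sup>2 \<partial>M) / s + s * (\<integral>x. (q x)\<^sup>2 \<partial>M)) / 2 + ((\<integral>x. (q' x - q x)\<^sup>2 \<partial>M) / s + s * (\<integral>x. (p x)\<^sup>2 \<partial>M)) / 2"
    using dp(1) dq(1) ip by simp
  also have "\<dots> \<le> (e + e) / 2 + (e / s + s * (\<integral>x. (q x)\<^sup>2 \<partial>M)) / 2 + (e / s + s * (\<integral>x. (p x)\<^sup>2 \<partial>M)) / 2"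
    using dp(2) dq(2) s by (intro add_mono divide_right_mono) auto
  also have "\<dots> = e + s * (1 + ((\<integral>x. (p x)\<^sup>2 \<partial>M) + (\<integral>x. (q x)\<^sup>2 \<partial>M)) / 2)"
  proof -
    have "e / s = s" using s by (simp add: divide_eq_eq)
    then show ?thesis by (simp add: algebra_simps add_divide_distrib)
  qed
  finally show ?thesis by (simp add: s_def)
qed

lemma (in prob_space) L2_bounded:
  assumes [measurable]: "f \<in> borel_measurable M" and b: "\<And>x. \<bar>f x\<bar> \<le> E"
  shows "L2 M f"
  unfolding L2_def
proof
  show "integrable M (\<lambda>x. (f x)\<^sup>2)"
  proof (rule integrable_const_bound[where B="E\<^sup>2"])
    show "AE x in M. norm ((f x)\<^sup>2) \<le> E\<^sup>2" using power_mono[OF b abs_ge_zero, of _ 2] by (intro AE_I2) simp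
  qed measurable
qed measurable

lemma C1_bounded_lin_comb:
  fixes \<Phi> :: "nat \<Rightarrow> real ^ 'n \<Rightarrow> real"
  assumes \<Phi>: "\<And>i. i < m \<Longrightarrow> C1_bounded (\<Phi> i)"
  shows "C1_bounded (lin_comb m c \<Phi>)" "gradient (lin_comb m c \<Phi>) x = (\<Sum>i<m. c i *\<^sub>R gradient (\<Phi> i) x)"
proof -
  have D: "(lin_comb m c \<Phi> has_derivative (\<lambda>h. (\<Sum>i<m. c i *\<^sub>R gradient (\<Phi> i) x) \<bullet> h)) (at x)" for x
  proof -
    have "((\<lambda>x. \<Sum>i<m. c i * \<Phi> i x) has_derivative (\<lambda>h. \<Sum>i<m. c i * (gradient (\<Phi> i) x \<bullet> h))) (at x)"
      using \<Phi> by (intro has_derivative_sum has_derivative_mult_right has_derivative_gradient) (auto simp: C1_bounded_def)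
    then show ?thesis unfolding lin_comb_def[abs_def] by (simp add: inner_sum_left)
  qed
  show g: "gradient (lin_comb m c \<Phi>) x = (\<Sum>i<m. c i *\<^sub>R gradient (\<Phi> i) x)" for x by (rule gradient_unique[OF D])
  have "\<forall>i. \<exists>C B. i < m \<longrightarrow> (\<forall>x. \<bar>\<Phi> i x\<bar> \<le> C) \<and> (\<forall>x. norm (gradient (\<Phi> i) x) \<le> B)" using \<Phi> unfolding C1_bounded_def by blast
  then obtain C B where CB: "\<And>i x. i < m \<Longrightarrow> \<bar>\<Phi> i x\<bar> \<le> C i" "\<And>i x. i < m \<Longrightarrow> norm (gradient (\<Phi> i) x) \<le> B i" by metis
  show "C1_bounded (lin_comb m c \<Phi>)" unfolding C1_bounded_def
  proof (intro conjI allI exI)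
    show "lin_comb m c \<Phi> differentiable (at x)" for x using D differentiableI by blast
    show "\<bar>lin_comb m c \<Phi> x\<bar> \<le> (\<Sum>i<m. \<bar>c i\<bar> * C i)" for x
      unfolding lin_comb_def by (rule order_trans[OF sum_abs sum_mono]) (auto simp: abs_mult intro!: mult_left_mono CB)
    show "norm (gradient (lin_comb m c \<Phi>) x) \<le> (\<Sum>i<m. \<bar>c i\<bar> * B i)" for x
      unfolding g by (rule order_trans[OF norm_sum sum_mono]) (auto intro!: mult_left_mono CB)
    show "continuous_on UNIV (gradient (lin_comb m c \<Phi>))"
      unfolding g[abs_def] using \<Phi> by (intro continuous_intros) (auto simp: C1_bounded_def)
  qed
qed

text \<open>
  The derivative of \<open>S\<close> has operator norm at most one, so its transpose cannot lengthen the gradient of \<open>\<Psi>\<close>.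
\<close>
lemma C1_bounded_comp_contraction:
  fixes \<Psi> :: "real ^ 'n \<Rightarrow> real" and S :: "real ^ 'n \<Rightarrow> real ^ 'n"
  assumes \<Psi>: "C1_bounded \<Psi>" and S: "diff_contraction S"
  shows "(\<Psi> \<circ> S) differentiable (at y)" "norm (gradient (\<Psi> \<circ> S) y) \<le> norm (gradient \<Psi> (S y))"
    "is_weak_gradient (\<Psi> \<circ> S) (gradient (\<Psi> \<circ> S))"
proof -
  have ne: "norm (S x - S y) \<le> norm (x - y)" for x y using S by (simp add: diff_contraction_def)
  show d: "(\<Psi> \<circ> S) differentiable (at y)" for y using \<Psi> S unfolding C1_bounded_def diff_contraction_def by (intro differentiable_chain_at) auto
  show b: "norm (gradient (\<Psi> \<circ> S) y) \<le> norm (gradient \<Psi> (S y))" for y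
  proof -
    obtain S' where S': "(S has_derivative S') (at y)" using S unfolding diff_contraction_def differentiable_def by blast
    have "norm (S' h) \<le> 1 * norm h" for h
    proof (rule derivative_norm_le_lipschitz[OF S'])
      fix z k show "norm (S (z + k) - S z) \<le> 1 * norm k" using ne[of "z + k" z] by simp
    qed
    then have nS': "norm (S' h) \<le> norm h" for h by simp
    have D\<Psi>: "(\<Psi> has_derivative (\<lambda>h. gradient \<Psi> (S y) \<bullet> h)) (at (S y))"
      using \<Psi> by (intro has_derivative_gradient) (simp add: C1_bounded_def)
    have "(\<lambda>h. gradient (\<Psi> \<circ> S) y \<bullet> h) = (\<lambda>h. gradient \<Psi> (S y) \<bullet> S' h)"
      using has_derivative_unique[OF has_derivative_gradient[OF d] diff_chain_at[OF S' D\<Psi>]] by (simp add: o_def)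
    then have "gradient (\<Psi> \<circ> S) y \<bullet> gradient (\<Psi> \<circ> S) y = gradient \<Psi> (S y) \<bullet> S' (gradient (\<Psi> \<circ> S) y)" by (rule fun_cong)
    also have "\<dots> \<le> norm (gradient \<Psi> (S y)) * norm (S' (gradient (\<Psi> \<circ> S) y))" by (rule norm_cauchy_schwarz)
    also have "\<dots> \<le> norm (gradient \<Psi> (S y)) * norm (gradient (\<Psi> \<circ> S) y)" by (intro mult_left_mono nS') auto
    finally have "norm (gradient (\<Psi> \<circ> S) y) * norm (gradient (\<Psi> \<circ> S) y) \<le> norm (gradient \<Psi> (S y)) * norm (gradient (\<Psi> \<circ> S) y)"
      by (simp add: power2_norm_eq_inner[symmetric] power2_eq_square)
    then show ?thesis by (cases "gradient (\<Psi> \<circ> S) y = 0") auto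
  qed
  obtain C B where "\<And>x. \<bar>\<Psi> x\<bar> \<le> C" "\<And>x. norm (gradient \<Psi> x) \<le> B" using \<Psi> unfolding C1_bounded_def by blast
  then show "is_weak_gradient (\<Psi> \<circ> S) (gradient (\<Psi> \<circ> S))"
    by (intro gradient_is_weak_gradient[where C=C and B=B] d) (auto intro: order_trans[OF b])
qed

text \<open>
  The weak gradient is determined up to Lebesgue-null sets only, so its energy is well defined for measures \<open>\<nu>\<close> that do not charge such sets.
\<close>
lemma nn_integral_weak_gradient:
  assumes G: "is_weak_gradient f G" and ac: "\<And>Q. AE x in lborel. Q x \<Longrightarrow> AE x in \<nu>. Q x"
    and i: "integrable \<nu> (\<lambda>x. (norm (G x))\<^sup>2)"
  shows "(\<integral>\<^sup>+x. ennreal ((norm (weak_gradient f x))\<^sup>2) \<partial>\<nu>) = ennreal (\<integral>x. (norm (G x))\<^sup>2 \<partial>\<nu>)"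
proof -
  have "AE x in \<nu>. weak_gradient f x = G x" by (rule ac[OF weak_gradient_AE[OF G]])
  then have "(\<integral>\<^sup>+x. ennreal ((norm (weak_gradient f x))\<^sup>2) \<partial>\<nu>) = (\<integral>\<^sup>+x. ennreal ((norm (G x))\<^sup>2) \<partial>\<nu>)"
    by (intro nn_integral_cong_AE) auto
  then show ?thesis using i by (simp add: nn_integral_eq_integral)
qed

section \<open>Comparison of the min-max values\<close>

text \<open>
  Let \<open>l\<close> be the largest Rayleigh quotient on the span of a given frame \<open>F\<close> of \<open>H\<^sup>1\<close> of the image measure, so \<open>B \<le> l A\<close> for the Gram matrix
  \<open>A\<close> of \<open>F\<close> and the Gram matrix \<open>B\<close> of the weak gradients. Pull back smooth functions \<open>\<Phi>\<close> close to \<open>F\<close> by a map \<open>S n\<close> close to \<open>T\<close>.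
  The Gram matrices of \<open>\<Phi> \<circ> S n\<close>, and of the vector fields \<open>(\<nabla>\<Phi>) \<circ> S n\<close> which dominate the gradients, are close to \<open>A\<close> and \<open>B\<close>. So
  the pulled back functions are independent, and their Rayleigh quotients are at most \<open>l + e\<close>.
\<close>
lemma eigval_nonexpansive_image:
  fixes \<rho> :: "real ^ 'n \<Rightarrow> real" and \<nu> :: "(real ^ 'n) measure"
  assumes \<rho>: "continuous_on UNIV \<rho>" "\<And>x. 0 < \<rho> x" and P\<mu>: "prob_space (density_measure \<rho>)"
    and P\<nu>: "prob_space \<nu>" and s\<nu>[measurable_cong]: "sets \<nu> = sets borel"
    and ac: "\<And>Q. AE x in lborel. Q x \<Longrightarrow> AE x in \<nu>. Q x"
    and S: "\<And>n. diff_contraction (S n)" and ST: "\<And>y. (\<lambda>n. S n y) \<longlonglongrightarrow> T y" and Tm[measurable]: "T \<in> borel_measurable borel"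
    and push: "distr \<nu> borel T = density_measure \<rho>"
  shows "eigval \<nu> k \<le> eigval (density_measure \<rho>) k"
  unfolding eigval_def[of "density_measure \<rho>"]
proof (rule INF_greatest)
  interpret \<nu>: prob_space \<nu> by fact
  let ?\<mu> = "density_measure \<rho>"
  interpret \<mu>: prob_space ?\<mu> by fact
  define m where "m = k + 1"
  have [measurable_cong]: "sets ?\<mu> = sets borel" by (simp add: density_measure_def)
  have [measurable]: "\<rho> \<in> borel_measurable borel" by (rule borel_measurable_continuous_onI[OF \<rho>(1)])
  have ac\<mu>: "AE x in ?\<mu>. Q x" if "AE x in lborel. Q x" for Q
    unfolding density_measure_def using that by (subst AE_density) auto
  fix F assume F0: "F \<in> H1_frames ?\<mu> (k + 1)"
  let ?\<Lambda> = "SUP f\<in>{f \<in> span_frame (k + 1) F. \<not> (AE x in ?\<mu>. f x = 0)}. rayleigh ?\<mu> f"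
  have F: "\<And>i. i < m \<Longrightarrow> F i \<in> H1 ?\<mu>" "\<And>c. AE x in ?\<mu>. lin_comb m c F x = 0 \<Longrightarrow> \<forall>i<m. c i = 0"
    using F0 by (auto simp: H1_frames_def m_def)
  show "eigval \<nu> k \<le> ?\<Lambda>"
  proof (cases "?\<Lambda>")
    case top show ?thesis unfolding top by (rule top_greatest)
  next
    case (real l)
    have "\<forall>i. \<exists>G. i < m \<longrightarrow> is_weak_gradient (F i) G \<and> (\<forall>j. L2 ?\<mu> (\<lambda>x. G x $ j))" using F(1) unfolding H1_def by blast
    from choice[OF this] obtain G where G: "\<And>i. i < m \<Longrightarrow> is_weak_gradient (F i) (G i)" "\<And>i j. i < m \<Longrightarrow> L2 ?\<mu> (\<lambda>x. G i x $ j)" by blast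
    have FL2: "L2 ?\<mu> (F i)" if "i < m" for i using F(1)[OF that] by (simp add: H1_def)
    have iF: "integrable ?\<mu> (\<lambda>x. F i x \<bullet> F j x)" if "i < m" "j < m" for i j using L2_mult_integrable[OF FL2[OF that(1)] FL2[OF that(2)]] by simp
    have iG: "integrable ?\<mu> (\<lambda>x. G i x \<bullet> G j x)" if "i < m" "j < m" for i j
      unfolding inner_vec_def using L2_mult_integrable[OF G(2)[OF that(1)] G(2)[OF that(2)]] by simp
    define A where "A = (\<lambda>i j. \<integral>x. F i x \<bullet> F j x \<partial>?\<mu>)"
    define B where "B = (\<lambda>i j. \<integral>x. G i x \<bullet> G j x \<partial>?\<mu>)"
    have qA: "integrable ?\<mu> (\<lambda>x. (lin_comb m c F x)\<^sup>2)" "(\<integral>x. (lin_comb m c F x)\<^sup>2 \<partial>?\<mu>) = quad_form m A c" for c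
      using integral_norm_sq_sum[where X=F and M="?\<mu>" and m=m and c=c, OF iF] by (simp_all add: lin_comb_def A_def)
    have qB: "integrable ?\<mu> (\<lambda>x. (norm (\<Sum>i<m. c i *\<^sub>R G i x))\<^sup>2)" "(\<integral>x. (norm (\<Sum>i<m. c i *\<^sub>R G i x))\<^sup>2 \<partial>?\<mu>) = quad_form m B c" for c
      using integral_norm_sq_sum[where X=G and M="?\<mu>" and m=m and c=c, OF iG] by (simp_all add: B_def)
    have posA: "0 < quad_form m A c" if "\<exists>i<m. c i \<noteq> 0" for c
    proof -
      have "0 \<le> quad_form m A c" unfolding qA(2)[symmetric] by (intro integral_nonneg_AE) auto
      moreover have "quad_form m A c \<noteq> 0"
      proof
        assume "quad_form m A c = 0"
        then have "AE x in ?\<mu>. (lin_comb m c F x)\<^sup>2 = 0" unfolding qA(2)[symmetric] by (subst (asm) integral_nonneg_eq_0_iff_AE[OF qA(1)]) auto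
        then have "AE x in ?\<mu>. lin_comb m c F x = 0" by simp
        then show False using F(2) that by blast
      qed
      ultimately show ?thesis by simp
    qed
    have leB: "quad_form m B c \<le> l * quad_form m A c" if c: "\<exists>i<m. c i \<noteq> 0" for c
    proof -
      have nz: "\<not> (AE x in ?\<mu>. lin_comb m c F x = 0)" using F(2) c by blast
      have "rayleigh ?\<mu> (lin_comb m c F) \<le> ?\<Lambda>" using nz by (intro SUP_upper) (auto simp: span_frame_def m_def)
      then have r: "rayleigh ?\<mu> (lin_comb m c F) \<le> ennreal l" unfolding real(2) .
      have num: "(\<integral>\<^sup>+x. ennreal ((norm (weak_gradient (lin_comb m c F) x))\<^sup>2) \<partial>?\<mu>) = ennreal (quad_form m B c)"
        using nn_integral_weak_gradient[OF is_weak_gradient_lin_comb[OF G(1)] ac\<mu> qB(1)] unfolding qB(2) .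
      have den: "(\<integral>\<^sup>+x. ennreal ((lin_comb m c F x)\<^sup>2) \<partial>?\<mu>) = ennreal (quad_form m A c)"
        using nn_integral_eq_integral[OF qA(1)] by (simp add: qA(2))
      have "rayleigh ?\<mu> (lin_comb m c F) = ennreal (quad_form m B c) / ennreal (quad_form m A c)"
        unfolding rayleigh_def num den ..
      also have "\<dots> = ennreal (quad_form m B c / quad_form m A c)"
      proof (rule divide_ennreal)
        show "0 \<le> quad_form m B c" unfolding qB(2)[symmetric] by (intro integral_nonneg_AE) auto
      qed (rule posA[OF c])
      finally have "quad_form m B c / quad_form m A c \<le> l" using r real(1) by (simp add: ennreal_le_iff)
      then show ?thesis using posA[OF c] by (simp add: divide_le_eq)
    qed
    have "\<forall>n. \<forall>i. \<exists>\<Phi>. i < m \<longrightarrow> C1_bounded \<Phi> \<and> L2_close ?\<mu> (1 / real (Suc n)) \<Phi> (F i) \<and> (\<forall>j. L2_close ?\<mu> (1 / real (Suc n)) (\<lambda>x. gradient \<Phi> x $ j) (\<lambda>x. G i x $ j))"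
    proof (intro allI)
      fix n i
      show "\<exists>\<Phi>. i < m \<longrightarrow> C1_bounded \<Phi> \<and> L2_close ?\<mu> (1 / real (Suc n)) \<Phi> (F i) \<and> (\<forall>j. L2_close ?\<mu> (1 / real (Suc n)) (\<lambda>x. gradient \<Phi> x $ j) (\<lambda>x. G i x $ j))"
      proof (cases "i < m")
        case True
        show ?thesis using H1_smooth_approx[OF \<rho> G(1)[OF True] FL2[OF True] G(2)[OF True], of "1 / real (Suc n)"] by simp
      qed simp
    qed
    then obtain \<Phi> where \<Phi>: "\<And>n i. i < m \<Longrightarrow> C1_bounded (\<Phi> n i)" "\<And>n i. i < m \<Longrightarrow> L2_close ?\<mu> (1 / real (Suc n)) (\<Phi> n i) (F i)"
      "\<And>n i j. i < m \<Longrightarrow> L2_close ?\<mu> (1 / real (Suc n)) (\<lambda>x. gradient (\<Phi> n i) x $ j) (\<lambda>x. G i x $ j)"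
      by metis
    have \<Phi>c: "continuous_on UNIV (\<Phi> n i)" "continuous_on UNIV (gradient (\<Phi> n i))" if "i < m" for n i
      using \<Phi>(1)[OF that, of n] unfolding C1_bounded_def
      by (auto intro!: continuous_at_imp_continuous_on differentiable_imp_continuous_within)
    have \<Phi>L2: "L2 ?\<mu> (\<Phi> n i)" "L2 ?\<mu> (\<lambda>x. gradient (\<Phi> n i) x $ j)" if i: "i < m" for n i j
    proof -
      obtain C D where CD: "\<And>x. \<bar>\<Phi> n i x\<bar> \<le> C" "\<And>x. norm (gradient (\<Phi> n i) x) \<le> D" using \<Phi>(1)[OF i, of n] unfolding C1_bounded_def by blast
      have sq: "L2 ?\<mu> f" if [measurable]: "f \<in> borel_measurable borel" and b: "\<And>x. \<bar>f x\<bar> \<le> E" for f E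
        by (rule \<mu>.L2_bounded[OF _ b]) measurable
      have [measurable]: "\<Phi> n i \<in> borel_measurable borel" "gradient (\<Phi> n i) \<in> borel_measurable borel"
        using \<Phi>c[OF i] by (auto intro: borel_measurable_continuous_onI)
      show "L2 ?\<mu> (\<Phi> n i)" by (rule sq[OF _ CD(1)]) measurable
      show "L2 ?\<mu> (\<lambda>x. gradient (\<Phi> n i) x $ j)" by (rule sq[OF _ order_trans[OF component_le_norm_cart CD(2)]]) measurable
    qed
    have inv0: "(\<lambda>n. 1 / real (Suc n)) \<longlonglongrightarrow> 0"
      using LIMSEQ_inverse_real_of_nat by (simp add: inverse_eq_divide del: of_nat_Suc)
    have lim2: "(\<lambda>n. \<integral>x. p n x * q n x \<partial>?\<mu>) \<longlonglongrightarrow> (\<integral>x. p' x * q' x \<partial>?\<mu>)"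
      if "L2 ?\<mu> p'" "\<And>n. L2 ?\<mu> (p n)" "\<And>n. L2_close ?\<mu> (1 / real (Suc n)) (p n) p'"
         "L2 ?\<mu> q'" "\<And>n. L2 ?\<mu> (q n)" "\<And>n. L2_close ?\<mu> (1 / real (Suc n)) (q n) q'" for p q p' q'
    proof -
      let ?K = "1 + ((\<integral>x. (p' x)\<^sup>2 \<partial>?\<mu>) + (\<integral>x. (q' x)\<^sup>2 \<partial>?\<mu>)) / 2"
      have "(\<lambda>n. (\<integral>x. p n x * q n x \<partial>?\<mu>) - (\<integral>x. p' x * q' x \<partial>?\<mu>)) \<longlonglongrightarrow> 0"
      proof (rule Lim_null_comparison)
        show "\<forall>\<^sub>F n in sequentially. norm ((\<integral>x. p n x * q n x \<partial>?\<mu>) - (\<integral>x. p' x * q' x \<partial>?\<mu>)) \<le> 1 / real (Suc n) + sqrt (1 / real (Suc n)) * ?K"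
          unfolding real_norm_def by (intro always_eventually allI L2_close_mult_integral that) simp
        have "(\<lambda>n. 1 / real (Suc n) + sqrt (1 / real (Suc n)) * ?K) \<longlonglongrightarrow> 0 + sqrt 0 * ?K" by (intro tendsto_intros inv0)
        then show "(\<lambda>n. 1 / real (Suc n) + sqrt (1 / real (Suc n)) * ?K) \<longlonglongrightarrow> 0" by simp
      qed
      then show ?thesis by (simp add: LIM_zero_iff)
    qed
    \<comment> \<open>Gram matrices of the smooth approximations and of their gradients\<close>
    define a where "a = (\<lambda>n i j. \<integral>x. \<Phi> n i x * \<Phi> n j x \<partial>?\<mu>)"
    define b where "b = (\<lambda>n i j. \<integral>x. gradient (\<Phi> n i) x \<bullet> gradient (\<Phi> n j) x \<partial>?\<mu>)"
    have la: "(\<lambda>n. a n i j) \<longlonglongrightarrow> A i j" if "i < m" "j < m" for i j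
      unfolding a_def A_def inner_real_def using that by (intro lim2 FL2 \<Phi>L2 \<Phi>(2))
    have lb: "(\<lambda>n. b n i j) \<longlonglongrightarrow> B i j" if ij: "i < m" "j < m" for i j
    proof -
      have "b n i j = (\<Sum>r\<in>UNIV. \<integral>x. gradient (\<Phi> n i) x $ r * gradient (\<Phi> n j) x $ r \<partial>?\<mu>)" for n
        unfolding b_def inner_vec_def using L2_mult_integrable[OF \<Phi>L2(2)[OF ij(1)] \<Phi>L2(2)[OF ij(2)]]
        by (simp add: Bochner_Integration.integral_sum)
      moreover have "B i j = (\<Sum>r\<in>UNIV. \<integral>x. G i x $ r * G j x $ r \<partial>?\<mu>)"
        unfolding B_def inner_vec_def using L2_mult_integrable[OF G(2)[OF ij(1)] G(2)[OF ij(2)]]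
        by (simp add: Bochner_Integration.integral_sum)
      moreover have "(\<lambda>n. \<Sum>r\<in>UNIV. \<integral>x. gradient (\<Phi> n i) x $ r * gradient (\<Phi> n j) x $ r \<partial>?\<mu>) \<longlonglongrightarrow> (\<Sum>r\<in>UNIV. \<integral>x. G i x $ r * G j x $ r \<partial>?\<mu>)"
        using ij by (intro tendsto_sum lim2 G(2) \<Phi>L2 \<Phi>(3))
      ultimately show ?thesis by simp
    qed
    have Sm[measurable]: "S n \<in> borel_measurable borel" for n by (rule diff_contraction_measurable[OF S])
    have weak: "(\<lambda>N. \<integral>y. \<psi> (S N y) \<partial>\<nu>) \<longlonglongrightarrow> (\<integral>x. \<psi> x \<partial>?\<mu>)"
      if c: "continuous_on UNIV \<psi>" and bd: "\<And>x. \<bar>\<psi> x\<bar> \<le> E" for \<psi> :: "real ^ 'n \<Rightarrow> real" and E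
    proof -
      have [measurable]: "\<psi> \<in> borel_measurable borel" by (rule borel_measurable_continuous_onI[OF c])
      have "(\<lambda>N. \<integral>y. \<psi> (S N y) \<partial>\<nu>) \<longlonglongrightarrow> (\<integral>y. \<psi> (T y) \<partial>\<nu>)"
      proof (rule integral_dominated_convergence[where w="\<lambda>_. E"])
        show "AE y in \<nu>. (\<lambda>N. \<psi> (S N y)) \<longlonglongrightarrow> \<psi> (T y)"
          by (intro AE_I2 continuous_on_tendsto_compose[OF c ST]) auto
      qed (use bd in auto)
      also have "(\<integral>y. \<psi> (T y) \<partial>\<nu>) = (\<integral>x. \<psi> x \<partial>?\<mu>)" unfolding push[symmetric] by (subst integral_distr) auto
      finally show ?thesis .
    qed
    \<comment> \<open>for fixed smooth functions the bounded continuous integrands converge along \<open>S\<close>, so \<open>n\<close> can be matched with a suitable index\<close>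
    have ex: "\<exists>N. \<forall>i<m. \<forall>j<m. \<bar>(\<integral>y. \<Phi> n i (S N y) * \<Phi> n j (S N y) \<partial>\<nu>) - a n i j\<bar> < 1 / real (Suc n) \<and>
        \<bar>(\<integral>y. gradient (\<Phi> n i) (S N y) \<bullet> gradient (\<Phi> n j) (S N y) \<partial>\<nu>) - b n i j\<bar> < 1 / real (Suc n)" for n
    proof -
      have "\<forall>\<^sub>F N in sequentially. \<forall>i\<in>{..<m}. \<forall>j\<in>{..<m}. \<bar>(\<integral>y. \<Phi> n i (S N y) * \<Phi> n j (S N y) \<partial>\<nu>) - a n i j\<bar> < 1 / real (Suc n) \<and>
        \<bar>(\<integral>y. gradient (\<Phi> n i) (S N y) \<bullet> gradient (\<Phi> n j) (S N y) \<partial>\<nu>) - b n i j\<bar> < 1 / real (Suc n)"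
      proof (intro eventually_ball_finite finite_lessThan ballI eventually_conj)
        fix i j assume "i \<in> {..<m}" "j \<in> {..<m}"
        then have ij: "i < m" "j < m" by auto
        obtain C1 D1 where CD1: "\<And>x. \<bar>\<Phi> n i x\<bar> \<le> C1" "\<And>x. norm (gradient (\<Phi> n i) x) \<le> D1" using \<Phi>(1)[OF ij(1), of n] unfolding C1_bounded_def by blast
        obtain C2 D2 where CD2: "\<And>x. \<bar>\<Phi> n j x\<bar> \<le> C2" "\<And>x. norm (gradient (\<Phi> n j) x) \<le> D2" using \<Phi>(1)[OF ij(2), of n] unfolding C1_bounded_def by blast
        have C0: "0 \<le> C1" "0 \<le> D1" using CD1(1)[of 0] CD1(2)[of 0] abs_ge_zero[of "\<Phi> n i 0"] norm_ge_zero[of "gradient (\<Phi> n i) 0"] by linarith+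
        have l1: "(\<lambda>N. \<integral>y. \<Phi> n i (S N y) * \<Phi> n j (S N y) \<partial>\<nu>) \<longlonglongrightarrow> a n i j" unfolding a_def
        proof (rule weak[of _ "C1 * C2"])
          show "continuous_on UNIV (\<lambda>x. \<Phi> n i x * \<Phi> n j x)" by (intro continuous_intros \<Phi>c ij)
          show "\<bar>\<Phi> n i x * \<Phi> n j x\<bar> \<le> C1 * C2" for x unfolding abs_mult by (intro mult_mono CD1 CD2 C0) auto
        qed
        have l2: "(\<lambda>N. \<integral>y. gradient (\<Phi> n i) (S N y) \<bullet> gradient (\<Phi> n j) (S N y) \<partial>\<nu>) \<longlonglongrightarrow> b n i j" unfolding b_def
        proof (rule weak[of _ "D1 * D2"])
          show "continuous_on UNIV (\<lambda>x. gradient (\<Phi> n i) x \<bullet> gradient (\<Phi> n j) x)" by (intro continuous_intros \<Phi>c ij)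
          show "\<bar>gradient (\<Phi> n i) x \<bullet> gradient (\<Phi> n j) x\<bar> \<le> D1 * D2" for x
            by (rule order_trans[OF Cauchy_Schwarz_ineq2]) (intro mult_mono CD1 CD2 C0 norm_ge_zero)
        qed
        have p: "0 < 1 / real (Suc n)" by simp
        show "\<forall>\<^sub>F N in sequentially. \<bar>(\<integral>y. \<Phi> n i (S N y) * \<Phi> n j (S N y) \<partial>\<nu>) - a n i j\<bar> < 1 / real (Suc n)"
          using tendstoD[OF l1 p] by (simp add: dist_real_def)
        show "\<forall>\<^sub>F N in sequentially. \<bar>(\<integral>y. gradient (\<Phi> n i) (S N y) \<bullet> gradient (\<Phi> n j) (S N y) \<partial>\<nu>) - b n i j\<bar> < 1 / real (Suc n)"
          using tendstoD[OF l2 p] by (simp add: dist_real_def)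
      qed
      from eventually_happens[OF this] show ?thesis by auto
    qed
    define near_at where "near_at = (\<lambda>n N. \<forall>i<m. \<forall>j<m. \<bar>(\<integral>y. \<Phi> n i (S N y) * \<Phi> n j (S N y) \<partial>\<nu>) - a n i j\<bar> < 1 / real (Suc n) \<and>
        \<bar>(\<integral>y. gradient (\<Phi> n i) (S N y) \<bullet> gradient (\<Phi> n j) (S N y) \<partial>\<nu>) - b n i j\<bar> < 1 / real (Suc n))"
    have "\<forall>n. \<exists>N. near_at n N" using ex unfolding near_at_def by (rule allI)
    then obtain \<sigma> where \<sigma>: "\<forall>n. near_at n (\<sigma> n)" by (rule choice[THEN exE])
    have \<sigma>12: "\<bar>(\<integral>y. \<Phi> n i (S (\<sigma> n) y) * \<Phi> n j (S (\<sigma> n) y) \<partial>\<nu>) - a n i j\<bar> < 1 / real (Suc n) \<and>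
        \<bar>(\<integral>y. gradient (\<Phi> n i) (S (\<sigma> n) y) \<bullet> gradient (\<Phi> n j) (S (\<sigma> n) y) \<partial>\<nu>) - b n i j\<bar> < 1 / real (Suc n)"
      if "i < m" "j < m" for n i j
      using \<sigma>[rule_format, of n] that unfolding near_at_def by (elim allE impE) assumption+
    note \<sigma>1 = \<sigma>12[THEN conjunct1] and \<sigma>2 = \<sigma>12[THEN conjunct2]
    \<comment> \<open>Gram matrices of the pulled back functions and of the pulled back gradient fields\<close>
    define A' where "A' = (\<lambda>n i j. \<integral>y. \<Phi> n i (S (\<sigma> n) y) \<bullet> \<Phi> n j (S (\<sigma> n) y) \<partial>\<nu>)"
    define B' where "B' = (\<lambda>n i j. \<integral>y. gradient (\<Phi> n i) (S (\<sigma> n) y) \<bullet> gradient (\<Phi> n j) (S (\<sigma> n) y) \<partial>\<nu>)"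
    have near: "p \<longlonglongrightarrow> L" if "q \<longlonglongrightarrow> L" "\<And>n. \<bar>p n - q n\<bar> < 1 / real (Suc n)" for p q :: "nat \<Rightarrow> real" and L
    proof -
      have "(\<lambda>n. p n - q n) \<longlonglongrightarrow> 0"
        by (rule Lim_null_comparison[OF _ inv0]) (use that(2) in \<open>auto intro!: always_eventually less_imp_le\<close>)
      from tendsto_add[OF this that(1)] show ?thesis by simp
    qed
    have lA': "(\<lambda>n. A' n i j) \<longlonglongrightarrow> A i j" if "i < m" "j < m" for i j
      by (rule near[OF la[OF that]]) (use \<sigma>1[OF that] in \<open>simp add: A'_def\<close>)
    have lB': "(\<lambda>n. B' n i j) \<longlonglongrightarrow> B i j" if "i < m" "j < m" for i j
      by (rule near[OF lb[OF that]]) (use \<sigma>2[OF that] in \<open>simp add: B'_def\<close>)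
    show ?thesis unfolding real(2)
    proof (rule ennreal_le_epsilon)
      fix e :: real assume e: "0 < e"
      obtain n where n: "\<And>c. \<exists>i<m. c i \<noteq> 0 \<Longrightarrow> 0 < quad_form m (A' n) c" "\<And>c. \<exists>i<m. c i \<noteq> 0 \<Longrightarrow> quad_form m (B' n) c \<le> (l + e) * quad_form m (A' n) c"
        using quadratic_form_perturbation[of m A' A B' B l e, OF lA' lB' posA leB e] by blast
      define H where "H = (\<lambda>i. \<Phi> n i \<circ> S (\<sigma> n))"
      have lcH: "lin_comb m c H = lin_comb m c (\<Phi> n) \<circ> S (\<sigma> n)" for c by (simp add: fun_eq_iff lin_comb_def H_def)
      have \<Phi>n: "\<And>i. i < m \<Longrightarrow> C1_bounded (\<Phi> n i)" by (rule \<Phi>(1))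
      have bL2: "L2 \<nu> f" if [measurable]: "f \<in> borel_measurable borel" and b: "\<And>x. \<bar>f x\<bar> \<le> E" for f E
        by (rule \<nu>.L2_bounded[OF _ b]) measurable
      have H1_props: "L2 \<nu> (\<Psi> \<circ> S N) \<and> (\<forall>i. L2 \<nu> (\<lambda>x. gradient (\<Psi> \<circ> S N) x $ i)) \<and> (\<Psi> \<circ> S N) \<in> H1 \<nu>" if \<Psi>: "C1_bounded \<Psi>" for \<Psi> N
      proof -
        obtain C D where CD: "\<And>x. \<bar>\<Psi> x\<bar> \<le> C" "\<And>x. norm (gradient \<Psi> x) \<le> D" using \<Psi> unfolding C1_bounded_def by blast
        note np = C1_bounded_comp_contraction[OF \<Psi> S[of N]]
        have "continuous_on UNIV (\<Psi> \<circ> S N)"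
          by (intro continuous_at_imp_continuous_on ballI differentiable_imp_continuous_within np(1))
        then have 1: "L2 \<nu> (\<Psi> \<circ> S N)" by (intro bL2[of _ C] borel_measurable_continuous_onI) (auto simp: CD)
        have 2: "L2 \<nu> (\<lambda>x. gradient (\<Psi> \<circ> S N) x $ i)" for i
        proof (rule bL2[of _ D])
          show "(\<lambda>x. gradient (\<Psi> \<circ> S N) x $ i) \<in> borel_measurable borel"
            using partial_measurable[OF np(1), of i] by (simp add: partial_eq_gradient[abs_def])
          show "\<bar>gradient (\<Psi> \<circ> S N) x $ i\<bar> \<le> D" for x
            by (rule order_trans[OF component_le_norm_cart order_trans[OF np(2) CD(2)]])
        qed
        show ?thesis using 1 2 np(3) unfolding H1_def by blast
      qed
      have iH: "integrable \<nu> (\<lambda>y. \<Phi> n i (S (\<sigma> n) y) \<bullet> \<Phi> n j (S (\<sigma> n) y))" if "i < m" "j < m" for i j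
        using L2_mult_integrable[of \<nu> "\<Phi> n i \<circ> S (\<sigma> n)" "\<Phi> n j \<circ> S (\<sigma> n)"] H1_props[OF \<Phi>n[OF that(1)]] H1_props[OF \<Phi>n[OF that(2)]]
        by (simp add: o_def)
      have iH': "integrable \<nu> (\<lambda>y. gradient (\<Phi> n i) (S (\<sigma> n) y) \<bullet> gradient (\<Phi> n j) (S (\<sigma> n) y))" if ij: "i < m" "j < m" for i j
      proof -
        obtain D1 where D1: "\<And>x. norm (gradient (\<Phi> n i) x) \<le> D1" using \<Phi>n[OF ij(1)] unfolding C1_bounded_def by blast
        obtain D2 where D2: "\<And>x. norm (gradient (\<Phi> n j) x) \<le> D2" using \<Phi>n[OF ij(2)] unfolding C1_bounded_def by blast
        have D0: "0 \<le> D1" using D1[of 0] norm_ge_zero order_trans by blast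
        have [measurable]: "gradient (\<Phi> n i) \<in> borel_measurable borel" "gradient (\<Phi> n j) \<in> borel_measurable borel"
          using \<Phi>c(2) ij by (auto intro: borel_measurable_continuous_onI)
        show ?thesis
        proof (rule \<nu>.integrable_const_bound[where B="D1 * D2"])
          show "AE y in \<nu>. norm (gradient (\<Phi> n i) (S (\<sigma> n) y) \<bullet> gradient (\<Phi> n j) (S (\<sigma> n) y)) \<le> D1 * D2"
            unfolding real_norm_def by (intro AE_I2 order_trans[OF Cauchy_Schwarz_ineq2] mult_mono D1 D2 D0 norm_ge_zero)
        qed measurable
      qed
      have qA': "integrable \<nu> (\<lambda>x. (lin_comb m c H x)\<^sup>2)" "(\<integral>x. (lin_comb m c H x)\<^sup>2 \<partial>\<nu>) = quad_form m (A' n) c" for c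
        using integral_norm_sq_sum[where X="\<lambda>i y. \<Phi> n i (S (\<sigma> n) y)" and M=\<nu> and m=m and c=c, OF iH]
        by (simp_all add: lin_comb_def A'_def H_def)
      have qB': "integrable \<nu> (\<lambda>y. (norm (\<Sum>i<m. c i *\<^sub>R gradient (\<Phi> n i) (S (\<sigma> n) y)))\<^sup>2)" "(\<integral>y. (norm (\<Sum>i<m. c i *\<^sub>R gradient (\<Phi> n i) (S (\<sigma> n) y)))\<^sup>2 \<partial>\<nu>) = quad_form m (B' n) c" for c
        using integral_norm_sq_sum[where X="\<lambda>i y. gradient (\<Phi> n i) (S (\<sigma> n) y)" and M=\<nu> and m=m and c=c, OF iH']
        by (simp_all add: B'_def)
      have nz: "\<exists>i<m. c i \<noteq> 0" if "\<not> (AE x in \<nu>. lin_comb m c H x = 0)" for c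
      proof (rule ccontr)
        assume "\<not> (\<exists>i<m. c i \<noteq> 0)"
        then have "lin_comb m c H x = 0" for x by (simp add: lin_comb_def)
        then show False using that by simp
      qed
      have frame: "H \<in> H1_frames \<nu> m" unfolding H1_frames_def
      proof (intro CollectI conjI allI impI)
        show "H i \<in> H1 \<nu>" if "i < m" for i using H1_props[OF \<Phi>n[OF that]] by (simp add: H_def)
        fix c i assume z: "AE x in \<nu>. lin_comb m c H x = 0" and i: "i < m"
        show "c i = 0"
        proof (rule ccontr)
          assume "c i \<noteq> 0"
          then have "0 < quad_form m (A' n) c" using i by (intro n(1)) blast
          moreover have "(\<integral>x. (lin_comb m c H x)\<^sup>2 \<partial>\<nu>) = (\<integral>x. 0 \<partial>\<nu>)" using z by (intro integral_cong_AE) (use qA'(1)[of c] in auto)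
          ultimately show False by (simp add: qA'(2))
        qed
      qed
      have ray: "rayleigh \<nu> (lin_comb m c H) \<le> ennreal (l + e)" if c: "\<exists>i<m. c i \<noteq> 0" for c
      proof -
        let ?\<Psi> = "lin_comb m c (\<Phi> n)"
        have \<Psi>: "C1_bounded ?\<Psi>" by (rule C1_bounded_lin_comb(1)[OF \<Phi>n])
        note np = C1_bounded_comp_contraction[OF \<Psi> S[of "\<sigma> n"]]
        have gb: "(norm (gradient (?\<Psi> \<circ> S (\<sigma> n)) y))\<^sup>2 \<le> (norm (\<Sum>i<m. c i *\<^sub>R gradient (\<Phi> n i) (S (\<sigma> n) y)))\<^sup>2" for y
        proof -
          have "gradient ?\<Psi> (S (\<sigma> n) y) = (\<Sum>i<m. c i *\<^sub>R gradient (\<Phi> n i) (S (\<sigma> n) y))"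
            by (rule C1_bounded_lin_comb(2)[OF \<Phi>n])
          then show ?thesis using np(2)[of y] by (intro power_mono) auto
        qed
        have gm[measurable]: "gradient (?\<Psi> \<circ> S (\<sigma> n)) \<in> borel_measurable borel" by (rule gradient_measurable[OF np(1)])
        have gi: "integrable \<nu> (\<lambda>y. (norm (gradient (?\<Psi> \<circ> S (\<sigma> n)) y))\<^sup>2)"
          by (rule Bochner_Integration.integrable_bound[OF qB'(1)[of c]]) (use gb in \<open>auto intro!: AE_I2\<close>)
        have num: "(\<integral>\<^sup>+x. ennreal ((norm (weak_gradient (lin_comb m c H) x))\<^sup>2) \<partial>\<nu>) = ennreal (\<integral>y. (norm (gradient (?\<Psi> \<circ> S (\<sigma> n)) y))\<^sup>2 \<partial>\<nu>)"
          unfolding lcH by (rule nn_integral_weak_gradient[OF np(3) ac gi])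
        have den: "(\<integral>\<^sup>+x. ennreal ((lin_comb m c H x)\<^sup>2) \<partial>\<nu>) = ennreal (quad_form m (A' n) c)"
          using nn_integral_eq_integral[OF qA'(1)[of c]] by (simp add: qA'(2))
        have "rayleigh \<nu> (lin_comb m c H) = ennreal (\<integral>y. (norm (gradient (?\<Psi> \<circ> S (\<sigma> n)) y))\<^sup>2 \<partial>\<nu>) / ennreal (quad_form m (A' n) c)"
          unfolding rayleigh_def num den ..
        also have "\<dots> = ennreal ((\<integral>y. (norm (gradient (?\<Psi> \<circ> S (\<sigma> n)) y))\<^sup>2 \<partial>\<nu>) / quad_form m (A' n) c)"
          by (rule divide_ennreal) (auto intro!: integral_nonneg_AE n(1)[OF c])
        also have "\<dots> \<le> ennreal (l + e)"
        proof (rule ennreal_leI)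
          have "(\<integral>y. (norm (gradient (?\<Psi> \<circ> S (\<sigma> n)) y))\<^sup>2 \<partial>\<nu>) \<le> quad_form m (B' n) c"
            unfolding qB'(2)[symmetric] by (rule integral_mono[OF gi qB'(1) gb])
          also have "\<dots> \<le> (l + e) * quad_form m (A' n) c" by (rule n(2)[OF c])
          finally show "(\<integral>y. (norm (gradient (?\<Psi> \<circ> S (\<sigma> n)) y))\<^sup>2 \<partial>\<nu>) / quad_form m (A' n) c \<le> l + e"
            using n(1)[OF c] by (simp add: divide_le_eq)
        qed
        finally show ?thesis .
      qed
      have "eigval \<nu> k \<le> (SUP f\<in>{f \<in> span_frame (k + 1) H. \<not> (AE x in \<nu>. f x = 0)}. rayleigh \<nu> f)"
        unfolding eigval_def using frame by (intro INF_lower) (simp add: m_def)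
      also have "\<dots> \<le> ennreal (l + e)"
      proof (rule SUP_least)
        fix f assume "f \<in> {f \<in> span_frame (k + 1) H. \<not> (AE x in \<nu>. f x = 0)}"
        then obtain c where "f = lin_comb m c H" "\<not> (AE x in \<nu>. f x = 0)" by (auto simp: span_frame_def m_def)
        then show "rayleigh \<nu> f \<le> ennreal (l + e)" using ray[OF nz] by simp
      qed
      also have "\<dots> = ennreal l + ennreal e" using real(1) e by simp
      finally show "eigval \<nu> k \<le> ennreal l + ennreal e" .
    qed
  qed
qed

theorem theorem1p1:
  fixes \<mu> :: "(real ^ 'n) measure"
  assumes "log_concave_measure \<mu>"
  shows "poincare_constant \<mu> \<le> poincare_constant (\<mu> \<star> std_gaussian) \<and>
    (\<forall>\<rho>. smooth \<rho> \<and> (\<forall>x. 0 < \<rho> x) \<and> \<mu> = density_measure \<rho> \<and> discrete_laplace_spectrum \<rho>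
       \<longrightarrow> (\<forall>k\<ge>1. eigval (\<mu> \<star> std_gaussian) k \<le> eigval \<mu> k))"
proof -
  interpret noisy \<mu>
    by (intro noisy.intro noisy_axioms.intro prob_space_log_concave_measure sets_log_concave_measure assms)
  let ?\<nu> = "\<mu> \<star> std_gaussian"
  \<comment> \<open>log-concavity makes the posterior mean a contraction, through the log-concavity of Gaussian mixtures\<close>
  have ne: "norm ((x - r *\<^sub>R drift r x) - (y - r *\<^sub>R drift r y)) \<le> norm (x - y)" if r: "0 < r" for r x y
  proof (rule posterior_mean_nonexpansive[OF r])
    have "mass r y = (\<integral>x. exp (- (1 / (2 * r\<^sup>2)) * (norm (y - x))\<^sup>2) \<partial>\<mu>)" for y by (simp add: mass_def bell_def)
    then show "mass r y * mass r z \<le> (mass r ((1/2) *\<^sub>R (y + z)))\<^sup>2" for y z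
      using gaussian_mixture_midpoint[OF assms, of "1 / (2 * r\<^sup>2)" y z] by simp
  qed
  obtain T S where S: "\<And>n. diff_contraction (S n :: real ^ 'n \<Rightarrow> real ^ 'n)" and ST: "\<And>x. (\<lambda>n. S n x) \<longlonglongrightarrow> T x"
    and T: "\<And>x y. norm (T x - T y) \<le> norm (x - y)" and push: "distr P borel (\<lambda>p. T (fst p + snd p)) = \<mu>"
    by (rule reverse_heat_flow_map[OF ne]) (assumption, rule that, assumption+)
  have Tm[measurable]: "T \<in> borel_measurable borel"
  proof (rule borel_measurable_continuous_onI[OF lipschitz_on_continuous_on])
    show "1-lipschitz_on UNIV T" using T by (intro lipschitz_onI) (auto simp: dist_norm)
  qed
  have \<nu>: "?\<nu> = distr P borel (\<lambda>p. fst p + snd p)" by (simp add: convolution_def std_gaussian_eq case_prod_beta')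
  have s\<nu>: "sets ?\<nu> = sets borel" by simp
  have pushT: "distr ?\<nu> borel T = \<mu>"
  proof -
    have "distr ?\<nu> borel T = distr P borel (\<lambda>p. T (fst p + snd p))" unfolding \<nu> by (subst distr_distr) (auto simp: o_def)
    then show ?thesis unfolding push .
  qed
  have P\<nu>: "prob_space ?\<nu>" unfolding \<nu> by (rule P.prob_space_distr) measurable
  \<comment> \<open>convolution with a Gaussian density makes the measure absolutely continuous\<close>
  have ac: "AE x in ?\<nu>. Q x" if Q: "AE x in lborel. Q x" for Q
  proof -
    obtain N where N: "{x. \<not> Q x} \<subseteq> N" "N \<in> null_sets lborel" using Q unfolding eventually_ae_filter by auto
    then have Nm[measurable]: "N \<in> sets borel" by (simp add: null_sets_def)
    have "emeasure ?\<nu> N = (\<integral>\<^sup>+p. indicator N (fst p + 1 *\<^sub>R snd p) \<partial>P)"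
    proof -
      have "emeasure ?\<nu> N = (\<integral>\<^sup>+y. indicator N y \<partial>distr P borel (\<lambda>p. fst p + snd p))" unfolding \<nu> by simp
      also have "\<dots> = (\<integral>\<^sup>+p. indicator N (fst p + snd p) \<partial>P)" by (rule nn_integral_distr) measurable
      finally show ?thesis by simp
    qed
    also have "\<dots> = (\<integral>\<^sup>+x. \<integral>\<^sup>+z. indicator N (x + 1 *\<^sub>R z) \<partial>gauss_measure \<partial>\<mu>)"
      by (subst gauss.nn_integral_fst[symmetric]) auto
    also have "\<dots> = (\<integral>\<^sup>+x. \<integral>\<^sup>+y. ennreal (gauss 1 (y - x)) * indicator N y \<partial>lborel \<partial>\<mu>)"
      by (intro nn_integral_cong nn_integral_gauss_measure) auto
    also have "\<dots> = (\<integral>\<^sup>+x. 0 \<partial>\<mu>)"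
    proof (intro nn_integral_cong)
      fix x
      have "AE y in lborel. y \<notin> N" using N(2) by (rule AE_not_in)
      then have "AE y in lborel. ennreal (gauss 1 (y - x)) * indicator N y = 0" by eventually_elim simp
      then show "(\<integral>\<^sup>+y. ennreal (gauss 1 (y - x)) * indicator N y \<partial>lborel) = 0" by (subst nn_integral_0_iff_AE) auto
    qed
    finally have "N \<in> null_sets ?\<nu>" by (auto simp: null_sets_def)
    then show ?thesis using N(1) by (intro AE_I') auto
  qed
  show ?thesis
  proof (intro conjI allI impI)
    show "poincare_constant \<mu> \<le> poincare_constant ?\<nu>"
      using poincare_constant_nonexpansive_image[OF s\<nu> T] unfolding pushT .
  next
    fix \<rho> :: "real ^ 'n \<Rightarrow> real" and k :: nat
    assume \<rho>: "smooth \<rho> \<and> (\<forall>x. 0 < \<rho> x) \<and> \<mu> = density_measure \<rho> \<and> discrete_laplace_spectrum \<rho>"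
    then have \<mu>: "\<mu> = density_measure \<rho>" by blast
    have "eigval ?\<nu> k \<le> eigval (density_measure \<rho>) k"
    proof (rule eigval_nonexpansive_image[OF _ _ _ P\<nu> s\<nu> ac S ST Tm])
      show "continuous_on UNIV \<rho>" using \<rho> by (intro smooth_continuous) blast
      show "0 < \<rho> x" for x using \<rho> by blast
      show "prob_space (density_measure \<rho>)" using prob_space_axioms unfolding \<mu> .
      show "distr ?\<nu> borel T = density_measure \<rho>" using pushT unfolding \<mu>[symmetric] .
    qed
    then show "eigval ?\<nu> k \<le> eigval \<mu> k" unfolding \<mu>[symmetric] .
  qed
qed

end
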